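(* Let $X$ and $U=Y$ be Hilbert spaces. For $t\in[0,\infty)$ let $\mathcal A(t)=A_0(t)M(t)$ (with $D(\mathcal A(t))=\{x\in X:M(t)x\in D_0\}$), where - $A_0(t):D_0\subset X\to X$ are generators of contraction semigroups on $X$ with time-independent domain $D_0$, and $t\mapsto A_0(t)x$ is continuously differentiable for every $x\in D_0$; - $M(t)\in L(X)$ are symmetric, there are constants $\underline m,\overline m\in(0,\infty)$ with $\underline m\le M(t)\le\overline m$ for all $t\in[0,\infty)$, $t\mapsto M(t)$ is twice strongly continuously differentiable, and $t\mapsto M(t)$ is monotonically decreasing, i.e. $\langle M(t)x,x\rangle_X\le\langle M(s)x,x\rangle_X$ for all $x\in X$ and $s\le t$. Let $\mathcal B(t)\in L(U,X)$ and $\mathcal C(t)\in L(X,U)$ with $\mathcal C(t)=\mathcal B(t)^*M(t)$ for all $t\in[0,\infty)$, and let $t\mapsto\mathcal B(t)$ be locally Lipschitz. Let $g:U\to U$ be Lipschitz on bounded subsets of $U$ and such that for some $\varsigma>0$ one has $\langle y,g(y)\rangle_U\ge\varsigma\|y\|_U^2$ for all $y\in U$. Define $f:[0,\infty)\times X\to X$ by $f(t,x):=-\mathcal B(t)\,g\big(\mathcal B(t)^*M(t)x\big)$. Then the (closed-loop) system $$\dot x(t)=\mathcal A(t)x(t)+f(t,x(t))+\mathcal B(t)u(t),\qquad y(t)=\mathcal C(t)x(t)\qquad(\ast)$$ is well-posed and uniformly globally stable.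
   Context: $\mathcal K$ is the set of continuous strictly increasing $\gamma:[0,\infty)\to[0,\infty)$ with $\gamma(0)=0$. $C_c^2([0,\infty),U)$ is the space of $C^2$-functions $[0,\infty)\to U$ with compact support in $[0,\infty)$ (they need not vanish at $0$). For $u\in L^p_{\mathrm{loc}}([0,\infty),U)$ put $\|u\|_{[0,t],p}:=\|u|_{[0,t]}\|_{L^p([0,t],U)}$. Classical solution of $(\ast)$ for initial state $x_s\in X$ at time $s\in[0,\infty)$ and input $u$: a function $x\in C^1(J,X)$ on an interval $J$ with $\min J=s$, $x(s)=x_s$, such that $x(t)\in D(\mathcal A(t))$ and $(\ast)$ holds for all $t\in J$. Generalized solution and generalized output of $(\ast)$ for $x_0\in X$ (at time $0$) and $u\in L^2_{\mathrm{loc}}([0,\infty),U)$: functions $x\in C([0,\infty),X)$ and $y\in L^2_{\mathrm{loc}}([0,\infty),Y)$ such that there is a sequence $(x_{0n},u_n)\in X\times C_c^2([0,\infty),U)$ with $x_{0n}\to x_0$ in $X$ and $\|u_n-u\|_{[0,t],2}\to0$ for every $t>0$, for which $(\ast)$ has a unique global classical solution $x(\cdot,x_{0n},u_n)$ (on $[0,\infty)$, with initial state $x_{0n}$ at time $0$), and $\|x(\cdot,x_{0n},u_n)-x\|_{[0,t],\infty}\to0$ and $\|\mathcal C(\cdot)x(\cdot,x_{0n},u_n)-y\|_{[0,t],2}\to0$ for every $t>0$. Well-posed: for every $(x_0,u)\in X\times L^2_{\mathrm{loc}}([0,\infty),U)$ there are a unique generalized solution $x(\cdot,x_0,u)\in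 C([0,\infty),X)$ and a unique generalized output $y(\cdot,x_0,u)\in L^2_{\mathrm{loc}}([0,\infty),Y)$, and the maps $(x_0,u)\mapsto x(\cdot,x_0,u)\in C([0,\infty),X)$ and $(x_0,u)\mapsto y(\cdot,x_0,u)\in L^2_{\mathrm{loc}}([0,\infty),Y)$ are continuous w.r.t. the canonical locally convex topologies (uniform convergence on every $[0,t]$ for $C$, $L^2$-convergence on every $[0,t]$ for $L^2_{\mathrm{loc}}$). Uniformly globally stable: for every $(x_0,u)\in X\times L^2_{\mathrm{loc}}([0,\infty),U)$ there is a unique generalized solution $x(\cdot,x_0,u)$, and there are $\sigma,\gamma\in\mathcal K$ such that $\|x(t,x_0,u)\|\le\sigma(\|x_0\|)+\gamma(\|u\|_{[0,t],2})$ for all $t\in[0,\infty)$ and all $(x_0,u)\in X\times L^2_{\mathrm{loc}}([0,\infty),U)$. *)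

theory Defs
  imports "HOL-Analysis.Analysis"
begin

text \<open>
  Hilbert spaces are types of class \<open>{real_inner, complete_space}\<close>; no separability is assumed.
  Functions on \<open>[0,\<infinity>)\<close> are represented by functions on \<open>real\<close> whose values at negative
  arguments are irrelevant: derivatives are taken within the interval, and uniqueness is
  understood on \<open>{0..}\<close>.
\<close>

section \<open>Differentiability and comparison functions\<close>

text \<open>One-sided derivatives at end points, unlike \<open>C1_differentiable_on\<close>.\<close>

definition C1_on :: "real set \<Rightarrow> (real \<Rightarrow> 'a::real_normed_vector) \<Rightarrow> bool" where
  "C1_on J h \<longleftrightarrow>
     (\<exists>h'. (\<forall>t\<in>J. (h has_vector_derivative h' t) (at t within J)) \<and> continuous_on J h')"

definition C2_on :: "real set \<Rightarrow> (real \<Rightarrow> 'a::real_normed_vector) \<Rightarrow> bool" where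
  "C2_on J h \<longleftrightarrow>
     (\<exists>h'. (\<forall>t\<in>J. (h has_vector_derivative h' t) (at t within J)) \<and> C1_on J h')"

text \<open>The support is compact in \<open>[0,\<infinity>)\<close>; the function need not vanish at \<open>0\<close>.\<close>

definition C2_compact_support :: "(real \<Rightarrow> 'a::real_normed_vector) set" where
  "C2_compact_support = {u. C2_on {0..} u \<and> compact (closure {t. 0 \<le> t \<and> u t \<noteq> 0})}"

definition class_K :: "(real \<Rightarrow> real) set" where
  "class_K = {\<gamma>. \<gamma> \<in> {0..} \<rightarrow> {0..} \<and> continuous_on {0..} \<gamma> \<and> strict_mono_on {0..} \<gamma> \<and> \<gamma> 0 = 0}"

section \<open>Locally square-integrable functions\<close>

text \<open>
  Bochner measurability: since the library's Bochner integral is restricted to second-countable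
  target spaces, measurability of vector-valued functions is spelled out as almost everywhere
  approximability by simple functions; only the norms are integrated.
\<close>

definition strongly_measurable :: "'m measure \<Rightarrow> ('m \<Rightarrow> 'a::real_normed_vector) \<Rightarrow> bool" where
  "strongly_measurable N h \<longleftrightarrow>
     (\<exists>\<phi>. (\<forall>n. simple_function N (\<phi> n)) \<and> (AE s in N. (\<lambda>n. \<phi> n s) \<longlonglongrightarrow> h s))"

text \<open>Elements are representatives; equality in \<open>L\<^sup>2\<close> is equality almost everywhere.\<close>

definition L2_loc :: "(real \<Rightarrow> 'a::real_normed_vector) set" where
  "L2_loc = {h. strongly_measurable (lebesgue_on {0..}) h \<and>
                (\<forall>t>0. integrable (lebesgue_on {0..t}) (\<lambda>s. (norm (h s))\<^sup>2))}"

definition L2_norm :: "real \<Rightarrow> (real \<Rightarrow> 'a::real_normed_vector) \<Rightarrow> real" where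
  "L2_norm t h = sqrt (\<integral>s. (norm (h s))\<^sup>2 \<partial>lebesgue_on {0..t})"

text \<open>
  Membership in \<open>L2_loc\<close> is part of the definition, since \<open>L2_norm\<close> is \<open>0\<close> for functions whose
  squared norm is not integrable.
\<close>

definition L2_loc_tendsto ::
    "(nat \<Rightarrow> real \<Rightarrow> 'a::real_normed_vector) \<Rightarrow> (real \<Rightarrow> 'a) \<Rightarrow> bool" where
  "L2_loc_tendsto h h\<^sub>0 \<longleftrightarrow>
     (\<forall>n. h n \<in> L2_loc) \<and> h\<^sub>0 \<in> L2_loc \<and>
     (\<forall>t>0. (\<lambda>n. L2_norm t (\<lambda>s. h n s - h\<^sub>0 s)) \<longlonglongrightarrow> 0)"

section \<open>Generators of contraction semigroups\<close>

definition contraction_semigroup :: "(real \<Rightarrow> 'x \<Rightarrow>\<^sub>L 'x::real_normed_vector) \<Rightarrow> bool" where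
  "contraction_semigroup S \<longleftrightarrow>
     S 0 = id_blinfun \<and>
     (\<forall>s\<ge>0. \<forall>t\<ge>0. S (s + t) = S s o\<^sub>L S t) \<and>
     (\<forall>x. ((\<lambda>h. S h x) \<longlongrightarrow> x) (at_right 0)) \<and>
     (\<forall>t\<ge>0. norm (S t) \<le> 1)"

text \<open>An unbounded operator is given by its domain \<open>D\<close> and a function relevant only on \<open>D\<close>.\<close>

definition generates_contraction_semigroup ::
    "'x set \<Rightarrow> ('x \<Rightarrow> 'x::real_normed_vector) \<Rightarrow> bool" where
  "generates_contraction_semigroup D A \<longleftrightarrow>
     (\<exists>S. contraction_semigroup S \<and>
          D = {x. \<exists>y. ((\<lambda>h. (S h x - x) /\<^sub>R h) \<longlongrightarrow> y) (at_right 0)} \<and>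
          (\<forall>x\<in>D. ((\<lambda>h. (S h x - x) /\<^sub>R h) \<longlongrightarrow> A x) (at_right 0)))"

section \<open>Solution concepts\<close>

text \<open>
  The system \<open>x'(t) = A(t) x(t) + f(t, x(t)) + B(t) u(t)\<close>, \<open>y(t) = C(t) x(t)\<close> is given by the
  domains \<open>D t\<close> of \<open>A t\<close> and by \<open>A\<close>, \<open>f\<close>, \<open>B\<close>, \<open>C\<close>. The state at initial time \<open>s\<close> is \<open>x\<^sub>s\<close>.
\<close>

definition classical_solution ::
    "(real \<Rightarrow> 'x set) \<Rightarrow> (real \<Rightarrow> 'x \<Rightarrow> 'x) \<Rightarrow> (real \<Rightarrow> 'x \<Rightarrow> 'x) \<Rightarrow>
     (real \<Rightarrow> 'u::real_normed_vector \<Rightarrow>\<^sub>L 'x::real_normed_vector) \<Rightarrow>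
     real set \<Rightarrow> real \<Rightarrow> 'x \<Rightarrow> (real \<Rightarrow> 'u) \<Rightarrow> (real \<Rightarrow> 'x) \<Rightarrow> bool" where
  "classical_solution D A f B J s x\<^sub>s u x \<longleftrightarrow>
     0 \<le> s \<and> is_interval J \<and> s \<in> J \<and> (\<forall>t\<in>J. s \<le> t) \<and>
     C1_on J x \<and> x s = x\<^sub>s \<and>
     (\<forall>t\<in>J. x t \<in> D t \<and>
        (x has_vector_derivative A t (x t) + f t (x t) + B t (u t)) (at t within J))"

definition unique_global_classical_solution ::
    "(real \<Rightarrow> 'x set) \<Rightarrow> (real \<Rightarrow> 'x \<Rightarrow> 'x) \<Rightarrow> (real \<Rightarrow> 'x \<Rightarrow> 'x) \<Rightarrow>
     (real \<Rightarrow> 'u::real_normed_vector \<Rightarrow>\<^sub>L 'x::real_normed_vector) \<Rightarrow>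
     'x \<Rightarrow> (real \<Rightarrow> 'u) \<Rightarrow> (real \<Rightarrow> 'x) \<Rightarrow> bool" where
  "unique_global_classical_solution D A f B x\<^sub>0 u x \<longleftrightarrow>
     classical_solution D A f B {0..} 0 x\<^sub>0 u x \<and>
     (\<forall>z. classical_solution D A f B {0..} 0 x\<^sub>0 u z \<longrightarrow> (\<forall>t\<ge>0. z t = x t))"

definition generalized_solution_output ::
    "(real \<Rightarrow> 'x set) \<Rightarrow> (real \<Rightarrow> 'x \<Rightarrow> 'x) \<Rightarrow> (real \<Rightarrow> 'x \<Rightarrow> 'x) \<Rightarrow>
     (real \<Rightarrow> 'u::real_normed_vector \<Rightarrow>\<^sub>L 'x::real_normed_vector) \<Rightarrow>
     (real \<Rightarrow> 'x \<Rightarrow>\<^sub>L 'y::real_normed_vector) \<Rightarrow>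
     'x \<Rightarrow> (real \<Rightarrow> 'u) \<Rightarrow> (real \<Rightarrow> 'x) \<Rightarrow> (real \<Rightarrow> 'y) \<Rightarrow> bool" where
  "generalized_solution_output D A f B C x\<^sub>0 u x y \<longleftrightarrow>
     continuous_on {0..} x \<and> y \<in> L2_loc \<and>
     (\<exists>x\<^sub>0\<^sub>n u\<^sub>n x\<^sub>n.
        (\<forall>n. u\<^sub>n n \<in> C2_compact_support) \<and>
        x\<^sub>0\<^sub>n \<longlonglongrightarrow> x\<^sub>0 \<and> L2_loc_tendsto u\<^sub>n u \<and>
        (\<forall>n. unique_global_classical_solution D A f B (x\<^sub>0\<^sub>n n) (u\<^sub>n n) (x\<^sub>n n)) \<and>
        (\<forall>t>0. uniform_limit {0..t} x\<^sub>n x sequentially) \<and>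
        L2_loc_tendsto (\<lambda>n s. C s (x\<^sub>n n s)) y)"

definition generalized_solution ::
    "(real \<Rightarrow> 'x set) \<Rightarrow> (real \<Rightarrow> 'x \<Rightarrow> 'x) \<Rightarrow> (real \<Rightarrow> 'x \<Rightarrow> 'x) \<Rightarrow>
     (real \<Rightarrow> 'u::real_normed_vector \<Rightarrow>\<^sub>L 'x::real_normed_vector) \<Rightarrow>
     (real \<Rightarrow> 'x \<Rightarrow>\<^sub>L 'y::real_normed_vector) \<Rightarrow>
     'x \<Rightarrow> (real \<Rightarrow> 'u) \<Rightarrow> (real \<Rightarrow> 'x) \<Rightarrow> bool" where
  "generalized_solution D A f B C x\<^sub>0 u x \<longleftrightarrow>
     (\<exists>y. generalized_solution_output D A f B C x\<^sub>0 u x y)"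

section \<open>Well-posedness and stability\<close>

text \<open>
  Continuity of the solution and output maps is continuity with respect to the seminorms
  \<open>sup on [0,t]\<close> and \<open>L2_norm t\<close>. Both families increase with \<open>t\<close>, so a basic neighbourhood of
  an input is described by a single such seminorm.
\<close>

definition well_posed ::
    "(real \<Rightarrow> 'x set) \<Rightarrow> (real \<Rightarrow> 'x \<Rightarrow> 'x) \<Rightarrow> (real \<Rightarrow> 'x \<Rightarrow> 'x) \<Rightarrow>
     (real \<Rightarrow> 'u::real_normed_vector \<Rightarrow>\<^sub>L 'x::real_normed_vector) \<Rightarrow>
     (real \<Rightarrow> 'x \<Rightarrow>\<^sub>L 'y::real_normed_vector) \<Rightarrow> bool" where
  "well_posed D A f B C \<longleftrightarrow>
     (let sol = generalized_solution_output D A f B C in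
     (\<forall>x\<^sub>0. \<forall>u\<in>L2_loc.
        (\<exists>x y. sol x\<^sub>0 u x y) \<and>
        (\<forall>x y x' y'. sol x\<^sub>0 u x y \<and> sol x\<^sub>0 u x' y' \<longrightarrow>
           (\<forall>t\<ge>0. x t = x' t) \<and> (AE t in lebesgue_on {0..}. y t = y' t))) \<and>
     (\<forall>x\<^sub>0. \<forall>u\<in>L2_loc. \<forall>x y. sol x\<^sub>0 u x y \<longrightarrow>
        (\<forall>t>0. \<forall>\<epsilon>>0. \<exists>T>0. \<exists>\<delta>>0. \<forall>x\<^sub>0'. \<forall>u'\<in>L2_loc. \<forall>x' y'.
           sol x\<^sub>0' u' x' y' \<and> norm (x\<^sub>0' - x\<^sub>0) < \<delta> \<and> L2_norm T (\<lambda>s. u' s - u s) < \<delta> \<longrightarrow>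
             (\<forall>s\<in>{0..t}. norm (x' s - x s) < \<epsilon>))) \<and>
     (\<forall>x\<^sub>0. \<forall>u\<in>L2_loc. \<forall>x y. sol x\<^sub>0 u x y \<longrightarrow>
        (\<forall>t>0. \<forall>\<epsilon>>0. \<exists>T>0. \<exists>\<delta>>0. \<forall>x\<^sub>0'. \<forall>u'\<in>L2_loc. \<forall>x' y'.
           sol x\<^sub>0' u' x' y' \<and> norm (x\<^sub>0' - x\<^sub>0) < \<delta> \<and> L2_norm T (\<lambda>s. u' s - u s) < \<delta> \<longrightarrow>
             L2_norm t (\<lambda>s. y' s - y s) < \<epsilon>)))"

definition uniformly_globally_stable ::
    "(real \<Rightarrow> 'x set) \<Rightarrow> (real \<Rightarrow> 'x \<Rightarrow> 'x) \<Rightarrow> (real \<Rightarrow> 'x \<Rightarrow> 'x) \<Rightarrow>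
     (real \<Rightarrow> 'u::real_normed_vector \<Rightarrow>\<^sub>L 'x::real_normed_vector) \<Rightarrow>
     (real \<Rightarrow> 'x \<Rightarrow>\<^sub>L 'y::real_normed_vector) \<Rightarrow> bool" where
  "uniformly_globally_stable D A f B C \<longleftrightarrow>
     (let sol = generalized_solution D A f B C in
     (\<forall>x\<^sub>0. \<forall>u\<in>L2_loc.
        (\<exists>x. sol x\<^sub>0 u x) \<and>
        (\<forall>x x'. sol x\<^sub>0 u x \<and> sol x\<^sub>0 u x' \<longrightarrow> (\<forall>t\<ge>0. x t = x' t))) \<and>
     (\<exists>\<sigma>\<in>class_K. \<exists>\<gamma>\<in>class_K. \<forall>x\<^sub>0. \<forall>u\<in>L2_loc. \<forall>x. sol x\<^sub>0 u x \<longrightarrow>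
        (\<forall>t\<ge>0. norm (x t) \<le> \<sigma> (norm x\<^sub>0) + \<gamma> (L2_norm t u))))"

end

theory Submission
  imports Defs
begin

text \<open>
  The energy \<open>\<langle>M(t) x, x\<rangle>\<close> is a Lyapunov function: along classical solutions, dissipativity of
  \<open>A\<^sub>0(t)\<close>, monotonicity of \<open>M\<close> and the damping of \<open>g\<close> give
  \<open>d/dt \<langle>M x, x\<rangle> \<le> 2 \<langle>y, u\<rangle> - 2 \<zeta> |y|\<^sup>2 \<le> |u|\<^sup>2 / (2 \<zeta>)\<close>. Hence solutions are bounded in terms of the
  \<open>L\<^sup>2\<close>-norm of the input, the nonlinearity is effectively globally Lipschitz, and a Gronwall argument
  shows that solutions depend on initial state and input in a locally Lipschitz way. As smooth inputs
  and the initial states in \<open>M(0)\<^sup>-\<^sup>1 D\<^sub>0\<close> are dense, existence, uniqueness and continuity of generalized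
  solutions and outputs follow once smooth data are known to admit global classical solutions.

  Classical solutions are limits of solutions of the Yosida-regularized equations, which are linear
  differential equations with bounded operators. Because \<open>M\<close> is \<open>C\<^sup>2\<close>, the modified derivative
  \<open>x' + M\<^sup>-\<^sup>1 M' x\<close> solves an equation of the same type, so that for \<open>C\<^sup>1\<close> right-hand sides the
  derivatives converge as well. Along a Lipschitz candidate solution the nonlinearity is merely
  Lipschitz in time; such right-hand sides are approximated by \<open>C\<^sup>1\<close> functions whose derivatives converge
  in \<open>L\<^sup>1\<close>, by the Radon-Nikodym property of Hilbert spaces. The semilinear problem is then a fixed
  point problem in a weighted norm on functions with exponentially growing Lipschitz constant.
\<close>

section \<open>Hilbert and Banach spaces\<close>

text \<open>The derivatives of the regularized solutions see the time derivative of the right-hand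
  side, and since \<open>g\<close> is only Lipschitz, the right-hand side along a solution has no
  continuous derivative in general. What saves the argument is that the derivative estimate contains
  this time derivative only under an integral, so that convergence in \<open>L^1\<close> suffices.
  For the same reason the nonlinear fixed point map is contractive only in a supremum norm: a
  Lipschitz bound on the candidates is merely preserved, but it survives uniform limits.
  Monotonicity of \<open>M\<close> keeps the energy bound free of factors growing in time, which is
  what allows comparison functions valid for all \<open>t\<close> at once. The spaces may be
  nonseparable; antiderivatives of continuous functions are therefore produced by the Riesz theorem,
  and otherwise only scalar functions such as norms and inner products are integrated. Outputs need
  little separate work, because every generalized output equals \<open>C x\<close> almost
  everywhere.\<close>

lemma riesz_on_closed_subspace:
  fixes S :: "'a::{real_inner,complete_space} set" and \<phi> :: "'a \<Rightarrow> real"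
  assumes S: "subspace S" "closed S" and \<phi>: "bounded_linear \<phi>"
  shows "\<exists>p\<in>S. \<forall>y\<in>S. inner p y = \<phi> y"
proof -
  interpret \<phi>: bounded_linear \<phi> by fact
  \<comment> \<open>Up to a constant this is the squared distance to the vector representing
    \<open>\<phi>\<close>, so its minimiser over \<open>S\<close> is the projection of that vector.
    Working on a closed subspace yields the Riesz theorem and orthogonal projections at
    once.\<close>
  define J where "J x = (norm x)\<^sup>2 - 2 * \<phi> x" for x
  obtain K where K: "\<And>x. norm (\<phi> x) \<le> norm x * K" using \<phi>.bounded by blast
  have J_ge: "- K\<^sup>2 \<le> J x" for x
  proof -
    have "\<phi> x \<le> norm x * K" using K[of x] by simp
    moreover have "0 \<le> (norm x - K)\<^sup>2" by simp
    ultimately show ?thesis unfolding J_def power2_diff by linarith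
  qed
  have bdd: "bdd_below (J ` S)" using J_ge by (rule bdd_belowI2)
  have ne: "S \<noteq> {}" using subspace_0[OF S(1)] by auto
  define d where "d = Inf (J ` S)"
  have d_le: "d \<le> J x" if "x \<in> S" for x unfolding d_def using bdd that by (simp add: cINF_lower)
  have "\<exists>x\<in>S. J x < d + inverse (Suc n)" for n
  proof -
    have "Inf (J ` S) < d + inverse (Suc n)" by (simp add: d_def)
    then show ?thesis using cInf_less_iff[of "J ` S"] bdd ne by auto
  qed
  then obtain x where xS: "\<And>n. x n \<in> S" and xJ: "\<And>n. J (x n) < d + inverse (Suc n)" by metis
  \<comment> \<open>Parallelogram law; the linear part of \<open>J\<close> cancels. Two
    near-minimisers whose midpoint is again in \<open>S\<close> are therefore close.\<close>
  have par: "(norm (a - b))\<^sup>2 = 2 * J a + 2 * J b - 4 * J ((1/2) *\<^sub>R (a + b))" for a b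
  proof -
    have e1: "(norm (a - b))\<^sup>2 = inner a a - 2 * inner a b + inner b b"
      by (simp add: power2_norm_eq_inner inner_diff_left inner_diff_right inner_commute[of b a])
    have e2: "(norm ((1/2) *\<^sub>R (a + b)))\<^sup>2 = (inner a a + 2 * inner a b + inner b b) / 4"
      by (simp only: power2_norm_eq_inner inner_scaleR_left inner_scaleR_right inner_add_left
          inner_add_right inner_commute[of b a]) (simp add: field_simps)
    have e3: "\<phi> ((1/2) *\<^sub>R (a + b)) = (\<phi> a + \<phi> b) / 2"
      by (simp add: \<phi>.scaleR \<phi>.add)
    show ?thesis
      unfolding J_def e1 e2 e3 power2_norm_eq_inner[of a] power2_norm_eq_inner[of b]
      by (simp add: field_simps)
  qed
  have close: "(norm (x m - x n))\<^sup>2 < 4 * inverse (Suc N)" if "N \<le> m" "N \<le> n" for m n N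
  proof -
    have "d \<le> J ((1/2) *\<^sub>R (x m + x n))"
      by (intro d_le subspace_scale subspace_add S xS)
    moreover have "inverse (real (Suc m)) \<le> inverse (Suc N)" "inverse (real (Suc n)) \<le> inverse (Suc N)"
      using that by (auto simp: field_simps)
    ultimately show ?thesis using par[of "x m" "x n"] xJ[of m] xJ[of n] by linarith
  qed
  have "Cauchy x"
  proof (rule CauchyI)
    fix e :: real assume e: "0 < e"
    then obtain N where N: "inverse (Suc N) < e\<^sup>2 / 4"
      using reals_Archimedean[of "e\<^sup>2 / 4"] by auto
    have "norm (x m - x n) < e" if "N \<le> m" "N \<le> n" for m n
      by (rule power2_less_imp_less) (use close[OF that] N e in auto)
    then show "\<exists>M. \<forall>m\<ge>M. \<forall>n\<ge>M. norm (x m - x n) < e" by blast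
  qed
  then obtain p where p: "x \<longlonglongrightarrow> p" using Cauchy_convergent_iff convergent_def by blast
  have pS: "p \<in> S" using closed_sequentially[OF S(2)] xS p by blast
  have "(\<lambda>n. J (x n)) \<longlonglongrightarrow> J p"
    unfolding J_def by (intro tendsto_intros p \<phi>.tendsto)
  moreover have "(\<lambda>n. d + inverse (Suc n)) \<longlonglongrightarrow> d + 0"
    by (intro tendsto_intros LIMSEQ_inverse_real_of_nat)
  ultimately have Jp: "J p \<le> d"
    by (rule LIMSEQ_le[THEN order_trans]) (intro exI[of _ 0] allI impI less_imp_le xJ, simp)
  have "inner p y = \<phi> y" if "y \<in> S" for y
  proof (rule ccontr)
    assume ne: "inner p y \<noteq> \<phi> y"
    define c where "c = inner p y - \<phi> y"
    \<comment> \<open>The minimiser of \<open>t \<mapsto> J (p + t *\<^sub>R y)\<close> would be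
      \<open>- c / inner y y\<close>; the added \<open>1\<close> spares a separate treatment of
      \<open>y = 0\<close>.\<close>
    define t where "t = - c / (inner y y + 1)"
    have pos: "inner y y + 1 > 0" by (simp add: add_nonneg_pos)
    have "d \<le> J (p + t *\<^sub>R y)" by (intro d_le subspace_scale subspace_add S pS that)
    also have "\<dots> = J p + 2 * t * c + t\<^sup>2 * inner y y"
      unfolding J_def c_def power2_norm_eq_inner \<phi>.scaleR \<phi>.add inner_add_left inner_add_right
        inner_scaleR_left inner_scaleR_right inner_commute[of y p] power2_eq_square[of t]
      by (simp add: algebra_simps)
    finally have "0 \<le> 2 * t * c + t\<^sup>2 * inner y y" using Jp by simp
    also have "\<dots> \<le> 2 * t * c + t\<^sup>2 * (inner y y + 1)" by (simp add: mult_left_mono)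
    also have "\<dots> = 2 * t * c + t * (t * (inner y y + 1))"
      by (simp add: power2_eq_square)
    also have "t * (inner y y + 1) = - c"
      using pos by (simp add: t_def)
    also have "2 * t * c + t * - c = - c\<^sup>2 / (inner y y + 1)"
      by (simp add: t_def power2_eq_square)
    also have "\<dots> < 0" using pos ne by (simp add: c_def)
    finally show False by simp
  qed
  then show ?thesis using pS by blast
qed

text \<open>Subtracting from a vector outside \<open>S\<close> its projection onto \<open>S\<close>
  leaves the desired vector. Surjectivity of \<open>M t\<close> and of \<open>1 - h A\<close> is
  later reduced to this: the range is closed and nothing is orthogonal to it.\<close>

lemma ex_orthogonal_to_closed_subspace:
  fixes S :: "'a::{real_inner,complete_space} set"
  assumes "subspace S" "closed S" "S \<noteq> UNIV"
  shows "\<exists>y. y \<noteq> 0 \<and> (\<forall>x\<in>S. inner x y = 0)"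
proof -
  obtain v where v: "v \<notin> S" using assms(3) by blast
  obtain p where "p \<in> S" "\<forall>y\<in>S. inner p y = inner v y"
    using riesz_on_closed_subspace[OF assms(1,2) bounded_linear_inner_right, of v] by blast
  then have "v - p \<noteq> 0" "\<forall>x\<in>S. inner x (v - p) = 0"
    using v by (auto simp: inner_diff_right inner_commute)
  then show ?thesis by blast
qed

text \<open>\<open>adjoint\<close> is a choice term, so the identity needs a witness; the Riesz
  theorem supplies one because the domain is complete.\<close>

lemma inner_adjoint:
  fixes B :: "'a::{real_inner,complete_space} \<Rightarrow>\<^sub>L 'b::real_inner"
  shows "inner (B u) x = inner u (adjoint B x)"
proof -
  have "\<exists>w. \<forall>u. inner w u = inner (B u) x" for x
    using riesz_on_closed_subspace[of UNIV "\<lambda>u. inner (B u) x"]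
      bounded_linear_compose[OF bounded_linear_inner_left blinfun.bounded_linear_right]
    by (metis UNIV_I closed_UNIV subspace_UNIV)
  then obtain w where w: "\<And>x u. inner (w x) u = inner (B u) x" by metis
  then have "\<exists>f'. \<forall>u x. inner (B u) x = inner u (f' x)"
    by (intro exI[of _ w]) (simp add: inner_commute)
  then have "\<forall>u x. inner (B u) x = inner u (adjoint B x)"
    unfolding adjoint_def by (rule someI_ex)
  then show ?thesis by blast
qed

lemma norm_adjoint_le:
  fixes B :: "'a::{real_inner,complete_space} \<Rightarrow>\<^sub>L 'b::real_inner"
  shows "norm (adjoint B x) \<le> norm B * norm x"
proof -
  have "(norm (adjoint B x))\<^sup>2 = inner (B (adjoint B x)) x"
    by (simp add: inner_adjoint power2_norm_eq_inner)
  also have "\<dots> \<le> norm (B (adjoint B x)) * norm x" by (rule norm_cauchy_schwarz)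
  also have "\<dots> \<le> (norm B * norm (adjoint B x)) * norm x"
    by (intro mult_right_mono norm_blinfun) auto
  finally have "norm (adjoint B x) * norm (adjoint B x) \<le> norm (adjoint B x) * (norm B * norm x)"
    by (simp add: power2_eq_square mult_ac)
  then show ?thesis
    by (cases "adjoint B x = 0") auto
qed

lemma adjoint_diff_operator:
  fixes B C :: "'a::{real_inner,complete_space} \<Rightarrow>\<^sub>L 'b::real_inner"
  shows "adjoint B x - adjoint C x = adjoint (B - C) x"
  by (rule vector_eq_ldot[THEN iffD1])
     (simp add: inner_simps blinfun.diff_left flip: inner_adjoint)

lemma adjoint_diff_argument:
  fixes B :: "'a::{real_inner,complete_space} \<Rightarrow>\<^sub>L 'b::real_inner"
  shows "adjoint B (x - y) = adjoint B x - adjoint B y"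
  by (rule vector_eq_ldot[THEN iffD1]) (simp add: inner_simps flip: inner_adjoint)

text \<open>Baire category: the closed sets on which all operators are bounded by \<open>k\<close>
  cover the space, so one of them contains a ball. Subtracting the value at the centre moves the
  bound to a ball around \<open>0\<close>.\<close>

lemma uniform_boundedness:
  fixes F :: "'i \<Rightarrow> 'a::{real_normed_vector,complete_space} \<Rightarrow> 'b::real_normed_vector"
  assumes lin: "\<And>i. i \<in> I \<Longrightarrow> bounded_linear (F i)"
    and ptw: "\<And>x. \<exists>c. \<forall>i\<in>I. norm (F i x) \<le> c"
  shows "\<exists>K>0. \<forall>i\<in>I. \<forall>x. norm (F i x) \<le> K * norm x"
proof -
  define C where "C k = {x. \<forall>i\<in>I. norm (F i x) \<le> real k}" for k
  have cl: "closed (C k)" for k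
  proof -
    have "C k = (\<Inter>i\<in>I. {x. norm (F i x) \<le> real k})" by (auto simp: C_def)
    moreover have "closed {x. norm (F i x) \<le> real k}" if "i \<in> I" for i
      by (intro closed_Collect_le continuous_intros)
         (use lin[OF that] in \<open>simp add: linear_continuous_on\<close>)
    ultimately show ?thesis by auto
  qed
  have un: "(\<Union>k. C k) = UNIV"
  proof -
    have "\<exists>k. x \<in> C k" for x
    proof -
      obtain c where "\<forall>i\<in>I. norm (F i x) \<le> c" using ptw by blast
      then show ?thesis using real_arch_simple[of c] by (auto simp: C_def intro: order_trans)
    qed
    then show ?thesis by auto
  qed
  have "\<exists>k. interior (C k) \<noteq> {}"
  proof (rule ccontr)
    assume "\<not> ?thesis"
    then have "interior (\<Union> (range C)) = {}"
      using Met_TC.metric_Baire_category_alt[where 'a='a, of "range C"] cl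
      by (auto simp: mcomplete_iff_complete complete_UNIV interior_of_openin)
    then show False using un by simp
  qed
  then obtain k x0 e where e: "e > 0" "ball x0 e \<subseteq> C k" by (meson ex_in_conv mem_interior)
  \<comment> \<open>A bound \<open>2 * k\<close> at radius \<open>e / 2\<close> amounts to the
    factor \<open>4 * k / e\<close>; the extra \<open>1\<close> keeps \<open>K\<close> positive when
    \<open>k = 0\<close>.\<close>
  define K where "K = (2 * (2 * real k) + 1) / e"
  have "norm (F i x) \<le> K * norm x" if i: "i \<in> I" for i x
  proof (cases "x = 0")
    case True then show ?thesis using lin[OF i] by (simp add: linear_simps)
  next
    case False
    interpret bounded_linear "F i" using lin[OF i] .
    define s where "s = e / (2 * norm x)"
    have s: "s > 0" using e False by (simp add: s_def)
    have "x0 + s *\<^sub>R x \<in> ball x0 e" "x0 \<in> ball x0 e"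
      using e False by (auto simp: dist_norm s_def)
    then have "x0 + s *\<^sub>R x \<in> C k" "x0 \<in> C k" using e by blast+
    then have "norm (F i (x0 + s *\<^sub>R x)) \<le> k" "norm (F i x0) \<le> k" using i by (auto simp: C_def)
    moreover have "s *\<^sub>R F i x = F i (x0 + s *\<^sub>R x) - F i x0" by (simp add: add scaleR)
    ultimately have "norm (s *\<^sub>R F i x) \<le> 2 * k"
      using norm_triangle_ineq4[of "F i (x0 + s *\<^sub>R x)" "F i x0"] by simp
    then have "norm (F i x) \<le> 2 * k / s" using s by (simp add: field_simps)
    also have "\<dots> = (2 * (2 * k)) / e * norm x" using e False by (simp add: s_def)
    also have "\<dots> \<le> K * norm x"
      using e by (intro mult_right_mono) (auto simp: K_def divide_right_mono)
    finally show ?thesis .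
  qed
  moreover have "K > 0" using e by (simp add: K_def add_nonneg_pos)
  ultimately show ?thesis by blast
qed

section \<open>Calculus for vector-valued functions of a real variable\<close>

lemma has_vector_derivative_within_alt:
  "(f has_vector_derivative f') (at t within S) \<longleftrightarrow>
     (\<forall>e>0. \<exists>d>0. \<forall>s\<in>S. \<bar>s - t\<bar> < d \<longrightarrow> norm (f s - f t - (s - t) *\<^sub>R f') \<le> e * \<bar>s - t\<bar>)"
  by (simp add: has_vector_derivative_def has_derivative_within_alt bounded_linear_scaleR_left)

text \<open>A weak integral: \<open>V t\<close> represents the bounded functional that maps
  \<open>y\<close> to the integral of \<open>inner (f s) y\<close> over \<open>{a..t}\<close>.
  Differentiability in norm follows because the modulus of continuity of \<open>f\<close> controls
  the scalar remainders uniformly in the test vector.\<close>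

lemma antiderivative_exists:
  fixes f :: "real \<Rightarrow> 'a::{real_inner,complete_space}"
  assumes f: "continuous_on {a..b} f"
  shows "\<exists>F. F a = 0 \<and> (\<forall>t\<in>{a..b}. (F has_vector_derivative f t) (at t within {a..b}))"
proof -
  have int: "(\<lambda>s. inner (f s) y) integrable_on {a..t}" "(\<lambda>s. norm (f s)) integrable_on {a..t}"
    if "t \<le> b" for t y
    using that by (auto intro!: integrable_continuous_interval continuous_intros
        continuous_on_subset[OF f])
  have bl: "bounded_linear (\<lambda>y. integral {a..t} (\<lambda>s. inner (f s) y))" if t: "t \<le> b" for t
  proof (rule bounded_linear_intro)
    fix y show "norm (integral {a..t} (\<lambda>s. inner (f s) y)) \<le> norm y * integral {a..t} (\<lambda>s. norm (f s))"
    proof -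
      have "norm (integral {a..t} (\<lambda>s. inner (f s) y)) \<le> integral {a..t} (\<lambda>s. norm (f s) * norm y)"
        using int[OF t] by (intro integral_norm_bound_integral)
          (auto simp: Cauchy_Schwarz_ineq2 intro: integrable_on_mult_left)
      then show ?thesis by (simp add: mult.commute)
    qed
  qed (use int[OF t] in \<open>auto simp: inner_simps integral_add\<close>)
  have "\<exists>v. \<forall>y. inner v y = integral {a..t} (\<lambda>s. inner (f s) y)" if "t \<le> b" for t
    using riesz_on_closed_subspace[OF _ _ bl[OF that], of UNIV] by auto
  then obtain V where V: "\<And>t y. t \<le> b \<Longrightarrow> inner (V t) y = integral {a..t} (\<lambda>s. inner (f s) y)"
    by metis
  have dV: "((\<lambda>t. inner (V t) y) has_vector_derivative inner (f t) y) (at t within {a..b})"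
    if "t \<in> {a..b}" for t y
  proof (rule has_vector_derivative_transform[OF that])
    show "inner (V s) y = integral {a..s} (\<lambda>s. inner (f s) y)" if "s \<in> {a..b}" for s
      using V that by simp
    show "((\<lambda>s. integral {a..s} (\<lambda>s. inner (f s) y)) has_vector_derivative inner (f t) y) (at t within {a..b})"
      using that by (intro integral_has_vector_derivative continuous_intros f)
  qed
  have "(V has_vector_derivative f t) (at t within {a..b})" if t: "t \<in> {a..b}" for t
    unfolding has_vector_derivative_within_alt
  proof safe
    fix e :: real assume e: "0 < e"
    then obtain d where d: "d > 0" "\<And>s. s \<in> {a..b} \<Longrightarrow> \<bar>s - t\<bar> < d \<Longrightarrow> norm (f s - f t) < e"
      using f t unfolding continuous_on_iff dist_norm by (metis real_norm_def)
    have "norm (V s - V t - (s - t) *\<^sub>R f t) \<le> e * \<bar>s - t\<bar>" if s: "s \<in> {a..b}" "\<bar>s - t\<bar> < d" for s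
    proof -
      \<comment> \<open>The remainder is tested against itself, which turns the scalar estimate for
        \<open>inner (V r) z\<close> into one for \<open>norm z\<close>.\<close>
      obtain z where z: "z = V s - V t - (s - t) *\<^sub>R f t" by blast
      have sub: "closed_segment t s \<subseteq> {a..b}" "\<And>r. r \<in> closed_segment t s \<Longrightarrow> \<bar>r - t\<bar> < d"
        using s t by (auto simp: closed_segment_eq_real_ivl split: if_splits)
      have "norm (inner (V s) z - inner (V t) z - (s - t) *\<^sub>R inner (f t) z) \<le> norm (s - t) * (e * norm z)"
      proof (rule vector_differentiable_bound_linearization[where S="closed_segment t s"
              and f="\<lambda>r. inner (V r) z" and f'="\<lambda>r. inner (f r) z" and ?x0.0=t])
        fix r assume r: "r \<in> closed_segment t s"
        show "((\<lambda>r. inner (V r) z) has_vector_derivative inner (f r) z) (at r within closed_segment t s)"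
          using dV sub r by (meson has_vector_derivative_within_subset subsetD)
        have "norm (inner (f r) z - inner (f t) z) = \<bar>inner (f r - f t) z\<bar>" by (simp add: inner_simps)
        also have "\<dots> \<le> norm (f r - f t) * norm z" by (rule Cauchy_Schwarz_ineq2)
        also have "\<dots> \<le> e * norm z" using d(2)[of r] sub r by (intro mult_right_mono) (auto simp: less_imp_le)
        finally show "norm (inner (f r) z - inner (f t) z) \<le> e * norm z" .
      qed auto
      moreover have "inner (V s) z - inner (V t) z - (s - t) *\<^sub>R inner (f t) z = norm z * norm z"
      proof -
        have "inner (V s) z - inner (V t) z - (s - t) *\<^sub>R inner (f t) z =
            inner (V s - V t - (s - t) *\<^sub>R f t) z"
          by (simp only: inner_diff_left inner_scaleR_left real_scaleR_def)
        also have "\<dots> = norm z * norm z"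
          by (subst z[symmetric]) (simp only: dot_square_norm power2_eq_square)
        finally show ?thesis .
      qed
      ultimately have "\<bar>norm z * norm z\<bar> \<le> \<bar>s - t\<bar> * (e * norm z)"
        by (metis real_norm_def)
      then have "norm z * norm z \<le> norm z * (e * \<bar>s - t\<bar>)"
        by (simp add: mult.commute mult.left_commute)
      then have "norm z \<le> e * \<bar>s - t\<bar>" using e
        by (cases "z = 0") auto
      then show ?thesis by (simp add: z)
    qed
    then show "\<exists>d>0. \<forall>s\<in>{a..b}. \<bar>s - t\<bar> < d \<longrightarrow> norm (V s - V t - (s - t) *\<^sub>R f t) \<le> e * \<bar>s - t\<bar>"
      using d(1) by blast
  qed
  moreover have "V a = 0" if "a \<le> b"
    using V[OF that, of "V a"] by simp
  ultimately show ?thesis by (cases "a \<le> b") (auto intro: exI[of _ "\<lambda>_. 0"])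
qed

lemma vector_mvt_bound:
  fixes f :: "real \<Rightarrow> 'a::real_normed_vector"
  assumes "a \<le> b"
    and f': "\<And>t. t \<in> {a..b} \<Longrightarrow> (f has_vector_derivative f' t) (at t within {a..b})"
    and \<phi>': "\<And>t. t \<in> {a..b} \<Longrightarrow> (\<phi> has_vector_derivative \<phi>' t) (at t within {a..b})"
    and le: "\<And>t. t \<in> {a..b} \<Longrightarrow> norm (f' t) \<le> \<phi>' t"
  shows "norm (f b - f a) \<le> \<phi> b - \<phi> a"
proof (cases "a = b")
  case False
  then have ab: "a < b" using assms(1) by simp
  have at: "at t within {a..b} = at t" if "a < t" "t < b" for t
    using that at_within_Icc_at[of a t b] by simp
  show ?thesis
  proof (rule differentiable_bound_general[OF ab])
    show "continuous_on {a..b} f" "continuous_on {a..b} \<phi>"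
      using f' \<phi>' has_vector_derivative_continuous continuous_on_eq_continuous_within by blast+
    show "(f has_vector_derivative f' t) (at t)" "(\<phi> has_vector_derivative \<phi>' t) (at t)"
      "norm (f' t) \<le> \<phi>' t" if "a < t" "t < b" for t
      using at[OF that] f'[of t] \<phi>'[of t] le[of t] that by auto
  qed
qed simp

lemma vector_mvt_bound_const:
  fixes f :: "real \<Rightarrow> 'a::real_normed_vector"
  assumes ab: "a \<le> b" and f': "\<And>t. t \<in> {a..b} \<Longrightarrow> (f has_vector_derivative f' t) (at t within {a..b})"
    and le: "\<And>t. t \<in> {a..b} \<Longrightarrow> norm (f' t) \<le> K"
  shows "norm (f b - f a) \<le> K * (b - a)"
proof -
  have "((\<lambda>t. K * t) has_vector_derivative K) (at t within {a..b})" for t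
    by (auto intro!: derivative_eq_intros simp flip: has_real_derivative_iff_has_vector_derivative)
  from vector_mvt_bound[OF ab f' this le] show ?thesis by (simp add: algebra_simps)
qed

lemma nonincreasing_of_nonpos_derivative:
  fixes f :: "real \<Rightarrow> real"
  assumes "a \<le> b" "\<And>t. t \<in> {a..b} \<Longrightarrow> (f has_vector_derivative f' t) (at t within {a..b})"
    and "\<And>t. t \<in> {a..b} \<Longrightarrow> f' t \<le> 0"
  shows "f b \<le> f a"
proof -
  have "\<exists>x\<in>{a..b}. f b - f a = (b - a) *\<^sub>R f' x"
    by (rule mvt_very_simple[OF assms(1)]) (use assms(2) in \<open>auto simp: has_vector_derivative_def\<close>)
  then obtain x where "x \<in> {a..b}" "f b - f a = (b - a) *\<^sub>R f' x" by blast
  moreover have "(b - a) * f' x \<le> 0"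
    using calculation(1) assms(1) assms(3)[of x] by (intro mult_nonneg_nonpos) auto
  ultimately show ?thesis by simp
qed

section \<open>Gronwall's inequality and contractions in weighted norms\<close>

lemma gronwall:
  fixes \<phi> :: "real \<Rightarrow> real"
  assumes \<phi>: "continuous_on {0..T} \<phi>" and b: "0 \<le> b" and t: "t \<in> {0..T}"
    and le: "\<And>t. t \<in> {0..T} \<Longrightarrow> \<phi> t \<le> a + b * integral {0..t} \<phi>"
  shows "\<phi> t \<le> a * exp (b * t)"
proof -
  define \<Psi> where "\<Psi> t = exp (- b * t) * (a + b * integral {0..t} \<phi>)" for t
  have "\<Psi> t \<le> \<Psi> 0"
  proof (rule nonincreasing_of_nonpos_derivative[where f=\<Psi> and
        f'="\<lambda>s. exp (- b * s) * b * (\<phi> s - (a + b * integral {0..s} \<phi>))"])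
    fix s assume s: "s \<in> {0..t}"
    have "((\<lambda>t. integral {0..t} \<phi>) has_real_derivative \<phi> s) (at s within {0..t})"
      using s t \<phi> by (intro integral_has_real_derivative continuous_on_subset[OF \<phi>]) auto
    then have "(\<Psi> has_real_derivative exp (- b * s) * b * (\<phi> s - (a + b * integral {0..s} \<phi>))) (at s within {0..t})"
      unfolding \<Psi>_def by (auto intro!: derivative_eq_intros simp: algebra_simps)
    then show "(\<Psi> has_vector_derivative exp (- b * s) * b * (\<phi> s - (a + b * integral {0..s} \<phi>))) (at s within {0..t})"
      by (simp add: has_real_derivative_iff_has_vector_derivative)
    show "exp (- b * s) * b * (\<phi> s - (a + b * integral {0..s} \<phi>)) \<le> 0"
      using le[of s] s t b by (intro mult_nonneg_nonpos) auto
  qed (use t in auto)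
  then have "\<Psi> t \<le> a" by (simp add: \<Psi>_def)
  then have "a + b * integral {0..t} \<phi> \<le> a * exp (b * t)"
    by (simp add: \<Psi>_def exp_minus field_simps)
  then show ?thesis using le[OF t] by simp
qed

text \<open>Integration against an exponential weight gains the factor \<open>1 / \<mu>\<close>. A
  large \<open>\<mu>\<close> therefore makes Volterra operators contractive on an interval of any
  length.\<close>

lemma integral_exp_weight:
  fixes h :: "real \<Rightarrow> real"
  assumes h: "continuous_on {0..t} h" and "\<And>s. s \<in> {0..t} \<Longrightarrow> h s \<le> d * exp (\<mu> * s)"
    and pos: "0 \<le> t" "0 < \<mu>" "0 \<le> d"
  shows "integral {0..t} h \<le> d / \<mu> * exp (\<mu> * t)"
proof -
  have "((\<lambda>s. d * exp (\<mu> * s)) has_integral (d / \<mu> * exp (\<mu> * t) - d / \<mu> * exp (\<mu> * 0))) {0..t}"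
    using pos by (intro fundamental_theorem_of_calculus)
      (auto intro!: derivative_eq_intros simp flip: has_real_derivative_iff_has_vector_derivative)
  then have "integral {0..t} (\<lambda>s. d * exp (\<mu> * s)) \<le> d / \<mu> * exp (\<mu> * t)"
    "(\<lambda>s. d * exp (\<mu> * s)) integrable_on {0..t}"
    using pos by (auto simp only: integral_unique) auto
  moreover have "integral {0..t} h \<le> integral {0..t} (\<lambda>s. d * exp (\<mu> * s))"
    using assms by (intro integral_le integrable_continuous_interval continuous_intros) auto
  ultimately show ?thesis by simp
qed

lemma bounded_weighted_imp_uniformly_Cauchy:
  fixes u :: "nat \<Rightarrow> 'b \<Rightarrow> 'a::real_normed_vector"
  assumes step: "\<And>n t. t \<in> I \<Longrightarrow> norm (u (Suc n) t - u n t) \<le> d * (1/2)^n"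
  shows "uniformly_Cauchy_on I u"
proof -
  \<comment> \<open>The subtracted tail is the exact remainder of the geometric series; with it the
    induction on \<open>k\<close> closes without loss.\<close>
  have tele: "norm (u (n + k) t - u n t) \<le> 2 * d * (1/2)^n - 2 * d * (1/2)^(n+k)" if "t \<in> I" for n k t
  proof (induction k)
    case (Suc k)
    have "norm (u (n + Suc k) t - u n t) \<le> norm (u (Suc (n + k)) t - u (n + k) t) + norm (u (n + k) t - u n t)"
      using norm_triangle_ineq[of "u (Suc (n + k)) t - u (n + k) t" "u (n + k) t - u n t"] by simp
    then show ?case using Suc step[OF that, of "n + k"] by simp
  qed simp
  have "(\<lambda>n. 2 * d * (1/2)^n) \<longlonglongrightarrow> 2 * d * 0"
    by (intro tendsto_intros LIMSEQ_realpow_zero) auto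
  then have lim: "(\<lambda>n. 2 * d * (1/2)^n) \<longlonglongrightarrow> 0" by simp
  show ?thesis
  proof (cases "I = {}")
    case False
    then obtain t0 where "t0 \<in> I" by blast
    have d: "0 \<le> d" using order_trans[OF norm_ge_zero step[OF \<open>t0 \<in> I\<close>, of 0]] by simp
    show ?thesis
    proof (rule uniformly_Cauchy_onI')
      fix e :: real assume "0 < e"
      then obtain N where N: "\<And>n. n \<ge> N \<Longrightarrow> 2 * d * (1/2)^n < e"
        using order_tendstoD(2)[OF lim, of e] by (auto simp: eventually_sequentially)
      have "dist (u m t) (u n t) < e" if t: "t \<in> I" and mn: "m \<ge> N" "m < n" for t m n
      proof -
        have "norm (u (m + (n - m)) t - u m t) \<le> 2 * d * (1/2)^m"
          using tele[OF t, of m "n - m"] d by (smt (verit) zero_le_mult_iff zero_le_power divide_nonneg_nonneg)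
        then show ?thesis using N[OF mn(1)] mn by (simp add: dist_norm norm_minus_commute)
      qed
      then show "\<exists>M. \<forall>x\<in>I. \<forall>m\<ge>M. \<forall>n>m. dist (u m x) (u n x) < e" by blast
    qed
  qed (simp add: uniformly_Cauchy_on_def)
qed

text \<open>Banach's theorem for the supremum of \<open>norm (x t) / w t\<close>. It is written
  pointwise, since elements of \<open>S\<close> are functions on the whole type that are compared on
  \<open>I\<close> only. As \<open>w\<close> lies between \<open>1\<close> and \<open>W\<close>,
  weighted and plain uniform convergence coincide, so \<open>S\<close> is asked to be closed in the
  latter sense.\<close>

lemma weighted_contraction_fixpoint:
  fixes \<Phi> :: "('b \<Rightarrow> 'a::{real_normed_vector,complete_space}) \<Rightarrow> 'b \<Rightarrow> 'a"
  assumes x0: "x0 \<in> S" and \<Phi>: "\<And>x. x \<in> S \<Longrightarrow> \<Phi> x \<in> S"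
    and bdd: "\<And>x. x \<in> S \<Longrightarrow> bounded (x ` I)"
    and closed: "\<And>u x. \<lbrakk>\<And>n. u n \<in> S; uniform_limit I u x sequentially\<rbrakk> \<Longrightarrow> x \<in> S"
    and w: "\<And>t. t \<in> I \<Longrightarrow> 1 \<le> w t" "\<And>t. t \<in> I \<Longrightarrow> w t \<le> W"
    and contr: "\<And>x y d. \<lbrakk>x \<in> S; y \<in> S; 0 \<le> d; \<And>t. t \<in> I \<Longrightarrow> norm (x t - y t) \<le> d * w t\<rbrakk>
           \<Longrightarrow> (\<And>t. t \<in> I \<Longrightarrow> norm (\<Phi> x t - \<Phi> y t) \<le> d / 2 * w t)"
  shows "\<exists>x\<in>S. \<forall>t\<in>I. \<Phi> x t = x t"
proof -
  define u where "u n = (\<Phi> ^^ n) x0" for n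
  have uS: "u n \<in> S" for n by (induction n) (auto simp: u_def x0 \<Phi>)
  obtain b c where b: "\<And>t. t \<in> I \<Longrightarrow> norm (x0 t) \<le> b" and c: "\<And>t. t \<in> I \<Longrightarrow> norm (\<Phi> x0 t) \<le> c"
    using bdd[OF x0] bdd[OF \<Phi>[OF x0]] by (auto simp: bounded_iff)
  define d where "d = \<bar>b\<bar> + \<bar>c\<bar>"
  have d: "0 \<le> d" by (simp add: d_def)
  have step: "norm (u (Suc n) t - u n t) \<le> d * (1/2)^n * w t" if "t \<in> I" for n t
    using that
  proof (induction n arbitrary: t)
    case 0
    have "norm (\<Phi> x0 t - x0 t) \<le> d"
      using norm_triangle_ineq4[of "\<Phi> x0 t" "x0 t"] b[OF 0] c[OF 0] by (simp add: d_def)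
    also have "\<dots> \<le> d * w t" using d w(1)[OF 0] by (simp add: mult_le_cancel_left1)
    finally show ?case by (simp add: u_def)
  next
    case (Suc n)
    have "norm (\<Phi> (u (Suc n)) t - \<Phi> (u n) t) \<le> d * (1/2)^n / 2 * w t"
      by (rule contr[OF uS uS]) (use d Suc in auto)
    then show ?case by (simp add: u_def)
  qed
  have "norm (u (Suc n) t - u n t) \<le> d * W * (1/2)^n" if "t \<in> I" for n t
    using order_trans[OF step[OF that, of n] mult_left_mono[OF w(2)[OF that]]] d by (simp add: mult_ac)
  then have "uniformly_Cauchy_on I u" by (rule bounded_weighted_imp_uniformly_Cauchy)
  then obtain x where x: "uniform_limit I u x sequentially"
    using Cauchy_uniformly_convergent uniformly_convergent_on_def by blast
  then have xS: "x \<in> S" using closed uS by blast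
  have "\<Phi> x t = x t" if t: "t \<in> I" for t
  proof -
    have "norm (\<Phi> x t - x t) \<le> 0"
    proof (rule field_le_epsilon)
      fix e :: real assume e: "0 < e"
      have W: "1 \<le> W" using w[OF t] by linarith
      define e' where "e' = e / (2 * W)"
      have e': "0 < e'" using e W by (simp add: e'_def)
      obtain N where N: "\<And>n s. n \<ge> N \<Longrightarrow> s \<in> I \<Longrightarrow> dist (u n s) (x s) < e'"
        using uniform_limitD[OF x e'] by (auto simp: eventually_sequentially)
      have "norm (\<Phi> x t - \<Phi> (u N) t) \<le> e' / 2 * w t"
      proof (rule contr[OF xS uS _ _ t])
        fix s assume s: "s \<in> I"
        show "norm (x s - u N s) \<le> e' * w s"
        proof -
          have "norm (x s - u N s) \<le> e' * 1" using N[OF order_refl s] by (simp add: dist_norm norm_minus_commute)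
          also have "\<dots> \<le> e' * w s" using w(1)[OF s] e' by (intro mult_left_mono) auto
          finally show ?thesis .
        qed
      qed (use e' in auto)
      also have "\<dots> \<le> e' / 2 * W" using w(2)[OF t] e' by (intro mult_left_mono) auto
      also have "\<dots> = e / 4" using W by (simp add: e'_def)
      finally have 1: "norm (\<Phi> x t - u (Suc N) t) \<le> e / 4" by (simp add: u_def)
      have 2: "norm (u (Suc N) t - x t) \<le> e / 2"
      proof -
        have "e' * 1 \<le> e' * W" using W e' by (intro mult_left_mono) auto
        then show ?thesis using N[OF _ t, of "Suc N"] W by (simp add: dist_norm e'_def)
      qed
      show "norm (\<Phi> x t - x t) \<le> 0 + e"
        using 1 2 e norm_triangle_ineq[of "\<Phi> x t - u (Suc N) t" "u (Suc N) t - x t"] by simp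
    qed
    then show ?thesis by simp
  qed
  then show ?thesis using xS by blast
qed

text \<open>Split \<open>L s (v s)\<close> into \<open>L s (v s - v t)\<close> and
  \<open>L s (v t)\<close>: the uniform bound handles the first term and strong continuity the
  second. Norm continuity of the operators is never available here.\<close>

lemma continuous_on_strongly_continuous:
  fixes L :: "real \<Rightarrow> 'a::real_normed_vector \<Rightarrow> 'b::real_normed_vector"
  assumes lin: "\<And>t. t \<in> I \<Longrightarrow> bounded_linear (L t)"
    and bnd: "\<And>t v. t \<in> I \<Longrightarrow> norm (L t v) \<le> c * norm v"
    and cont: "\<And>v. continuous_on I (\<lambda>t. L t v)" and v: "continuous_on I v"
  shows "continuous_on I (\<lambda>t. L t (v t))"
  unfolding continuous_on_def
proof
  fix t assume t: "t \<in> I"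
  have "((\<lambda>s. v s - v t) \<longlongrightarrow> 0) (at t within I)"
    using v t by (simp add: continuous_on_def LIM_zero)
  then have z: "((\<lambda>s. c * norm (v s - v t)) \<longlongrightarrow> 0) (at t within I)"
    by (intro tendsto_mult_right_zero tendsto_norm_zero)
  have "((\<lambda>s. L s (v s - v t)) \<longlongrightarrow> 0) (at t within I)"
  proof (rule tendsto_0_le[OF z, of _ 1])
    show "\<forall>\<^sub>F s in at t within I. norm (L s (v s - v t)) \<le> norm (c * norm (v s - v t)) * 1"
      unfolding eventually_at_filter
      by (intro always_eventually allI impI) (simp only: real_norm_def mult_1_right order_trans[OF bnd abs_ge_self])
  qed
  moreover have "((\<lambda>s. L s (v t)) \<longlongrightarrow> L t (v t)) (at t within I)"
    using cont[of "v t"] t by (simp add: continuous_on_def)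
  ultimately have "((\<lambda>s. L s (v s - v t) + L s (v t)) \<longlongrightarrow> 0 + L t (v t)) (at t within I)"
    by (rule tendsto_add)
  moreover have "\<forall>\<^sub>F s in at t within I. L s (v s - v t) + L s (v t) = L s (v s)"
    using linear_diff[OF bounded_linear.linear[OF lin]] by (auto simp: eventually_at_filter)
  ultimately show "((\<lambda>s. L s (v s)) \<longlongrightarrow> L t (v t)) (at t within I)"
    by (simp add: tendsto_cong)
qed

text \<open>Product rule for families that are differentiable only strongly. It asks for the
  derivative at the single vector \<open>z t\<close> and for continuity at the single vector
  \<open>z'\<close>; the uniform bound takes care of the remainder of \<open>z\<close>, which moves
  with \<open>s\<close>.\<close>

lemma has_vector_derivative_strong_product:
  fixes L :: "real \<Rightarrow> 'a::real_normed_vector \<Rightarrow> 'b::real_normed_vector"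
  assumes t: "t \<in> I" and lin: "\<And>s. s \<in> I \<Longrightarrow> bounded_linear (L s)"
    and bnd: "\<And>s v. s \<in> I \<Longrightarrow> norm (L s v) \<le> c * norm v"
    and cont: "((\<lambda>s. L s z') \<longlongrightarrow> L t z') (at t within I)"
    and L': "((\<lambda>s. L s (z t)) has_vector_derivative a) (at t within I)"
    and z': "(z has_vector_derivative z') (at t within I)"
  shows "((\<lambda>s. L s (z s)) has_vector_derivative a + L t z') (at t within I)"
  unfolding has_vector_derivative_within_alt
proof safe
  fix e :: real assume e: "0 < e"
  define \<epsilon> where "\<epsilon> = e / (\<bar>c\<bar> + 3)"
  have \<epsilon>: "0 < \<epsilon>" using e by (simp add: \<epsilon>_def)
  obtain d1 where d1: "d1 > 0" "\<And>s. s \<in> I \<Longrightarrow> \<bar>s - t\<bar> < d1 \<Longrightarrow> norm (z s - z t - (s - t) *\<^sub>R z') \<le> \<epsilon> * \<bar>s - t\<bar>"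
    using z' \<epsilon> unfolding has_vector_derivative_within_alt by meson
  obtain d2 where d2: "d2 > 0" "\<And>s. s \<in> I \<Longrightarrow> \<bar>s - t\<bar> < d2 \<Longrightarrow> norm (L s (z t) - L t (z t) - (s - t) *\<^sub>R a) \<le> \<epsilon> * \<bar>s - t\<bar>"
    using L' \<epsilon> unfolding has_vector_derivative_within_alt by meson
  obtain d3 where d3: "d3 > 0" "\<And>s. s \<in> I \<Longrightarrow> \<bar>s - t\<bar> < d3 \<Longrightarrow> norm (L s z' - L t z') \<le> \<epsilon>"
  proof -
    obtain d where "d > 0" "\<forall>s\<in>I. 0 < dist s t \<and> dist s t < d \<longrightarrow> dist (L s z') (L t z') < \<epsilon>"
      using tendstoD[OF cont \<epsilon>] by (auto simp: eventually_at)
    then show thesis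
      using \<epsilon> by (intro that[of d]) (force simp: dist_norm dist_real_def intro: less_imp_le)+
  qed
  show "\<exists>d>0. \<forall>s\<in>I. \<bar>s - t\<bar> < d \<longrightarrow>
      norm (L s (z s) - L t (z t) - (s - t) *\<^sub>R (a + L t z')) \<le> e * \<bar>s - t\<bar>"
  proof (intro exI[of _ "min d1 (min d2 d3)"] conjI ballI impI)
    fix s assume s: "s \<in> I" "\<bar>s - t\<bar> < min d1 (min d2 d3)"
    interpret Ls: bounded_linear "L s" using lin[OF s(1)] .
    have eq: "L s (z s) - L t (z t) - (s - t) *\<^sub>R (a + L t z') =
        L s (z s - z t - (s - t) *\<^sub>R z') + (L s (z t) - L t (z t) - (s - t) *\<^sub>R a) + (s - t) *\<^sub>R (L s z' - L t z')"
      unfolding Ls.diff Ls.scaleR by (simp add: algebra_simps)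
    have "norm (L s (z s - z t - (s - t) *\<^sub>R z')) \<le> \<bar>c\<bar> * (\<epsilon> * \<bar>s - t\<bar>)"
    proof -
      have "norm (L s (z s - z t - (s - t) *\<^sub>R z')) \<le> \<bar>c\<bar> * norm (z s - z t - (s - t) *\<^sub>R z')"
        using bnd[OF s(1)] by (rule order_trans) (simp add: mult_right_mono)
      also have "\<dots> \<le> \<bar>c\<bar> * (\<epsilon> * \<bar>s - t\<bar>)" using d1(2)[OF s(1)] s(2) by (intro mult_left_mono) auto
      finally show ?thesis .
    qed
    moreover have "norm (L s (z t) - L t (z t) - (s - t) *\<^sub>R a) \<le> \<epsilon> * \<bar>s - t\<bar>"
      using d2(2)[OF s(1)] s(2) by auto
    moreover have "norm ((s - t) *\<^sub>R (L s z' - L t z')) \<le> \<epsilon> * \<bar>s - t\<bar>"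
      using d3(2)[OF s(1)] s(2) by (simp add: mult.commute[of "\<bar>s - t\<bar>"] mult_right_mono)
    ultimately have "norm (L s (z s) - L t (z t) - (s - t) *\<^sub>R (a + L t z')) \<le> (\<bar>c\<bar> + 2) * (\<epsilon> * \<bar>s - t\<bar>)"
      unfolding eq by (intro order_trans[OF norm_triangle_le[OF add_mono[OF norm_triangle_ineq order_refl]]])
        (auto simp: algebra_simps)
    also have "\<dots> \<le> e * \<bar>s - t\<bar>"
      using e by (simp add: \<epsilon>_def field_simps)
    finally show "norm (L s (z s) - L t (z t) - (s - t) *\<^sub>R (a + L t z')) \<le> e * \<bar>s - t\<bar>" .
  qed (use d1 d2 d3 in auto)
qed

lemma has_vector_derivative_imp_tendsto:
  "(f has_vector_derivative f') (at t within I) \<Longrightarrow> (f \<longlongrightarrow> f t) (at t within I)"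
  using has_vector_derivative_continuous continuous_within by blast

text \<open>Derivative of an inverse: \<open>R s\<close> inverts the possibly unbounded operator \<open>N s\<close>.\<close>

lemma has_vector_derivative_inverse_family:
  fixes R :: "real \<Rightarrow> 'a::real_normed_vector \<Rightarrow> 'b::real_normed_vector"
  assumes t: "t \<in> I" and lin: "\<And>s. s \<in> I \<Longrightarrow> bounded_linear (R s)"
    and bnd: "\<And>s v. s \<in> I \<Longrightarrow> norm (R s v) \<le> c * norm v"
    and inv: "\<And>s w. s \<in> I \<Longrightarrow> R s (N s (R t w)) = R t w" "\<And>w. N t (R t w) = w"
    and N': "\<And>w. ((\<lambda>s. N s (R t w)) has_vector_derivative N' w) (at t within I)"
  shows "((\<lambda>s. R s v) has_vector_derivative - R t (N' v)) (at t within I)"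
proof -
  \<comment> \<open>Resolvent identity. The difference of the inverses involves \<open>N s\<close>
    at the fixed vector \<open>R t w\<close> only, so the unbounded operators are never
    differentiated along a moving argument.\<close>
  have eq: "R s w - R t w = - R s (N s (R t w) - w)" if "s \<in> I" for s w
    using that by (simp add: bounded_linear.linear[OF lin] linear_diff inv)
  have cont: "((\<lambda>s. R s w) \<longlongrightarrow> R t w) (at t within I)" for w
  proof -
    have "((\<lambda>s. N s (R t w)) \<longlongrightarrow> w) (at t within I)"
      using has_vector_derivative_imp_tendsto[OF N', of w] by (simp add: inv)
    then have "((\<lambda>s. c * norm (N s (R t w) - w)) \<longlongrightarrow> 0) (at t within I)"
      by (intro tendsto_mult_right_zero tendsto_norm_zero LIM_zero)
    then have "((\<lambda>s. R s w - R t w) \<longlongrightarrow> 0) (at t within I)"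
      by (rule tendsto_0_le[where K=1])
         (auto simp: eventually_at_filter eq intro!: always_eventually order_trans[OF bnd abs_ge_self])
    then show ?thesis by (simp add: LIM_zero_iff)
  qed
  \<comment> \<open>The inner vector vanishes at \<open>s = t\<close>, so the still unknown
    derivative of \<open>R\<close> enters only through its value at \<open>0\<close>. Strong
    continuity of \<open>R\<close> is then enough for the product rule.\<close>
  have "((\<lambda>s. - R s (N s (R t v) - v)) has_vector_derivative - (0 + R t (N' v))) (at t within I)"
  proof (intro has_vector_derivative_minus has_vector_derivative_strong_product[OF t lin bnd cont])
    have "(\<lambda>s. R s (N t (R t v) - v)) = (\<lambda>s. R s 0)" by (simp add: inv)
    moreover have "((\<lambda>s. R s 0) has_vector_derivative 0) (at t within I)"
      by (rule has_vector_derivative_transform[OF t, where f="\<lambda>_. 0"])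
         (use lin in \<open>auto simp: linear_simps\<close>)
    ultimately show "((\<lambda>s. R s (N t (R t v) - v)) has_vector_derivative 0) (at t within I)" by simp
    show "((\<lambda>s. N s (R t v) - v) has_vector_derivative N' v) (at t within I)"
      using has_vector_derivative_diff[OF N' has_vector_derivative_const, of v v] by simp
  qed
  then have "((\<lambda>s. R s v - R t v) has_vector_derivative - R t (N' v)) (at t within I)"
    by (intro has_vector_derivative_transform[OF t, of "\<lambda>s. R s v - R t v"]) (auto simp: eq)
  from has_vector_derivative_add[OF this has_vector_derivative_const[of "R t v"]]
  show ?thesis by simp
qed

text \<open>With the weight \<open>exp (\<mu> * t)\<close> and \<open>\<mu> = 2 * c + 1\<close> the
  factor \<open>c / \<mu>\<close> is at most \<open>1 / 2\<close>, whatever \<open>c\<close> and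
  \<open>T\<close> are, so no continuation over short intervals is required.\<close>

lemma volterra_fixpoint:
  fixes \<Phi> :: "(real \<Rightarrow> 'a::{real_normed_vector,complete_space}) \<Rightarrow> real \<Rightarrow> 'a"
  assumes \<Phi>: "\<And>x. continuous_on {0..T} x \<Longrightarrow> continuous_on {0..T} (\<Phi> x)"
    and c: "0 \<le> c"
    and contr: "\<And>x y t. \<lbrakk>continuous_on {0..T} x; continuous_on {0..T} y; t \<in> {0..T}\<rbrakk>
           \<Longrightarrow> norm (\<Phi> x t - \<Phi> y t) \<le> c * integral {0..t} (\<lambda>s. norm (x s - y s))"
  shows "\<exists>x. continuous_on {0..T} x \<and> (\<forall>t\<in>{0..T}. \<Phi> x t = x t)"
proof -
  define \<mu> where "\<mu> = 2 * c + 1"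
  have "\<exists>x\<in>{x. continuous_on {0..T} x}. \<forall>t\<in>{0..T}. \<Phi> x t = x t"
  proof (rule weighted_contraction_fixpoint[where w="\<lambda>t. exp (\<mu> * t)" and W="exp (\<mu> * T)" and ?x0.0="\<lambda>_. 0"])
    show "bounded (x ` {0..T})" if "x \<in> {x. continuous_on {0..T} x}" for x :: "real \<Rightarrow> 'a"
      using that by (auto intro: compact_imp_bounded compact_continuous_image)
    show "x \<in> {x. continuous_on {0..T} x}"
      if "\<And>n. u n \<in> {x. continuous_on {0..T} x}" "uniform_limit {0..T} u x sequentially"
      for u and x :: "real \<Rightarrow> 'a"
      using that uniform_limit_theorem[where f=u and F=sequentially] by simp
    show "1 \<le> exp (\<mu> * t)" "exp (\<mu> * t) \<le> exp (\<mu> * T)" if "t \<in> {0..T}" for t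
      using that c by (auto simp: \<mu>_def intro: mult_left_mono)
    fix x y :: "real \<Rightarrow> 'a" and d t
    assume xy: "x \<in> {x. continuous_on {0..T} x}" "y \<in> {x. continuous_on {0..T} x}" and d: "0 \<le> d"
      and le: "\<And>t. t \<in> {0..T} \<Longrightarrow> norm (x t - y t) \<le> d * exp (\<mu> * t)" and t: "t \<in> {0..T}"
    have "norm (\<Phi> x t - \<Phi> y t) \<le> c * integral {0..t} (\<lambda>s. norm (x s - y s))"
      using contr xy t by simp
    also have "\<dots> \<le> c * (d / \<mu> * exp (\<mu> * t))"
    proof (intro mult_left_mono integral_exp_weight)
      show "continuous_on {0..t} (\<lambda>s. norm (x s - y s))"
        using xy t by (intro continuous_intros) (auto elim: continuous_on_subset)
    qed (use le t c d in \<open>auto simp: \<mu>_def\<close>)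
    also have "\<dots> = (c / \<mu>) * (d * exp (\<mu> * t))" by simp
    also have "\<dots> \<le> (1 / 2) * (d * exp (\<mu> * t))"
      using c d by (intro mult_right_mono) (auto simp: \<mu>_def field_simps)
    finally show "norm (\<Phi> x t - \<Phi> y t) \<le> d / 2 * exp (\<mu> * t)" by simp
  qed (use \<Phi> in auto)
  then show ?thesis by blast
qed

text \<open>Picard iteration. The integral operator is \<open>x \<mapsto> x0 + P x\<close>, where
  \<open>P x\<close> is some antiderivative vanishing at \<open>0\<close>; two of them are compared
  by the mean value inequality, which brings in only the scalar integral of
  \<open>norm (x s - y s)\<close>.\<close>

lemma linear_ode_exists:
  fixes L :: "real \<Rightarrow> 'a::{real_inner,complete_space} \<Rightarrow> 'a"
  assumes lin: "\<And>t. t \<in> {0..T} \<Longrightarrow> bounded_linear (L t)"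
    and bnd: "\<And>t v. t \<in> {0..T} \<Longrightarrow> norm (L t v) \<le> c * norm v" and c: "0 \<le> c"
    and cont: "\<And>v. continuous_on {0..T} (\<lambda>t. L t v)" and G: "continuous_on {0..T} G"
  shows "\<exists>x. x 0 = x0 \<and> (\<forall>t\<in>{0..T}. (x has_vector_derivative L t (x t) + G t) (at t within {0..T}))"
proof (cases "0 \<le> T")
  case True
  have Lx: "continuous_on {0..T} (\<lambda>t. L t (x t) + G t)" if "continuous_on {0..T} x" for x
    by (intro continuous_intros G continuous_on_strongly_continuous[OF lin bnd cont that]) auto
  have "\<exists>F. F 0 = 0 \<and> (\<forall>t\<in>{0..T}. (F has_vector_derivative L t (x t) + G t) (at t within {0..T}))"
    if "continuous_on {0..T} x" for x
    using antiderivative_exists[OF Lx[OF that]] .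
  then obtain P where P0: "\<And>x. continuous_on {0..T} x \<Longrightarrow> P x 0 = 0"
    and P: "\<And>x t. continuous_on {0..T} x \<Longrightarrow> t \<in> {0..T} \<Longrightarrow> (P x has_vector_derivative L t (x t) + G t) (at t within {0..T})"
    by metis
  have "\<exists>x. continuous_on {0..T} x \<and> (\<forall>t\<in>{0..T}. x0 + P x t = x t)"
  proof (rule volterra_fixpoint[OF _ c])
    show "continuous_on {0..T} (\<lambda>t. x0 + P x t)" if "continuous_on {0..T} x" for x
      using has_vector_derivative_continuous[OF P[OF that]]
      by (intro continuous_intros) (simp add: continuous_on_eq_continuous_within)
    fix x y :: "real \<Rightarrow> 'a" and t assume xy: "continuous_on {0..T} x" "continuous_on {0..T} y" and t: "t \<in> {0..T}"
    have cont_xy: "continuous_on {0..t} (\<lambda>s. norm (x s - y s))"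
      using xy t by (intro continuous_intros) (auto elim: continuous_on_subset)
    have "norm ((P x t - P y t) - (P x 0 - P y 0)) \<le>
        c * integral {0..t} (\<lambda>s. norm (x s - y s)) - c * integral {0..0} (\<lambda>s. norm (x s - y s))"
    proof (rule vector_mvt_bound[where f="\<lambda>t. P x t - P y t" and \<phi>="\<lambda>t. c * integral {0..t} (\<lambda>s. norm (x s - y s))"])
      fix s assume s: "s \<in> {0..t}"
      then have sT: "s \<in> {0..T}" using t by auto
      show "((\<lambda>t. P x t - P y t) has_vector_derivative (L s (x s) + G s) - (L s (y s) + G s)) (at s within {0..t})"
        using s t xy by (intro has_vector_derivative_diff has_vector_derivative_within_subset[OF P]) auto
      show "((\<lambda>t. c * integral {0..t} (\<lambda>s. norm (x s - y s))) has_vector_derivative c * norm (x s - y s)) (at s within {0..t})"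
        using integral_has_real_derivative[OF cont_xy s]
        by (auto intro!: derivative_eq_intros simp flip: has_real_derivative_iff_has_vector_derivative)
      have "(L s (x s) + G s) - (L s (y s) + G s) = L s (x s - y s)"
        using lin[OF sT] by (simp add: linear_simps)
      then show "norm ((L s (x s) + G s) - (L s (y s) + G s)) \<le> c * norm (x s - y s)"
        using bnd[OF sT] by simp
    qed (use t in auto)
    then show "norm ((x0 + P x t) - (x0 + P y t)) \<le> c * integral {0..t} (\<lambda>s. norm (x s - y s))"
      using P0 xy by simp
  qed
  then obtain x where x: "continuous_on {0..T} x" "\<And>t. t \<in> {0..T} \<Longrightarrow> x0 + P x t = x t" by blast
  have "(x has_vector_derivative L t (x t) + G t) (at t within {0..T})" if t: "t \<in> {0..T}" for t
    using has_vector_derivative_add[OF has_vector_derivative_const P[OF x(1) t], of x0]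
    by (intro has_vector_derivative_transform[OF t, of x "\<lambda>t. x0 + P x t"]) (auto simp: x(2))
  moreover have "x 0 = x0" using x(2)[of 0] P0[OF x(1)] True by simp
  ultimately show ?thesis by blast
qed auto

lemma uniform_limit_has_vector_derivative:
  fixes f :: "nat \<Rightarrow> real \<Rightarrow> 'a::real_normed_vector"
  assumes f': "\<And>n t. t \<in> {a..b} \<Longrightarrow> (f n has_vector_derivative f' n t) (at t within {a..b})"
    and f: "\<And>t. t \<in> {a..b} \<Longrightarrow> (\<lambda>n. f n t) \<longlonglongrightarrow> g t"
    and g': "uniform_limit {a..b} f' g' sequentially"
    and cont: "continuous_on {a..b} g'" and t: "t \<in> {a..b}"
  shows "(g has_vector_derivative g' t) (at t within {a..b})"
  unfolding has_vector_derivative_within_alt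
proof safe
  fix e :: real assume e: "0 < e"
  obtain d where d: "d > 0" "\<And>s. s \<in> {a..b} \<Longrightarrow> \<bar>s - t\<bar> < d \<Longrightarrow> norm (g' s - g' t) < e / 2"
    using cont t e unfolding continuous_on_iff dist_norm by (metis half_gt_zero real_norm_def)
  obtain N where N: "\<And>n s. n \<ge> N \<Longrightarrow> s \<in> {a..b} \<Longrightarrow> norm (f' n s - g' s) < e / 2"
    using uniform_limitD[OF g', of "e / 2"] e unfolding eventually_sequentially dist_norm by (meson half_gt_zero)
  have "norm (g s - g t - (s - t) *\<^sub>R g' t) \<le> e * \<bar>s - t\<bar>" if s: "s \<in> {a..b}" "\<bar>s - t\<bar> < d" for s
  proof -
    have seg: "r \<in> {a..b}" "\<bar>r - t\<bar> < d" if "r \<in> closed_segment t s" for r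
      using s t that by (auto simp: closed_segment_eq_real_ivl split: if_splits)
    have bound: "norm (f n s - f n t - (s - t) *\<^sub>R g' t) \<le> e * \<bar>s - t\<bar>" if n: "n \<ge> N" for n
    proof -
      have "norm ((f n s - s *\<^sub>R g' t) - (f n t - t *\<^sub>R g' t)) \<le> e * norm (s - t)"
      proof (rule differentiable_bound[of "closed_segment t s" "\<lambda>r. f n r - r *\<^sub>R g' t" "\<lambda>r h. h *\<^sub>R (f' n r - g' t)"])
        fix r assume r: "r \<in> closed_segment t s"
        have "((\<lambda>r. f n r - r *\<^sub>R g' t) has_vector_derivative f' n r - g' t) (at r within closed_segment t s)"
          using seg(1) r by (auto intro!: derivative_eq_intros has_vector_derivative_within_subset[OF f'])
        then show "((\<lambda>r. f n r - r *\<^sub>R g' t) has_derivative (\<lambda>h. h *\<^sub>R (f' n r - g' t))) (at r within closed_segment t s)"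
          by (simp add: has_vector_derivative_def)
        have "norm (f' n r - g' t) \<le> norm (f' n r - g' r) + norm (g' r - g' t)"
          using norm_triangle_ineq[of "f' n r - g' r" "g' r - g' t"] by simp
        then have "norm (f' n r - g' t) \<le> e" using N[OF n seg(1)[OF r]] d(2)[OF seg[OF r]] by simp
        then show "onorm (\<lambda>h. h *\<^sub>R (f' n r - g' t)) \<le> e"
          using e by (intro onorm_bound) (auto simp: mult.commute[of e] intro: mult_left_mono)
      qed auto
      then show ?thesis by (simp add: algebra_simps)
    qed
    have "(\<lambda>n. norm (f n s - f n t - (s - t) *\<^sub>R g' t)) \<longlonglongrightarrow> norm (g s - g t - (s - t) *\<^sub>R g' t)"
      by (intro tendsto_intros f s t)
    then show ?thesis by (rule LIMSEQ_le_const2) (use bound in blast)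
  qed
  then show "\<exists>d>0. \<forall>s\<in>{a..b}. \<bar>s - t\<bar> < d \<longrightarrow> norm (g s - g t - (s - t) *\<^sub>R g' t) \<le> e * \<bar>s - t\<bar>"
    using d(1) by blast
qed

lemma has_vector_derivative_shift:
  assumes "(V has_vector_derivative V') (at (t - h) within {a - h..b - h})"
  shows "((\<lambda>t. V (t - h)) has_vector_derivative V') (at t within {a..b})"
proof -
  have "(\<lambda>t. t - h) ` {a..b} = {a - h..b - h}"
    using image_add_atLeastAtMost[of "-h" a b] by (simp add: add.commute)
  then have "((V \<circ> (\<lambda>t. t - h)) has_vector_derivative 1 *\<^sub>R V') (at t within {a..b})"
    using assms by (intro vector_diff_chain_within) (auto intro!: derivative_eq_intros)
  then show ?thesis by (simp add: o_def)
qed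

text \<open>Steklov averages over the past, so that the derivative at \<open>t\<close> only sees \<open>F\<close> up to time \<open>t\<close>.\<close>

lemma steklov_average:
  fixes F :: "real \<Rightarrow> 'a::{real_inner,complete_space}"
  assumes F: "continuous_on {0..T} F" and h: "0 < h" and T: "0 \<le> T"
  shows "\<exists>G. (\<forall>t\<in>{0..T}. (G has_vector_derivative (F t - F (max 0 (t - h))) /\<^sub>R h) (at t within {0..T})) \<and>
     (\<forall>t\<in>{0..T}. \<forall>e. (\<forall>s\<in>{0..t}. t - s \<le> h \<longrightarrow> norm (F s - F t) \<le> e) \<longrightarrow> norm (G t - F t) \<le> e)"
proof -
  \<comment> \<open>Constant extension to the left, so that averages over \<open>{t - h..t}\<close>
    make sense for \<open>t < h\<close>.\<close>
  define E where "E s = F (max 0 s)" for s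
  have E: "continuous_on {-h..T} E"
    unfolding E_def by (rule continuous_on_compose2[OF F]) (use T in \<open>auto intro!: continuous_intros\<close>)
  obtain V where V: "\<And>t. t \<in> {-h..T} \<Longrightarrow> (V has_vector_derivative E t) (at t within {-h..T})"
    using antiderivative_exists[OF E] by blast
  define G where "G t = (V t - V (t - h)) /\<^sub>R h" for t
  have "(G has_vector_derivative (F t - F (max 0 (t - h))) /\<^sub>R h) (at t within {0..T})" if t: "t \<in> {0..T}" for t
  proof -
    have "((\<lambda>t. V (t - h)) has_vector_derivative E (t - h)) (at t within {0..T})"
      by (intro has_vector_derivative_shift has_vector_derivative_within_subset[OF V]) (use h t in auto)
    moreover have "(V has_vector_derivative E t) (at t within {0..T})"
      by (intro has_vector_derivative_within_subset[OF V]) (use h t in auto)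
    ultimately have "(G has_vector_derivative inverse h *\<^sub>R (E t - E (t - h))) (at t within {0..T})"
      unfolding G_def using bounded_linear.has_vector_derivative[OF bounded_linear_scaleR_right[of "inverse h"]]
        has_vector_derivative_diff by blast
    then show ?thesis using t by (simp add: E_def)
  qed
  moreover have "norm (G t - F t) \<le> e"
    if t: "t \<in> {0..T}" and e: "\<forall>s\<in>{0..t}. t - s \<le> h \<longrightarrow> norm (F s - F t) \<le> e" for t e
  proof -
    have "norm ((V t - t *\<^sub>R F t) - (V (t - h) - (t - h) *\<^sub>R F t)) \<le> e * (t - (t - h))"
    proof (rule vector_mvt_bound_const)
      fix s assume s: "s \<in> {t - h..t}"
      show "((\<lambda>s. V s - s *\<^sub>R F t) has_vector_derivative E s - F t) (at s within {t - h..t})"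
        by (auto intro!: derivative_eq_intros has_vector_derivative_within_subset[OF V]) (use s t h in auto)
      show "norm (E s - F t) \<le> e" unfolding E_def by (rule e[rule_format]) (use s t h in auto)
    qed (use h in auto)
    then have "norm (h *\<^sub>R (G t - F t)) \<le> e * h" using h by (simp add: G_def algebra_simps)
    then show ?thesis using h by simp
  qed
  ultimately show ?thesis by blast
qed

text \<open>
  A Lipschitz function with values in a Hilbert space is the limit of \<open>C\<^sup>1\<close> functions whose derivatives
  converge in \<open>L\<^sup>1\<close> (the Radon-Nikodym property). The approximants nearly minimise the \<open>L\<^sup>2\<close>-norm
  of the derivative over convex sets of \<open>C\<^sup>1\<close> functions that shrink to \<open>F\<close>.
\<close>

lemma lipschitz_C1_approximation:
  fixes F :: "real \<Rightarrow> 'a::{real_inner,complete_space}"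
  assumes T: "0 < T" and l: "mono_on {0..T} l" and l0: "\<And>t. t \<in> {0..T} \<Longrightarrow> 0 \<le> l t"
    and F: "\<And>s t. 0 \<le> s \<Longrightarrow> s \<le> t \<Longrightarrow> t \<le> T \<Longrightarrow> norm (F t - F s) \<le> l t * (t - s)"
  shows "\<exists>G G'. (\<forall>n. \<forall>t\<in>{0..T}. (G n has_vector_derivative G' n t) (at t within {0..T})) \<and>
    (\<forall>n. continuous_on {0..T} (G' n)) \<and> (\<forall>n. \<forall>t\<in>{0..T}. norm (G' n t) \<le> l t) \<and>
    (\<forall>n. \<forall>t\<in>{0..T}. norm (G n t - F t) \<le> 1 / Suc n) \<and>
    (\<forall>e>0. \<exists>N. \<forall>m\<ge>N. \<forall>n\<ge>N. integral {0..T} (\<lambda>t. norm (G' m t - G' n t)) < e)"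
proof -
  have lT: "l t \<le> l T" if "t \<in> {0..T}" for t using l that T by (auto simp: mono_on_def)
  have lT0: "0 \<le> l T" using l0[of T] T by simp
  have contF: "continuous_on {0..T} F"
  proof (rule continuous_on_iff[THEN iffD2], safe)
    fix t e :: real assume t: "t \<in> {0..T}" and e: "0 < e"
    have "dist (F s) (F t) < e" if s: "s \<in> {0..T}" "dist s t < e / (l T + 1)" for s
    proof -
      have "norm (F s - F t) \<le> l T * \<bar>s - t\<bar>"
      proof (cases "s \<le> t")
        case True
        then show ?thesis using F[of s t] lT[OF t] s t
          by (simp add: norm_minus_commute) (meson diff_ge_0_iff_ge mult_right_mono order_trans)
      next
        case False
        then have "norm (F s - F t) \<le> l s * (s - t)" using F[of t s] s t by simp
        also have "\<dots> \<le> l T * (s - t)" using False lT[OF s(1)] by (intro mult_right_mono) auto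
        finally show ?thesis using False by simp
      qed
      also have "\<dots> \<le> (l T + 1) * \<bar>s - t\<bar>" by (simp add: mult_right_mono)
      also have "\<dots> < e" using s(2) lT0 by (simp add: dist_real_def field_simps)
      finally show ?thesis by (simp add: dist_norm)
    qed
    then show "\<exists>d>0. \<forall>x'\<in>{0..T}. dist x' t < d \<longrightarrow> dist (F x') (F t) < e"
      using e lT0 by (intro exI[of _ "e / (l T + 1)"]) auto
  qed
  \<comment> \<open>Pairs of a function and its derivative. Each condition is convex, so midpoints
    stay inside; only the last one depends on \<open>n\<close>, so the sets decrease.\<close>
  define K where "K n = {(G, G'). (\<forall>t\<in>{0..T}. (G has_vector_derivative G' t) (at t within {0..T})) \<and>
    continuous_on {0..T} G' \<and> (\<forall>t\<in>{0..T}. norm (G' t) \<le> l t) \<and>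
    (\<forall>t\<in>{0..T}. norm (G t - F t) \<le> 1 / Suc n)}" for n :: nat
  have KI: "(P, Q) \<in> K n"
    if "\<And>t. t \<in> {0..T} \<Longrightarrow> (P has_vector_derivative Q t) (at t within {0..T})"
      "continuous_on {0..T} Q" "\<And>t. t \<in> {0..T} \<Longrightarrow> norm (Q t) \<le> l t"
      "\<And>t. t \<in> {0..T} \<Longrightarrow> norm (P t - F t) \<le> 1 / Suc n" for P Q n
    using that by (simp add: K_def)
  define J where "J g = integral {0..T} (\<lambda>t. (norm (g t))\<^sup>2)" for g :: "real \<Rightarrow> 'a"
  have int: "(\<lambda>t. (norm (g t))\<^sup>2) integrable_on {0..T}" if "continuous_on {0..T} g" for g :: "real \<Rightarrow> 'a"
    using that by (intro integrable_continuous_interval continuous_intros)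
  have ne: "\<exists>G G'. (G, G') \<in> K n" for n
  proof -
    \<comment> \<open>This step keeps the backward average within \<open>1 / Suc n\<close> of
      \<open>F\<close>. Its difference quotient at \<open>t\<close> looks back from
      \<open>t\<close>, hence is bounded by \<open>l t\<close> and not by a later, larger value of
      \<open>l\<close>.\<close>
    define h where "h = 1 / ((l T + 1) * Suc n)"
    have h: "0 < h" using lT0 by (simp add: h_def)
    obtain G where G: "\<And>t. t \<in> {0..T} \<Longrightarrow> (G has_vector_derivative (F t - F (max 0 (t - h))) /\<^sub>R h) (at t within {0..T})"
      and GF: "\<And>t e. t \<in> {0..T} \<Longrightarrow> (\<And>s. s \<in> {0..t} \<Longrightarrow> t - s \<le> h \<Longrightarrow> norm (F s - F t) \<le> e) \<Longrightarrow> norm (G t - F t) \<le> e"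
      using steklov_average[OF contF h] T by (metis less_imp_le)
    have "continuous_on {0..T} (\<lambda>t. F (max 0 (t - h)))"
      by (rule continuous_on_compose2[OF contF]) (use h T in \<open>auto intro!: continuous_intros\<close>)
    then have "continuous_on {0..T} (\<lambda>t. (F t - F (max 0 (t - h))) /\<^sub>R h)"
      by (intro continuous_intros contF) (use h in auto)
    moreover have "norm ((F t - F (max 0 (t - h))) /\<^sub>R h) \<le> l t" if t: "t \<in> {0..T}" for t
    proof -
      have "norm (F t - F (max 0 (t - h))) \<le> l t * (t - max 0 (t - h))"
        using t h by (intro F) auto
      also have "\<dots> \<le> l t * h" using l0[OF t] t by (intro mult_left_mono) auto
      finally show ?thesis using h by (simp add: divide_inverse_commute[symmetric] pos_divide_le_eq)
    qed
    moreover have "norm (G t - F t) \<le> 1 / Suc n" if t: "t \<in> {0..T}" for t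
    proof (rule GF[OF t])
      fix s assume s: "s \<in> {0..t}" "t - s \<le> h"
      have "norm (F s - F t) \<le> l t * (t - s)" using F[of s t] s t by (simp add: norm_minus_commute)
      also have "\<dots> \<le> l T * h" using s t lT[OF t] lT0 by (intro mult_mono) auto
      also have "\<dots> \<le> (l T + 1) * h" using h by (intro mult_right_mono) auto
      also have "\<dots> = 1 / Suc n" using lT0 by (simp add: h_def)
      finally show "norm (F s - F t) \<le> 1 / Suc n" .
    qed
    ultimately have "(G, \<lambda>t. (F t - F (max 0 (t - h))) /\<^sub>R h) \<in> K n"
      by (intro KI G) blast+
    then show ?thesis by blast
  qed
  define d where "d n = Inf (J ` snd ` K n)" for n
  have J0: "0 \<le> J g" if "continuous_on {0..T} g" for g :: "real \<Rightarrow> 'a"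
    unfolding J_def by (intro integral_nonneg int that) auto
  have Kc: "continuous_on {0..T} G'" if "(G, G') \<in> K n" for G G' n using that by (simp add: K_def)
  have bdd: "bdd_below (J ` snd ` K n)" for n
    using J0 Kc by (intro bdd_belowI[of _ 0]) auto
  have d_le: "d n \<le> J G'" if "(G, G') \<in> K n" for G G' n
    unfolding d_def using that by (intro cInf_lower bdd) force
  have "\<exists>G G'. (G, G') \<in> K n \<and> J G' < d n + inverse (Suc n)" for n
  proof -
    have "Inf (J ` snd ` K n) < d n + inverse (Suc n)" by (simp add: d_def)
    moreover have "J ` snd ` K n \<noteq> {}" using ne[of n] by auto
    ultimately show ?thesis using cInf_less_iff[OF _ bdd] by fastforce
  qed
  then obtain G G' where GK: "\<And>n. (G n, G' n) \<in> K n" and GJ: "\<And>n. J (G' n) < d n + inverse (Suc n)"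
    by metis
  have K_mono: "K m \<subseteq> K n" if "n \<le> m" for m n
  proof -
    have "1 / real (Suc m) \<le> 1 / real (Suc n)" using that by (simp add: field_simps)
    then show ?thesis unfolding K_def by (auto intro: order_trans)
  qed
  have "bdd_above (range d)"
  proof (rule bdd_aboveI2)
    fix n
    have "J (G' n) \<le> integral {0..T} (\<lambda>t. (l T)\<^sup>2)"
      unfolding J_def
    proof (rule integral_le)
      fix t assume t: "t \<in> {0..T}"
      have "norm (G' n t) \<le> l T" using GK[of n] lT[OF t] t by (auto simp: K_def intro: order_trans)
      then show "(norm (G' n t))\<^sup>2 \<le> (l T)\<^sup>2" by (simp add: power_mono)
    qed (use int Kc[OF GK] in auto)
    then show "d n \<le> integral {0..T} (\<lambda>t. (l T)\<^sup>2)" using d_le[OF GK[of n]] by simp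
  qed
  \<comment> \<open>Infima over decreasing sets increase; being bounded by the integral of the
    squared constant \<open>l T\<close>, they converge.\<close>
  moreover have "incseq d"
  proof (rule monoI)
    fix n m :: nat assume "n \<le> m"
    then show "d n \<le> d m" unfolding d_def using K_mono bdd ne[of m]
      by (intro cInf_superset_mono image_mono) auto
  qed
  ultimately have "convergent d" using incseq_convergent[of d] by (metis Bseq_mono_convergent Bseq_monoseq_convergent bdd_above.E convergentI rangeI)
  then have dC: "Cauchy d" by (rule convergent_Cauchy)
  have mid: "((\<lambda>t. (1/2) *\<^sub>R (G m t + G n t)), (\<lambda>t. (1/2) *\<^sub>R (G' m t + G' n t))) \<in> K n" if "n \<le> m" for m n
  proof -
    have K2: "(G m, G' m) \<in> K n" "(G n, G' n) \<in> K n" using GK K_mono[OF that] by blast+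
    show ?thesis
    proof (rule KI)
      fix t assume t: "t \<in> {0..T}"
      have "((\<lambda>t. G m t + G n t) has_vector_derivative G' m t + G' n t) (at t within {0..T})"
        using K2 t by (intro has_vector_derivative_add) (auto simp: K_def)
      from bounded_linear.has_vector_derivative[OF bounded_linear_scaleR_right this, of "1/2"]
      show "((\<lambda>t. (1/2) *\<^sub>R (G m t + G n t)) has_vector_derivative (1/2) *\<^sub>R (G' m t + G' n t)) (at t within {0..T})" .
      have "norm (G' m t + G' n t) \<le> l t + l t"
        using K2 t by (intro norm_triangle_mono) (auto simp: K_def)
      then show "norm ((1/2) *\<^sub>R (G' m t + G' n t)) \<le> l t" by simp
      have "norm ((G m t - F t) + (G n t - F t)) \<le> 1 / Suc n + 1 / Suc n"
        using K2 t by (intro norm_triangle_mono) (auto simp: K_def)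
      moreover have "(G m t - F t) + (G n t - F t) = 2 *\<^sub>R ((1/2) *\<^sub>R (G m t + G n t) - F t)"
        by (simp add: scaleR_diff_right scaleR_2)
      ultimately show "norm ((1/2) *\<^sub>R (G m t + G n t) - F t) \<le> 1 / Suc n" by simp
    next
      show "continuous_on {0..T} (\<lambda>t. (1/2) *\<^sub>R (G' m t + G' n t))"
        using Kc[OF GK] by (intro continuous_intros) auto
    qed
  qed
  \<comment> \<open>Parallelogram law in \<open>L^2\<close>. For \<open>n \<le> m\<close> the
    midpoint lies in \<open>K n\<close>, the larger of the two sets, so its functional is at least
    \<open>d n\<close>.\<close>
  have close: "J (\<lambda>t. G' m t - G' n t) \<le> 2 * (d m - d n) + 4 * inverse (Suc n)" if "n \<le> m" for m n
  proof -
    have "J (\<lambda>t. G' m t - G' n t) = 2 * J (G' m) + 2 * J (G' n) - 4 * J (\<lambda>t. (1/2) *\<^sub>R (G' m t + G' n t))"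
    proof -
      have "(norm (a - b))\<^sup>2 = 2 * (norm a)\<^sup>2 + 2 * (norm b)\<^sup>2 - 4 * (norm ((1/2) *\<^sub>R (a + b)))\<^sup>2" for a b :: 'a
        by (simp add: power2_norm_eq_inner inner_simps power_divide inner_commute field_simps)
      then have "J (\<lambda>t. G' m t - G' n t) = integral {0..T} (\<lambda>t. 2 * (norm (G' m t))\<^sup>2 + 2 * (norm (G' n t))\<^sup>2
          - 4 * (norm ((1/2) *\<^sub>R (G' m t + G' n t)))\<^sup>2)"
        unfolding J_def by presburger
      also have "\<dots> = integral {0..T} (\<lambda>t. 2 * (norm (G' m t))\<^sup>2) + integral {0..T} (\<lambda>t. 2 * (norm (G' n t))\<^sup>2)
          - integral {0..T} (\<lambda>t. 4 * (norm ((1/2) *\<^sub>R (G' m t + G' n t)))\<^sup>2)"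
        using Kc[OF GK] by (subst integral_diff, (intro integrable_continuous_interval continuous_intros; auto)+)
          (subst integral_add, (intro integrable_continuous_interval continuous_intros; auto)+, simp)
      finally show ?thesis unfolding J_def by simp
    qed
    moreover have "d n \<le> J (\<lambda>t. (1/2) *\<^sub>R (G' m t + G' n t))" using d_le[OF mid[OF that]] .
    moreover have "inverse (real (Suc m)) \<le> inverse (Suc n)" using that by (simp add: field_simps)
    ultimately show ?thesis using GJ[of m] GJ[of n] by argo
  qed
  have L1: "\<exists>N. \<forall>m\<ge>N. \<forall>n\<ge>N. integral {0..T} (\<lambda>t. norm (G' m t - G' n t)) < e" if e: "0 < e" for e
  proof -
    \<comment> \<open>Passage from \<open>L^2\<close> to \<open>L^1\<close> by
      \<open>v \<le> \<eta> + v\<^sup>2 / \<eta>\<close>: the first term contributes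
      \<open>e / 4\<close>, the second \<open>6 * \<epsilon> / \<eta> = 3 / 8 * e\<close>.\<close>
    define \<eta> where "\<eta> = e / (4 * T)"
    have \<eta>: "0 < \<eta>" using e T by (simp add: \<eta>_def)
    define \<epsilon> where "\<epsilon> = \<eta> * e / 16"
    have \<epsilon>: "0 < \<epsilon>" using \<eta> e by (simp add: \<epsilon>_def)
    obtain N1 where N1: "\<And>m n. m \<ge> N1 \<Longrightarrow> n \<ge> N1 \<Longrightarrow> \<bar>d m - d n\<bar> < \<epsilon>"
      using dC \<epsilon> unfolding Cauchy_def dist_real_def by meson
    obtain N2 where N2: "inverse (Suc N2) < \<epsilon>" using reals_Archimedean[OF \<epsilon>] by auto
    have less: "integral {0..T} (\<lambda>t. norm (G' m t - G' n t)) < e" if mn: "n \<ge> max N1 N2" "n \<le> m" for m n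
    proof -
      have "inverse (real (Suc n)) \<le> inverse (Suc N2)" using mn by (simp add: field_simps)
      then have "inverse (real (Suc n)) < \<epsilon>" using N2 by (rule le_less_trans)
      moreover have "\<bar>d m - d n\<bar> < \<epsilon>" using N1[of m n] mn by simp
      then have "d m - d n < \<epsilon>" by simp
      ultimately have Jl: "J (\<lambda>t. G' m t - G' n t) \<le> 6 * \<epsilon>"
        using close[OF mn(2)] by argo
      have "integral {0..T} (\<lambda>t. norm (G' m t - G' n t)) \<le> integral {0..T} (\<lambda>t. \<eta> + (norm (G' m t - G' n t))\<^sup>2 / \<eta>)"
      proof (rule integral_le)
        show "norm (G' m t - G' n t) \<le> \<eta> + (norm (G' m t - G' n t))\<^sup>2 / \<eta>" for t
        proof -
          have "v \<le> \<eta> + v\<^sup>2 / \<eta>" for v :: real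
          proof -
            have "0 \<le> (v - \<eta>)\<^sup>2 + v * v + \<eta> * \<eta>" by simp
            then have "v * \<eta> \<le> \<eta> * \<eta> + v\<^sup>2" by (simp add: power2_eq_square algebra_simps)
            then show ?thesis using \<eta> by (simp add: field_simps power2_eq_square)
          qed
          then show ?thesis .
        qed
      qed (use \<eta> Kc[OF GK] in \<open>intro integrable_continuous_interval continuous_intros; auto\<close>)+
      also have "\<dots> = \<eta> * T + J (\<lambda>t. G' m t - G' n t) / \<eta>"
        using int[of "\<lambda>t. G' m t - G' n t"] Kc[OF GK] T \<eta>
        by (subst integral_add) (auto simp: J_def intro!: continuous_intros integrable_continuous_interval)
      also have "\<dots> \<le> \<eta> * T + (6 * \<epsilon>) / \<eta>" using Jl \<eta> by (simp add: divide_right_mono)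
      also have "\<dots> = 5 / 8 * e" using \<eta> T e by (simp add: \<eta>_def \<epsilon>_def)
      finally show ?thesis using e by simp
    qed
    have "integral {0..T} (\<lambda>t. norm (G' m t - G' n t)) < e" if "m \<ge> max N1 N2" "n \<ge> max N1 N2" for m n
      using less[of n m] less[of m n] that by (cases "n \<le> m") (auto simp: norm_minus_commute)
    then show ?thesis by blast
  qed
  show ?thesis
    by (intro exI[of _ G] exI[of _ G'] conjI) (use GK L1 in \<open>auto simp: K_def\<close>)
qed

section \<open>Dissipative operators\<close>

text \<open>The conditions of the Lumer-Phillips theorem, the only form in which the generators
  enter the evolution equation. Linearity is spelled out on \<open>D\<close>, because
  \<open>A\<close> is arbitrary elsewhere.\<close>

definition m_dissipative :: "'a::real_inner set \<Rightarrow> ('a \<Rightarrow> 'a) \<Rightarrow> bool" where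
  "m_dissipative D A \<longleftrightarrow> subspace D \<and> closure D = UNIV \<and>
     (\<forall>x\<in>D. \<forall>y\<in>D. A (x + y) = A x + A y) \<and> (\<forall>c. \<forall>x\<in>D. A (c *\<^sub>R x) = c *\<^sub>R A x) \<and>
     (\<forall>x\<in>D. inner (A x) x \<le> 0) \<and> (\<forall>h>0. \<forall>y. \<exists>x\<in>D. x - h *\<^sub>R A x = y)"

text \<open>Clears the denominator, so that generator limits can be attacked with mean value
  estimates for the increments.\<close>

lemma tendsto_right_quotient_iff:
  fixes q :: "real \<Rightarrow> 'a::real_normed_vector"
  shows "((\<lambda>h. q h /\<^sub>R h) \<longlongrightarrow> v) (at_right 0) \<longleftrightarrow>
     (\<forall>e>0. \<exists>d>0. \<forall>h. 0 < h \<and> h < d \<longrightarrow> norm (q h - h *\<^sub>R v) \<le> e * h)"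
proof -
  have eq: "norm (q h /\<^sub>R h - v) = norm (q h - h *\<^sub>R v) / h" if "0 < h" for h
  proof -
    have "q h /\<^sub>R h - v = (q h - h *\<^sub>R v) /\<^sub>R h" using that by (simp add: scaleR_diff_right)
    then show ?thesis using that by (simp add: divide_inverse_commute)
  qed
  have "((\<lambda>h. q h /\<^sub>R h) \<longlongrightarrow> v) (at_right 0) \<longleftrightarrow>
     (\<forall>e>0. \<exists>d>0. \<forall>h. 0 < h \<and> h < d \<longrightarrow> norm (q h - h *\<^sub>R v) / h < e)"
    unfolding tendsto_iff eventually_at_right_field dist_norm
    by (intro all_cong imp_cong ex_cong refl) (auto simp: eq)
  also have "\<dots> \<longleftrightarrow> (\<forall>e>0. \<exists>d>0. \<forall>h. 0 < h \<and> h < d \<longrightarrow> norm (q h - h *\<^sub>R v) \<le> e * h)"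
  proof (intro iffI allI impI)
    fix e :: real assume l: "\<forall>e>0. \<exists>d>0. \<forall>h. 0 < h \<and> h < d \<longrightarrow> norm (q h - h *\<^sub>R v) / h < e" and e: "0 < e"
    obtain d where "0 < d" "\<And>h. 0 < h \<and> h < d \<Longrightarrow> norm (q h - h *\<^sub>R v) / h < e" using l e by blast
    then show "\<exists>d>0. \<forall>h. 0 < h \<and> h < d \<longrightarrow> norm (q h - h *\<^sub>R v) \<le> e * h"
      by (intro exI[of _ d]) (auto simp: pos_divide_less_eq intro: less_imp_le)
  next
    fix e :: real assume r: "\<forall>e>0. \<exists>d>0. \<forall>h. 0 < h \<and> h < d \<longrightarrow> norm (q h - h *\<^sub>R v) \<le> e * h" and e: "0 < e"
    obtain d where d: "0 < d" "\<And>h. 0 < h \<and> h < d \<Longrightarrow> norm (q h - h *\<^sub>R v) \<le> e / 2 * h"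
      using r e by (meson half_gt_zero)
    have "norm (q h - h *\<^sub>R v) / h < e" if "0 < h \<and> h < d" for h
    proof -
      have "norm (q h - h *\<^sub>R v) / h \<le> e / 2" using d(2)[OF that] that by (simp add: pos_divide_le_eq)
      then show ?thesis using e by linarith
    qed
    then show "\<exists>d>0. \<forall>h. 0 < h \<and> h < d \<longrightarrow> norm (q h - h *\<^sub>R v) / h < e" using d(1) by blast
  qed
  finally show ?thesis .
qed

section \<open>Generators of contraction semigroups are m-dissipative\<close>

context
  fixes S :: "real \<Rightarrow> 'a::{real_inner,complete_space} \<Rightarrow>\<^sub>L 'a" and D :: "'a set" and A :: "'a \<Rightarrow> 'a"
  assumes S: "contraction_semigroup S"
    and D: "D = {x. \<exists>y. ((\<lambda>h. (S h x - x) /\<^sub>R h) \<longlongrightarrow> y) (at_right 0)}"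
    and A: "\<And>x. x \<in> D \<Longrightarrow> ((\<lambda>h. (S h x - x) /\<^sub>R h) \<longlongrightarrow> A x) (at_right 0)"
begin

lemma semigroup_0: "S 0 x = x"
  using S by (simp add: contraction_semigroup_def)

lemma semigroup_add: "0 \<le> s \<Longrightarrow> 0 \<le> t \<Longrightarrow> S (s + t) x = S s (S t x)"
  using S by (simp add: contraction_semigroup_def)

lemma semigroup_norm_le: "0 \<le> t \<Longrightarrow> norm (S t x) \<le> norm x"
  using S norm_blinfun[of "S t" x] mult_right_mono[of "norm (S t)" 1 "norm x"]
  by (auto simp: contraction_semigroup_def)

lemma generator_eqI:
  assumes "((\<lambda>h. (S h x - x) /\<^sub>R h) \<longlongrightarrow> y) (at_right 0)"
  shows "x \<in> D" "A x = y"
proof -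
  show "x \<in> D" using assms D by blast
  show "A x = y" by (rule tendsto_unique[OF _ A[OF \<open>x \<in> D\<close>] assms]) simp
qed

lemma generator_add:
  assumes "x \<in> D" "y \<in> D" shows "x + y \<in> D" "A (x + y) = A x + A y"
proof -
  have "((\<lambda>h. (S h (x + y) - (x + y)) /\<^sub>R h) \<longlongrightarrow> A x + A y) (at_right 0)"
    using tendsto_add[OF A[OF assms(1)] A[OF assms(2)]]
    by (simp add: blinfun.add_right add_diff_add scaleR_add_right[symmetric])
  then show "x + y \<in> D" "A (x + y) = A x + A y" by (rule generator_eqI)+
qed

lemma generator_scaleR:
  assumes "x \<in> D" shows "c *\<^sub>R x \<in> D" "A (c *\<^sub>R x) = c *\<^sub>R A x"
proof -
  have "((\<lambda>h. (S h (c *\<^sub>R x) - c *\<^sub>R x) /\<^sub>R h) \<longlongrightarrow> c *\<^sub>R A x) (at_right 0)"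
    using tendsto_scaleR[OF tendsto_const A[OF assms], of c]
    by (simp add: blinfun.scaleR_right scaleR_diff_right mult.commute)
  then show "c *\<^sub>R x \<in> D" "A (c *\<^sub>R x) = c *\<^sub>R A x" by (rule generator_eqI)+
qed

lemma generator_dissipative:
  assumes "x \<in> D" shows "inner (A x) x \<le> 0"
proof -
  have "((\<lambda>h. inner ((S h x - x) /\<^sub>R h) x) \<longlongrightarrow> inner (A x) x) (at_right 0)"
    by (intro tendsto_intros A assms)
  moreover have "\<forall>\<^sub>F h in at_right 0. inner ((S h x - x) /\<^sub>R h) x \<le> 0"
  proof (rule eventually_at_right_less[THEN eventually_mono])
    fix h :: real assume h: "0 < h"
    have "inner (S h x) x \<le> norm (S h x) * norm x" by (rule norm_cauchy_schwarz)
    also have "\<dots> \<le> norm x * norm x" using h by (intro mult_right_mono semigroup_norm_le) auto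
    finally have "inner (S h x - x) x \<le> 0"
      by (simp add: inner_diff_left dot_square_norm power2_eq_square)
    then show "inner ((S h x - x) /\<^sub>R h) x \<le> 0" using h by (simp add: mult_nonneg_nonpos)
  qed
  ultimately show ?thesis by (rule tendsto_upperbound) simp
qed

lemma semigroup_continuous_at_0: "\<exists>d>0. \<forall>h. 0 \<le> h \<and> h < d \<longrightarrow> norm (S h x - x) < e" if "0 < e"
proof -
  have "((\<lambda>h. S h x) \<longlongrightarrow> x) (at_right 0)" using S by (simp add: contraction_semigroup_def)
  then obtain d where "d > 0" "\<And>h. 0 < h \<Longrightarrow> h < d \<Longrightarrow> norm (S h x - x) < e"
    using \<open>0 < e\<close> unfolding tendsto_iff eventually_at_right_field dist_norm by blast
  then show ?thesis using that semigroup_0 by (intro exI[of _ d]) (metis cancel_comm_monoid_add_class.diff_cancel norm_zero order_le_less)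
qed

lemma semigroup_diff:
  assumes "0 \<le> s" "0 \<le> t"
  shows "norm (S s x - S t x) \<le> norm (S \<bar>s - t\<bar> x - x)"
proof -
  have *: "norm (S s x - S t x) \<le> norm (S (s - t) x - x)" if "0 \<le> t" "t \<le> s" for s t
  proof -
    have "S s x - S t x = S t (S (s - t) x - x)"
      using semigroup_add[of t "s - t" x] that by (simp add: blinfun.diff_right)
    then show ?thesis using semigroup_norm_le that by simp
  qed
  show ?thesis
    using *[of t s] *[of s t] assms by (cases "t \<le> s") (auto simp: norm_minus_commute)
qed

lemma semigroup_continuous: "continuous_on {0..} (\<lambda>t. S t x)"
  unfolding continuous_on_iff
proof safe
  fix t e :: real assume t: "0 \<le> t" and e: "0 < e"
  obtain d where "d > 0" "\<forall>h. 0 \<le> h \<and> h < d \<longrightarrow> norm (S h x - x) < e"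
    using semigroup_continuous_at_0[OF e] by blast
  then show "\<exists>d>0. \<forall>s\<in>{0..}. dist s t < d \<longrightarrow> dist (S s x) (S t x) < e"
    using t by (intro exI[of _ d])
      (auto simp: dist_norm dist_real_def intro: le_less_trans[OF semigroup_diff])
qed

lemma semigroup_generator:
  assumes x: "x \<in> D" and t: "0 \<le> t"
  shows "S t x \<in> D" "A (S t x) = S t (A x)"
proof -
  have "((\<lambda>h. S t ((S h x - x) /\<^sub>R h)) \<longlongrightarrow> S t (A x)) (at_right 0)"
    by (intro blinfun.tendsto tendsto_const A x)
  moreover have "\<forall>\<^sub>F h in at_right 0. S t ((S h x - x) /\<^sub>R h) = (S h (S t x) - S t x) /\<^sub>R h"
  proof (rule eventually_at_right_less[THEN eventually_mono])
    fix h :: real assume h: "0 < h"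
    then show "S t ((S h x - x) /\<^sub>R h) = (S h (S t x) - S t x) /\<^sub>R h"
      using semigroup_add[of t h x] semigroup_add[of h t x] t
      by (simp add: blinfun.scaleR_right blinfun.diff_right add.commute)
  qed
  ultimately have "((\<lambda>h. (S h (S t x) - S t x) /\<^sub>R h) \<longlongrightarrow> S t (A x)) (at_right 0)"
    by (rule Lim_transform_eventually)
  then show "S t x \<in> D" "A (S t x) = S t (A x)" by (rule generator_eqI)+
qed

text \<open>The generator is a right limit at \<open>0\<close>. Applying the contraction
  \<open>S m\<close> with \<open>m = min s t\<close> transports it to both sides of
  \<open>t\<close>; the remaining defect \<open>S m (A x) - S t (A x)\<close> is small by strong
  continuity.\<close>

lemma semigroup_has_vector_derivative:
  assumes x: "x \<in> D" and t: "0 \<le> t"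
  shows "((\<lambda>t. S t x) has_vector_derivative S t (A x)) (at t within {0..})"
  unfolding has_vector_derivative_within_alt
proof safe
  fix e :: real assume e: "0 < e"
  obtain d1 where d1: "0 < d1" "\<And>h. 0 < h \<Longrightarrow> h < d1 \<Longrightarrow> norm (S h x - x - h *\<^sub>R A x) \<le> e / 2 * h"
    using A[OF x] e unfolding tendsto_right_quotient_iff by (meson half_gt_zero)
  obtain d2 where d2: "0 < d2" "\<And>h. 0 \<le> h \<Longrightarrow> h < d2 \<Longrightarrow> norm (S h (A x) - A x) < e / 2"
    using semigroup_continuous_at_0[of "e / 2" "A x"] e by auto
  have "norm (S s x - S t x - (s - t) *\<^sub>R S t (A x)) \<le> e * \<bar>s - t\<bar>" if s: "0 \<le> s" "\<bar>s - t\<bar> < min d1 d2" for s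
  proof (cases "s = t")
    case False
    define m where "m = min s t"
    define k where "k = \<bar>s - t\<bar>"
    have mk: "0 \<le> m" "0 < k" "k < d1" "k < d2" "\<bar>m - t\<bar> \<le> k" using s t False by (auto simp: m_def k_def)
    have eq: "S s x - S t x = sgn (s - t) *\<^sub>R S m (S k x - x)"
    proof (cases "t \<le> s")
      case True
      then show ?thesis using semigroup_add[of t "s - t" x] t False
        by (simp add: m_def k_def blinfun.diff_right)
    next
      case f: False
      then show ?thesis using semigroup_add[of s "t - s" x] s
        by (simp add: m_def k_def blinfun.diff_right)
    qed
    have "S s x - S t x - (s - t) *\<^sub>R S t (A x) =
        sgn (s - t) *\<^sub>R (S m (S k x - x - k *\<^sub>R A x) + k *\<^sub>R (S m (A x) - S t (A x)))"
    proof -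
      have "s - t = sgn (s - t) * k" by (simp add: k_def sgn_mult_abs)
      then have "(s - t) *\<^sub>R S t (A x) = sgn (s - t) *\<^sub>R (k *\<^sub>R S t (A x))" by (metis scaleR_scaleR)
      then show ?thesis unfolding eq by (simp add: blinfun.diff_right blinfun.scaleR_right scaleR_diff_right scaleR_add_right)
    qed
    then have "norm (S s x - S t x - (s - t) *\<^sub>R S t (A x)) =
        norm (S m (S k x - x - k *\<^sub>R A x) + k *\<^sub>R (S m (A x) - S t (A x)))"
      using False by (simp add: sgn_real_def)
    also have "\<dots> \<le> e / 2 * k + k * (e / 2)"
    proof (rule norm_triangle_mono)
      show "norm (S m (S k x - x - k *\<^sub>R A x)) \<le> e / 2 * k"
        using semigroup_norm_le[OF mk(1)] d1(2)[OF mk(2,3)] by (rule order_trans)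
      have "norm (S m (A x) - S t (A x)) \<le> e / 2"
        using semigroup_diff[OF mk(1) t, of "A x"] d2(2)[of "\<bar>m - t\<bar>"] mk by auto
      then show "norm (k *\<^sub>R (S m (A x) - S t (A x))) \<le> k * (e / 2)"
        using mk(2) by (simp add: mult_left_mono)
    qed
    finally show ?thesis by (simp add: k_def field_simps)
  qed simp
  then show "\<exists>d>0. \<forall>s\<in>{0..}. \<bar>s - t\<bar> < d \<longrightarrow> norm (S s x - S t x - (s - t) *\<^sub>R S t (A x)) \<le> e * \<bar>s - t\<bar>"
    using d1(1) d2(1) by (intro exI[of _ "min d1 d2"]) auto
qed

text \<open>The mean value inequality bounds the increments of the orbits of \<open>x n\<close> for
  all small \<open>h\<close> at once, with a threshold independent of \<open>n\<close>. Hence the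
  limit in \<open>n\<close> may be taken before the limit in \<open>h\<close>.\<close>

lemma generator_closed:
  assumes xD: "\<And>n. x n \<in> D" and x: "x \<longlonglongrightarrow> z" and Ax: "(\<lambda>n. A (x n)) \<longlonglongrightarrow> y"
  shows "z \<in> D" "A z = y"
proof -
  have "((\<lambda>h. (S h z - z) /\<^sub>R h) \<longlongrightarrow> y) (at_right 0)"
    unfolding tendsto_right_quotient_iff
  proof (intro allI impI)
    fix e :: real assume e: "0 < e"
    obtain d where d: "0 < d" "\<And>h. 0 \<le> h \<Longrightarrow> h < d \<Longrightarrow> norm (S h y - y) < e"
      using semigroup_continuous_at_0[OF e] by blast
    have "norm (S h z - z - h *\<^sub>R y) \<le> e * h" if h: "0 < h" "h < d" for h
    proof -
      have *: "norm (S h (x n) - x n - h *\<^sub>R y) \<le> (norm (A (x n) - y) + e) * h" for n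
      proof -
        have "norm ((S h (x n) - h *\<^sub>R y) - (S 0 (x n) - 0 *\<^sub>R y)) \<le> (norm (A (x n) - y) + e) * (h - 0)"
        proof (rule vector_mvt_bound_const)
          fix s assume s: "s \<in> {0..h}"
          have "((\<lambda>s. S s (x n)) has_vector_derivative S s (A (x n))) (at s within {0..h})"
            by (intro has_vector_derivative_within_subset[OF semigroup_has_vector_derivative[OF xD]]) (use s in auto)
          then show "((\<lambda>s. S s (x n) - s *\<^sub>R y) has_vector_derivative S s (A (x n)) - y) (at s within {0..h})"
            by (auto intro!: derivative_eq_intros)
          have "norm (S s (A (x n)) - y) = norm (S s (A (x n) - y) + (S s y - y))"
            by (simp add: blinfun.diff_right)
          also have "\<dots> \<le> norm (A (x n) - y) + e"
            using s h d(2)[of s] by (intro norm_triangle_mono semigroup_norm_le) auto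
          finally show "norm (S s (A (x n)) - y) \<le> norm (A (x n) - y) + e" .
        qed (use h in auto)
        then show ?thesis by (simp add: semigroup_0 algebra_simps)
      qed
      have "(\<lambda>n. norm (S h (x n) - x n - h *\<^sub>R y)) \<longlonglongrightarrow> norm (S h z - z - h *\<^sub>R y)"
        by (intro tendsto_intros blinfun.tendsto x)
      moreover have "(\<lambda>n. (norm (A (x n) - y) + e) * h) \<longlonglongrightarrow> (norm (y - y) + e) * h"
        by (intro tendsto_intros Ax)
      ultimately have "norm (S h z - z - h *\<^sub>R y) \<le> (norm (y - y) + e) * h"
        by (rule LIMSEQ_le) (use * in blast)
      then show ?thesis by simp
    qed
    then show "\<exists>d>0. \<forall>h. 0 < h \<and> h < d \<longrightarrow> norm (S h z - z - h *\<^sub>R y) \<le> e * h"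
      using d(1) by blast
  qed
  then show "z \<in> D" "A z = y" by (rule generator_eqI)+
qed

text \<open>The means \<open>(1 / t) *\<^sub>R V t\<close> of the orbit of \<open>x\<close>, with
  \<open>V\<close> its antiderivative, lie in \<open>D\<close> and tend to \<open>x\<close> as
  \<open>t\<close> decreases to \<open>0\<close>.\<close>

lemma generator_dense: "closure D = UNIV"
proof -
  have "\<exists>v\<in>D. dist v x < e" if e: "0 < e" for x e
  proof -
    have "continuous_on {0..1} (\<lambda>t. S t x)" using semigroup_continuous by (rule continuous_on_subset) auto
    from antiderivative_exists[OF this] obtain V where V0: "V 0 = 0"
      and V: "\<And>t. t \<in> {0..1} \<Longrightarrow> (V has_vector_derivative S t x) (at t within {0..1})" by blast
    obtain d where d: "0 < d" "\<And>s. s \<in> {0..1} \<Longrightarrow> \<bar>s - 0\<bar> < d \<Longrightarrow> norm (V s - V 0 - (s - 0) *\<^sub>R S 0 x) \<le> e / 2 * \<bar>s - 0\<bar>"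
      using V[of 0, unfolded has_vector_derivative_within_alt, rule_format, of "e / 2"] e by auto
    define t where "t = min (d / 2) (1 / 2)"
    have t: "0 < t" "t < d" "t < 1" using d(1) by (auto simp: t_def)
    \<comment> \<open>\<open>S h\<close> commutes with integration of the orbit: both sides have the
      same derivative in \<open>t\<close> and agree at \<open>0\<close>.\<close>
    have shift: "S h (V t) = V (t + h) - V h" if h: "0 < h" "t + h \<le> 1" for h
    proof -
      have "norm ((S h (V t) - V (t + h)) - (S h (V 0) - V (0 + h))) \<le> 0 * (t - 0)"
      proof (rule vector_mvt_bound_const[where f="\<lambda>s. S h (V s) - V (s + h)" and f'="\<lambda>s. 0"])
        fix s assume s: "s \<in> {0..t}"
        have "((\<lambda>s. S h (V s)) has_vector_derivative S h (S s x)) (at s within {0..t})"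
          by (intro bounded_linear.has_vector_derivative[OF blinfun.bounded_linear_right]
              has_vector_derivative_within_subset[OF V]) (use s t in auto)
        moreover have "((\<lambda>s. V (s + h)) has_vector_derivative S (s + h) x) (at s within {0..t})"
          using has_vector_derivative_shift[of V "S (s + h) x" s "-h" 0 t]
            has_vector_derivative_within_subset[OF V[of "s + h"], of "{h..t + h}"] s h by auto
        ultimately show "((\<lambda>s. S h (V s) - V (s + h)) has_vector_derivative 0) (at s within {0..t})"
          using has_vector_derivative_diff semigroup_add[of h s x] s h by (fastforce simp: add.commute)
      qed (use t in auto)
      then have "S h (V t) - V (t + h) + V h = 0" by (simp add: V0)
      moreover have "S h (V t) = (S h (V t) - V (t + h) + V h) + (V (t + h) - V h)" by simp
      ultimately show ?thesis by simp
    qed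
    have "((\<lambda>h. (S h (V t) - V t) /\<^sub>R h) \<longlongrightarrow> S t x - x) (at_right 0)"
      unfolding tendsto_right_quotient_iff
    proof (intro allI impI)
      fix \<epsilon> :: real assume \<epsilon>: "0 < \<epsilon>"
      obtain d1 where d1: "0 < d1" "\<And>s. s \<in> {0..1} \<Longrightarrow> \<bar>s - 0\<bar> < d1 \<Longrightarrow> norm (V s - V 0 - (s - 0) *\<^sub>R S 0 x) \<le> \<epsilon> / 2 * \<bar>s - 0\<bar>"
        using V[of 0, unfolded has_vector_derivative_within_alt, rule_format, of "\<epsilon> / 2"] \<epsilon> by auto
      obtain d2 where d2: "0 < d2" "\<And>s. s \<in> {0..1} \<Longrightarrow> \<bar>s - t\<bar> < d2 \<Longrightarrow> norm (V s - V t - (s - t) *\<^sub>R S t x) \<le> \<epsilon> / 2 * \<bar>s - t\<bar>"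
        using V[of t, unfolded has_vector_derivative_within_alt, rule_format, of "\<epsilon> / 2"] \<epsilon> t by auto
      have "norm (S h (V t) - V t - h *\<^sub>R (S t x - x)) \<le> \<epsilon> * h" if h: "0 < h" "h < min (min d1 d2) (1 - t)" for h
      proof -
        have "S h (V t) - V t - h *\<^sub>R (S t x - x) =
            (V (t + h) - V t - ((t + h) - t) *\<^sub>R S t x) - (V h - V 0 - (h - 0) *\<^sub>R S 0 x)"
          using shift[of h] h by (simp add: V0 semigroup_0 algebra_simps)
        also have "norm \<dots> \<le> \<epsilon> / 2 * \<bar>(t + h) - t\<bar> + \<epsilon> / 2 * \<bar>h - 0\<bar>"
          by (intro order_trans[OF norm_triangle_ineq4] add_mono d1(2) d2(2)) (use h t in auto)
        finally show ?thesis using h by simp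
      qed
      then show "\<exists>d>0. \<forall>h. 0 < h \<and> h < d \<longrightarrow> norm (S h (V t) - V t - h *\<^sub>R (S t x - x)) \<le> \<epsilon> * h"
        using d1(1) d2(1) t by (intro exI[of _ "min (min d1 d2) (1 - t)"]) auto
    qed
    then have "V t \<in> D" by (rule generator_eqI)
    then have "(1 / t) *\<^sub>R V t \<in> D" by (rule generator_scaleR)
    moreover have "norm (t *\<^sub>R ((1 / t) *\<^sub>R V t - x)) \<le> e / 2 * t"
      using d(2)[of t] t by (simp add: V0 semigroup_0 scaleR_diff_right)
    then have "norm ((1 / t) *\<^sub>R V t - x) < e" using t e by simp
    ultimately show ?thesis by (auto simp: dist_norm)
  qed
  then show ?thesis by (auto simp: closure_approachable)
qed

text \<open>No Laplace transform is formed. Dissipativity and closedness make the range closed; a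
  vector \<open>w\<close> orthogonal to it would force \<open>inner (S t x) w\<close> to grow like
  \<open>exp (t / h)\<close> for every \<open>x\<close> in \<open>D\<close> not orthogonal to
  \<open>w\<close>, against contractivity. So \<open>w\<close> is orthogonal to the dense set
  \<open>D\<close>.\<close>

lemma generator_range:
  assumes h: "0 < h"
  shows "\<exists>x\<in>D. x - h *\<^sub>R A x = y"
proof -
  define R where "R = (\<lambda>x. x - h *\<^sub>R A x) ` D"
  have D0: "subspace D"
    unfolding subspace_def using generator_add generator_scaleR(1) generator_scaleR(1)[of _ 0] generator_dense
    by (metis closure_empty empty_not_UNIV ex_in_conv scaleR_zero_left)
  have norm_le: "norm x \<le> norm (x - h *\<^sub>R A x)" if x: "x \<in> D" for x
  proof -
    have "norm x * norm x \<le> inner (x - h *\<^sub>R A x) x"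
      using generator_dissipative[OF x] h
      by (simp add: inner_diff_left dot_square_norm power2_eq_square mult_nonneg_nonpos)
    also have "\<dots> \<le> norm (x - h *\<^sub>R A x) * norm x" by (rule norm_cauchy_schwarz)
    finally show ?thesis by (cases "x = 0") auto
  qed
  have sub: "subspace R"
    unfolding subspace_def
  proof (intro conjI allI ballI)
    show "0 \<in> R"
      unfolding R_def using generator_scaleR(2)[of 0 0] subspace_0[OF D0] by (intro image_eqI[of _ _ 0]) auto
    fix u assume "u \<in> R"
    then obtain x where x: "x \<in> D" "u = x - h *\<^sub>R A x" by (auto simp: R_def)
    have "c *\<^sub>R u = c *\<^sub>R x - h *\<^sub>R A (c *\<^sub>R x)" for c
      by (simp add: x(2) generator_scaleR(2)[OF x(1)] scaleR_diff_right mult.commute)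
    then show "c *\<^sub>R u \<in> R" for c unfolding R_def using generator_scaleR(1)[OF x(1)] by blast
    fix v assume "v \<in> R"
    then obtain z where z: "z \<in> D" "v = z - h *\<^sub>R A z" by (auto simp: R_def)
    have "u + v = (x + z) - h *\<^sub>R A (x + z)"
      by (simp add: x(2) z(2) generator_add(2)[OF x(1) z(1)] scaleR_add_right)
    then show "u + v \<in> R" unfolding R_def using generator_add(1)[OF x(1) z(1)] by blast
  qed
  have cl: "closed R"
    unfolding closed_sequential_limits
  proof safe
    fix u l assume uR: "\<forall>n. u n \<in> R" and u: "u \<longlonglongrightarrow> l"
    then have "\<forall>n. \<exists>x. x \<in> D \<and> u n = x - h *\<^sub>R A x" unfolding R_def by blast
    then obtain x where x: "\<And>n. x n \<in> D" "\<And>n. u n = x n - h *\<^sub>R A (x n)" by metis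
    have "norm (x m - x n) \<le> norm (u m - u n)" for m n
      using norm_le[of "x m - x n"] generator_add[OF x(1) generator_scaleR(1)[OF x(1)], of m "-1" n]
        generator_scaleR(2)[OF x(1), of "-1" n] by (simp add: x(2) algebra_simps)
    then have "Cauchy x"
      using LIMSEQ_imp_Cauchy[OF u] unfolding Cauchy_def dist_norm by (meson le_less_trans)
    then obtain z where z: "x \<longlonglongrightarrow> z" using Cauchy_convergent_iff convergent_def by blast
    have "(\<lambda>n. (1 / h) *\<^sub>R (x n - u n)) \<longlonglongrightarrow> (1 / h) *\<^sub>R (z - l)" by (intro tendsto_intros z u)
    moreover have "(1 / h) *\<^sub>R (x n - u n) = A (x n)" for n using x(2) h by simp
    ultimately have "z \<in> D" "A z = (1 / h) *\<^sub>R (z - l)" using generator_closed[OF x(1) z] by auto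
    then show "l \<in> R" unfolding R_def using h by (intro image_eqI[of _ _ z]) auto
  qed
  have "R = UNIV"
  proof (rule ccontr)
    assume "R \<noteq> UNIV"
    then obtain w where w: "w \<noteq> 0" "\<And>u. u \<in> R \<Longrightarrow> inner u w = 0"
      using ex_orthogonal_to_closed_subspace[OF sub cl] by blast
    have "inner x w = 0" if x: "x \<in> D" for x
    proof (rule ccontr)
      assume ne: "inner x w \<noteq> 0"
      define \<psi> where "\<psi> t = exp (- t / h) * inner (S t x) w" for t
      have d\<psi>: "(\<psi> has_vector_derivative 0) (at t within {0..T})" if t: "t \<in> {0..T}" for t T
      proof -
        have "S t x - h *\<^sub>R A (S t x) \<in> R" unfolding R_def using semigroup_generator(1)[OF x] t by auto
        then have e: "inner (S t (A x)) w = inner (S t x) w / h"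
          using w(2) semigroup_generator(2)[OF x] t h by (force simp: inner_diff_left field_simps)
        have "((\<lambda>t. S t x) has_vector_derivative S t (A x)) (at t within {0..T})"
          by (intro has_vector_derivative_within_subset[OF semigroup_has_vector_derivative[OF x]]) (use t in auto)
        from bounded_linear.has_vector_derivative[OF bounded_linear_inner_left this, of w]
        have "((\<lambda>t. inner (S t x) w) has_real_derivative inner (S t x) w / h) (at t within {0..T})"
          by (simp add: e has_real_derivative_iff_has_vector_derivative)
        then have "(\<psi> has_real_derivative 0) (at t within {0..T})"
          unfolding \<psi>_def using h by (auto intro!: derivative_eq_intros simp: field_simps)
        then show ?thesis by (simp add: has_real_derivative_iff_has_vector_derivative)
      qed
      have const: "\<psi> T = inner x w" if T: "0 \<le> T" for T
        using vector_mvt_bound_const[OF T d\<psi>[of _ T], where K=0] by (simp add: \<psi>_def semigroup_0)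
      have "exp (T / h) * \<bar>inner x w\<bar> \<le> norm x * norm w" if T: "0 \<le> T" for T
      proof -
        have "inner (S T x) w = exp (T / h) * inner x w"
          using const[OF T] by (simp add: \<psi>_def exp_minus field_simps)
        then have "exp (T / h) * \<bar>inner x w\<bar> = \<bar>inner (S T x) w\<bar>" by (simp add: abs_mult)
        also have "\<dots> \<le> norm (S T x) * norm w" by (rule Cauchy_Schwarz_ineq2)
        also have "\<dots> \<le> norm x * norm w" using semigroup_norm_le[OF T] by (intro mult_right_mono) auto
        finally show ?thesis .
      qed
      \<comment> \<open>With \<open>r\<close> the quotient of \<open>norm x * norm w\<close> by the
        absolute value of \<open>inner x w\<close>, the time \<open>h * r\<close> yields
        \<open>exp r \<le> r\<close>, which is impossible.\<close>
      from this[of "h * (norm x * norm w / \<bar>inner x w\<bar>)"]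
      have "exp (norm x * norm w / \<bar>inner x w\<bar>) * \<bar>inner x w\<bar> \<le> norm x * norm w" using h by simp
      then have "exp (norm x * norm w / \<bar>inner x w\<bar>) \<le> norm x * norm w / \<bar>inner x w\<bar>"
        using ne by (simp add: pos_le_divide_eq)
      then show False using exp_ge_add_one_self[of "norm x * norm w / \<bar>inner x w\<bar>"] by linarith
    qed
    then have "D \<subseteq> {x. inner x w = 0}" by blast
    then have "closure D \<subseteq> {x. inner x w = 0}"
      by (rule closure_minimal) (intro closed_Collect_eq continuous_intros)
    then have "w \<in> {x. inner x w = 0}" using generator_dense by blast
    then show False using w(1) by simp
  qed
  then have "y \<in> (\<lambda>x. x - h *\<^sub>R A x) ` D" unfolding R_def by blast
  then show ?thesis by blast
qed

end

lemma generates_contraction_semigroup_imp_m_dissipative: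
  fixes D :: "'a::{real_inner,complete_space} set"
  assumes "generates_contraction_semigroup D A"
  shows "m_dissipative D A"
proof -
  obtain S where S: "contraction_semigroup S"
    "D = {x. \<exists>y. ((\<lambda>h. (S h x - x) /\<^sub>R h) \<longlongrightarrow> y) (at_right 0)}"
    "\<And>x. x \<in> D \<Longrightarrow> ((\<lambda>h. (S h x - x) /\<^sub>R h) \<longlongrightarrow> A x) (at_right 0)"
    using assms unfolding generates_contraction_semigroup_def by auto
  have "0 \<in> D"
    using generator_scaleR(1)[OF S, of _ 0] generator_dense[OF S] by (metis closure_empty empty_not_UNIV ex_in_conv scaleR_zero_left)
  then have "subspace D"
    using generator_add(1)[OF S] generator_scaleR(1)[OF S] by (auto simp: subspace_def)
  then show ?thesis
    unfolding m_dissipative_def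
    using generator_add(2)[OF S] generator_scaleR(2)[OF S] generator_dissipative[OF S]
      generator_range[OF S] generator_dense[OF S] by blast
qed

lemma m_dissipativeD:
  assumes "m_dissipative D A"
  shows "subspace D" "closure D = UNIV" "\<And>x y. x \<in> D \<Longrightarrow> y \<in> D \<Longrightarrow> A (x + y) = A x + A y"
    "\<And>x c. x \<in> D \<Longrightarrow> A (c *\<^sub>R x) = c *\<^sub>R A x" "\<And>x. x \<in> D \<Longrightarrow> inner (A x) x \<le> 0"
    "\<And>h y. 0 < h \<Longrightarrow> \<exists>x\<in>D. x - h *\<^sub>R A x = y"
  using assms by (auto simp: m_dissipative_def)

lemma m_dissipative_diff:
  assumes "m_dissipative D A" "x \<in> D" "y \<in> D"
  shows "A (x - y) = A x - A y"
proof -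
  have "A (x + (- 1) *\<^sub>R y) = A x + (- 1) *\<^sub>R A y"
    using assms m_dissipativeD(3,4)[OF assms(1)] subspace_scale[OF m_dissipativeD(1)[OF assms(1)]] by metis
  then show ?thesis by simp
qed

lemma m_dissipative_norm_le:
  assumes "m_dissipative D A" "x \<in> D" "0 \<le> h"
  shows "norm x \<le> norm (x - h *\<^sub>R A x)"
proof -
  have "norm x * norm x \<le> inner (x - h *\<^sub>R A x) x"
    using m_dissipativeD(5)[OF assms(1,2)] assms(3)
    by (simp add: inner_diff_left dot_square_norm power2_eq_square mult_nonneg_nonpos)
  also have "\<dots> \<le> norm (x - h *\<^sub>R A x) * norm x" by (rule norm_cauchy_schwarz)
  finally show ?thesis by (cases "x = 0") auto
qed

text \<open>Parametrised by the step: this is \<open>(1 - h A)^(-1)\<close>, so that it tends to the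
  identity, and the Yosida approximation to \<open>A\<close>, as \<open>h\<close> tends to
  \<open>0\<close>.\<close>

definition resolvent :: "'a::real_inner set \<Rightarrow> ('a \<Rightarrow> 'a) \<Rightarrow> real \<Rightarrow> 'a \<Rightarrow> 'a" where
  "resolvent D A h y = (SOME x. x \<in> D \<and> x - h *\<^sub>R A x = y)"

definition yosida :: "'a::real_inner set \<Rightarrow> ('a \<Rightarrow> 'a) \<Rightarrow> real \<Rightarrow> 'a \<Rightarrow> 'a" where
  "yosida D A h y = A (resolvent D A h y)"

context
  fixes D :: "'a::real_inner set" and A :: "'a \<Rightarrow> 'a" and h :: real
  assumes A: "m_dissipative D A" and h: "0 < h"
begin

lemma resolvent_props: "resolvent D A h y \<in> D" "resolvent D A h y - h *\<^sub>R A (resolvent D A h y) = y"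
proof -
  have "\<exists>x. x \<in> D \<and> x - h *\<^sub>R A x = y" using m_dissipativeD(6)[OF A h] by blast
  then have "resolvent D A h y \<in> D \<and> resolvent D A h y - h *\<^sub>R A (resolvent D A h y) = y"
    unfolding resolvent_def by (rule someI_ex)
  then show "resolvent D A h y \<in> D" "resolvent D A h y - h *\<^sub>R A (resolvent D A h y) = y" by blast+
qed

lemma resolvent_eqI:
  assumes "x \<in> D" "x - h *\<^sub>R A x = y" shows "resolvent D A h y = x"
proof -
  define r where "r = resolvent D A h y"
  have r: "r \<in> D" "r - h *\<^sub>R A r = y" using resolvent_props by (auto simp: r_def)
  have "(r - x) - h *\<^sub>R A (r - x) = (r - h *\<^sub>R A r) - (x - h *\<^sub>R A x)"
    unfolding m_dissipative_diff[OF A r(1) assms(1)] by (simp add: scaleR_diff_right)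
  then have "norm (r - x) \<le> 0"
    using m_dissipative_norm_le[OF A subspace_diff[OF m_dissipativeD(1)[OF A] r(1) assms(1)], of h] h r assms by simp
  then show ?thesis by (simp add: r_def)
qed

lemma norm_resolvent_le: "norm (resolvent D A h y) \<le> norm y"
  using m_dissipative_norm_le[OF A resolvent_props(1)[of y], of h] h resolvent_props(2)[of y] by simp

lemma bounded_linear_resolvent: "bounded_linear (resolvent D A h)"
proof (rule bounded_linear_intro)
  fix y z and c :: real
  show "resolvent D A h (y + z) = resolvent D A h y + resolvent D A h z"
  proof (rule resolvent_eqI)
    have "(resolvent D A h y + resolvent D A h z) - h *\<^sub>R A (resolvent D A h y + resolvent D A h z) =
      (resolvent D A h y - h *\<^sub>R A (resolvent D A h y)) + (resolvent D A h z - h *\<^sub>R A (resolvent D A h z))"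
      by (simp only: m_dissipativeD(3)[OF A resolvent_props(1) resolvent_props(1)]) (simp add: algebra_simps)
    then show "(resolvent D A h y + resolvent D A h z) - h *\<^sub>R A (resolvent D A h y + resolvent D A h z) = y + z"
      by (simp only: resolvent_props(2))
  qed (intro subspace_add m_dissipativeD(1)[OF A] resolvent_props(1))
  show "resolvent D A h (c *\<^sub>R y) = c *\<^sub>R resolvent D A h y"
  proof (rule resolvent_eqI)
    have "c *\<^sub>R resolvent D A h y - h *\<^sub>R A (c *\<^sub>R resolvent D A h y) =
      c *\<^sub>R (resolvent D A h y - h *\<^sub>R A (resolvent D A h y))"
      by (simp only: m_dissipativeD(4)[OF A resolvent_props(1)]) (simp add: algebra_simps)
    then show "c *\<^sub>R resolvent D A h y - h *\<^sub>R A (c *\<^sub>R resolvent D A h y) = c *\<^sub>R y"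
      by (simp only: resolvent_props(2))
  qed (intro subspace_scale m_dissipativeD(1)[OF A] resolvent_props(1))
  show "norm (resolvent D A h y) \<le> norm y * 1" using norm_resolvent_le by simp
qed

lemma yosida_eq: "yosida D A h y = (1 / h) *\<^sub>R (resolvent D A h y - y)"
proof -
  have "h *\<^sub>R yosida D A h y = resolvent D A h y - y"
    using resolvent_props(2)[of y] unfolding yosida_def by (simp add: algebra_simps)
  then show ?thesis using h by (metis scaleR_one scaleR_scaleR nonzero_divide_eq_eq less_numeral_extra(3))
qed

lemma resolvent_eq: "resolvent D A h y = y + h *\<^sub>R yosida D A h y"
  using h by (simp add: yosida_eq)

lemma bounded_linear_yosida: "bounded_linear (yosida D A h)"
proof -
  have "yosida D A h = (\<lambda>y. (1 / h) *\<^sub>R (resolvent D A h y - y))" using yosida_eq by blast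
  then show ?thesis
    using bounded_linear_compose[OF bounded_linear_scaleR_right
        bounded_linear_sub[OF bounded_linear_resolvent bounded_linear_ident]] by simp
qed

lemma norm_yosida_le: "norm (yosida D A h y) \<le> 2 / h * norm y"
proof -
  have "norm (resolvent D A h y - y) \<le> 2 * norm y"
    using norm_triangle_ineq4[of "resolvent D A h y" y] norm_resolvent_le[of y] by simp
  then show ?thesis using h by (simp add: yosida_eq divide_right_mono)
qed

lemma yosida_on_domain:
  assumes "x \<in> D" shows "yosida D A h x = resolvent D A h (A x)"
proof -
  interpret bounded_linear "resolvent D A h" by (rule bounded_linear_resolvent)
  have "resolvent D A h (x - h *\<^sub>R A x) = x" by (rule resolvent_eqI[OF assms refl])
  then have "resolvent D A h x - x = h *\<^sub>R resolvent D A h (A x)"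
    by (simp add: diff scaleR algebra_simps)
  then show ?thesis using h by (simp add: yosida_eq)
qed

lemma norm_yosida_on_domain: "x \<in> D \<Longrightarrow> norm (yosida D A h x) \<le> norm (A x)"
  by (simp add: yosida_on_domain norm_resolvent_le)

lemma norm_resolvent_diff_le: "x \<in> D \<Longrightarrow> norm (resolvent D A h x - x) \<le> h * norm (A x)"
  using norm_yosida_on_domain[of x] h by (simp add: resolvent_eq mult_left_mono)

lemma yosida_dissipative: "inner (yosida D A h y) y \<le> 0"
proof -
  have "inner (yosida D A h y) y = inner (A (resolvent D A h y)) (resolvent D A h y) - h * inner (yosida D A h y) (yosida D A h y)"
    by (subst (2) resolvent_props(2)[of y, symmetric]) (simp add: yosida_def inner_diff_right)
  also have "\<dots> \<le> 0" using m_dissipativeD(5)[OF A resolvent_props(1)] h by (smt (verit) inner_ge_zero mult_nonneg_nonneg)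
  finally show ?thesis .
qed

end

section \<open>A nonautonomous evolution equation on a bounded interval\<close>

text \<open>Restriction to \<open>{0..T}\<close>, because uniform constants are obtained by
  compactness. One \<open>\<kappa>\<close> serves for the graph norms and for both derivatives of
  \<open>M\<close>. Operators are plain functions, as their differentiability is only
  strong.\<close>

locale evolution_system =
  fixes D :: "'x::{real_inner,complete_space} set" and A A' :: "real \<Rightarrow> 'x \<Rightarrow> 'x"
    and M M' M'' :: "real \<Rightarrow> 'x \<Rightarrow> 'x" and T m\<^sub>1 m\<^sub>2 \<kappa> :: real
  assumes T: "0 < T" and m: "0 < m\<^sub>1" "0 < m\<^sub>2" and \<kappa>: "0 \<le> \<kappa>"
    and A_m_dissipative: "\<And>t. t \<in> {0..T} \<Longrightarrow> m_dissipative D (A t)"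
    and A_deriv: "\<And>t x. t \<in> {0..T} \<Longrightarrow> x \<in> D \<Longrightarrow> ((\<lambda>t. A t x) has_vector_derivative A' t x) (at t within {0..T})"
    and A'_cont: "\<And>x. x \<in> D \<Longrightarrow> continuous_on {0..T} (\<lambda>t. A' t x)"
    and A'_bound: "\<And>t x. t \<in> {0..T} \<Longrightarrow> x \<in> D \<Longrightarrow> norm (A' t x) \<le> \<kappa> * (norm x + norm (A t x))"
    and A_bound: "\<And>s t x. s \<in> {0..T} \<Longrightarrow> t \<in> {0..T} \<Longrightarrow> x \<in> D \<Longrightarrow> norm (A s x) \<le> \<kappa> * (norm x + norm (A t x))"
    and M_lin: "\<And>t. t \<in> {0..T} \<Longrightarrow> bounded_linear (M t)"
    and M'_lin: "\<And>t. t \<in> {0..T} \<Longrightarrow> bounded_linear (M' t)"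
    and M''_lin: "\<And>t. t \<in> {0..T} \<Longrightarrow> bounded_linear (M'' t)"
    and M_sym: "\<And>t x y. t \<in> {0..T} \<Longrightarrow> inner (M t x) y = inner x (M t y)"
    and M_lower: "\<And>t x. t \<in> {0..T} \<Longrightarrow> m\<^sub>1 * (norm x)\<^sup>2 \<le> inner (M t x) x"
    and M_norm: "\<And>t x. t \<in> {0..T} \<Longrightarrow> norm (M t x) \<le> m\<^sub>2 * norm x"
    and M'_norm: "\<And>t x. t \<in> {0..T} \<Longrightarrow> norm (M' t x) \<le> \<kappa> * norm x"
    and M''_norm: "\<And>t x. t \<in> {0..T} \<Longrightarrow> norm (M'' t x) \<le> \<kappa> * norm x"
    and M_deriv: "\<And>t x. t \<in> {0..T} \<Longrightarrow> ((\<lambda>t. M t x) has_vector_derivative M' t x) (at t within {0..T})"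
    and M'_deriv: "\<And>t x. t \<in> {0..T} \<Longrightarrow> ((\<lambda>t. M' t x) has_vector_derivative M'' t x) (at t within {0..T})"
    and M''_cont: "\<And>x. continuous_on {0..T} (\<lambda>t. M'' t x)"
    and M'_nonpos: "\<And>t x. t \<in> {0..T} \<Longrightarrow> inner (M' t x) x \<le> 0"
begin

abbreviation "I \<equiv> {0..T}"

definition J where "J h t = resolvent D (A t) h"
definition Y where "Y h t = yosida D (A t) h"

lemma continuous_on_I:
  "(\<And>t. t \<in> I \<Longrightarrow> (f has_vector_derivative f' t) (at t within I)) \<Longrightarrow> continuous_on I f"
  by (metis continuous_on_eq_continuous_within has_vector_derivative_continuous)

lemma D_subspace: "subspace D" using A_m_dissipative[of 0] m_dissipativeD(1) T by fastforce

lemma D_dense: "closure D = UNIV" using A_m_dissipative[of 0] m_dissipativeD(2) T by fastforce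

lemma A_cont: "x \<in> D \<Longrightarrow> continuous_on I (\<lambda>t. A t x)"
  by (rule continuous_on_I) (rule A_deriv)

lemma M_cont: "continuous_on I (\<lambda>t. M t x)" by (rule continuous_on_I) (rule M_deriv)

lemma M'_cont: "continuous_on I (\<lambda>t. M' t x)" by (rule continuous_on_I) (rule M'_deriv)

lemma derivative_unique:
  assumes "t \<in> I" "(f has_vector_derivative a) (at t within I)" "(f has_vector_derivative b) (at t within I)"
  shows "a = b"
  using vector_derivative_unique_within_closed_interval[of 0 T t f a b] assms T by simp

lemma A'_add:
  assumes t: "t \<in> I" and xy: "x \<in> D" "y \<in> D"
  shows "A' t (x + y) = A' t x + A' t y"
proof (rule derivative_unique[OF t A_deriv[OF t subspace_add[OF D_subspace xy]]])
  have eq: "A s (x + y) = A s x + A s y" if "s \<in> I" for s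
    using m_dissipativeD(3)[OF A_m_dissipative[OF that] xy] .
  show "((\<lambda>t. A t (x + y)) has_vector_derivative A' t x + A' t y) (at t within I)"
    by (rule has_vector_derivative_transform[OF t, where f="\<lambda>t. A t x + A t y"])
       (intro eq, assumption, intro has_vector_derivative_add A_deriv t xy)
qed

lemma A'_scaleR:
  assumes t: "t \<in> I" and x: "x \<in> D"
  shows "A' t (c *\<^sub>R x) = c *\<^sub>R A' t x"
proof (rule derivative_unique[OF t A_deriv[OF t subspace_scale[OF D_subspace x]]])
  have eq: "A s (c *\<^sub>R x) = c *\<^sub>R A s x" if "s \<in> I" for s
    using m_dissipativeD(4)[OF A_m_dissipative[OF that] x] .
  show "((\<lambda>t. A t (c *\<^sub>R x)) has_vector_derivative c *\<^sub>R A' t x) (at t within I)"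
    by (rule has_vector_derivative_transform[OF t, where f="\<lambda>t. c *\<^sub>R A t x"])
       (intro eq, assumption, intro bounded_linear.has_vector_derivative[OF bounded_linear_scaleR_right] A_deriv t x)
qed

lemma A'_diff:
  assumes t: "t \<in> I" and xy: "x \<in> D" "y \<in> D"
  shows "A' t (x - y) = A' t x - A' t y"
  using A'_add[OF t xy(1) subspace_scale[OF D_subspace xy(2)], of "-1"] A'_scaleR[OF t xy(2), of "-1"] by simp

text \<open>Rule for inverse families with \<open>N s x = x - h *\<^sub>R A s x\<close>; the common
  domain \<open>D\<close> is what lets all \<open>N s\<close> act on the one vector
  \<open>J h t w\<close>.\<close>

lemma J_deriv:
  assumes h: "0 < h" and t: "t \<in> I"
  shows "((\<lambda>t. J h t v) has_vector_derivative h *\<^sub>R J h t (A' t (J h t v))) (at t within I)"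
proof -
  have "((\<lambda>t. J h t v) has_vector_derivative - J h t (- (h *\<^sub>R A' t (J h t v)))) (at t within I)"
  proof (rule has_vector_derivative_inverse_family[OF t, where N="\<lambda>s x. x - h *\<^sub>R A s x" and c=1])
    show "J h s (J h t w - h *\<^sub>R A s (J h t w)) = J h t w" if s: "s \<in> I" for s w
      unfolding J_def by (rule resolvent_eqI[OF A_m_dissipative[OF s] h _ refl])
        (rule resolvent_props(1)[OF A_m_dissipative[OF t] h])
    show "J h t w - h *\<^sub>R A t (J h t w) = w" for w
      unfolding J_def by (rule resolvent_props(2)[OF A_m_dissipative[OF t] h])
    show "((\<lambda>s. J h t w - h *\<^sub>R A s (J h t w)) has_vector_derivative - (h *\<^sub>R A' t (J h t w))) (at t within I)" for w
    proof -
      have "J h t w \<in> D" unfolding J_def by (rule resolvent_props(1)[OF A_m_dissipative[OF t] h])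
      from has_vector_derivative_diff[OF has_vector_derivative_const
          bounded_linear.has_vector_derivative[OF bounded_linear_scaleR_right A_deriv[OF t this]], of "J h t w" h]
      show ?thesis by simp
    qed
    show "bounded_linear (J h s)" "norm (J h s v) \<le> 1 * norm v" if "s \<in> I" for s v
      using bounded_linear_resolvent[OF A_m_dissipative[OF that] h] norm_resolvent_le[OF A_m_dissipative[OF that] h]
      by (auto simp: J_def)
  qed
  moreover have "bounded_linear (J h t)"
    using bounded_linear_resolvent[OF A_m_dissipative[OF t] h] by (simp add: J_def)
  ultimately show ?thesis by (simp add: linear_simps)
qed

lemma J_props:
  assumes "0 < h" "t \<in> I"
  shows "J h t y \<in> D" "J h t y - h *\<^sub>R A t (J h t y) = y" "bounded_linear (J h t)" "norm (J h t y) \<le> norm y"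
    "J h t y = y + h *\<^sub>R Y h t y" "A t (J h t y) = Y h t y"
  using resolvent_props[OF A_m_dissipative[OF assms(2)] assms(1)] norm_resolvent_le[OF A_m_dissipative[OF assms(2)] assms(1)]
    bounded_linear_resolvent[OF A_m_dissipative[OF assms(2)] assms(1)]
    resolvent_eq[OF A_m_dissipative[OF assms(2)] assms(1)]
  unfolding J_def Y_def yosida_def by auto

lemma Y_props:
  assumes "0 < h" "t \<in> I"
  shows "bounded_linear (Y h t)" "norm (Y h t y) \<le> 2 / h * norm y" "inner (Y h t y) y \<le> 0"
    "x \<in> D \<Longrightarrow> Y h t x = J h t (A t x)" "x \<in> D \<Longrightarrow> norm (Y h t x) \<le> norm (A t x)"
    "x \<in> D \<Longrightarrow> norm (J h t x - x) \<le> h * norm (A t x)"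
  using bounded_linear_yosida[OF A_m_dissipative[OF assms(2)] assms(1)] norm_yosida_le[OF A_m_dissipative[OF assms(2)] assms(1)]
    yosida_dissipative[OF A_m_dissipative[OF assms(2)] assms(1)] yosida_on_domain[OF A_m_dissipative[OF assms(2)] assms(1)]
    norm_yosida_on_domain[OF A_m_dissipative[OF assms(2)] assms(1)] norm_resolvent_diff_le[OF A_m_dissipative[OF assms(2)] assms(1)]
  unfolding J_def Y_def by auto

lemma J_cont: "0 < h \<Longrightarrow> continuous_on I (\<lambda>t. J h t v)"
  by (rule continuous_on_I) (rule J_deriv)

lemma Y_deriv:
  assumes h: "0 < h" and t: "t \<in> I"
  shows "((\<lambda>t. Y h t v) has_vector_derivative J h t (A' t (J h t v))) (at t within I)"
proof -
  have "((\<lambda>t. (1 / h) *\<^sub>R (J h t v - v)) has_vector_derivative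
      (1 / h) *\<^sub>R (h *\<^sub>R J h t (A' t (J h t v)) - 0)) (at t within I)"
    by (intro bounded_linear.has_vector_derivative[OF bounded_linear_scaleR_right]
        has_vector_derivative_diff has_vector_derivative_const J_deriv h t)
  moreover have eq: "Y h s v = (1 / h) *\<^sub>R (J h s v - v)" if "s \<in> I" for s
    using yosida_eq[OF A_m_dissipative[OF that] h] by (simp add: J_def Y_def)
  ultimately have "((\<lambda>t. (1 / h) *\<^sub>R (J h t v - v)) has_vector_derivative J h t (A' t (J h t v))) (at t within I)"
    using h by simp
  then show ?thesis using eq by (rule has_vector_derivative_transform[OF t, rotated])
qed

lemma Y_cont: "0 < h \<Longrightarrow> continuous_on I (\<lambda>t. Y h t v)"
  by (rule continuous_on_I) (rule Y_deriv)

text \<open>A bounded substitute for the unbounded \<open>A'\<close>: composed with the resolvent of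
  step \<open>1\<close> it has norm at most \<open>3 * \<kappa>\<close>. Via
  \<open>A' t x = K t (x - A t x)\<close> a time derivative of the generator is controlled by
  \<open>x\<close> and \<open>A t x\<close>.\<close>

definition K where "K t y = A' t (J 1 t y)"

lemma A'_eq_K: "t \<in> I \<Longrightarrow> x \<in> D \<Longrightarrow> A' t x = K t (x - A t x)"
  using resolvent_eqI[OF A_m_dissipative, of t 1 x] by (simp add: K_def J_def)

lemma assumes t: "t \<in> I" shows K_lin: "bounded_linear (K t)"
  and K_norm: "norm (K t y) \<le> 3 * \<kappa> * norm y"
proof -
  interpret J: bounded_linear "J 1 t" using J_props(3) t by simp
  have bnd: "norm (K t y) \<le> 3 * \<kappa> * norm y" for y
  proof -
    have "norm (K t y) \<le> \<kappa> * (norm (J 1 t y) + norm (Y 1 t y))"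
      unfolding K_def using A'_bound[OF t J_props(1)[OF _ t], of 1 y] J_props(6)[OF _ t, of 1 y] by simp
    also have "\<dots> \<le> \<kappa> * (norm y + 2 / 1 * norm y)"
      by (intro mult_left_mono add_mono J_props(4) Y_props(2) t \<kappa>) auto
    finally show ?thesis by simp
  qed
  show "norm (K t y) \<le> 3 * \<kappa> * norm y" by (rule bnd)
  show "bounded_linear (K t)"
    by (rule bounded_linear_intro[of _ "3 * \<kappa>"])
       (use bnd in \<open>auto simp: K_def J.add J.scaleR A'_add[OF t] A'_scaleR[OF t] J_props(1)[OF _ t] mult.commute\<close>)
qed

text \<open>Both \<open>A'\<close> and the resolvent move with time. The graph norm bound of
  \<open>A'\<close> reduces the motion of the argument to convergence of \<open>v s\<close> and of
  \<open>A s (v s)\<close>, and the latter is \<open>v s - y\<close>.\<close>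

lemma K_cont: "continuous_on I (\<lambda>t. K t y)"
  unfolding continuous_on_def
proof
  fix t assume t: "t \<in> I"
  define v where "v s = J 1 s y" for s
  have vD: "v s \<in> D" if "s \<in> I" for s using J_props(1)[OF _ that, of 1 y] by (simp add: v_def)
  have Av: "A s (v s) = v s - y" if "s \<in> I" for s
    using J_props(2)[OF _ that, of 1 y] by (simp add: v_def algebra_simps)
  have v: "(v \<longlongrightarrow> v t) (at t within I)"
    using J_cont[of 1 y] t unfolding v_def continuous_on_def by simp
  have lim: "((\<lambda>s. norm (v s - v t) + norm ((v s - y) - A s (v t))) \<longlongrightarrow> norm (v t - v t) + norm ((v t - y) - A t (v t))) (at t within I)"
    using A_cont[OF vD[OF t]] t unfolding continuous_on_def by (intro tendsto_intros v) auto
  then have lim0: "((\<lambda>s. \<kappa> * (norm (v s - v t) + norm ((v s - y) - A s (v t)))) \<longlongrightarrow> 0) (at t within I)"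
    using Av[OF t] by (intro tendsto_mult_right_zero) simp
  have "((\<lambda>s. K s y - A' s (v t)) \<longlongrightarrow> 0) (at t within I)"
  proof (rule tendsto_0_le[OF lim0, of _ 1])
    have "norm (K s y - A' s (v t)) \<le> \<kappa> * (norm (v s - v t) + norm ((v s - y) - A s (v t)))" if s: "s \<in> I" for s
    proof -
      have "K s y - A' s (v t) = A' s (v s - v t)"
        using A'_diff[OF s vD[OF s] vD[OF t]] by (simp add: K_def v_def)
      then show ?thesis
        using A'_bound[OF s subspace_diff[OF D_subspace vD[OF s] vD[OF t]]]
          m_dissipative_diff[OF A_m_dissipative[OF s] vD[OF s] vD[OF t]] Av[OF s] by simp
    qed
    then show "\<forall>\<^sub>F s in at t within I. norm (K s y - A' s (v t)) \<le> norm (\<kappa> * (norm (v s - v t) + norm ((v s - y) - A s (v t)))) * 1"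
      unfolding eventually_at_filter by (intro always_eventually allI impI) (use abs_ge_self order_trans in \<open>force\<close>)
  qed
  moreover have "((\<lambda>s. A' s (v t)) \<longlongrightarrow> K t y) (at t within I)"
    using A'_cont[OF vD[OF t]] t unfolding continuous_on_def K_def v_def by blast
  ultimately have "((\<lambda>s. (K s y - A' s (v t)) + A' s (v t)) \<longlongrightarrow> 0 + K t y) (at t within I)" by (rule tendsto_add)
  then show "((\<lambda>t. K t y) \<longlongrightarrow> K t y) (at t within I)" by simp
qed

section \<open>The inverse of \<open>M\<close> and the correction \<open>Q\<close> in the modified
  derivative\<close>

definition Mi where "Mi t = inv (M t)"

lemma norm_M_ge: assumes t: "t \<in> I" shows "m\<^sub>1 * norm x \<le> norm (M t x)"
proof -
  have "norm x * (m\<^sub>1 * norm x) \<le> inner (M t x) x"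
    using M_lower[OF t, of x] by (simp add: power2_eq_square mult_ac)
  also have "\<dots> \<le> norm x * norm (M t x)" using norm_cauchy_schwarz[of "M t x" x] by (simp add: mult.commute)
  finally show ?thesis using m by (cases "x = 0") auto
qed

text \<open>Lax-Milgram argument: coercivity gives injectivity and a closed range, and it excludes a
  nonzero vector \<open>w\<close> orthogonal to the range, since \<open>inner (M t w) w = 0\<close>
  forces \<open>w = 0\<close>.\<close>

lemma M_bij: assumes t: "t \<in> I" shows "bij (M t)"
proof -
  interpret M: bounded_linear "M t" using M_lin[OF t] .
  have inj: "inj (M t)"
  proof (rule injI)
    fix x y assume "M t x = M t y"
    then have "m\<^sub>1 * norm (x - y) \<le> 0" using norm_M_ge[OF t, of "x - y"] by (simp add: M.diff)
    then show "x = y" using m by (simp add: mult_le_0_iff)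
  qed
  have "range (M t) = UNIV"
  proof (rule ccontr)
    assume ne: "range (M t) \<noteq> UNIV"
    have "subspace (range (M t))"
      using linear_subspace_image[OF M.linear_axioms subspace_UNIV] .
    moreover have "closed (range (M t))"
      unfolding closed_sequential_limits
    proof safe
      fix u l assume uR: "\<forall>n. u n \<in> range (M t)" and u: "u \<longlonglongrightarrow> l"
      then have "\<forall>n. \<exists>x. u n = M t x" by blast
      then obtain x where x: "\<And>n. u n = M t (x n)" by metis
      have le: "norm (x p - x q) \<le> norm (u p - u q) / m\<^sub>1" for p q
        using norm_M_ge[OF t, of "x p - x q"] m by (simp add: x M.diff field_simps)
      have "Cauchy x"
      proof (rule CauchyI)
        fix e :: real assume "0 < e"
        then have "0 < e * m\<^sub>1" using m by simp
        then obtain N where N: "\<And>p q. p \<ge> N \<Longrightarrow> q \<ge> N \<Longrightarrow> norm (u p - u q) < e * m\<^sub>1"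
          using CauchyD[OF LIMSEQ_imp_Cauchy[OF u]] by meson
        have "norm (x p - x q) < e" if "p \<ge> N" "q \<ge> N" for p q
          using le[of p q] N[OF that] m by (smt (verit) pos_divide_less_eq)
        then show "\<exists>M. \<forall>m\<ge>M. \<forall>n\<ge>M. norm (x m - x n) < e" by blast
      qed
      then obtain z where "x \<longlonglongrightarrow> z" using Cauchy_convergent_iff convergent_def by blast
      moreover have "u = (\<lambda>n. M t (x n))" using x by blast
      ultimately have "u \<longlonglongrightarrow> M t z" using M.tendsto[of x z sequentially] by simp
      then show "l \<in> range (M t)" using LIMSEQ_unique u by blast
    qed
    ultimately obtain w where w: "w \<noteq> 0" "\<forall>x\<in>range (M t). inner x w = 0"
      using ex_orthogonal_to_closed_subspace ne by blast
    then have "inner (M t w) w = 0" by blast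
    then show False using M_lower[OF t, of w] m w(1) by (simp add: mult_le_0_iff)
  qed
  then show ?thesis using inj by (simp add: bij_def)
qed

lemma M_Mi: "t \<in> I \<Longrightarrow> M t (Mi t y) = y" "t \<in> I \<Longrightarrow> Mi t (M t y) = y"
  using M_bij unfolding Mi_def by (auto simp: bij_def surj_f_inv_f inv_f_f)

lemma assumes t: "t \<in> I" shows Mi_lin: "bounded_linear (Mi t)"
  and Mi_norm: "norm (Mi t y) \<le> (1 / m\<^sub>1) * norm y"
proof -
  interpret M: bounded_linear "M t" using M_lin[OF t] .
  have bnd: "norm (Mi t y) \<le> (1 / m\<^sub>1) * norm y" for y
    using norm_M_ge[OF t, of "Mi t y"] m by (simp add: M_Mi[OF t] field_simps)
  then show "norm (Mi t y) \<le> (1 / m\<^sub>1) * norm y" .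
  have inj: "x = y" if "M t x = M t y" for x y using that M_Mi(2)[OF t] by metis
  show "bounded_linear (Mi t)"
  proof (rule bounded_linear_intro)
    show "norm (Mi t x) \<le> norm x * (1 / m\<^sub>1)" for x using bnd[of x] by simp
  qed (rule inj, simp add: M_Mi[OF t] M.add M.scaleR)+
qed

lemma Mi_deriv:
  assumes t: "t \<in> I"
  shows "((\<lambda>t. Mi t v) has_vector_derivative - Mi t (M' t (Mi t v))) (at t within I)"
proof (rule has_vector_derivative_inverse_family[OF t Mi_lin Mi_norm, where N=M and N'="\<lambda>w. M' t (Mi t w)"])
  show "Mi s (M s (Mi t w)) = Mi t w" if "s \<in> I" for s w by (rule M_Mi(2)[OF that])
  show "M t (Mi t w) = w" for w by (rule M_Mi(1)[OF t])
  show "((\<lambda>s. M s (Mi t w)) has_vector_derivative M' t (Mi t w)) (at t within I)" for w by (rule M_deriv[OF t])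
qed

lemma Mi_cont: "continuous_on I (\<lambda>t. Mi t v)" by (rule continuous_on_I) (rule Mi_deriv)

definition Q where "Q t v = Mi t (M' t v)"
text \<open>The strong derivative of \<open>Q\<close>, by the rule for inverses and the product
  rule. This is the place where the second derivative of \<open>M\<close> enters.\<close>

definition Q' where "Q' t v = - Mi t (M' t (Mi t (M' t v))) + Mi t (M'' t v)"

lemma Q_lin: "t \<in> I \<Longrightarrow> bounded_linear (Q t)"
  unfolding Q_def[abs_def] using bounded_linear_compose[OF Mi_lin M'_lin] .

lemma Q'_lin: "t \<in> I \<Longrightarrow> bounded_linear (Q' t)"
  unfolding Q'_def[abs_def]
  by (intro bounded_linear_add bounded_linear_minus bounded_linear_compose[OF Mi_lin] bounded_linear_compose[OF M'_lin] M'_lin M''_lin)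

text \<open>\<open>\<kappa> / m\<^sub>1\<close> bounds \<open>Mi M'\<close> and
  \<open>Mi M''\<close>, its square bounds \<open>Mi M' Mi M'\<close>; the sum serves for
  \<open>Q\<close> and \<open>Q'\<close> alike.\<close>

definition q where "q = \<kappa> / m\<^sub>1 + (\<kappa> / m\<^sub>1)\<^sup>2"

lemma q_nonneg: "0 \<le> q" using \<kappa> m by (simp add: q_def)

lemma assumes t: "t \<in> I" shows Q_norm: "norm (Q t v) \<le> q * norm v"
  and Q'_norm: "norm (Q' t v) \<le> q * norm v"
proof -
  have Mi_le: "norm (Mi t (f v)) \<le> \<kappa> / m\<^sub>1 * c" if "norm (f v) \<le> \<kappa> * c" for f :: "'x \<Rightarrow> 'x" and v c
  proof -
    have "norm (Mi t (f v)) \<le> (1 / m\<^sub>1) * (\<kappa> * c)"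
      using Mi_norm[OF t, of "f v"] that m by (meson divide_nonneg_nonneg less_imp_le mult_left_mono order_trans zero_le_one)
    then show ?thesis by simp
  qed
  have 1: "norm (Mi t (M' t w)) \<le> \<kappa> / m\<^sub>1 * norm w" "norm (Mi t (M'' t w)) \<le> \<kappa> / m\<^sub>1 * norm w" for w
    by (rule Mi_le, rule M'_norm[OF t], rule Mi_le, rule M''_norm[OF t])
  have "norm (Mi t (M' t (Mi t (M' t v)))) \<le> \<kappa> / m\<^sub>1 * norm (Mi t (M' t v))" by (rule 1)
  also have "\<dots> \<le> \<kappa> / m\<^sub>1 * (\<kappa> / m\<^sub>1 * norm v)"
    by (intro mult_left_mono 1) (use \<kappa> m in auto)
  finally have 2: "norm (Mi t (M' t (Mi t (M' t v)))) \<le> (\<kappa> / m\<^sub>1)\<^sup>2 * norm v"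
    by (simp add: power2_eq_square)
  have "norm (Q' t v) \<le> norm (Mi t (M' t (Mi t (M' t v)))) + norm (Mi t (M'' t v))"
    unfolding Q'_def by (metis norm_minus_cancel norm_triangle_ineq)
  then show "norm (Q' t v) \<le> q * norm v" using 1(2)[of v] 2 by (simp add: q_def distrib_right)
  have "0 \<le> (\<kappa> / m\<^sub>1)\<^sup>2 * norm v" by simp
  then show "norm (Q t v) \<le> q * norm v" using 1(1)[of v] unfolding Q_def q_def distrib_right by linarith
qed

lemma Q_deriv:
  assumes t: "t \<in> I"
  shows "((\<lambda>t. Q t v) has_vector_derivative Q' t v) (at t within I)"
  unfolding Q_def Q'_def
proof (rule has_vector_derivative_strong_product[OF t Mi_lin Mi_norm _ Mi_deriv[OF t] M'_deriv[OF t]])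
  show "((\<lambda>s. Mi s (M'' t v)) \<longlongrightarrow> Mi t (M'' t v)) (at t within I)"
    using Mi_cont t by (simp add: continuous_on_def)
qed

lemma Q_cont: "continuous_on I (\<lambda>t. Q t v)" by (rule continuous_on_I) (rule Q_deriv)

lemma continuous_on_operators:
  assumes v: "continuous_on I v"
  shows "continuous_on I (\<lambda>t. M t (v t))" "continuous_on I (\<lambda>t. M' t (v t))" "continuous_on I (\<lambda>t. M'' t (v t))"
    "continuous_on I (\<lambda>t. Mi t (v t))" "continuous_on I (\<lambda>t. Q t (v t))" "continuous_on I (\<lambda>t. K t (v t))"
    "0 < h \<Longrightarrow> continuous_on I (\<lambda>t. J h t (v t))" "0 < h \<Longrightarrow> continuous_on I (\<lambda>t. Y h t (v t))"
proof -
  show "continuous_on I (\<lambda>t. M t (v t))"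
    by (rule continuous_on_strongly_continuous[OF M_lin M_norm M_cont v])
  show "continuous_on I (\<lambda>t. M' t (v t))"
    by (rule continuous_on_strongly_continuous[OF M'_lin M'_norm M'_cont v])
  show "continuous_on I (\<lambda>t. M'' t (v t))"
    by (rule continuous_on_strongly_continuous[OF M''_lin M''_norm M''_cont v])
  show "continuous_on I (\<lambda>t. Mi t (v t))"
    by (rule continuous_on_strongly_continuous[OF Mi_lin Mi_norm Mi_cont v])
  show "continuous_on I (\<lambda>t. Q t (v t))"
    by (rule continuous_on_strongly_continuous[OF Q_lin Q_norm Q_cont v])
  show "continuous_on I (\<lambda>t. K t (v t))"
    by (rule continuous_on_strongly_continuous[OF K_lin K_norm K_cont v])
  show "continuous_on I (\<lambda>t. J h t (v t))" if h: "0 < h"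
    by (rule continuous_on_strongly_continuous[OF J_props(3)[OF h] _ J_cont[OF h] v, where c=1])
       (simp_all add: J_props(4)[OF h])
  show "continuous_on I (\<lambda>t. Y h t (v t))" if h: "0 < h"
    by (rule continuous_on_strongly_continuous[OF Y_props(1)[OF h] Y_props(2)[OF h] Y_cont[OF h] v])
qed

lemma Q'_continuous_on:
  assumes v: "continuous_on I v" shows "continuous_on I (\<lambda>t. Q' t (v t))"
  unfolding Q'_def by (intro continuous_intros continuous_on_operators v)

end

text \<open>Graph membership is an equation for the bounded resolvent,
  \<open>resolvent D A 1 (x - A x) = x\<close>, which passes to limits.\<close>

lemma m_dissipative_closed:
  fixes D :: "'a::real_inner set"
  assumes A: "m_dissipative D A" and xD: "\<And>n. x n \<in> D" and x: "x \<longlonglongrightarrow> z" and Ax: "(\<lambda>n. A (x n)) \<longlonglongrightarrow> y"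
  shows "z \<in> D" "A z = y"
proof -
  have "(\<lambda>n. resolvent D A 1 (x n - 1 *\<^sub>R A (x n))) \<longlonglongrightarrow> resolvent D A 1 (z - 1 *\<^sub>R y)"
    by (intro bounded_linear.tendsto[OF bounded_linear_resolvent[OF A zero_less_one]] tendsto_intros x Ax)
  moreover have "resolvent D A 1 (x n - 1 *\<^sub>R A (x n)) = x n" for n
    by (rule resolvent_eqI[OF A zero_less_one xD refl])
  ultimately have eq: "resolvent D A 1 (z - 1 *\<^sub>R y) = z" using LIMSEQ_unique x by fastforce
  then show "z \<in> D" using resolvent_props(1)[OF A zero_less_one] by metis
  show "A z = y" using resolvent_props(2)[OF A zero_less_one, of "z - 1 *\<^sub>R y"] unfolding eq by simp
qed

lemma uniform_limit_combine:
  fixes X :: "nat \<Rightarrow> real \<Rightarrow> 'a::real_normed_vector"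
  assumes "\<And>e. 0 < e \<Longrightarrow> \<exists>N. \<forall>n\<ge>N. \<forall>t\<in>S. norm (X n t - x t) \<le> e"
  shows "uniform_limit S X x sequentially"
  unfolding uniform_limit_sequentially_iff dist_norm
proof safe
  fix e :: real assume "0 < e"
  then obtain N where "\<forall>n\<ge>N. \<forall>t\<in>S. norm (X n t - x t) \<le> e / 2" using assms[of "e / 2"] by auto
  then show "\<exists>N. \<forall>n\<ge>N. \<forall>t\<in>S. norm (X n t - x t) < e"
    using \<open>0 < e\<close> by (intro exI[of _ N]) (fastforce intro: le_less_trans)
qed

lemma uniform_limitE:
  fixes X :: "nat \<Rightarrow> real \<Rightarrow> 'a::real_normed_vector"
  assumes "uniform_limit S X x sequentially" "0 < e"
  obtains N where "\<And>n t. n \<ge> N \<Longrightarrow> t \<in> S \<Longrightarrow> norm (X n t - x t) \<le> e"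
  using uniform_limitD[OF assms] unfolding eventually_sequentially dist_norm by (meson less_imp_le)

section \<open>Energy estimate and the Yosida-regularized equation\<close>

context evolution_system
begin

text \<open>A common majorant of the two natural constants of the energy estimate:
  \<open>sqrt (m\<^sub>2 / m\<^sub>1)\<close> in front of the initial value and
  \<open>m\<^sub>2 / m\<^sub>1\<close> in front of the integral.\<close>

definition c\<^sub>0 where "c\<^sub>0 = 1 + m\<^sub>2 / m\<^sub>1"

lemma c0_ge: "1 \<le> c\<^sub>0" using m by (simp add: c\<^sub>0_def)

lemma I_0: "0 \<in> I" using T by simp



lemma Mx_deriv:
  assumes t: "t \<in> I" and x: "(x has_vector_derivative x') (at t within I)"
  shows "((\<lambda>t. M t (x t)) has_vector_derivative M' t (x t) + M t x') (at t within I)"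
proof (rule has_vector_derivative_strong_product[OF t M_lin M_norm _ M_deriv[OF t] x])
  show "((\<lambda>s. M s x') \<longlongrightarrow> M t x') (at t within I)"
    using M_cont t by (simp add: continuous_on_def)
qed

lemma energy_deriv:
  assumes t: "t \<in> I" and x: "(x has_vector_derivative x') (at t within I)"
  shows "((\<lambda>t. inner (M t (x t)) (x t)) has_vector_derivative
           inner (M' t (x t)) (x t) + 2 * inner (M t (x t)) x') (at t within I)"
proof -
  have "((\<lambda>t. inner (M t (x t)) (x t)) has_vector_derivative
      inner (M t (x t)) x' + inner (M' t (x t) + M t x') (x t)) (at t within I)"
    by (rule bounded_bilinear.has_vector_derivative[OF bounded_bilinear_inner Mx_deriv[OF t x] x])
  moreover have "inner (M t x') (x t) = inner (M t (x t)) x'" by (metis M_sym[OF t] inner_commute)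
  ultimately show ?thesis by (simp add: inner_add_left algebra_simps)
qed

text \<open>As \<open>inner (M' x) x\<close> and the dissipative part are nonpositive,
  \<open>E' \<le> 2 * inner (M x) G \<le> 2 * k * sqrt E * norm G\<close>, that is,
  \<open>sqrt E\<close> grows at rate at most \<open>k * norm G\<close>. Dissipativity is assumed of
  \<open>x' - G\<close> along the solution, so that regularized, classical and damped nonlinear
  equations are all covered.\<close>

lemma energy_estimate:
  assumes x': "\<And>t. t \<in> I \<Longrightarrow> (x has_vector_derivative x' t) (at t within I)"
    and diss: "\<And>t. t \<in> I \<Longrightarrow> inner (M t (x t)) (x' t - G t) \<le> 0"
    and G: "continuous_on I G" and t: "t \<in> I"
  shows "norm (x t) \<le> c\<^sub>0 * (norm (x 0) + integral {0..t} (\<lambda>s. norm (G s)))"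
proof -
  define E where "E t = inner (M t (x t)) (x t)" for t
  define k where "k = m\<^sub>2 / sqrt m\<^sub>1"
  have E_ge: "m\<^sub>1 * (norm (x s))\<^sup>2 \<le> E s" if "s \<in> I" for s using M_lower[OF that] by (simp add: E_def)
  have E0: "0 \<le> E s" if "s \<in> I" for s using order_trans[OF _ E_ge[OF that]] m by simp
  have x_le: "sqrt m\<^sub>1 * norm (x s) \<le> sqrt (E s)" if "s \<in> I" for s
    using real_sqrt_le_mono[OF E_ge[OF that]] by (simp add: real_sqrt_mult)
  have Gc: "continuous_on {0..t} (\<lambda>s. norm (G s))"
    using t by (intro continuous_intros continuous_on_subset[OF G]) auto
  have main: "sqrt m\<^sub>1 * norm (x t) \<le> (sqrt m\<^sub>2 * norm (x 0) + k * integral {0..t} (\<lambda>s. norm (G s))) + e"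
    if e: "0 < e" for e
  proof -
    \<comment> \<open>The term \<open>e\<^sup>2\<close> keeps the square root differentiable where
      the energy vanishes; \<open>e\<close> disappears in the end.\<close>
    define r where "r s = sqrt (E s + e\<^sup>2)" for s
    have r_pos: "0 < r s" if "s \<in> I" for s using E0[OF that] e by (simp add: r_def add_nonneg_pos)
    define E' where "E' s = inner (M' s (x s)) (x s) + 2 * inner (M s (x s)) (x' s)" for s
    have "r t - k * integral {0..t} (\<lambda>s. norm (G s)) \<le> r 0 - k * integral {0..0} (\<lambda>s. norm (G s))"
    proof (rule nonincreasing_of_nonpos_derivative[where f="\<lambda>u. r u - k * integral {0..u} (\<lambda>s. norm (G s))"
          and f'="\<lambda>s. E' s / (2 * r s) - k * norm (G s)"])
      fix s assume s: "s \<in> {0..t}"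
      then have sI: "s \<in> I" using t by auto
      have "(E has_real_derivative E' s) (at s within {0..t})"
        using has_vector_derivative_within_subset[OF energy_deriv[OF sI x'[OF sI]], of "{0..t}"] t
        by (auto simp: E_def[abs_def] E'_def has_real_derivative_iff_has_vector_derivative)
      then have "(r has_real_derivative E' s / (2 * r s)) (at s within {0..t})"
        using r_pos[OF sI] unfolding r_def
        by (auto intro!: derivative_eq_intros simp: field_simps)
      moreover have "((\<lambda>u. k * integral {0..u} (\<lambda>s. norm (G s))) has_real_derivative k * norm (G s)) (at s within {0..t})"
        by (intro DERIV_cmult integral_has_real_derivative Gc s)
      ultimately show "((\<lambda>u. r u - k * integral {0..u} (\<lambda>s. norm (G s))) has_vector_derivative
          E' s / (2 * r s) - k * norm (G s)) (at s within {0..t})"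
        using DERIV_diff by (fastforce simp: has_real_derivative_iff_has_vector_derivative)
      have "E' s \<le> 2 * inner (M s (x s)) (x' s)" using M'_nonpos[OF sI] by (simp add: E'_def)
      also have "\<dots> \<le> 2 * inner (M s (x s)) (G s)" using diss[OF sI] by (simp add: inner_diff_right)
      also have "\<dots> \<le> 2 * (norm (M s (x s)) * norm (G s))" using norm_cauchy_schwarz[of "M s (x s)" "G s"] by simp
      also have "\<dots> \<le> 2 * ((m\<^sub>2 * norm (x s)) * norm (G s))" by (intro mult_left_mono mult_right_mono M_norm sI) auto
      also have "\<dots> \<le> 2 * ((k * r s) * norm (G s))"
      proof (intro mult_left_mono mult_right_mono)
        have "sqrt m\<^sub>1 * norm (x s) \<le> r s"
          by (rule order_trans[OF x_le[OF sI]]) (simp add: r_def)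
        then have "m\<^sub>2 / sqrt m\<^sub>1 * (sqrt m\<^sub>1 * norm (x s)) \<le> m\<^sub>2 / sqrt m\<^sub>1 * r s"
          using m by (intro mult_left_mono) auto
        then show "m\<^sub>2 * norm (x s) \<le> k * r s" using m by (simp add: k_def)
      qed auto
      finally show "E' s / (2 * r s) - k * norm (G s) \<le> 0" using r_pos[OF sI] by (simp add: field_simps)
    qed (use t in auto)
    then have "r t \<le> r 0 + k * integral {0..t} (\<lambda>s. norm (G s))" by simp
    moreover have "sqrt m\<^sub>1 * norm (x t) \<le> r t" using x_le[OF t] by (rule order_trans) (simp add: r_def)
    moreover have "r 0 \<le> sqrt m\<^sub>2 * norm (x 0) + e"
    proof -
      have "E 0 \<le> norm (M 0 (x 0)) * norm (x 0)" unfolding E_def by (rule norm_cauchy_schwarz)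
      also have "\<dots> \<le> m\<^sub>2 * norm (x 0) * norm (x 0)" by (intro mult_right_mono M_norm I_0) auto
      finally have "r 0 \<le> sqrt (m\<^sub>2 * (norm (x 0))\<^sup>2 + e\<^sup>2)" by (simp add: r_def power2_eq_square)
      also have "\<dots> \<le> sqrt (m\<^sub>2 * (norm (x 0))\<^sup>2) + sqrt (e\<^sup>2)" by (rule sqrt_add_le_add_sqrt) (use m in auto)
      finally show ?thesis using e by (simp add: real_sqrt_mult)
    qed
    ultimately show ?thesis by simp
  qed
  have "sqrt m\<^sub>1 * norm (x t) \<le> sqrt m\<^sub>2 * norm (x 0) + k * integral {0..t} (\<lambda>s. norm (G s))"
    by (rule field_le_epsilon) (rule main)
  then have "norm (x t) \<le> (sqrt m\<^sub>2 * norm (x 0) + k * integral {0..t} (\<lambda>s. norm (G s))) / sqrt m\<^sub>1"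
    using m by (simp add: pos_le_divide_eq mult.commute)
  also have "\<dots> = sqrt (m\<^sub>2 / m\<^sub>1) * norm (x 0) + m\<^sub>2 / m\<^sub>1 * integral {0..t} (\<lambda>s. norm (G s))"
    using m by (simp add: k_def add_divide_distrib real_sqrt_divide)
  also have "\<dots> \<le> c\<^sub>0 * norm (x 0) + c\<^sub>0 * integral {0..t} (\<lambda>s. norm (G s))"
  proof (intro add_mono mult_right_mono)
    have "sqrt a \<le> 1 + a" if "0 \<le> a" for a :: real
      using that by (intro real_le_lsqrt) (auto simp: power2_eq_square algebra_simps)
    then show "sqrt (m\<^sub>2 / m\<^sub>1) \<le> c\<^sub>0" using m by (simp add: c\<^sub>0_def)
    show "0 \<le> integral {0..t} (\<lambda>s. norm (G s))" by (intro integral_nonneg integrable_continuous_interval Gc) auto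
  qed (auto simp: c\<^sub>0_def)
  finally show ?thesis by (simp add: distrib_left)
qed

text \<open>Without an initial value, so that differences and modified derivatives of solutions fall
  under the same notion with a new inhomogeneity.\<close>

definition yosida_sol where
  "yosida_sol h G y \<longleftrightarrow> (\<forall>t\<in>I. (y has_vector_derivative Y h t (M t (y t)) + G t) (at t within I))"

lemma yosida_sol_continuous: "yosida_sol h G y \<Longrightarrow> continuous_on I y"
  unfolding yosida_sol_def by (intro continuous_on_I) blast

lemma yosida_sol_exists:
  assumes h: "0 < h" and G: "continuous_on I G"
  shows "\<exists>y. y 0 = y0 \<and> yosida_sol h G y"
  unfolding yosida_sol_def
proof (rule linear_ode_exists[where c="2 / h * m\<^sub>2"])
  show "bounded_linear (\<lambda>v. Y h t (M t v))" if "t \<in> I" for t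
    by (rule bounded_linear_compose[OF Y_props(1)[OF h that] M_lin[OF that]])
  show "norm (Y h t (M t v)) \<le> 2 / h * m\<^sub>2 * norm v" if "t \<in> I" for t v
  proof -
    have "norm (Y h t (M t v)) \<le> 2 / h * norm (M t v)" by (rule Y_props(2)[OF h that])
    also have "\<dots> \<le> 2 / h * (m\<^sub>2 * norm v)" by (intro mult_left_mono M_norm that) (use h in auto)
    finally show ?thesis by simp
  qed
  show "continuous_on I (\<lambda>t. Y h t (M t v))" for v
    by (intro continuous_on_operators(8) h M_cont)
qed (use h m G in auto)

lemma yosida_sol_diff:
  assumes h: "0 < h" and y: "yosida_sol h G y" and z: "yosida_sol h H z"
  shows "yosida_sol h (\<lambda>t. G t - H t) (\<lambda>t. y t - z t)"
  unfolding yosida_sol_def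
proof
  fix t assume t: "t \<in> I"
  have lin: "linear (\<lambda>v. Y h t (M t v))"
    by (rule bounded_linear.linear, rule bounded_linear_compose[OF Y_props(1)[OF h t] M_lin[OF t]])
  have "((\<lambda>t. y t - z t) has_vector_derivative (Y h t (M t (y t)) + G t) - (Y h t (M t (z t)) + H t)) (at t within I)"
    using y z t unfolding yosida_sol_def by (intro has_vector_derivative_diff) auto
  then show "((\<lambda>t. y t - z t) has_vector_derivative Y h t (M t (y t - z t)) + (G t - H t)) (at t within I)"
    by (simp add: linear_diff[OF lin] algebra_simps)
qed

lemma yosida_sol_bound:
  assumes h: "0 < h" and y: "yosida_sol h G y" and G: "continuous_on I G" and t: "t \<in> I"
  shows "norm (y t) \<le> c\<^sub>0 * (norm (y 0) + integral {0..t} (\<lambda>s. norm (G s)))"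
proof (rule energy_estimate[OF _ _ G t])
  show "(y has_vector_derivative Y h t (M t (y t)) + G t) (at t within I)" if "t \<in> I" for t
    using y that by (simp add: yosida_sol_def)
  show "inner (M t (y t)) (Y h t (M t (y t)) + G t - G t) \<le> 0" if "t \<in> I" for t
    using Y_props(3)[OF h that, of "M t (y t)"] by (simp add: inner_commute)
qed

text \<open>
  The modified derivative \<open>w = x' + M\<^sup>-\<^sup>1 M' x\<close> of a solution solves an equation of the same form, because
  \<open>(M x)' = M w\<close>.
\<close>

definition yderiv where "yderiv h F x t = Y h t (M t (x t)) + F t + Q t (x t)"

text \<open>What remains of the derivative of \<open>yderiv\<close> once
  \<open>Y h t (M t w)\<close> is split off. The \<open>K\<close> term is the time derivative of the
  Yosida approximation, with the argument rewritten so that only \<open>w\<close>, \<open>x\<close>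
  and \<open>F\<close> occur; the \<open>Q\<close> terms come from \<open>Q x\<close> with
  \<open>x' = w - Q x\<close>. Every operator left is bounded uniformly in \<open>h\<close>.\<close>

definition yderiv_rhs where
  "yderiv_rhs h F F' x t = J h t (K t (J h t (M t (x t)) - yderiv h F x t + Q t (x t) + F t)) +
     Q' t (x t) + Q t (yderiv h F x t - Q t (x t)) + F' t"

lemma yderiv_continuous:
  assumes h: "0 < h" and F: "continuous_on I F" and x: "continuous_on I x"
  shows "continuous_on I (yderiv h F x)"
  unfolding yderiv_def[abs_def] by (intro continuous_intros continuous_on_operators F x h)

lemma yderiv_rhs_continuous:
  assumes h: "0 < h" and F: "continuous_on I F" "continuous_on I F'" and x: "continuous_on I x"
  shows "continuous_on I (yderiv_rhs h F F' x)"
  unfolding yderiv_rhs_def[abs_def]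
  by (intro continuous_intros continuous_on_operators Q'_continuous_on yderiv_continuous F x h)

lemma yderiv_yosida_sol:
  assumes h: "0 < h" and x: "yosida_sol h F x"
    and F': "\<And>t. t \<in> I \<Longrightarrow> (F has_vector_derivative F' t) (at t within I)"
  shows "yosida_sol h (yderiv_rhs h F F' x) (yderiv h F x)"
  unfolding yosida_sol_def
proof
  fix t assume t: "t \<in> I"
  define w where "w = yderiv h F x t"
  define z where "z t = M t (x t)" for t
  interpret Mt: bounded_linear "M t" by (rule M_lin[OF t])
  have x': "(x has_vector_derivative w - Q t (x t)) (at t within I)"
    using x t by (simp add: yosida_sol_def w_def yderiv_def)
  \<comment> \<open>The reason for adding \<open>Q\<close>: since \<open>M Q = M'\<close>, the term
    \<open>M' x\<close> in the derivative of \<open>M x\<close> cancels.\<close>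
  have MQ: "M t (Q t v) = M' t v" for v by (simp add: Q_def M_Mi[OF t])
  have z': "(z has_vector_derivative M t w) (at t within I)"
    using Mx_deriv[OF t x'] by (simp add: z_def[abs_def] Mt.diff MQ)
  have Jz: "J h t (z t) \<in> D" "A t (J h t (z t)) = Y h t (z t)"
    using J_props(1,6)[OF h t] by auto
  have Yz: "Y h t (z t) = w - F t - Q t (x t)" by (simp add: w_def yderiv_def z_def)
  have A'J: "A' t (J h t (z t)) = K t (J h t (z t) - w + Q t (x t) + F t)"
    unfolding A'_eq_K[OF t Jz(1)] Jz(2) Yz by (simp add: algebra_simps)
  have Y': "((\<lambda>t. Y h t (z t)) has_vector_derivative J h t (A' t (J h t (z t))) + Y h t (M t w)) (at t within I)"
  proof (rule has_vector_derivative_strong_product[OF t Y_props(1)[OF h] Y_props(2)[OF h] _ Y_deriv[OF h t] z'])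
    show "((\<lambda>s. Y h s (M t w)) \<longlongrightarrow> Y h t (M t w)) (at t within I)"
      using Y_cont[OF h] t by (simp add: continuous_on_def)
  qed
  have Q': "((\<lambda>t. Q t (x t)) has_vector_derivative Q' t (x t) + Q t (w - Q t (x t))) (at t within I)"
  proof (rule has_vector_derivative_strong_product[OF t Q_lin Q_norm _ Q_deriv[OF t] x'])
    show "((\<lambda>s. Q s (w - Q t (x t))) \<longlongrightarrow> Q t (w - Q t (x t))) (at t within I)"
      using Q_cont t by (simp add: continuous_on_def)
  qed
  have "((\<lambda>t. Y h t (z t) + F t + Q t (x t)) has_vector_derivative
      (J h t (A' t (J h t (z t))) + Y h t (M t w)) + F' t + (Q' t (x t) + Q t (w - Q t (x t)))) (at t within I)"
    by (intro has_vector_derivative_add Y' F' Q' t)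
  then show "(yderiv h F x has_vector_derivative Y h t (M t (yderiv h F x t)) + yderiv_rhs h F F' x t) (at t within I)"
    unfolding A'J by (simp add: yderiv_def[abs_def] yderiv_rhs_def w_def z_def add_ac)
qed

text \<open>\<open>a\<^sub>1\<close> and \<open>a\<^sub>2\<close> are read off from the estimate of
  \<open>yderiv_rhs\<close> as the coefficients of the solution and of its modified derivative.
  Neither depends on \<open>h\<close>.\<close>

definition a\<^sub>1 where "a\<^sub>1 = 3 * \<kappa> * (m\<^sub>2 + q) + q + q * q"
definition a\<^sub>2 where "a\<^sub>2 = 3 * \<kappa> + q"

lemma a_nonneg: "0 \<le> a\<^sub>1" "0 \<le> a\<^sub>2"
  using \<kappa> q_nonneg m by (auto simp: a\<^sub>1_def a\<^sub>2_def)

lemma norm_yderiv_rhs_le: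
  assumes h: "0 < h" and t: "t \<in> I"
  shows "norm (yderiv_rhs h F F' x t) \<le> a\<^sub>1 * norm (x t) + a\<^sub>2 * norm (yderiv h F x t) + 3 * \<kappa> * norm (F t) + norm (F' t)"
proof -
  define w where "w = yderiv h F x t"
  define p where "p = J h t (M t (x t)) - w + Q t (x t) + F t"
  have "norm p \<le> norm (J h t (M t (x t))) + norm w + norm (Q t (x t)) + norm (F t)"
    unfolding p_def by (intro norm_triangle_le add_mono order_refl norm_triangle_ineq4)
  also have "\<dots> \<le> m\<^sub>2 * norm (x t) + norm w + q * norm (x t) + norm (F t)"
    by (intro add_mono order_refl Q_norm[OF t] order_trans[OF J_props(4)[OF h t] M_norm[OF t]])
  finally have p: "norm p \<le> m\<^sub>2 * norm (x t) + norm w + q * norm (x t) + norm (F t)" .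
  have "norm (J h t (K t p)) \<le> 3 * \<kappa> * norm p" by (rule order_trans[OF J_props(4)[OF h t] K_norm[OF t]])
  also have "\<dots> \<le> 3 * \<kappa> * (m\<^sub>2 * norm (x t) + norm w + q * norm (x t) + norm (F t))"
    using p \<kappa> by (intro mult_left_mono) auto
  finally have 1: "norm (J h t (K t p)) \<le> 3 * \<kappa> * (m\<^sub>2 * norm (x t) + norm w + q * norm (x t) + norm (F t))" .
  have "norm (w - Q t (x t)) \<le> norm w + q * norm (x t)"
    using norm_triangle_ineq4[of w "Q t (x t)"] Q_norm[OF t, of "x t"] by simp
  then have 2: "norm (Q t (w - Q t (x t))) \<le> q * (norm w + q * norm (x t))"
    using order_trans[OF Q_norm[OF t] mult_left_mono[OF _ q_nonneg]] by blast
  have "norm (yderiv_rhs h F F' x t) \<le> norm (J h t (K t p)) + norm (Q' t (x t)) + norm (Q t (w - Q t (x t))) + norm (F' t)"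
    unfolding yderiv_rhs_def p_def w_def by (intro norm_triangle_le add_mono order_refl)
  also have "\<dots> \<le> 3 * \<kappa> * (m\<^sub>2 * norm (x t) + norm w + q * norm (x t) + norm (F t)) + q * norm (x t)
      + q * (norm w + q * norm (x t)) + norm (F' t)"
    by (intro add_mono 1 2 Q'_norm[OF t] order_refl)
  also have "\<dots> = a\<^sub>1 * norm (x t) + a\<^sub>2 * norm w + 3 * \<kappa> * norm (F t) + norm (F' t)"
    by (simp add: a\<^sub>1_def a\<^sub>2_def algebra_simps)
  finally show ?thesis by (simp add: w_def)
qed

text \<open>The outcome of the Gronwall argument in \<open>yderiv_bound\<close>; it depends on the
  system and on \<open>T\<close>, but not on \<open>h\<close> or on the data.\<close>

definition c\<^sub>d where
  "c\<^sub>d = c\<^sub>0 * (1 + q + T * a\<^sub>1 * c\<^sub>0 + T * T * a\<^sub>1 * c\<^sub>0 + 3 * \<kappa> * T) * exp (c\<^sub>0 * a\<^sub>2 * T)"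

lemma cd_nonneg: "0 \<le> c\<^sub>d"
  using c0_ge a_nonneg q_nonneg \<kappa> T by (simp add: c\<^sub>d_def)

text \<open>The energy estimate applied to the modified derivative, followed by Gronwall. That
  \<open>M 0 (x 0)\<close> lies in \<open>D\<close> bounds its initial value uniformly in
  \<open>h\<close>. The derivative of \<open>F\<close> enters through its integral up to
  \<open>t\<close>, and \<open>F\<close> only through its size before \<open>t\<close>; both
  features are needed later, for \<open>L^1\<close> approximation and for tracking exponential
  growth.\<close>

lemma yderiv_bound:
  assumes h: "0 < h" and x: "yosida_sol h F x"
    and F': "\<And>t. t \<in> I \<Longrightarrow> (F has_vector_derivative F' t) (at t within I)" and F'c: "continuous_on I F'"
    and x0: "M 0 (x 0) \<in> D" and t: "t \<in> I" and b: "\<And>s. s \<in> {0..t} \<Longrightarrow> norm (F s) \<le> b"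
  shows "norm (yderiv h F x t) \<le>
           c\<^sub>d * (norm (x 0) + norm (A 0 (M 0 (x 0))) + b + integral {0..t} (\<lambda>s. norm (F' s)))"
proof -
  define w where "w = yderiv h F x"
  define S where "S = integral {0..t} (\<lambda>s. norm (F' s))"
  define N where "N = norm (A 0 (M 0 (x 0)))"
  define X where "X = c\<^sub>0 * (norm (x 0) + T * b)"
  have Fc: "continuous_on I F" by (rule continuous_on_I) (rule F')
  have xc: "continuous_on I x" by (rule yosida_sol_continuous[OF x])
  have wc: "continuous_on I w" unfolding w_def by (rule yderiv_continuous[OF h Fc xc])
  have b0: "0 \<le> b" using order_trans[OF norm_ge_zero b[of 0]] t by simp
  have F'int: "(\<lambda>s. norm (F' s)) integrable_on {0..u}" if "u \<in> I" for u
    using that by (intro integrable_continuous_interval continuous_intros continuous_on_subset[OF F'c]) auto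
  have S0: "0 \<le> S" unfolding S_def by (intro integral_nonneg F'int t) auto
  have xX: "norm (x s) \<le> X" if s: "s \<in> {0..t}" for s
  proof -
    have sI: "s \<in> I" using s t by auto
    have "norm (x s) \<le> c\<^sub>0 * (norm (x 0) + integral {0..s} (\<lambda>s. norm (F s)))"
      by (rule yosida_sol_bound[OF h x Fc sI])
    also have "integral {0..s} (\<lambda>s. norm (F s)) \<le> integral {0..s} (\<lambda>s. b)"
      using s t sI b by (intro integral_le integrable_continuous_interval continuous_intros continuous_on_subset[OF Fc]) auto
    also have "\<dots> \<le> T * b" using s t b0 by (simp add: mult_right_mono)
    finally show ?thesis using c0_ge by (simp add: X_def)
  qed
  have w0: "norm (w 0) \<le> N + b + q * norm (x 0)"
  proof -
    have "norm (w 0) \<le> norm (Y h 0 (M 0 (x 0))) + norm (F 0) + norm (Q 0 (x 0))"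
      unfolding w_def yderiv_def by (intro norm_triangle_le add_mono order_refl)
    also have "\<dots> \<le> N + b + q * norm (x 0)"
      unfolding N_def by (intro add_mono Y_props(5)[OF h I_0 x0] b Q_norm[OF I_0]) (use t in auto)
    finally show ?thesis .
  qed
  define a where "a = c\<^sub>0 * ((N + b + q * norm (x 0)) + (T * (a\<^sub>1 * X + 3 * \<kappa> * b) + S))"
  have "norm (w u) \<le> a + (c\<^sub>0 * a\<^sub>2) * integral {0..u} (\<lambda>s. norm (w s))" if u: "u \<in> {0..t}" for u
  proof -
    have uI: "u \<in> I" using u t by auto
    have Gc: "continuous_on I (yderiv_rhs h F F' x)" by (rule yderiv_rhs_continuous[OF h Fc F'c xc])
    have wi: "(\<lambda>s. norm (w s)) integrable_on {0..u}"
      using uI by (intro integrable_continuous_interval continuous_intros continuous_on_subset[OF wc]) auto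
    have "integral {0..u} (\<lambda>s. norm (yderiv_rhs h F F' x s)) \<le>
        integral {0..u} (\<lambda>s. (a\<^sub>1 * X + 3 * \<kappa> * b) + norm (F' s) + a\<^sub>2 * norm (w s))"
    proof (rule integral_le)
      fix s assume s: "s \<in> {0..u}"
      then have sI: "s \<in> I" "s \<in> {0..t}" using u t by auto
      have "norm (yderiv_rhs h F F' x s) \<le> a\<^sub>1 * norm (x s) + a\<^sub>2 * norm (w s) + 3 * \<kappa> * norm (F s) + norm (F' s)"
        unfolding w_def by (rule norm_yderiv_rhs_le[OF h sI(1)])
      also have "\<dots> \<le> a\<^sub>1 * X + a\<^sub>2 * norm (w s) + 3 * \<kappa> * b + norm (F' s)"
        using xX[OF sI(2)] b[OF sI(2)] a_nonneg \<kappa> by (intro add_mono mult_left_mono) auto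
      finally show "norm (yderiv_rhs h F F' x s) \<le> (a\<^sub>1 * X + 3 * \<kappa> * b) + norm (F' s) + a\<^sub>2 * norm (w s)" by simp
    qed (use uI in \<open>intro integrable_continuous_interval continuous_intros continuous_on_subset[OF Gc]
        continuous_on_subset[OF F'c] continuous_on_subset[OF wc]; auto\<close>)+
    also have "\<dots> = u * (a\<^sub>1 * X + 3 * \<kappa> * b) + integral {0..u} (\<lambda>s. norm (F' s)) + a\<^sub>2 * integral {0..u} (\<lambda>s. norm (w s))"
    proof (rule integral_unique)
      have "((\<lambda>s. a\<^sub>1 * X + 3 * \<kappa> * b) has_integral u * (a\<^sub>1 * X + 3 * \<kappa> * b)) {0..u}"
        using has_integral_const_real[of "a\<^sub>1 * X + 3 * \<kappa> * b" 0 u] u by simp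
      then show "((\<lambda>s. (a\<^sub>1 * X + 3 * \<kappa> * b) + norm (F' s) + a\<^sub>2 * norm (w s)) has_integral
          u * (a\<^sub>1 * X + 3 * \<kappa> * b) + integral {0..u} (\<lambda>s. norm (F' s)) + a\<^sub>2 * integral {0..u} (\<lambda>s. norm (w s))) {0..u}"
        by (intro has_integral_add has_integral_mult_right integrable_integral F'int[OF uI] wi)
    qed
    also have "\<dots> \<le> T * (a\<^sub>1 * X + 3 * \<kappa> * b) + S + a\<^sub>2 * integral {0..u} (\<lambda>s. norm (w s))"
    proof (intro add_mono order_refl mult_right_mono)
      show "integral {0..u} (\<lambda>s. norm (F' s)) \<le> S"
        unfolding S_def using u t by (intro integral_subset_le F'int uI) auto
      have "0 \<le> X" using order_trans[OF norm_ge_zero xX[of 0]] t by simp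
      then show "0 \<le> a\<^sub>1 * X + 3 * \<kappa> * b" using a_nonneg \<kappa> b0 by simp
    qed (use u t in auto)
    finally have int: "integral {0..u} (\<lambda>s. norm (yderiv_rhs h F F' x s)) \<le>
        T * (a\<^sub>1 * X + 3 * \<kappa> * b) + S + a\<^sub>2 * integral {0..u} (\<lambda>s. norm (w s))" .
    have "norm (w u) \<le> c\<^sub>0 * (norm (w 0) + integral {0..u} (\<lambda>s. norm (yderiv_rhs h F F' x s)))"
      unfolding w_def by (rule yosida_sol_bound[OF h yderiv_yosida_sol[OF h x F'] Gc uI])
    also have "\<dots> \<le> c\<^sub>0 * ((N + b + q * norm (x 0)) + (T * (a\<^sub>1 * X + 3 * \<kappa> * b) + S + a\<^sub>2 * integral {0..u} (\<lambda>s. norm (w s))))"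
      using c0_ge w0 int by (intro mult_left_mono add_mono) auto
    also have "\<dots> = a + (c\<^sub>0 * a\<^sub>2) * integral {0..u} (\<lambda>s. norm (w s))" by (simp add: a_def algebra_simps)
    finally show ?thesis .
  qed
  then have "norm (w t) \<le> a * exp (c\<^sub>0 * a\<^sub>2 * t)"
    using t c0_ge a_nonneg
    by (intro gronwall[of t "\<lambda>s. norm (w s)"] continuous_intros continuous_on_subset[OF wc]) auto
  also have "\<dots> \<le> (c\<^sub>0 * ((1 + q + T * a\<^sub>1 * c\<^sub>0 + T * T * a\<^sub>1 * c\<^sub>0 + 3 * \<kappa> * T) * (norm (x 0) + N + b + S))) * exp (c\<^sub>0 * a\<^sub>2 * T)"
  proof (intro mult_mono)
    define n where "n = norm (x 0)"
    have nn: "0 \<le> n" "0 \<le> N" by (auto simp: n_def N_def)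
    define u where "u = T * a\<^sub>1 * c\<^sub>0"
    have u: "0 \<le> u" "0 \<le> T * u" "0 \<le> 3 * \<kappa> * T" using T a_nonneg c0_ge \<kappa> by (auto simp: u_def)
    have "(N + b + q * n) + (T * (a\<^sub>1 * X + 3 * \<kappa> * b) + S) = (N + b + S) + q * n + u * n + (T * u) * b + (3 * \<kappa> * T) * b"
      by (simp add: X_def u_def n_def algebra_simps)
    also have "\<dots> \<le> (n + N + b + S) + q * (n + N + b + S) + u * (n + N + b + S) + (T * u) * (n + N + b + S) + (3 * \<kappa> * T) * (n + N + b + S)"
      using nn b0 S0 q_nonneg u by (intro add_mono mult_left_mono) auto
    also have "\<dots> = (1 + q + T * a\<^sub>1 * c\<^sub>0 + T * T * a\<^sub>1 * c\<^sub>0 + 3 * \<kappa> * T) * (n + N + b + S)"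
      by (simp add: u_def algebra_simps)
    finally show "a \<le> c\<^sub>0 * ((1 + q + T * a\<^sub>1 * c\<^sub>0 + T * T * a\<^sub>1 * c\<^sub>0 + 3 * \<kappa> * T) * (norm (x 0) + N + b + S))"
      unfolding a_def n_def using c0_ge by (intro mult_left_mono) auto
    show "exp (c\<^sub>0 * a\<^sub>2 * t) \<le> exp (c\<^sub>0 * a\<^sub>2 * T)" using t c0_ge a_nonneg by (simp add: mult_left_mono)
    have "0 \<le> N + b + S" using b0 S0 by (simp add: N_def)
    then show "0 \<le> c\<^sub>0 * ((1 + q + T * a\<^sub>1 * c\<^sub>0 + T * T * a\<^sub>1 * c\<^sub>0 + 3 * \<kappa> * T) * (norm (x 0) + N + b + S))"
      using u q_nonneg c0_ge T a_nonneg \<kappa> nn b0 S0 by (intro mult_nonneg_nonneg add_nonneg_nonneg) auto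
  qed auto
  also have "\<dots> = c\<^sub>d * (norm (x 0) + N + b + S)" by (simp add: c\<^sub>d_def mult_ac)
  finally show ?thesis by (simp add: w_def N_def S_def)
qed

end

section \<open>Convergence of the regularized solutions and mild solutions\<close>

context evolution_system
begin

definition hs :: "nat \<Rightarrow> real" where "hs n = inverse (real (Suc n))"

lemma hs_pos: "0 < hs n" by (simp add: hs_def)

lemma hs_mono: "N \<le> n \<Longrightarrow> hs n \<le> hs N" by (simp add: hs_def field_simps)

lemma ex_hs_less: "0 < e \<Longrightarrow> \<exists>N. hs N < e" unfolding hs_def by (rule reals_Archimedean)

text \<open>For two steps \<open>h\<close> and \<open>k\<close>, the energy of the difference
  \<open>d\<close> is tested against \<open>M d\<close>, which splits into a difference of
  resolvents plus terms of size \<open>h\<close> and \<open>k\<close> by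
  \<open>J h y = y + h Y h y\<close>. The first part is dissipative, because the Yosida terms are
  \<open>A\<close> of the resolvents; the rest is of order \<open>(h + k) * L\<^sup>2\<close>, where
  \<open>L\<close> bounds all Yosida terms by the derivative estimate.\<close>

lemma yosida_sol_Cauchy_smooth:
  assumes F': "\<And>t. t \<in> I \<Longrightarrow> (F has_vector_derivative F' t) (at t within I)" and F'c: "continuous_on I F'"
    and X: "\<And>n. yosida_sol (hs n) F (X n)" "\<And>n. X n 0 = x0" and x0: "M 0 x0 \<in> D"
  shows "uniformly_Cauchy_on I X"
proof -
  have Fc: "continuous_on I F" by (rule continuous_on_I) (rule F')
  obtain b where b: "\<And>t. t \<in> I \<Longrightarrow> norm (F t) \<le> b"
    using compact_continuous_image[OF Fc compact_Icc, THEN compact_imp_bounded] unfolding bounded_iff by blast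
  have b0: "0 \<le> b" using order_trans[OF norm_ge_zero b[OF I_0]] .
  define S where "S = integral I (\<lambda>s. norm (F' s))"
  define C where "C = c\<^sub>d * (norm x0 + norm (A 0 (M 0 x0)) + b + S)"
  define X\<^sub>b where "X\<^sub>b = c\<^sub>0 * (norm x0 + T * b)"
  define L where "L = C + b + q * X\<^sub>b"
  have hs: "0 < hs n" for n by (rule hs_pos)
  have Xb: "norm (X n t) \<le> X\<^sub>b" if t: "t \<in> I" for n t
  proof -
    have "norm (X n t) \<le> c\<^sub>0 * (norm (X n 0) + integral {0..t} (\<lambda>s. norm (F s)))"
      by (rule yosida_sol_bound[OF hs X(1) Fc t])
    also have "integral {0..t} (\<lambda>s. norm (F s)) \<le> integral {0..t} (\<lambda>s. b)"
      using t b by (intro integral_le integrable_continuous_interval continuous_intros continuous_on_subset[OF Fc]) auto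
    also have "\<dots> \<le> T * b" using t b0 by (simp add: mult_right_mono)
    finally show ?thesis using c0_ge by (simp add: X\<^sub>b_def X(2))
  qed
  have YL: "norm (Y (hs n) t (M t (X n t))) \<le> L" if t: "t \<in> I" for n t
  proof -
    have "norm (yderiv (hs n) F (X n) t) \<le>
        c\<^sub>d * (norm (X n 0) + norm (A 0 (M 0 (X n 0))) + b + integral {0..t} (\<lambda>s. norm (F' s)))"
      by (rule yderiv_bound[OF hs X(1) F' F'c _ t]) (use X(2) x0 b t in auto)
    also have "\<dots> \<le> C"
      unfolding C_def X(2) S_def using cd_nonneg t
      by (intro mult_left_mono add_mono order_refl integral_subset_le integrable_continuous_interval
          continuous_intros continuous_on_subset[OF F'c]) auto
    finally have "norm (yderiv (hs n) F (X n) t) \<le> C" .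
    moreover have "norm (Q t (X n t)) \<le> q * X\<^sub>b"
      using order_trans[OF Q_norm[OF t] mult_left_mono[OF Xb[OF t] q_nonneg]] .
    moreover have "Y (hs n) t (M t (X n t)) = yderiv (hs n) F (X n) t - F t - Q t (X n t)"
      by (simp add: yderiv_def)
    ultimately show ?thesis
      unfolding L_def using b[OF t] by (metis (no_types, opaque_lifting) add_mono norm_triangle_le_diff)
  qed
  have L0: "0 \<le> L" using order_trans[OF norm_ge_zero YL[OF I_0]] .
  have close: "m\<^sub>1 * (norm (X n t - X k t))\<^sup>2 \<le> 4 * L\<^sup>2 * T * (hs n + hs k)" if t: "t \<in> I" for n k t
  proof -
    define d where "d s = X n s - X k s" for s
    define d' where "d' s = Y (hs n) s (M s (X n s)) - Y (hs k) s (M s (X k s))" for s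
    define E where "E s = inner (M s (d s)) (d s)" for s
    define c where "c = 4 * L\<^sup>2 * (hs n + hs k)"
    have dd: "(d has_vector_derivative d' s) (at s within I)" if s: "s \<in> I" for s
    proof -
      have "((\<lambda>s. X n s - X k s) has_vector_derivative
          (Y (hs n) s (M s (X n s)) + F s) - (Y (hs k) s (M s (X k s)) + F s)) (at s within I)"
        using X(1) s unfolding yosida_sol_def by (intro has_vector_derivative_diff) auto
      then show ?thesis by (simp add: d_def[abs_def] d'_def)
    qed
    have "E t - c * t \<le> E 0 - c * 0"
    proof (rule nonincreasing_of_nonpos_derivative[where f="\<lambda>s. E s - c * s"
          and f'="\<lambda>s. (inner (M' s (d s)) (d s) + 2 * inner (M s (d s)) (d' s)) - c"])
      fix s assume s: "s \<in> {0..t}"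
      then have sI: "s \<in> I" using t by auto
      have "(E has_vector_derivative inner (M' s (d s)) (d s) + 2 * inner (M s (d s)) (d' s)) (at s within {0..t})"
        using has_vector_derivative_within_subset[OF energy_deriv[OF sI dd[OF sI]], of "{0..t}"] t
        by (auto simp: E_def[abs_def])
      moreover have "((\<lambda>s. c * s) has_vector_derivative c) (at s within {0..t})"
        by (auto intro!: derivative_eq_intros simp flip: has_real_derivative_iff_has_vector_derivative)
      ultimately show "((\<lambda>s. E s - c * s) has_vector_derivative
          (inner (M' s (d s)) (d s) + 2 * inner (M s (d s)) (d' s)) - c) (at s within {0..t})"
        by (rule has_vector_derivative_diff)
      define a where "a = M s (X n s)"
      define e where "e = M s (X k s)"
      define Ya where "Ya = Y (hs n) s a"
      define Ye where "Ye = Y (hs k) s e"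
      have Md: "M s (d s) = (J (hs n) s a - J (hs k) s e) - (hs n *\<^sub>R Ya - hs k *\<^sub>R Ye)"
        using linear_diff[OF bounded_linear.linear[OF M_lin[OF sI]], of "X n s" "X k s"]
          J_props(5)[OF hs sI, of n a] J_props(5)[OF hs sI, of k e]
        by (simp add: d_def a_def e_def Ya_def Ye_def)
      have d': "d' s = Ya - Ye" by (simp add: d'_def Ya_def Ye_def a_def e_def)
      have JD: "J (hs n) s a \<in> D" "J (hs k) s e \<in> D" using J_props(1)[OF hs sI] by auto
      have "Ya - Ye = A s (J (hs n) s a - J (hs k) s e)"
        using m_dissipative_diff[OF A_m_dissipative[OF sI] JD] J_props(6)[OF hs sI] by (simp add: Ya_def Ye_def)
      then have "inner (J (hs n) s a - J (hs k) s e) (Ya - Ye) \<le> 0"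
        using m_dissipativeD(5)[OF A_m_dissipative[OF sI] subspace_diff[OF D_subspace JD]]
        by (simp add: inner_commute)
      then have "inner (M s (d s)) (d' s) \<le> - inner (hs n *\<^sub>R Ya - hs k *\<^sub>R Ye) (Ya - Ye)"
        unfolding Md d' by (simp add: inner_diff_left)
      also have "\<dots> \<le> norm (hs n *\<^sub>R Ya - hs k *\<^sub>R Ye) * norm (Ya - Ye)"
        using Cauchy_Schwarz_ineq2[of "hs n *\<^sub>R Ya - hs k *\<^sub>R Ye" "Ya - Ye"] by linarith
      also have "\<dots> \<le> (hs n * L + hs k * L) * (L + L)"
      proof (intro mult_mono)
        have Y: "norm Ya \<le> L" "norm Ye \<le> L" using YL[OF sI] by (auto simp: Ya_def Ye_def a_def e_def)
        then show "norm (Ya - Ye) \<le> L + L" using norm_triangle_ineq4[of Ya Ye] by linarith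
        have "norm (hs n *\<^sub>R Ya) \<le> hs n * L" "norm (hs k *\<^sub>R Ye) \<le> hs k * L"
          using Y hs[of n] hs[of k] by (auto intro!: mult_left_mono)
        then show "norm (hs n *\<^sub>R Ya - hs k *\<^sub>R Ye) \<le> hs n * L + hs k * L"
          using norm_triangle_ineq4[of "hs n *\<^sub>R Ya" "hs k *\<^sub>R Ye"] by linarith
      qed (use L0 hs[of n] hs[of k] in auto)
      finally have "2 * inner (M s (d s)) (d' s) \<le> c"
        by (simp add: c_def power2_eq_square algebra_simps)
      then show "(inner (M' s (d s)) (d s) + 2 * inner (M s (d s)) (d' s)) - c \<le> 0"
        using M'_nonpos[OF sI, of "d s"] by simp
    qed (use t in auto)
    moreover have "E 0 = 0" using M_lin[OF I_0] by (simp add: E_def d_def X(2) linear_simps)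
    moreover have "c * t \<le> c * T" using t hs[of n] hs[of k] by (intro mult_left_mono) (auto simp: c_def)
    ultimately show ?thesis using M_lower[OF t, of "d t"] by (simp add: E_def d_def c_def mult_ac)
  qed
  show ?thesis
    unfolding uniformly_Cauchy_on_def
  proof (intro allI impI)
    fix e :: real assume e: "0 < e"
    define \<delta> where "\<delta> = m\<^sub>1 * e\<^sup>2 / (8 * L\<^sup>2 * T + 1)"
    have den: "0 < 8 * L\<^sup>2 * T + 1" using T by (simp add: add_nonneg_pos)
    have \<delta>: "0 < \<delta>" using e m den by (simp add: \<delta>_def)
    obtain N where N: "hs N < \<delta>" using ex_hs_less[OF \<delta>] by blast
    have "dist (X n t) (X k t) < e" if nk: "n \<ge> N" "k \<ge> N" and t: "t \<in> I" for n k t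
    proof -
      have "hs n \<le> hs N" "hs k \<le> hs N" using nk by (auto intro: hs_mono)
      then have "hs n + hs k \<le> 2 * \<delta>" using N by linarith
      then have "4 * L\<^sup>2 * T * (hs n + hs k) \<le> 4 * L\<^sup>2 * T * (2 * \<delta>)" using T by (intro mult_left_mono) auto
      also have "\<dots> = (8 * L\<^sup>2 * T) * \<delta>" by simp
      also have "\<dots> < (8 * L\<^sup>2 * T + 1) * \<delta>" using \<delta> by (simp add: distrib_right)
      also have "\<dots> = m\<^sub>1 * e\<^sup>2" using den by (simp add: \<delta>_def)
      finally have "m\<^sub>1 * (norm (X n t - X k t))\<^sup>2 < m\<^sub>1 * e\<^sup>2" using close[OF t, of n k] by linarith
      then have "(norm (X n t - X k t))\<^sup>2 < e\<^sup>2" using m by simp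
      then show ?thesis using e by (simp add: dist_norm power2_less_imp_less)
    qed
    then show "\<exists>M. \<forall>x\<in>I. \<forall>m\<ge>M. \<forall>n\<ge>M. dist (X m x) (X n x) < e" by blast
  qed
qed

lemma integral_norm_le_const:
  fixes g :: "real \<Rightarrow> 'b::real_normed_vector"
  assumes g: "continuous_on I g" and b: "\<And>s. s \<in> I \<Longrightarrow> norm (g s) \<le> b" and t: "t \<in> I"
  shows "integral {0..t} (\<lambda>s. norm (g s)) \<le> T * b"
proof -
  have b0: "0 \<le> b" using order_trans[OF norm_ge_zero b[OF I_0]] .
  have "integral {0..t} (\<lambda>s. norm (g s)) \<le> integral {0..t} (\<lambda>s. b)"
    using t b by (intro integral_le integrable_continuous_interval continuous_intros continuous_on_subset[OF g]) auto
  also have "\<dots> \<le> T * b" using t b0 by (simp add: mult_right_mono)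
  finally show ?thesis .
qed

lemma C1_uniformly_dense:
  fixes G :: "real \<Rightarrow> 'x"
  assumes G: "continuous_on I G" and e: "0 < e"
  shows "\<exists>F F'. (\<forall>t\<in>I. (F has_vector_derivative F' t) (at t within I)) \<and> continuous_on I F' \<and>
     (\<forall>t\<in>I. norm (F t - G t) \<le> e)"
proof -
  have "uniformly_continuous_on I G" by (rule compact_uniformly_continuous[OF G]) simp
  then obtain d where d: "0 < d" "\<And>s t. s \<in> I \<Longrightarrow> t \<in> I \<Longrightarrow> dist s t < d \<Longrightarrow> dist (G s) (G t) < e"
    using e unfolding uniformly_continuous_on_def by metis
  define h where "h = d / 2"
  have h: "0 < h" "h < d" using d(1) by (auto simp: h_def)
  obtain F where F: "\<And>t. t \<in> I \<Longrightarrow> (F has_vector_derivative (G t - G (max 0 (t - h))) /\<^sub>R h) (at t within I)"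
    and FG: "\<And>t e. t \<in> I \<Longrightarrow> (\<And>s. s \<in> {0..t} \<Longrightarrow> t - s \<le> h \<Longrightarrow> norm (G s - G t) \<le> e) \<Longrightarrow> norm (F t - G t) \<le> e"
    using steklov_average[OF G h(1)] T by (metis less_imp_le)
  have "continuous_on I (\<lambda>t. G (max 0 (t - h)))"
    by (rule continuous_on_compose2[OF G]) (use h T in \<open>auto intro!: continuous_intros\<close>)
  then have "continuous_on I (\<lambda>t. (G t - G (max 0 (t - h))) /\<^sub>R h)"
    by (intro continuous_intros G) (use h in auto)
  moreover have "norm (F t - G t) \<le> e" if t: "t \<in> I" for t
  proof (rule FG[OF t])
    fix s assume "s \<in> {0..t}" "t - s \<le> h"
    then show "norm (G s - G t) \<le> e" using d(2)[of s t] t h by (simp add: dist_norm less_imp_le)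
  qed
  ultimately show ?thesis
    using F by - (rule exI[of _ F], rule exI[of _ "\<lambda>t. (G t - G (max 0 (t - h))) /\<^sub>R h"], blast)
qed

lemma initial_states_dense:
  assumes e: "0 < e" shows "\<exists>y. M 0 y \<in> D \<and> norm (y - x) \<le> e"
proof -
  have "M 0 x \<in> closure D" using D_dense by simp
  then obtain d where d: "d \<in> D" "dist d (M 0 x) < e * m\<^sub>1"
    using e m unfolding closure_approachable by (metis mult_pos_pos)
  have "m\<^sub>1 * norm (Mi 0 d - x) \<le> norm (M 0 (Mi 0 d - x))" by (rule norm_M_ge[OF I_0])
  also have "M 0 (Mi 0 d - x) = d - M 0 x"
    using linear_diff[OF bounded_linear.linear[OF M_lin[OF I_0]]] by (simp add: M_Mi[OF I_0])
  finally have "norm (Mi 0 d - x) * m\<^sub>1 \<le> e * m\<^sub>1" using d(2) by (simp add: dist_norm mult.commute)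
  then have "norm (Mi 0 d - x) \<le> e" using m by simp
  then show ?thesis using d(1) M_Mi[OF I_0] by (intro exI[of _ "Mi 0 d"]) simp
qed

text \<open>Data as in the smooth case are dense, and the solution bound does not depend on the
  step, so approximating the data costs an error uniform in \<open>n\<close>.\<close>

lemma yosida_sol_Cauchy:
  assumes G: "continuous_on I G" and X: "\<And>n. yosida_sol (hs n) G (X n)" "\<And>n. X n 0 = x0"
  shows "uniformly_Cauchy_on I X"
  unfolding uniformly_Cauchy_on_def
proof (intro allI impI)
  fix e :: real assume e: "0 < e"
  define \<epsilon> where "\<epsilon> = e / (4 * c\<^sub>0 * (1 + T))"
  have den: "0 < 4 * c\<^sub>0 * (1 + T)" using c0_ge T by simp
  then have \<epsilon>: "0 < \<epsilon>" using e by (simp add: \<epsilon>_def)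
  obtain F F' where F: "\<And>t. t \<in> I \<Longrightarrow> (F has_vector_derivative F' t) (at t within I)" "continuous_on I F'"
    and FG: "\<And>t. t \<in> I \<Longrightarrow> norm (F t - G t) \<le> \<epsilon>"
    using C1_uniformly_dense[OF G \<epsilon>] by blast
  obtain z0 where z0: "M 0 z0 \<in> D" "norm (z0 - x0) \<le> \<epsilon>" using initial_states_dense[OF \<epsilon>] by blast
  have Fc: "continuous_on I F" by (rule continuous_on_I) (rule F)
  have "\<exists>z. z 0 = z0 \<and> yosida_sol (hs n) F z" for n by (rule yosida_sol_exists[OF hs_pos Fc])
  then obtain Z where Z: "\<And>n. Z n 0 = z0" "\<And>n. yosida_sol (hs n) F (Z n)" by metis
  obtain N where N: "\<And>t n k. t \<in> I \<Longrightarrow> n \<ge> N \<Longrightarrow> k \<ge> N \<Longrightarrow> dist (Z n t) (Z k t) < e / 2"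
    using yosida_sol_Cauchy_smooth[OF F Z(2,1) z0(1)] e unfolding uniformly_Cauchy_on_def by (meson half_gt_zero)
  have ZX: "norm (Z n t - X n t) \<le> e / 4" if t: "t \<in> I" for n t
  proof -
    have c: "continuous_on I (\<lambda>t. F t - G t)" by (intro continuous_intros Fc G)
    have "norm (Z n t - X n t) \<le> c\<^sub>0 * (norm (Z n 0 - X n 0) + integral {0..t} (\<lambda>s. norm (F s - G s)))"
      using yosida_sol_bound[OF hs_pos yosida_sol_diff[OF hs_pos Z(2) X(1)] c t] by simp
    also have "\<dots> \<le> c\<^sub>0 * (\<epsilon> + T * \<epsilon>)"
      using c0_ge z0(2) by (intro mult_left_mono add_mono integral_norm_le_const[OF c FG t]) (auto simp: Z X)
    also have "\<dots> = (4 * c\<^sub>0 * (1 + T)) * \<epsilon> / 4" by (simp add: algebra_simps)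
    also have "\<dots> = e / 4" using c0_ge T by (simp add: \<epsilon>_def)
    finally show ?thesis .
  qed
  have "dist (X n t) (X k t) < e" if t: "t \<in> I" and "n \<ge> N" "k \<ge> N" for t n k
  proof -
    have "X n t - X k t = (Z n t - Z k t) - (Z n t - X n t) + (Z k t - X k t)" by simp
    also have "norm \<dots> \<le> norm (Z n t - Z k t) + norm (Z n t - X n t) + norm (Z k t - X k t)"
      by (intro norm_triangle_le add_mono norm_triangle_ineq4 order_refl)
    finally show ?thesis using N[OF that] ZX[OF t, of n] ZX[OF t, of k] by (simp add: dist_norm)
  qed
  then show "\<exists>M. \<forall>x\<in>I. \<forall>m\<ge>M. \<forall>n\<ge>M. dist (X m x) (X n x) < e" by blast
qed

text \<open>
  No evolution family is constructed: instead of by a variation-of-constants formula, mild solutions are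
  defined as limits of the solutions of the Yosida-regularized equations.
\<close>

definition mild where
  "mild x0 G x \<longleftrightarrow> (\<exists>X. (\<forall>n. yosida_sol (hs n) G (X n) \<and> X n 0 = x0) \<and> uniform_limit I X x sequentially)"

lemma mild_exists: assumes G: "continuous_on I G" shows "\<exists>x. mild x0 G x"
proof -
  have "\<exists>z. z 0 = x0 \<and> yosida_sol (hs n) G z" for n by (rule yosida_sol_exists[OF hs_pos G])
  then obtain X where X: "\<And>n. X n 0 = x0" "\<And>n. yosida_sol (hs n) G (X n)" by metis
  then obtain x where "uniform_limit I X x sequentially"
    using yosida_sol_Cauchy[OF G X(2,1)] Cauchy_uniformly_convergent uniformly_convergent_on_def by blast
  then show ?thesis unfolding mild_def using X by blast
qed

lemma mild_continuous: assumes "mild x0 G x" shows "continuous_on I x"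
proof -
  obtain X where X: "\<And>n. yosida_sol (hs n) G (X n)" "uniform_limit I X x sequentially"
    using assms unfolding mild_def by blast
  show ?thesis
    by (rule uniform_limit_theorem[OF _ X(2)]) (auto intro!: always_eventually yosida_sol_continuous[OF X(1)])
qed

lemma mild_diff_bound:
  assumes x: "mild x0 G x" and y: "mild y0 H y" and G: "continuous_on I G" and H: "continuous_on I H" and t: "t \<in> I"
  shows "norm (x t - y t) \<le> c\<^sub>0 * (norm (x0 - y0) + integral {0..t} (\<lambda>s. norm (G s - H s)))"
proof -
  obtain X where X: "\<And>n. yosida_sol (hs n) G (X n)" "\<And>n. X n 0 = x0" "uniform_limit I X x sequentially"
    using x unfolding mild_def by blast
  obtain Z where Z: "\<And>n. yosida_sol (hs n) H (Z n)" "\<And>n. Z n 0 = y0" "uniform_limit I Z y sequentially"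
    using y unfolding mild_def by blast
  have c: "continuous_on I (\<lambda>t. G t - H t)" by (intro continuous_intros H G)
  have "norm (X n t - Z n t) \<le> c\<^sub>0 * (norm (x0 - y0) + integral {0..t} (\<lambda>s. norm (G s - H s)))" for n
    using yosida_sol_bound[OF hs_pos yosida_sol_diff[OF hs_pos X(1) Z(1)] c t] by (simp add: X Z)
  moreover have "(\<lambda>n. norm (X n t - Z n t)) \<longlonglongrightarrow> norm (x t - y t)"
    by (intro tendsto_intros tendsto_uniform_limitI[OF X(3) t] tendsto_uniform_limitI[OF Z(3) t])
  ultimately show ?thesis by (intro LIMSEQ_le_const2) auto
qed

text \<open>On \<open>D\<close> the error is at most \<open>h * norm (A t d)\<close>, uniformly in
  \<open>t\<close> since all graph norms are controlled by the one at time \<open>0\<close>;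
  contractivity extends the convergence to the closure of \<open>D\<close>.\<close>

lemma J_uniform_limit_const: "uniform_limit I (\<lambda>n t. J (hs n) t v) (\<lambda>_. v) sequentially"
proof (rule uniform_limit_combine)
  fix e :: real assume e: "0 < e"
  have "v \<in> closure D" using D_dense by simp
  then obtain d where d: "d \<in> D" "norm (d - v) < e / 4"
    using e unfolding closure_approachable dist_norm by (metis zero_less_divide_iff zero_less_numeral)
  define c where "c = \<kappa> * (norm d + norm (A 0 d)) + 1"
  have c: "0 < c" using \<kappa> by (simp add: c_def add_nonneg_pos)
  obtain N where N: "hs N < e / (2 * c)" using ex_hs_less[of "e / (2 * c)"] e c by auto
  have "norm (J (hs n) t v - v) \<le> e" if n: "n \<ge> N" and t: "t \<in> I" for n t
  proof -
    have hs: "0 < hs n" by (rule hs_pos)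
    have "norm (J (hs n) t d - d) \<le> hs n * norm (A t d)" by (rule Y_props(6)[OF hs t d(1)])
    also have "\<dots> \<le> hs n * c"
      using A_bound[OF t I_0 d(1)] hs by (intro mult_left_mono) (auto simp: c_def)
    also have "\<dots> \<le> hs N * c" using n c by (intro mult_right_mono hs_mono) auto
    also have "\<dots> \<le> e / 2" using N c by (simp add: field_simps)
    finally have 1: "norm (J (hs n) t d - d) \<le> e / 2" .
    have 2: "norm (J (hs n) t (d - v)) \<le> e / 4" using J_props(4)[OF hs t, of "d - v"] d(2) by simp
    have "J (hs n) t v - v = (J (hs n) t d - d) - J (hs n) t (d - v) + (d - v)"
      using linear_diff[OF bounded_linear.linear[OF J_props(3)[OF hs t]], of d v] by simp
    also have "norm \<dots> \<le> norm (J (hs n) t d - d) + norm (J (hs n) t (d - v)) + norm (d - v)"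
      by (intro norm_triangle_le add_mono norm_triangle_ineq4 order_refl)
    finally show ?thesis using 1 2 d(2) by simp
  qed
  then show "\<exists>N. \<forall>n\<ge>N. \<forall>t\<in>I. norm (J (hs n) t v - v) \<le> e" by blast
qed

text \<open>The image of \<open>v\<close> is compact, so finitely many fixed vectors approximate
  every \<open>v t\<close>.\<close>

lemma J_uniform_limit:
  assumes v: "continuous_on I v"
  shows "uniform_limit I (\<lambda>n t. J (hs n) t (v t)) v sequentially"
proof (rule uniform_limit_combine)
  fix e :: real assume e: "0 < e"
  have "compact (v ` I)" by (intro compact_continuous_image v) simp
  moreover have "v ` I \<subseteq> (\<Union>y\<in>v ` I. ball y (e / 3))" using e by fastforce
  ultimately obtain k where k: "k \<subseteq> v ` I" "finite k" "v ` I \<subseteq> (\<Union>y\<in>k. ball y (e / 3))"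
    using compactE_image[of "v ` I" "v ` I" "\<lambda>y. ball y (e / 3)"] open_ball by metis
  have "\<forall>y. \<exists>N. \<forall>n\<ge>N. \<forall>t\<in>I. norm (J (hs n) t y - y) \<le> e / 3"
    using uniform_limitE[OF J_uniform_limit_const, of "e / 3"] e by (metis divide_pos_pos zero_less_numeral)
  then obtain N where N: "\<And>y n t. n \<ge> N y \<Longrightarrow> t \<in> I \<Longrightarrow> norm (J (hs n) t y - y) \<le> e / 3" by metis
  define N0 where "N0 = Max (insert 0 (N ` k))"
  have "norm (J (hs n) t (v t) - v t) \<le> e" if n: "n \<ge> N0" and t: "t \<in> I" for n t
  proof -
    have "v t \<in> (\<Union>y\<in>k. ball y (e / 3))" using k(3) t by blast
    then obtain y where y: "y \<in> k" "norm (y - v t) < e / 3" unfolding UN_iff mem_ball dist_norm by blast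
    have "N y \<le> N0" unfolding N0_def using k(2) y(1) by (intro Max_ge) auto
    then have 1: "norm (J (hs n) t y - y) \<le> e / 3" using N n t by simp
    have hs: "0 < hs n" by (rule hs_pos)
    have 2: "norm (J (hs n) t (y - v t)) \<le> e / 3" using J_props(4)[OF hs t, of "y - v t"] y(2) by simp
    have "J (hs n) t (v t) - v t = (J (hs n) t y - y) - J (hs n) t (y - v t) + (y - v t)"
      using linear_diff[OF bounded_linear.linear[OF J_props(3)[OF hs t]], of y "v t"] by simp
    also have "norm \<dots> \<le> norm (J (hs n) t y - y) + norm (J (hs n) t (y - v t)) + norm (y - v t)"
      by (intro norm_triangle_le add_mono norm_triangle_ineq4 order_refl)
    finally show ?thesis using 1 2 y(2) by simp
  qed
  then show "\<exists>N. \<forall>n\<ge>N. \<forall>t\<in>I. norm (J (hs n) t (v t) - v t) \<le> e" by blast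
qed

end

section \<open>Classical solutions of the linear equation\<close>

context evolution_system
begin

text \<open>Stated for a given inhomogeneity; a nonlinear equation is expressed by letting
  \<open>F\<close> be evaluated along the solution itself.\<close>

definition strict_sol where
  "strict_sol F x \<longleftrightarrow> (\<forall>t\<in>I. M t (x t) \<in> D \<and> (x has_vector_derivative A t (M t (x t)) + F t) (at t within I))"

lemma strict_sol_continuous: "strict_sol F x \<Longrightarrow> continuous_on I x"
  unfolding strict_sol_def by (intro continuous_on_I) blast

lemma strict_sol_bound:
  assumes x: "strict_sol F x" and F: "continuous_on I F" and t: "t \<in> I"
  shows "norm (x t) \<le> c\<^sub>0 * (norm (x 0) + integral {0..t} (\<lambda>s. norm (F s)))"
proof (rule energy_estimate[OF _ _ F t])
  show "(x has_vector_derivative A t (M t (x t)) + F t) (at t within I)" if "t \<in> I" for t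
    using x that by (simp add: strict_sol_def)
  show "inner (M t (x t)) (A t (M t (x t)) + F t - F t) \<le> 0" if "t \<in> I" for t
    using m_dissipativeD(5)[OF A_m_dissipative[OF that], of "M t (x t)"] x that
    by (simp add: strict_sol_def inner_commute)
qed

lemma strict_sol_diff:
  assumes x: "strict_sol F x" and y: "strict_sol G y"
  shows "strict_sol (\<lambda>t. F t - G t) (\<lambda>t. x t - y t)"
  unfolding strict_sol_def
proof
  fix t assume t: "t \<in> I"
  have D: "M t (x t) \<in> D" "M t (y t) \<in> D" using x y t by (auto simp: strict_sol_def)
  have Md: "M t (x t - y t) = M t (x t) - M t (y t)"
    using linear_diff[OF bounded_linear.linear[OF M_lin[OF t]]] by blast
  have "((\<lambda>t. x t - y t) has_vector_derivative (A t (M t (x t)) + F t) - (A t (M t (y t)) + G t)) (at t within I)"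
    using x y t unfolding strict_sol_def by (intro has_vector_derivative_diff) auto
  then have "((\<lambda>t. x t - y t) has_vector_derivative A t (M t (x t - y t)) + (F t - G t)) (at t within I)"
    unfolding Md m_dissipative_diff[OF A_m_dissipative[OF t] D] by (simp add: algebra_simps)
  then show "M t (x t - y t) \<in> D \<and>
      ((\<lambda>t. x t - y t) has_vector_derivative A t (M t (x t - y t)) + (F t - G t)) (at t within I)"
    using subspace_diff[OF D_subspace D] by (simp add: Md)
qed

lemma strict_sol_unique:
  assumes x: "strict_sol F x" and y: "strict_sol F y" and eq: "x 0 = y 0" and t: "t \<in> I"
  shows "x t = y t"
proof -
  have "norm (x t - y t) \<le> c\<^sub>0 * (norm (x 0 - y 0) + integral {0..t} (\<lambda>s. norm (F s - F s)))"
    by (rule strict_sol_bound[OF strict_sol_diff[OF x y] _ t]) simp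
  then show ?thesis by (simp add: eq)
qed

text \<open>The limit of approximate classical solutions is classical, since the generators are closed.\<close>

lemma strict_sol_limit:
  assumes X: "\<And>n t. t \<in> I \<Longrightarrow> (X n has_vector_derivative V n t + F n t) (at t within I)"
    and x: "uniform_limit I X x sequentially" and V: "uniform_limit I V v sequentially"
    and F: "uniform_limit I F f sequentially" and cont: "continuous_on I v" "continuous_on I f"
    and d: "\<And>n t. t \<in> I \<Longrightarrow> d n t \<in> D" "\<And>t. t \<in> I \<Longrightarrow> (\<lambda>n. d n t) \<longlonglongrightarrow> M t (x t)"
      "\<And>n t. t \<in> I \<Longrightarrow> A t (d n t) = V n t"
  shows "strict_sol f x" "\<And>t. t \<in> I \<Longrightarrow> A t (M t (x t)) = v t"
proof -
  have closed: "M t (x t) \<in> D" "A t (M t (x t)) = v t" if t: "t \<in> I" for t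
  proof -
    have "(\<lambda>n. A t (d n t)) \<longlonglongrightarrow> v t" unfolding d(3)[OF t] by (rule tendsto_uniform_limitI[OF V t])
    from m_dissipative_closed[OF A_m_dissipative[OF t] d(1)[OF t] d(2)[OF t] this]
    show "M t (x t) \<in> D" "A t (M t (x t)) = v t" by auto
  qed
  then show "\<And>t. t \<in> I \<Longrightarrow> A t (M t (x t)) = v t" by blast
  have "(x has_vector_derivative v t + f t) (at t within I)" if t: "t \<in> I" for t
  proof (rule uniform_limit_has_vector_derivative[OF X _ _ _ t])
    show "(\<lambda>n. X n t) \<longlonglongrightarrow> x t" if "t \<in> I" for t by (rule tendsto_uniform_limitI[OF x that])
    show "uniform_limit I (\<lambda>n t. V n t + F n t) (\<lambda>t. v t + f t) sequentially"
      by (intro uniform_limit_intros V F)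
  qed (assumption | intro continuous_on_add cont)+
  then show "strict_sol f x" unfolding strict_sol_def using closed by auto
qed

lemma Q_uniform_limit:
  assumes x: "uniform_limit I X x sequentially"
  shows "uniform_limit I (\<lambda>n t. Q t (X n t)) (\<lambda>t. Q t (x t)) sequentially"
proof (rule uniform_limit_combine)
  fix e :: real assume e: "0 < e"
  have e': "0 < e / (q + 1)" using e q_nonneg by simp
  obtain N where N: "\<And>n t. n \<ge> N \<Longrightarrow> t \<in> I \<Longrightarrow> norm (X n t - x t) \<le> e / (q + 1)"
    using uniform_limitE[OF x e'] by blast
  have "norm (Q t (X n t) - Q t (x t)) \<le> e" if "n \<ge> N" and t: "t \<in> I" for n t
  proof -
    have "norm (Q t (X n t) - Q t (x t)) \<le> q * norm (X n t - x t)"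
      using Q_norm[OF t, of "X n t - x t"] linear_diff[OF bounded_linear.linear[OF Q_lin[OF t]]] by metis
    also have "\<dots> \<le> (q + 1) * (e / (q + 1))" using N[OF that] q_nonneg by (intro mult_mono) auto
    finally show ?thesis using q_nonneg by simp
  qed
  then show "\<exists>N. \<forall>n\<ge>N. \<forall>t\<in>I. norm (Q t (X n t) - Q t (x t)) \<le> e" by blast
qed

text \<open>The limit of the modified derivatives is identified before convergence is known:
  \<open>w\<close> is the fixed point of mild solutions for the limiting equation, in which the
  already constructed \<open>x\<close> is inserted. Gronwall then compares the modified derivatives
  with the regularized solutions \<open>W n\<close> that tend to \<open>w\<close>. Uniform
  convergence of \<open>A\<close> on the resolvents follows by subtracting \<open>F\<close> and
  \<open>Q x\<close>.\<close>

lemma classical_solution_C1_rhs: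
  assumes F': "\<And>t. t \<in> I \<Longrightarrow> (F has_vector_derivative F' t) (at t within I)" and F'c: "continuous_on I F'"
    and x0: "M 0 x0 \<in> D"
  shows "\<exists>x. x 0 = x0 \<and> strict_sol F x \<and> continuous_on I (\<lambda>t. A t (M t (x t))) \<and>
    (\<forall>t\<in>I. \<forall>b. (\<forall>s\<in>{0..t}. norm (F s) \<le> b) \<longrightarrow>
       norm (A t (M t (x t)) + F t + Q t (x t)) \<le>
         c\<^sub>d * (norm x0 + norm (A 0 (M 0 x0)) + b + integral {0..t} (\<lambda>s. norm (F' s))))"
proof -
  have Fc: "continuous_on I F" by (rule continuous_on_I) (rule F')
  have hs: "0 < hs n" for n by (rule hs_pos)
  have "\<exists>z. z 0 = x0 \<and> yosida_sol (hs n) F z" for n by (rule yosida_sol_exists[OF hs Fc])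
  then obtain X where X: "\<And>n. X n 0 = x0" "\<And>n. yosida_sol (hs n) F (X n)" by metis
  obtain x where x: "uniform_limit I X x sequentially"
    using yosida_sol_Cauchy[OF Fc X(2,1)] Cauchy_uniformly_convergent uniformly_convergent_on_def by blast
  have Xc: "continuous_on I (X n)" for n by (rule yosida_sol_continuous[OF X(2)])
  have xc: "continuous_on I x"
    by (rule uniform_limit_theorem[OF _ x]) (auto intro!: always_eventually Xc)
  define w0 where "w0 = A 0 (M 0 x0) + F 0 + Q 0 x0"
  define p where "p v t = M t (x t) - v t + Q t (x t) + F t" for v t
  \<comment> \<open>Formal limit of \<open>yderiv_rhs\<close> for vanishing step: resolvents are
    replaced by the identity, the solution by \<open>x\<close>, and the modified derivative by the
    unknown \<open>v\<close>.\<close>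
  define Gs where "Gs v t = K t (p v t) + Q' t (x t) + Q t (v t - Q t (x t)) + F' t" for v t
  have Gsc: "continuous_on I (Gs v)" if "continuous_on I v" for v
    unfolding Gs_def[abs_def] p_def
    by (intro continuous_intros continuous_on_operators Q'_continuous_on xc Fc F'c that)
  have Gs_diff: "norm (Gs v t - Gs u t) \<le> a\<^sub>2 * norm (v t - u t)" if t: "t \<in> I" for u v t
  proof -
    have "Gs v t - Gs u t = - K t (v t - u t) + Q t (v t - u t)"
      unfolding Gs_def p_def
      by (simp add: linear_add[OF bounded_linear.linear[OF K_lin[OF t]]] linear_diff[OF bounded_linear.linear[OF K_lin[OF t]]]
          linear_diff[OF bounded_linear.linear[OF Q_lin[OF t]]])
    also have "norm \<dots> \<le> norm (K t (v t - u t)) + norm (Q t (v t - u t))"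
      using norm_triangle_ineq[of "- K t (v t - u t)" "Q t (v t - u t)"] by simp
    also have "\<dots> \<le> 3 * \<kappa> * norm (v t - u t) + q * norm (v t - u t)"
      by (intro add_mono K_norm[OF t] Q_norm[OF t])
    finally show ?thesis by (simp add: a\<^sub>2_def distrib_right)
  qed
  define \<Phi> where "\<Phi> v = (SOME y. mild w0 (Gs v) y)" for v
  have \<Phi>: "mild w0 (Gs v) (\<Phi> v)" if "continuous_on I v" for v
    unfolding \<Phi>_def by (rule someI_ex[OF mild_exists[OF Gsc[OF that]]])
  have "\<exists>w. continuous_on I w \<and> (\<forall>t\<in>I. \<Phi> w t = w t)"
  proof (rule volterra_fixpoint[where c="c\<^sub>0 * a\<^sub>2"])
    show "continuous_on I (\<Phi> v)" if "continuous_on I v" for v by (rule mild_continuous[OF \<Phi>[OF that]])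
    fix u v :: "real \<Rightarrow> 'x" and t assume uv: "continuous_on I u" "continuous_on I v" and t: "t \<in> I"
    have "norm (\<Phi> u t - \<Phi> v t) \<le> c\<^sub>0 * (norm (w0 - w0) + integral {0..t} (\<lambda>s. norm (Gs u s - Gs v s)))"
      by (rule mild_diff_bound[OF \<Phi>[OF uv(1)] \<Phi>[OF uv(2)] Gsc[OF uv(1)] Gsc[OF uv(2)] t])
    also have "integral {0..t} (\<lambda>s. norm (Gs u s - Gs v s)) \<le> integral {0..t} (\<lambda>s. a\<^sub>2 * norm (u s - v s))"
    proof (rule integral_le)
      show "norm (Gs u s - Gs v s) \<le> a\<^sub>2 * norm (u s - v s)" if "s \<in> {0..t}" for s
        using Gs_diff[of s u v] that t by auto
    qed (use t in \<open>intro integrable_continuous_interval continuous_intros continuous_on_subset[OF Gsc[OF uv(1)]]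
        continuous_on_subset[OF Gsc[OF uv(2)]] continuous_on_subset[OF uv(1)] continuous_on_subset[OF uv(2)]; auto\<close>)+
    finally show "norm (\<Phi> u t - \<Phi> v t) \<le> c\<^sub>0 * a\<^sub>2 * integral {0..t} (\<lambda>s. norm (u s - v s))"
      using c0_ge by simp
  qed (use c0_ge a_nonneg in auto)
  then obtain w where wc: "continuous_on I w" and w: "\<And>t. t \<in> I \<Longrightarrow> \<Phi> w t = w t" by blast
  obtain W where W: "\<And>n. yosida_sol (hs n) (Gs w) (W n)" "\<And>n. W n 0 = w0" "uniform_limit I W (\<Phi> w) sequentially"
    using \<Phi>[OF wc] unfolding mild_def by blast
  have Wlim: "uniform_limit I W w sequentially"
    using W(3) uniform_limit_cong'[of I W W "\<Phi> w" w sequentially] w by simp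
  define Y\<^sub>d where "Y\<^sub>d n = yderiv (hs n) F (X n)" for n
  have Ydc: "continuous_on I (Y\<^sub>d n)" for n unfolding Y\<^sub>d_def by (rule yderiv_continuous[OF hs Fc Xc])
  have Yd_yosida_sol: "yosida_sol (hs n) (yderiv_rhs (hs n) F F' (X n)) (Y\<^sub>d n)" for n
    unfolding Y\<^sub>d_def by (rule yderiv_yosida_sol[OF hs X(2) F'])
  have rhsc: "continuous_on I (yderiv_rhs (hs n) F F' (X n))" for n
    by (rule yderiv_rhs_continuous[OF hs Fc F'c Xc])
  \<comment> \<open>Independent of \<open>n\<close>. The resolvent in front of \<open>K\<close>
    tends to the identity only strongly, so its error has to be measured on a fixed continuous
    function.\<close>
  define U where "U t = K t (p w t)" for t
  have Uc: "continuous_on I U"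
    unfolding U_def[abs_def] p_def by (intro continuous_intros continuous_on_operators xc Fc wc)
  have Mxc: "continuous_on I (\<lambda>t. M t (x t))" by (intro continuous_on_operators xc)
  \<comment> \<open>All terms but the last tend to \<open>0\<close> uniformly; the last one, with
    factor \<open>a\<^sub>2\<close>, is absorbed by Gronwall.\<close>
  have rhs_diff: "norm (yderiv_rhs (hs n) F F' (X n) t - Gs w t) \<le>
      (3 * \<kappa> * ((m\<^sub>2 + q) * norm (X n t - x t) + norm (J (hs n) t (M t (x t)) - M t (x t))) + norm (J (hs n) t (U t) - U t)
        + (q + q * q) * norm (X n t - x t)) + a\<^sub>2 * norm (Y\<^sub>d n t - w t)" if t: "t \<in> I" for n t
  proof -
    interpret Jl: bounded_linear "J (hs n) t" by (rule J_props(3)[OF hs t])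
    interpret Kl: bounded_linear "K t" by (rule K_lin[OF t])
    interpret Ml: bounded_linear "M t" by (rule M_lin[OF t])
    interpret Ql: bounded_linear "Q t" by (rule Q_lin[OF t])
    interpret Q'l: bounded_linear "Q' t" by (rule Q'_lin[OF t])
    define dx where "dx = X n t - x t"
    define dw where "dw = Y\<^sub>d n t - w t"
    define r where "r = J (hs n) t (M t dx) + (J (hs n) t (M t (x t)) - M t (x t)) - dw + Q t dx"
    have diff: "yderiv_rhs (hs n) F F' (X n) t - Gs w t =
        J (hs n) t (K t r) + (J (hs n) t (U t) - U t) + Q' t dx + Q t (dw - Q t dx)"
    proof -
      have eq: "J (hs n) t (M t (X n t)) - yderiv (hs n) F (X n) t + Q t (X n t) + F t = r + p w t"
        by (simp add: r_def p_def dx_def dw_def Y\<^sub>d_def Ml.diff Jl.diff Ql.diff)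
      show ?thesis
        unfolding yderiv_rhs_def eq
        by (simp add: Gs_def U_def dx_def dw_def Y\<^sub>d_def Kl.add Jl.add Q'l.diff Ql.diff)
    qed
    have "norm (yderiv_rhs (hs n) F F' (X n) t - Gs w t) \<le>
        norm (J (hs n) t (K t r)) + norm (J (hs n) t (U t) - U t) + norm (Q' t dx) + norm (Q t (dw - Q t dx))"
      unfolding diff using norm_triangle_ineq[of "J (hs n) t (K t r) + (J (hs n) t (U t) - U t) + Q' t dx" "Q t (dw - Q t dx)"]
        norm_triangle_ineq[of "J (hs n) t (K t r) + (J (hs n) t (U t) - U t)" "Q' t dx"]
        norm_triangle_ineq[of "J (hs n) t (K t r)" "J (hs n) t (U t) - U t"] by linarith
    also have "\<dots> \<le> 3 * \<kappa> * (m\<^sub>2 * norm dx + norm (J (hs n) t (M t (x t)) - M t (x t)) + norm dw + q * norm dx)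
        + norm (J (hs n) t (U t) - U t) + q * norm dx + q * (norm dw + q * norm dx)"
    proof -
      have "norm r \<le> norm (J (hs n) t (M t dx)) + norm (J (hs n) t (M t (x t)) - M t (x t)) + norm dw + norm (Q t dx)"
        unfolding r_def
        using norm_triangle_ineq[of "J (hs n) t (M t dx) + (J (hs n) t (M t (x t)) - M t (x t)) - dw" "Q t dx"]
          norm_triangle_ineq4[of "J (hs n) t (M t dx) + (J (hs n) t (M t (x t)) - M t (x t))" dw]
          norm_triangle_ineq[of "J (hs n) t (M t dx)" "J (hs n) t (M t (x t)) - M t (x t)"] by linarith
      moreover have "norm (J (hs n) t (M t dx)) \<le> m\<^sub>2 * norm dx"
        using J_props(4)[OF hs[of n] t, of "M t dx"] M_norm[OF t, of dx] by linarith
      ultimately have r: "norm r \<le> m\<^sub>2 * norm dx + norm (J (hs n) t (M t (x t)) - M t (x t)) + norm dw + q * norm dx"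
        using Q_norm[OF t, of dx] by linarith
      have "norm (J (hs n) t (K t r)) \<le> 3 * \<kappa> * norm r"
        using J_props(4)[OF hs[of n] t, of "K t r"] K_norm[OF t, of r] by linarith
      moreover have "3 * \<kappa> * norm r \<le> 3 * \<kappa> * (m\<^sub>2 * norm dx + norm (J (hs n) t (M t (x t)) - M t (x t)) + norm dw + q * norm dx)"
        using \<kappa> by (intro mult_left_mono[OF r]) simp
      moreover have "norm (dw - Q t dx) \<le> norm dw + q * norm dx"
        using norm_triangle_ineq4[of dw "Q t dx"] Q_norm[OF t, of dx] by simp
      then have "norm (Q t (dw - Q t dx)) \<le> q * (norm dw + q * norm dx)"
        by (rule order_trans[OF Q_norm[OF t] mult_left_mono[OF _ q_nonneg]])
      ultimately show ?thesis using Q'_norm[OF t, of dx] by linarith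
    qed
    finally show ?thesis by (simp add: dx_def dw_def a\<^sub>2_def algebra_simps)
  qed
  have Wd: "uniform_limit I Y\<^sub>d w sequentially"
  proof (rule uniform_limit_combine)
    fix e :: real assume e: "0 < e"
    \<comment> \<open>The sum of the coefficients with which the uniformly small terms of
      \<open>rhs_diff\<close> occur.\<close>
    define L where "L = 3 * \<kappa> * (m\<^sub>2 + q + 1) + 1 + (q + q * q)"
    have L: "1 \<le> L" using \<kappa> m q_nonneg by (simp add: L_def)
    define C where "C = c\<^sub>0 * (1 + T * (L + a\<^sub>2)) * exp (c\<^sub>0 * a\<^sub>2 * T)"
    have C: "0 \<le> C" using c0_ge T L a_nonneg by (simp add: C_def)
    define \<epsilon> where "\<epsilon> = e / (C + 1)"
    have \<epsilon>: "0 < \<epsilon>" using e C by (simp add: \<epsilon>_def)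
    obtain N1 where N1: "\<And>n t. n \<ge> N1 \<Longrightarrow> t \<in> I \<Longrightarrow> norm (X n t - x t) \<le> \<epsilon>" using uniform_limitE[OF x \<epsilon>] by blast
    obtain N2 where N2: "\<And>n t. n \<ge> N2 \<Longrightarrow> t \<in> I \<Longrightarrow> norm (W n t - w t) \<le> \<epsilon>" using uniform_limitE[OF Wlim \<epsilon>] by blast
    obtain N3 where N3: "\<And>n t. n \<ge> N3 \<Longrightarrow> t \<in> I \<Longrightarrow> norm (J (hs n) t (M t (x t)) - M t (x t)) \<le> \<epsilon>"
      using uniform_limitE[OF J_uniform_limit[OF Mxc] \<epsilon>] by blast
    obtain N4 where N4: "\<And>n t. n \<ge> N4 \<Longrightarrow> t \<in> I \<Longrightarrow> norm (J (hs n) t (U t) - U t) \<le> \<epsilon>"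
      using uniform_limitE[OF J_uniform_limit[OF Uc] \<epsilon>] by blast
    obtain N5 where N5: "\<And>n t. n \<ge> N5 \<Longrightarrow> t \<in> I \<Longrightarrow> norm (J (hs n) t (A 0 (M 0 x0)) - A 0 (M 0 x0)) \<le> \<epsilon>"
      using uniform_limitE[OF J_uniform_limit_const \<epsilon>] by blast
    define N where "N = Max {N1, N2, N3, N4, N5}"
    have "norm (Y\<^sub>d n t - w t) \<le> e" if n: "n \<ge> N" and t: "t \<in> I" for n t
    proof -
      have n5: "n \<ge> N1" "n \<ge> N2" "n \<ge> N3" "n \<ge> N4" "n \<ge> N5" using n by (auto simp: N_def)
      \<comment> \<open>Since \<open>M 0 x0\<close> is in \<open>D\<close>, the Yosida term at time
        \<open>0\<close> equals \<open>J (hs n) 0 (A 0 (M 0 x0))\<close>, which tends to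
        \<open>A 0 (M 0 x0)\<close>.\<close>
      have init: "norm (Y\<^sub>d n 0 - W n 0) \<le> \<epsilon>"
        using N5[OF n5(5) I_0] Y_props(4)[OF hs I_0 x0] by (simp add: Y\<^sub>d_def yderiv_def W(2) w0_def X(1))
      define \<phi> where "\<phi> t = norm (Y\<^sub>d n t - W n t)" for t
      have \<phi>c: "continuous_on I \<phi>"
        unfolding \<phi>_def[abs_def] by (intro continuous_intros Ydc yosida_sol_continuous[OF W(1)])
      have bound: "norm (yderiv_rhs (hs n) F F' (X n) s - Gs w s) \<le> (L + a\<^sub>2) * \<epsilon> + a\<^sub>2 * \<phi> s" if s: "s \<in> I" for s
      proof -
        have "norm (Y\<^sub>d n s - w s) \<le> \<phi> s + \<epsilon>"
          using norm_triangle_ineq[of "Y\<^sub>d n s - W n s" "W n s - w s"] N2[OF n5(2) s] by (simp add: \<phi>_def)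
        then have "norm (yderiv_rhs (hs n) F F' (X n) s - Gs w s) \<le>
            (3 * \<kappa> * ((m\<^sub>2 + q) * \<epsilon> + \<epsilon>) + \<epsilon> + (q + q * q) * \<epsilon>) + a\<^sub>2 * (\<phi> s + \<epsilon>)"
          using \<kappa> m q_nonneg a_nonneg N1[OF n5(1) s] N3[OF n5(3) s] N4[OF n5(4) s]
          by (intro order_trans[OF rhs_diff[OF s]] add_mono mult_left_mono) auto
        then show ?thesis by (simp add: L_def algebra_simps)
      qed
      have "\<phi> u \<le> c\<^sub>0 * (1 + T * (L + a\<^sub>2)) * \<epsilon> + (c\<^sub>0 * a\<^sub>2) * integral {0..u} \<phi>" if u: "u \<in> I" for u
      proof -
        have sub: "{0..u} \<subseteq> I" using u by auto
        have c: "continuous_on I (\<lambda>s. yderiv_rhs (hs n) F F' (X n) s - Gs w s)"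
          by (intro continuous_intros rhsc Gsc wc)
        have "\<phi> u \<le> c\<^sub>0 * (norm (Y\<^sub>d n 0 - W n 0) + integral {0..u} (\<lambda>s. norm (yderiv_rhs (hs n) F F' (X n) s - Gs w s)))"
          unfolding \<phi>_def by (rule yosida_sol_bound[OF hs yosida_sol_diff[OF hs Yd_yosida_sol W(1)] c u])
        also have "integral {0..u} (\<lambda>s. norm (yderiv_rhs (hs n) F F' (X n) s - Gs w s)) \<le>
            integral {0..u} (\<lambda>s. (L + a\<^sub>2) * \<epsilon> + a\<^sub>2 * \<phi> s)"
        proof (rule integral_le)
          show "norm (yderiv_rhs (hs n) F F' (X n) s - Gs w s) \<le> (L + a\<^sub>2) * \<epsilon> + a\<^sub>2 * \<phi> s" if "s \<in> {0..u}" for s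
            using bound that sub by blast
        qed (intro integrable_continuous_interval continuous_intros continuous_on_subset[OF c sub] continuous_on_subset[OF \<phi>c sub])+
        also have "\<dots> = u * ((L + a\<^sub>2) * \<epsilon>) + a\<^sub>2 * integral {0..u} \<phi>"
        proof (rule integral_unique)
          have "((\<lambda>s. (L + a\<^sub>2) * \<epsilon>) has_integral u * ((L + a\<^sub>2) * \<epsilon>)) {0..u}"
            using has_integral_const_real[of "(L + a\<^sub>2) * \<epsilon>" 0 u] u by simp
          moreover have "(\<phi> has_integral integral {0..u} \<phi>) {0..u}"
            by (intro integrable_integral integrable_continuous_interval continuous_on_subset[OF \<phi>c sub])
          ultimately show "((\<lambda>s. (L + a\<^sub>2) * \<epsilon> + a\<^sub>2 * \<phi> s) has_integral
              u * ((L + a\<^sub>2) * \<epsilon>) + a\<^sub>2 * integral {0..u} \<phi>) {0..u}"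
            by (intro has_integral_add has_integral_mult_right)
        qed
        finally have "\<phi> u \<le> c\<^sub>0 * (norm (Y\<^sub>d n 0 - W n 0) + (u * ((L + a\<^sub>2) * \<epsilon>) + a\<^sub>2 * integral {0..u} \<phi>))"
          using c0_ge by simp
        also have "\<dots> \<le> c\<^sub>0 * (\<epsilon> + (T * ((L + a\<^sub>2) * \<epsilon>) + a\<^sub>2 * integral {0..u} \<phi>))"
          using c0_ge init u L a_nonneg \<epsilon> by (intro mult_left_mono add_mono mult_right_mono order_refl) auto
        also have "\<dots> = c\<^sub>0 * (1 + T * (L + a\<^sub>2)) * \<epsilon> + (c\<^sub>0 * a\<^sub>2) * integral {0..u} \<phi>" by (simp add: algebra_simps)
        finally show ?thesis .
      qed
      then have "\<phi> t \<le> c\<^sub>0 * (1 + T * (L + a\<^sub>2)) * \<epsilon> * exp (c\<^sub>0 * a\<^sub>2 * t)"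
        using t c0_ge a_nonneg by (intro gronwall[OF \<phi>c]) auto
      also have "\<dots> \<le> c\<^sub>0 * (1 + T * (L + a\<^sub>2)) * \<epsilon> * exp (c\<^sub>0 * a\<^sub>2 * T)"
        using t c0_ge a_nonneg T L \<epsilon> by (intro mult_left_mono) (auto simp: mult_left_mono)
      also have "\<dots> = C * \<epsilon>" by (simp add: C_def)
      finally have "norm (Y\<^sub>d n t - w t) \<le> C * \<epsilon> + \<epsilon>"
        using norm_triangle_ineq[of "Y\<^sub>d n t - W n t" "W n t - w t"] N2[OF n5(2) t] by (simp add: \<phi>_def)
      also have "\<dots> = (C + 1) * \<epsilon>" by (simp add: algebra_simps)
      also have "\<dots> = e" using C by (simp add: \<epsilon>_def)
      finally show ?thesis .
    qed
    then show "\<exists>N. \<forall>n\<ge>N. \<forall>t\<in>I. norm (Y\<^sub>d n t - w t) \<le> e" by blast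
  qed
  define V where "V n t = Y (hs n) t (M t (X n t))" for n t
  define v where "v t = w t - F t - Q t (x t)" for t
  have V_eq: "V = (\<lambda>n t. Y\<^sub>d n t - F t - Q t (X n t))" by (intro ext) (simp add: V_def Y\<^sub>d_def yderiv_def)
  have Vlim: "uniform_limit I V v sequentially"
    unfolding V_eq v_def by (intro uniform_limit_intros Wd Q_uniform_limit[OF x])
  have vc: "continuous_on I v" unfolding v_def by (intro continuous_intros continuous_on_operators wc Fc xc)
  have JM: "(\<lambda>n. J (hs n) t (M t (X n t))) \<longlonglongrightarrow> M t (x t)" if t: "t \<in> I" for t
  proof -
    have "(\<lambda>n. J (hs n) t (M t (x t))) \<longlonglongrightarrow> M t (x t)"
      using tendsto_uniform_limitI[OF J_uniform_limit_const t] .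
    moreover have "(\<lambda>n. J (hs n) t (M t (X n t - x t))) \<longlonglongrightarrow> 0"
    proof (rule Lim_null_comparison)
      show "\<forall>\<^sub>F n in sequentially. norm (J (hs n) t (M t (X n t - x t))) \<le> m\<^sub>2 * norm (X n t - x t)"
        using order_trans[OF J_props(4)[OF hs t] M_norm[OF t]] by (intro always_eventually) blast
      show "(\<lambda>n. m\<^sub>2 * norm (X n t - x t)) \<longlonglongrightarrow> 0"
        using tendsto_uniform_limitI[OF x t] by (intro tendsto_mult_right_zero tendsto_norm_zero LIM_zero)
    qed
    ultimately have "(\<lambda>n. J (hs n) t (M t (x t)) + J (hs n) t (M t (X n t - x t))) \<longlonglongrightarrow> M t (x t) + 0"
      by (rule tendsto_add)
    then show ?thesis
      using linear_diff[OF bounded_linear.linear[OF J_props(3)[OF hs t]]] linear_diff[OF bounded_linear.linear[OF M_lin[OF t]]]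
      by simp
  qed
  have Xd: "(X n has_vector_derivative V n t + F t) (at t within I)" if "t \<in> I" for n t
    using X(2) that unfolding yosida_sol_def V_def by blast
  have Flim: "uniform_limit I (\<lambda>_. F) F sequentially" by (rule uniform_limit_const)
  have JD: "J (hs n) t (M t (X n t)) \<in> D" if "t \<in> I" for n t by (rule J_props(1)[OF hs that])
  have JV: "A t (J (hs n) t (M t (X n t))) = V n t" if "t \<in> I" for n t
    using J_props(6)[OF hs that] by (simp add: V_def)
  have "strict_sol F x" by (rule strict_sol_limit(1)[OF Xd x Vlim Flim vc Fc JD JM JV])
  moreover have AM: "A t (M t (x t)) = v t" if "t \<in> I" for t
    by (rule strict_sol_limit(2)[OF Xd x Vlim Flim vc Fc JD JM JV that])
  moreover have "continuous_on I (\<lambda>t. A t (M t (x t)))" by (rule continuous_on_eq[OF vc]) (simp add: AM)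
  moreover have "x 0 = x0"
    using tendsto_uniform_limitI[OF x I_0] unfolding X(1) by (simp add: LIMSEQ_const_iff)
  moreover have "norm (A t (M t (x t)) + F t + Q t (x t)) \<le>
      c\<^sub>d * (norm x0 + norm (A 0 (M 0 x0)) + b + integral {0..t} (\<lambda>s. norm (F' s)))"
    if t: "t \<in> I" and b: "\<forall>s\<in>{0..t}. norm (F s) \<le> b" for t b
  proof -
    have "norm (Y\<^sub>d n t) \<le> c\<^sub>d * (norm x0 + norm (A 0 (M 0 x0)) + b + integral {0..t} (\<lambda>s. norm (F' s)))" for n
      using yderiv_bound[OF hs X(2) F' F'c _ t, of n b] x0 b by (simp add: Y\<^sub>d_def X(1))
    then have "norm (w t) \<le> c\<^sub>d * (norm x0 + norm (A 0 (M 0 x0)) + b + integral {0..t} (\<lambda>s. norm (F' s)))"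
      by (intro LIMSEQ_le_const2[OF tendsto_norm[OF tendsto_uniform_limitI[OF Wd t]]]) auto
    then show ?thesis by (simp add: AM[OF t] v_def)
  qed
  ultimately show ?thesis by blast
qed

text \<open>Differences of the solutions for the \<open>C^1\<close> approximants are solutions with
  initial value \<open>0\<close>, so their modified derivatives are bounded by the supremum of
  \<open>G m - G n\<close> and the \<open>L^1\<close> norm of \<open>G' m - G' n\<close>. Both are
  small, hence the modified derivatives converge uniformly. The pointwise bound of
  \<open>G' n\<close> by \<open>l\<close> survives as the integral of \<open>l\<close>.\<close>

lemma classical_solution_lipschitz_rhs:
  assumes l: "mono_on I l" "continuous_on I l" "\<And>t. t \<in> I \<Longrightarrow> 0 \<le> l t"
    and F: "\<And>s t. 0 \<le> s \<Longrightarrow> s \<le> t \<Longrightarrow> t \<le> T \<Longrightarrow> norm (F t - F s) \<le> l t * (t - s)"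
    and Fc: "continuous_on I F" and x0: "M 0 x0 \<in> D"
  shows "\<exists>x. x 0 = x0 \<and> strict_sol F x \<and> continuous_on I (\<lambda>t. A t (M t (x t))) \<and>
    (\<forall>t\<in>I. \<forall>b. (\<forall>s\<in>{0..t}. norm (F s) \<le> b) \<longrightarrow>
       norm (A t (M t (x t)) + F t + Q t (x t)) \<le>
         c\<^sub>d * (norm x0 + norm (A 0 (M 0 x0)) + b + integral {0..t} l))"
proof -
  have "\<exists>G G'. (\<forall>n. \<forall>t\<in>I. (G n has_vector_derivative G' n t) (at t within I)) \<and>
      (\<forall>n. continuous_on I (G' n)) \<and> (\<forall>n. \<forall>t\<in>I. norm (G' n t) \<le> l t) \<and>
      (\<forall>n. \<forall>t\<in>I. norm (G n t - F t) \<le> 1 / Suc n) \<and>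
      (\<forall>e>0. \<exists>N. \<forall>m\<ge>N. \<forall>n\<ge>N. integral I (\<lambda>t. norm (G' m t - G' n t)) < e)"
    by (rule lipschitz_C1_approximation[OF T l(1,3) F])
  then obtain G G' where GG': "\<forall>n. \<forall>t\<in>I. (G n has_vector_derivative G' n t) (at t within I)"
    "\<forall>n. continuous_on I (G' n)" "\<forall>n. \<forall>t\<in>I. norm (G' n t) \<le> l t"
    "\<forall>n. \<forall>t\<in>I. norm (G n t - F t) \<le> 1 / Suc n"
    "\<forall>e>0. \<exists>N. \<forall>m\<ge>N. \<forall>n\<ge>N. integral I (\<lambda>t. norm (G' m t - G' n t)) < e"
    by (elim exE conjE) (rule that; assumption)
  note G' = GG'(1)[rule_format] and G'c = GG'(2)[rule_format] and G'l = GG'(3)[rule_format]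
    and GF = GG'(4)[rule_format] and L1 = GG'(5)[rule_format]
  have Gc: "continuous_on I (G n)" for n by (rule continuous_on_I) (rule G')
  define P where "P n x \<longleftrightarrow> x 0 = x0 \<and> strict_sol (G n) x \<and> continuous_on I (\<lambda>t. A t (M t (x t))) \<and>
    (\<forall>t\<in>I. \<forall>b. (\<forall>s\<in>{0..t}. norm (G n s) \<le> b) \<longrightarrow>
       norm (A t (M t (x t)) + G n t + Q t (x t)) \<le>
         c\<^sub>d * (norm x0 + norm (A 0 (M 0 x0)) + b + integral {0..t} (\<lambda>s. norm (G' n s))))" for n x
  have "\<exists>x. P n x" for n
    unfolding P_def by (rule classical_solution_C1_rhs[OF G' G'c x0])
  then obtain X where "\<And>n. P n (X n)" by metis
  then have X0: "\<And>n. X n 0 = x0" and X: "\<And>n. strict_sol (G n) (X n)"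
    and Xb: "\<And>n t b. t \<in> I \<Longrightarrow> \<forall>s\<in>{0..t}. norm (G n s) \<le> b \<Longrightarrow> norm (A t (M t (X n t)) + G n t + Q t (X n t)) \<le>
         c\<^sub>d * (norm x0 + norm (A 0 (M 0 x0)) + b + integral {0..t} (\<lambda>s. norm (G' n s)))"
    and AXc: "\<And>n. continuous_on I (\<lambda>t. A t (M t (X n t)))" unfolding P_def by blast+
  define W where "W n t = A t (M t (X n t)) + G n t + Q t (X n t)" for n t
  have Xc: "continuous_on I (X n)" for n by (rule strict_sol_continuous[OF X])
  have Wc: "continuous_on I (W n)" for n
    unfolding W_def[abs_def] by (intro continuous_intros continuous_on_operators AXc Gc Xc)
  have GG: "norm (G m t - G n t) \<le> 1 / Suc m + 1 / Suc n" if "t \<in> I" for m n t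
    using norm_triangle_ineq4[of "G m t - F t" "G n t - F t"] GF[OF that, of m] GF[OF that, of n] by simp
  have M0: "M 0 0 = 0" using M_lin[OF I_0] by (simp add: linear_simps)
  have A0: "A 0 0 = 0" using m_dissipativeD(4)[OF A_m_dissipative[OF I_0] subspace_0[OF D_subspace], of 0] by simp
  have diffW: "norm (W m t - W n t) \<le> c\<^sub>d * ((1 / Suc m + 1 / Suc n) + integral I (\<lambda>s. norm (G' m s - G' n s)))"
    and diffX: "norm (X m t - X n t) \<le> c\<^sub>0 * (T * (1 / Suc m + 1 / Suc n))" if t: "t \<in> I" for m n t
  proof -
    define H where "H t = G m t - G n t" for t
    define H' where "H' t = G' m t - G' n t" for t
    have H': "(H has_vector_derivative H' t) (at t within I)" if "t \<in> I" for t
      unfolding H_def[abs_def] H'_def by (intro has_vector_derivative_diff G' that)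
    have H'c: "continuous_on I H'" unfolding H'_def[abs_def] by (intro continuous_intros G'c)
    have Hc: "continuous_on I H" unfolding H_def[abs_def] by (intro continuous_intros Gc)
    have GH: "norm (H s) \<le> 1 / Suc m + 1 / Suc n" if "s \<in> I" for s unfolding H_def by (rule GG[OF that])
    have dX: "strict_sol H (\<lambda>t. X m t - X n t)" unfolding H_def[abs_def] by (rule strict_sol_diff[OF X X])
    have "M 0 0 \<in> D" using subspace_0[OF D_subspace] by (simp add: M0)
    \<comment> \<open>The bound comes with some solution for \<open>H\<close>; uniqueness identifies
      it with \<open>X m - X n\<close>.\<close>
    from classical_solution_C1_rhs[OF H' H'c this] obtain z where z: "z 0 = 0" "strict_sol H z"
      and zb: "\<And>t b. t \<in> I \<Longrightarrow> \<forall>s\<in>{0..t}. norm (H s) \<le> b \<Longrightarrow> norm (A t (M t (z t)) + H t + Q t (z t)) \<le>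
         c\<^sub>d * (norm (0::'x) + norm (A 0 (M 0 0)) + b + integral {0..t} (\<lambda>s. norm (H' s)))" by blast
    have zX: "z t = X m t - X n t" by (rule strict_sol_unique[OF z(2) dX _ t]) (simp add: z(1) X0)
    have DX: "M t (X m t) \<in> D" "M t (X n t) \<in> D" using X t by (auto simp: strict_sol_def)
    have "W m t - W n t = A t (M t (z t)) + H t + Q t (z t)"
      unfolding zX W_def H_def linear_diff[OF bounded_linear.linear[OF M_lin[OF t]]]
        m_dissipative_diff[OF A_m_dissipative[OF t] DX] linear_diff[OF bounded_linear.linear[OF Q_lin[OF t]]] by simp
    then have "norm (W m t - W n t) \<le>
        c\<^sub>d * (norm (0::'x) + norm (A 0 (M 0 0)) + (1 / Suc m + 1 / Suc n) + integral {0..t} (\<lambda>s. norm (H' s)))"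
      using zb[OF t, of "1 / Suc m + 1 / Suc n"] GG t by (auto simp: H_def)
    also have "\<dots> \<le> c\<^sub>d * ((1 / Suc m + 1 / Suc n) + integral I (\<lambda>s. norm (H' s)))"
      using cd_nonneg t unfolding M0 A0
      by (intro mult_left_mono) (auto intro!: integral_subset_le integrable_continuous_interval
          continuous_intros continuous_on_subset[OF H'c])
    finally show "norm (W m t - W n t) \<le> c\<^sub>d * ((1 / Suc m + 1 / Suc n) + integral I (\<lambda>s. norm (G' m s - G' n s)))"
      by (simp add: H'_def)
    have "norm (X m t - X n t) \<le> c\<^sub>0 * (norm (X m 0 - X n 0) + integral {0..t} (\<lambda>s. norm (H s)))"
      by (rule strict_sol_bound[OF dX Hc t])
    also have "\<dots> \<le> c\<^sub>0 * (0 + T * (1 / Suc m + 1 / Suc n))"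
      using c0_ge by (intro mult_left_mono add_mono integral_norm_le_const[OF Hc GH t]) (auto simp: X0)
    finally show "norm (X m t - X n t) \<le> c\<^sub>0 * (T * (1 / Suc m + 1 / Suc n))" by simp
  qed
  have small: "\<exists>N. \<forall>n\<ge>N. 1 / real (Suc n) \<le> e" if e: "0 < e" for e :: real
  proof -
    obtain N where "inverse (real (Suc N)) < e" using reals_Archimedean[OF e] by blast
    then have N: "1 / real (Suc N) \<le> e" by (simp add: divide_inverse)
    have "1 / real (Suc n) \<le> e" if "n \<ge> N" for n
      by (rule order_trans[OF _ N]) (use that in \<open>simp add: frac_le\<close>)
    then show ?thesis by blast
  qed
  have "uniformly_Cauchy_on I X"
    unfolding uniformly_Cauchy_on_def dist_norm
  proof (intro allI impI)
    fix e :: real assume e: "0 < e"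
    define \<epsilon> where "\<epsilon> = e / (4 * (c\<^sub>0 * T))"
    have cT: "0 < c\<^sub>0 * T" using c0_ge T by simp
    have \<epsilon>: "0 < \<epsilon>" using e cT by (simp add: \<epsilon>_def)
    obtain N where N: "\<And>n. n \<ge> N \<Longrightarrow> 1 / real (Suc n) \<le> \<epsilon>" using small[OF \<epsilon>] by blast
    have "norm (X m t - X n t) < e" if "t \<in> I" "m \<ge> N" "n \<ge> N" for t m n
    proof -
      have "norm (X m t - X n t) \<le> c\<^sub>0 * T * (1 / Suc m + 1 / Suc n)" using diffX[OF that(1), of m n] by (simp add: mult.assoc)
      also have "\<dots> \<le> c\<^sub>0 * T * (\<epsilon> + \<epsilon>)" using cT N that by (intro mult_left_mono add_mono) auto
      also have "\<dots> < e" using cT e by (simp add: \<epsilon>_def)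
      finally show ?thesis .
    qed
    then show "\<exists>N. \<forall>t\<in>I. \<forall>m\<ge>N. \<forall>n\<ge>N. norm (X m t - X n t) < e" by blast
  qed
  then obtain x where x: "uniform_limit I X x sequentially"
    using Cauchy_uniformly_convergent uniformly_convergent_on_def by blast
  have "uniformly_Cauchy_on I W"
    unfolding uniformly_Cauchy_on_def dist_norm
  proof (intro allI impI)
    fix e :: real assume e: "0 < e"
    define \<epsilon> where "\<epsilon> = e / (4 * (c\<^sub>d + 1))"
    have \<epsilon>: "0 < \<epsilon>" using e cd_nonneg by (simp add: \<epsilon>_def)
    obtain N where N: "\<And>n. n \<ge> N \<Longrightarrow> 1 / real (Suc n) \<le> \<epsilon>" using small[OF \<epsilon>] by blast
    obtain N' where N': "\<And>m n. m \<ge> N' \<Longrightarrow> n \<ge> N' \<Longrightarrow> integral I (\<lambda>t. norm (G' m t - G' n t)) < \<epsilon>"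
      using L1[OF \<epsilon>] by blast
    have "norm (W m t - W n t) < e" if t: "t \<in> I" and mn: "m \<ge> max N N'" "n \<ge> max N N'" for t m n
    proof -
      have "norm (W m t - W n t) \<le> c\<^sub>d * ((1 / Suc m + 1 / Suc n) + integral I (\<lambda>s. norm (G' m s - G' n s)))"
        by (rule diffW[OF t])
      also have "\<dots> \<le> c\<^sub>d * ((\<epsilon> + \<epsilon>) + \<epsilon>)"
        using cd_nonneg N N'[of m n] mn by (intro mult_left_mono add_mono) auto
      also have "\<dots> \<le> (c\<^sub>d + 1) * (3 * \<epsilon>)" using \<epsilon> by (simp add: algebra_simps)
      also have "\<dots> = 3 / 4 * e"
      proof -
        have "c\<^sub>d + 1 \<noteq> 0" using cd_nonneg by simp
        then show ?thesis unfolding \<epsilon>_def by (simp add: divide_simps)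
      qed
      also have "\<dots> < e" using e by simp
      finally show ?thesis .
    qed
    then show "\<exists>N. \<forall>t\<in>I. \<forall>m\<ge>N. \<forall>n\<ge>N. norm (W m t - W n t) < e" by blast
  qed
  then obtain w where w: "uniform_limit I W w sequentially"
    using Cauchy_uniformly_convergent uniformly_convergent_on_def by blast
  have xc: "continuous_on I x"
    by (rule uniform_limit_theorem[OF _ x]) (auto intro!: always_eventually Xc)
  have wc: "continuous_on I w"
    by (rule uniform_limit_theorem[OF _ w]) (auto intro!: always_eventually Wc)
  have Glim: "uniform_limit I G F sequentially"
    by (rule uniform_limit_combine) (meson GF order_trans small)
  define V where "V n t = A t (M t (X n t))" for n t
  define v where "v t = w t - F t - Q t (x t)" for t
  have V_eq: "V = (\<lambda>n t. W n t - G n t - Q t (X n t))" by (intro ext) (simp add: V_def W_def)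
  have Vlim: "uniform_limit I V v sequentially"
    unfolding V_eq v_def by (intro uniform_limit_intros w Q_uniform_limit[OF x] Glim)
  have vc: "continuous_on I v" unfolding v_def by (intro continuous_intros continuous_on_operators wc Fc xc)
  have MX: "(\<lambda>n. M t (X n t)) \<longlonglongrightarrow> M t (x t)" if t: "t \<in> I" for t
    by (rule bounded_linear.tendsto[OF M_lin[OF t] tendsto_uniform_limitI[OF x t]])
  have "strict_sol F x" and AM: "\<And>t. t \<in> I \<Longrightarrow> A t (M t (x t)) = v t"
    using strict_sol_limit[where X=X and V=V and F=G and d="\<lambda>n t. M t (X n t)", OF _ x Vlim Glim vc Fc _ MX]
      X unfolding strict_sol_def V_def by auto
  moreover have "continuous_on I (\<lambda>t. A t (M t (x t)))" by (rule continuous_on_eq[OF vc]) (simp add: AM)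
  moreover have "x 0 = x0"
    using tendsto_uniform_limitI[OF x I_0] unfolding X0 by (simp add: LIMSEQ_const_iff)
  moreover have "norm (A t (M t (x t)) + F t + Q t (x t)) \<le> c\<^sub>d * (norm x0 + norm (A 0 (M 0 x0)) + b + integral {0..t} l)"
    if t: "t \<in> I" and b: "\<forall>s\<in>{0..t}. norm (F s) \<le> b" for t b
  proof -
    have "norm (W n t) \<le> c\<^sub>d * (norm x0 + norm (A 0 (M 0 x0)) + (b + 1 / Suc n) + integral {0..t} l)" for n
    proof -
      have "norm (G n s) \<le> b + 1 / Suc n" if "s \<in> {0..t}" for s
        using norm_triangle_ineq[of "F s" "G n s - F s"] b GF[of s n] t that by fastforce
      then have "norm (W n t) \<le> c\<^sub>d * (norm x0 + norm (A 0 (M 0 x0)) + (b + 1 / Suc n) + integral {0..t} (\<lambda>s. norm (G' n s)))"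
        unfolding W_def by (intro Xb[OF t]) blast
      also have "\<dots> \<le> c\<^sub>d * (norm x0 + norm (A 0 (M 0 x0)) + (b + 1 / Suc n) + integral {0..t} l)"
        using cd_nonneg t G'l
        by (intro mult_left_mono add_mono order_refl integral_le integrable_continuous_interval continuous_intros
            continuous_on_subset[OF G'c] continuous_on_subset[OF l(2)]) auto
      finally show ?thesis .
    qed
    moreover have "(\<lambda>n. c\<^sub>d * (norm x0 + norm (A 0 (M 0 x0)) + (b + 1 / Suc n) + integral {0..t} l)) \<longlonglongrightarrow>
        c\<^sub>d * (norm x0 + norm (A 0 (M 0 x0)) + (b + 0) + integral {0..t} l)"
      by (intro tendsto_intros LIMSEQ_Suc[OF lim_1_over_n])
    ultimately have "norm (w t) \<le> c\<^sub>d * (norm x0 + norm (A 0 (M 0 x0)) + (b + 0) + integral {0..t} l)"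
      by (intro LIMSEQ_le[OF tendsto_norm[OF tendsto_uniform_limitI[OF w t]]]) auto
    then show ?thesis by (simp add: AM[OF t] v_def)
  qed
  ultimately show ?thesis by blast
qed

end

section \<open>The semilinear equation on a bounded interval\<close>

context evolution_system
begin

text \<open>
  The fixed point is sought among functions whose Lipschitz constant grows at most exponentially; the
  solution operator preserves this class, so that every iterate is a classical solution.
\<close>

lemma semilinear_classical_solution:
  fixes N :: "real \<Rightarrow> 'x \<Rightarrow> 'x"
  assumes N_bound: "\<And>t x. t \<in> I \<Longrightarrow> norm (N t x) \<le> \<beta>"
    and N_lipschitz: "\<And>r. \<exists>c\<ge>0. \<forall>s\<in>I. \<forall>t\<in>I. \<forall>x y. norm x \<le> r \<longrightarrow> norm y \<le> r \<longrightarrow>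
           norm (N t x - N s y) \<le> c * (\<bar>t - s\<bar> + norm (x - y))"
    and x0: "M 0 x0 \<in> D"
  shows "\<exists>x. x 0 = x0 \<and> strict_sol (\<lambda>t. N t (x t)) x \<and> continuous_on I (\<lambda>t. A t (M t (x t)))"
proof -
  have \<beta>0: "0 \<le> \<beta>" using order_trans[OF norm_ge_zero N_bound[OF I_0]] .
  \<comment> \<open>The bound of \<open>N\<close> confines every image of the fixed point map to
    this ball, so a single Lipschitz constant \<open>c\<close> of \<open>N\<close> suffices.\<close>
  define \<rho> where "\<rho> = c\<^sub>0 * (norm x0 + T * \<beta>)"
  have \<rho>0: "0 \<le> \<rho>" using c0_ge T \<beta>0 by (simp add: \<rho>_def)
  obtain c where c: "0 \<le> c" and N_lip: "\<And>s t x y. s \<in> I \<Longrightarrow> t \<in> I \<Longrightarrow> norm x \<le> \<rho> \<Longrightarrow> norm y \<le> \<rho> \<Longrightarrow>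
      norm (N t x - N s y) \<le> c * (\<bar>t - s\<bar> + norm (x - y))"
    using N_lipschitz[of \<rho>] by blast
  \<comment> \<open>Makes both \<open>c\<^sub>d * c / \<mu>\<close> and
    \<open>c\<^sub>0 * c / \<mu>\<close> at most \<open>1 / 2\<close>. The first closes the
    Lipschitz bound of the self-map, the second the contraction estimate.\<close>
  define \<mu> where "\<mu> = 2 * (c\<^sub>d * c) + 2 * (c\<^sub>0 * c) + 1"
  have c0: "0 \<le> c\<^sub>d * c" "0 \<le> c\<^sub>0 * c" using c cd_nonneg c0_ge by auto
  then have \<mu>0: "0 < \<mu>" by (simp add: \<mu>_def)
  have "c\<^sub>d * c / \<mu> \<le> 1 / 2" "c\<^sub>0 * c / \<mu> \<le> 1 / 2"
    unfolding pos_divide_le_eq[OF \<mu>0] using c0 by (simp_all add: \<mu>_def)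
  note \<mu> = \<mu>0 this
  \<comment> \<open>The part of the derivative bound that is free of \<open>k\<close>. With
    \<open>k = 2 * C\<close> the full bound is at most
    \<open>(C + k / 2) * exp (\<mu> * t) = k * exp (\<mu> * t)\<close>, so the class reproduces
    itself.\<close>
  define C where "C = c\<^sub>d * (norm x0 + norm (A 0 (M 0 x0)) + \<beta> + c * T) + q * \<rho>"
  have C0: "0 \<le> C" using cd_nonneg c T \<beta>0 q_nonneg \<rho>0 by (simp add: C_def)
  define k where "k = 2 * C"
  define l where "l t = c * (1 + k * exp (\<mu> * t))" for t
  have k0: "0 \<le> k" using C0 by (simp add: k_def)
  \<comment> \<open>The Lipschitz constant belongs to the later time \<open>t\<close>, matching the
    increasing bound \<open>l\<close> in the linear theory.\<close>
  define S where "S = {x. x 0 = x0 \<and> (\<forall>t\<in>I. norm (x t) \<le> \<rho>) \<and>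
    (\<forall>s t. 0 \<le> s \<longrightarrow> s \<le> t \<longrightarrow> t \<le> T \<longrightarrow> norm (x t - x s) \<le> k * exp (\<mu> * t) * (t - s))}"
  have l: "mono_on I l" "continuous_on I l" "\<And>t. t \<in> I \<Longrightarrow> 0 \<le> l t"
    unfolding l_def[abs_def] using c k0 \<mu> by (auto intro!: mono_onI mult_left_mono continuous_intros)
  have F_lip: "norm (N t (x t) - N s (x s)) \<le> l t * (t - s)" if x: "x \<in> S" and st: "0 \<le> s" "s \<le> t" "t \<le> T" for x s t
  proof -
    have "norm (N t (x t) - N s (x s)) \<le> c * (\<bar>t - s\<bar> + norm (x t - x s))"
      using x st by (intro N_lip) (auto simp: S_def)
    also have "\<dots> \<le> c * ((t - s) + k * exp (\<mu> * t) * (t - s))"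
      using x st c unfolding S_def by (intro mult_left_mono add_mono) auto
    finally show ?thesis by (simp add: l_def algebra_simps)
  qed
  have F_cont: "continuous_on I (\<lambda>t. N t (x t))" if x: "x \<in> S" for x
  proof (rule continuous_on_iff[THEN iffD2], intro ballI allI impI)
    fix t e :: real assume t: "t \<in> I" and e: "0 < e"
    have lT: "0 \<le> l T" "\<And>s. s \<in> I \<Longrightarrow> l s \<le> l T" using l T by (auto simp: mono_on_def)
    have "dist (N s (x s)) (N t (x t)) < e" if s: "s \<in> I" "dist s t < e / (l T + 1)" for s
    proof -
      have le: "norm (N b (x b) - N a (x a)) \<le> l T * (b - a)" if "a \<in> I" "b \<in> I" "a \<le> b" for a b
      proof -
        have "norm (N b (x b) - N a (x a)) \<le> l b * (b - a)" using F_lip[OF x, of a b] that by auto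
        also have "\<dots> \<le> l T * (b - a)" using lT(2)[OF that(2)] that(3) by (intro mult_right_mono) auto
        finally show ?thesis .
      qed
      have "norm (N s (x s) - N t (x t)) \<le> l T * \<bar>s - t\<bar>"
        using le[OF s(1) t] le[OF t s(1)] by (cases "s \<le> t") (auto simp: norm_minus_commute)
      also have "\<dots> \<le> (l T + 1) * \<bar>s - t\<bar>" by (simp add: mult_right_mono)
      also have "\<dots> < e" using s(2) lT(1) by (simp add: dist_real_def pos_less_divide_eq mult.commute)
      finally show ?thesis by (simp add: dist_norm)
    qed
    then show "\<exists>d>0. \<forall>s\<in>I. dist s t < d \<longrightarrow> dist (N s (x s)) (N t (x t)) < e"
      using e lT(1) by (intro exI[of _ "e / (l T + 1)"]) auto
  qed
  define P where "P x z \<longleftrightarrow> z 0 = x0 \<and> strict_sol (\<lambda>t. N t (x t)) z \<and> continuous_on I (\<lambda>t. A t (M t (z t))) \<and>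
      (\<forall>t\<in>I. \<forall>b. (\<forall>s\<in>{0..t}. norm (N s (x s)) \<le> b) \<longrightarrow>
        norm (A t (M t (z t)) + N t (x t) + Q t (z t)) \<le>
          c\<^sub>d * (norm x0 + norm (A 0 (M 0 x0)) + b + integral {0..t} l))" for x z
  define \<Phi> where "\<Phi> x = (SOME z. P x z)" for x
  have \<Phi>: "P x (\<Phi> x)" if x: "x \<in> S" for x
  proof -
    have "\<exists>z. P x z" unfolding P_def by (rule classical_solution_lipschitz_rhs[OF l F_lip[OF x] F_cont[OF x] x0])
    then show ?thesis unfolding \<Phi>_def by (rule someI_ex)
  qed
  have \<Phi>_sol: "\<Phi> x 0 = x0" "strict_sol (\<lambda>t. N t (x t)) (\<Phi> x)" "continuous_on I (\<lambda>t. A t (M t (\<Phi> x t)))" if "x \<in> S" for x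
    using \<Phi>[OF that] by (auto simp: P_def)
  have \<Phi>_norm: "norm (\<Phi> x t) \<le> \<rho>" if x: "x \<in> S" and t: "t \<in> I" for x t
  proof -
    have "norm (\<Phi> x t) \<le> c\<^sub>0 * (norm (\<Phi> x 0) + integral {0..t} (\<lambda>s. norm (N s (x s))))"
      by (rule strict_sol_bound[OF \<Phi>_sol(2)[OF x] F_cont[OF x] t])
    also have "\<dots> \<le> c\<^sub>0 * (norm x0 + T * \<beta>)"
      using c0_ge by (intro mult_left_mono add_mono integral_norm_le_const[OF F_cont[OF x] N_bound t])
        (auto simp: \<Phi>_sol(1)[OF x])
    finally show ?thesis by (simp add: \<rho>_def)
  qed
  have \<Phi>_deriv: "norm (A t (M t (\<Phi> x t)) + N t (x t)) \<le> k * exp (\<mu> * t)" if x: "x \<in> S" and t: "t \<in> I" for x t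
  proof -
    have e1: "1 \<le> exp (\<mu> * t)" using \<mu> t by simp
    have "((\<lambda>t. c) has_integral t * c) {0..t}" using has_integral_const_real[of c 0 t] t by simp
    then have ic: "integral {0..t} (\<lambda>t. c) = t * c" by (rule integral_unique)
    have "integral {0..t} l = integral {0..t} (\<lambda>t. c) + integral {0..t} (\<lambda>t. c * k * exp (\<mu> * t))"
      unfolding l_def by (subst integral_add[symmetric])
        (auto intro!: integrable_continuous_interval continuous_intros simp: algebra_simps)
    also have "\<dots> \<le> t * c + c * k / \<mu> * exp (\<mu> * t)"
      unfolding ic using t \<mu> c k0 by (intro add_mono integral_exp_weight continuous_intros) auto
    also have "\<dots> \<le> c * T + c * k / \<mu> * exp (\<mu> * t)" using mult_left_mono[of t T c] t c by (simp add: mult.commute)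
    finally have il: "integral {0..t} l \<le> c * T + c * k / \<mu> * exp (\<mu> * t)" .
    have "norm (A t (M t (\<Phi> x t)) + N t (x t) + Q t (\<Phi> x t)) \<le>
        c\<^sub>d * (norm x0 + norm (A 0 (M 0 x0)) + \<beta> + integral {0..t} l)"
      using \<Phi>[OF x] t N_bound unfolding P_def by auto
    also have "\<dots> \<le> c\<^sub>d * (norm x0 + norm (A 0 (M 0 x0)) + \<beta> + (c * T + c * k / \<mu> * exp (\<mu> * t)))"
      using cd_nonneg il by (intro mult_left_mono add_mono order_refl) auto
    finally have 1: "norm (A t (M t (\<Phi> x t)) + N t (x t) + Q t (\<Phi> x t)) \<le> \<dots>" .
    have 2: "norm (Q t (\<Phi> x t)) \<le> q * \<rho>"
      by (rule order_trans[OF Q_norm[OF t] mult_left_mono[OF \<Phi>_norm[OF x t] q_nonneg]])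
    have "norm (A t (M t (\<Phi> x t)) + N t (x t)) \<le>
        norm (A t (M t (\<Phi> x t)) + N t (x t) + Q t (\<Phi> x t)) + norm (Q t (\<Phi> x t))"
      using norm_triangle_ineq4[of "A t (M t (\<Phi> x t)) + N t (x t) + Q t (\<Phi> x t)" "Q t (\<Phi> x t)"] by simp
    also have "\<dots> \<le> C + (c\<^sub>d * c / \<mu>) * (k * exp (\<mu> * t))"
      using 1 2 by (simp add: C_def algebra_simps)
    also have "\<dots> \<le> C * exp (\<mu> * t) + (1 / 2) * (k * exp (\<mu> * t))"
    proof (intro add_mono mult_right_mono \<mu>)
      show "C \<le> C * exp (\<mu> * t)" using C0 e1 by (simp add: mult_le_cancel_left1)
      show "0 \<le> k * exp (\<mu> * t)" using k0 by simp
    qed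
    also have "\<dots> = k * exp (\<mu> * t)" by (simp add: k_def)
    finally show ?thesis .
  qed
  have "\<exists>x\<in>S. \<forall>t\<in>I. \<Phi> x t = x t"
  proof (rule weighted_contraction_fixpoint[where w="\<lambda>t. exp (\<mu> * t)" and W="exp (\<mu> * T)" and ?x0.0="\<lambda>_. x0"])
    have "norm x0 * 1 \<le> norm x0 * c\<^sub>0" using c0_ge by (intro mult_left_mono) auto
    moreover have "0 \<le> c\<^sub>0 * (T * \<beta>)" using c0_ge T \<beta>0 by simp
    ultimately have "norm x0 \<le> \<rho>" by (simp add: \<rho>_def algebra_simps)
    then show "(\<lambda>_. x0) \<in> S" using k0 by (simp add: S_def)
    show "\<Phi> x \<in> S" if x: "x \<in> S" for x
      unfolding S_def
    proof (clarsimp simp: \<Phi>_sol(1)[OF x] \<Phi>_norm[OF x])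
      fix s t assume st: "0 \<le> s" "s \<le> t" "t \<le> T"
      show "norm (\<Phi> x t - \<Phi> x s) \<le> k * exp (\<mu> * t) * (t - s)"
      proof (rule vector_mvt_bound_const[OF st(2)])
        fix r assume r: "r \<in> {s..t}"
        then have rI: "r \<in> I" using st by auto
        have "(\<Phi> x has_vector_derivative A r (M r (\<Phi> x r)) + N r (x r)) (at r within I)"
          using \<Phi>_sol(2)[OF x] rI unfolding strict_sol_def by blast
        then show "(\<Phi> x has_vector_derivative A r (M r (\<Phi> x r)) + N r (x r)) (at r within {s..t})"
          by (rule has_vector_derivative_within_subset) (use st in auto)
        have "k * exp (\<mu> * r) \<le> k * exp (\<mu> * t)" using r k0 \<mu> by (intro mult_left_mono) auto
        then show "norm (A r (M r (\<Phi> x r)) + N r (x r)) \<le> k * exp (\<mu> * t)"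
          using \<Phi>_deriv[OF x rI] by simp
      qed
    qed
    show "bounded (x ` I)" if "x \<in> S" for x
      unfolding bounded_iff using that by (intro exI[of _ \<rho>]) (auto simp: S_def)
    show "x \<in> S" if u: "\<And>n. u n \<in> S" and lim: "uniform_limit I u x sequentially" for u x
    proof -
      have l: "(\<lambda>n. u n t) \<longlonglongrightarrow> x t" if "t \<in> I" for t by (rule tendsto_uniform_limitI[OF lim that])
      have "x 0 = x0" using l[OF I_0] u unfolding S_def by (simp add: LIMSEQ_const_iff)
      moreover have "norm (x t) \<le> \<rho>" if "t \<in> I" for t
        using u that unfolding S_def by (intro LIMSEQ_le_const2[OF tendsto_norm[OF l[OF that]]]) auto
      moreover have "norm (x t - x s) \<le> k * exp (\<mu> * t) * (t - s)" if st: "0 \<le> s" "s \<le> t" "t \<le> T" for s t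
      proof (rule LIMSEQ_le_const2)
        show "(\<lambda>n. norm (u n t - u n s)) \<longlonglongrightarrow> norm (x t - x s)"
          using st by (intro tendsto_intros l) auto
        show "\<exists>N. \<forall>n\<ge>N. norm (u n t - u n s) \<le> k * exp (\<mu> * t) * (t - s)"
          using u st unfolding S_def by auto
      qed
      ultimately show ?thesis by (simp add: S_def)
    qed
    show "1 \<le> exp (\<mu> * t)" "exp (\<mu> * t) \<le> exp (\<mu> * T)" if "t \<in> I" for t
      using that \<mu> by (auto intro: mult_left_mono)
    fix x y d t assume xy: "x \<in> S" "y \<in> S" and d: "0 \<le> d" and t: "t \<in> I"
      and le: "\<And>t. t \<in> I \<Longrightarrow> norm (x t - y t) \<le> d * exp (\<mu> * t)"
    have sub: "{0..t} \<subseteq> I" using t by auto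
    have c': "continuous_on I (\<lambda>s. N s (x s) - N s (y s))" by (intro continuous_intros F_cont xy)
    have "norm (\<Phi> x t - \<Phi> y t) \<le> c\<^sub>0 * (norm (\<Phi> x 0 - \<Phi> y 0) + integral {0..t} (\<lambda>s. norm (N s (x s) - N s (y s))))"
      by (rule strict_sol_bound[OF strict_sol_diff[OF \<Phi>_sol(2)[OF xy(1)] \<Phi>_sol(2)[OF xy(2)]] c' t])
    also have "\<dots> = c\<^sub>0 * integral {0..t} (\<lambda>s. norm (N s (x s) - N s (y s)))"
      by (simp add: \<Phi>_sol(1) xy)
    also have "\<dots> \<le> c\<^sub>0 * ((c * d) / \<mu> * exp (\<mu> * t))"
    proof (intro mult_left_mono integral_exp_weight)
      show "continuous_on {0..t} (\<lambda>s. norm (N s (x s) - N s (y s)))"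
        by (intro continuous_on_norm continuous_on_subset[OF c' sub])
      fix s assume "s \<in> {0..t}"
      then have s: "s \<in> I" using sub by blast
      have "norm (N s (x s) - N s (y s)) \<le> c * (\<bar>s - s\<bar> + norm (x s - y s))"
        using xy s by (intro N_lip) (auto simp: S_def)
      also have "\<dots> \<le> c * (d * exp (\<mu> * s))" using le[OF s] c by (simp add: mult_left_mono)
      finally show "norm (N s (x s) - N s (y s)) \<le> (c * d) * exp (\<mu> * s)" by simp
    qed (use t c d c0_ge \<mu> in auto)
    also have "\<dots> = (c\<^sub>0 * c / \<mu>) * (d * exp (\<mu> * t))" by simp
    also have "\<dots> \<le> (1 / 2) * (d * exp (\<mu> * t))" using d \<mu>(3) by (intro mult_right_mono) auto
    finally show "norm (\<Phi> x t - \<Phi> y t) \<le> d / 2 * exp (\<mu> * t)" by simp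
  qed
  then obtain x where x: "x \<in> S" "\<And>t. t \<in> I \<Longrightarrow> \<Phi> x t = x t" by blast
  \<comment> \<open>\<open>\<Phi> x\<close> solves the equation with \<open>x\<close> inserted in
    the nonlinearity; on the interval both functions agree.\<close>
  have "strict_sol (\<lambda>t. N t (\<Phi> x t)) (\<Phi> x)"
    using \<Phi>_sol(2)[OF x(1)] x(2) by (simp add: strict_sol_def)
  then show ?thesis using \<Phi>_sol(1,3)[OF x(1)] by blast
qed

end

section \<open>Uniform bounds from strong differentiability\<close>

lemma has_vector_derivative_norm_le:
  assumes f': "(f has_vector_derivative f') (at t within {a..b})" and ab: "a < b" "t \<in> {a..b}"
    and le: "\<And>s. s \<in> {a..b} \<Longrightarrow> norm (f s - f t) \<le> L * \<bar>s - t\<bar>"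
  shows "norm f' \<le> L"
proof (rule field_le_epsilon)
  fix e :: real assume "0 < e"
  then obtain d where d: "0 < d" "\<And>s. s \<in> {a..b} \<Longrightarrow> \<bar>s - t\<bar> < d \<Longrightarrow> norm (f s - f t - (s - t) *\<^sub>R f') \<le> e * \<bar>s - t\<bar>"
    using f' unfolding has_vector_derivative_within_alt by meson
  obtain s where s: "s \<in> {a..b}" "\<bar>s - t\<bar> < d" "s \<noteq> t"
  proof (cases "t < b")
    case True
    then show thesis using d(1) ab by (intro that[of "min b (t + d / 2)"]) auto
  next
    case False
    then show thesis using d(1) ab by (intro that[of "max a (t - d / 2)"]) auto
  qed
  have "norm ((s - t) *\<^sub>R f') \<le> norm (f s - f t) + norm (f s - f t - (s - t) *\<^sub>R f')"
    using norm_triangle_ineq4[of "f s - f t" "f s - f t - (s - t) *\<^sub>R f'"] by simp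
  also have "\<dots> \<le> (L + e) * \<bar>s - t\<bar>" using le[OF s(1)] d(2)[OF s(1,2)] by (simp add: distrib_right)
  finally have "norm f' * \<bar>s - t\<bar> \<le> (L + e) * \<bar>s - t\<bar>" by (simp add: mult.commute)
  then show "norm f' \<le> L + e" using s(3) by simp
qed

text \<open>Uniform boundedness is applied to the difference quotients over all pairs of distinct
  times, not to \<open>L' t\<close>, whose bounded linearity is part of the claim. For each vector
  the quotients are bounded by the maximum of the continuous derivative, and the derivatives inherit
  the uniform bound.\<close>

lemma strong_derivative_bounded:
  fixes L L' :: "real \<Rightarrow> 'a::{real_normed_vector,complete_space} \<Rightarrow> 'b::real_normed_vector"
  assumes T: "0 < T" and lin: "\<And>t. t \<in> {0..T} \<Longrightarrow> bounded_linear (L t)"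
    and L': "\<And>t x. t \<in> {0..T} \<Longrightarrow> ((\<lambda>t. L t x) has_vector_derivative L' t x) (at t within {0..T})"
    and cont: "\<And>x. continuous_on {0..T} (\<lambda>t. L' t x)"
  shows "\<exists>\<kappa>>0. \<forall>t\<in>{0..T}. bounded_linear (L' t) \<and> (\<forall>x. norm (L' t x) \<le> \<kappa> * norm x)"
proof -
  define I where "I = {(s, t). s \<in> {0..T} \<and> t \<in> {0..T} \<and> s \<noteq> t}"
  have diff_le: "norm (L t x - L s x) \<le> c * \<bar>t - s\<bar>"
    if st: "s \<in> {0..T}" "t \<in> {0..T}" and c: "\<And>t. t \<in> {0..T} \<Longrightarrow> norm (L' t x) \<le> c" for s t c x
  proof -
    have "norm (L b x - L a x) \<le> c * (b - a)" if "a \<in> {0..T}" "b \<in> {0..T}" "a \<le> b" for a b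
      by (rule vector_mvt_bound_const[OF that(3), where f'="\<lambda>t. L' t x"])
         (use that c in \<open>auto intro!: has_vector_derivative_within_subset[OF L']\<close>)
    from this[OF st] this[OF st(2,1)] show ?thesis
      by (cases "s \<le> t") (auto simp: norm_minus_commute)
  qed
  have "\<exists>\<kappa>>0. \<forall>i\<in>I. \<forall>x. norm ((\<lambda>x. (1 / (snd i - fst i)) *\<^sub>R (L (snd i) x - L (fst i) x)) x) \<le> \<kappa> * norm x"
  proof (rule uniform_boundedness)
    show "bounded_linear (\<lambda>x. (1 / (snd i - fst i)) *\<^sub>R (L (snd i) x - L (fst i) x))" if "i \<in> I" for i
      using that lin by (intro bounded_linear_compose[OF bounded_linear_scaleR_right] bounded_linear_sub)
        (auto simp: I_def)
    show "\<exists>c. \<forall>i\<in>I. norm ((1 / (snd i - fst i)) *\<^sub>R (L (snd i) x - L (fst i) x)) \<le> c" for x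
    proof -
      obtain c where c: "\<And>t. t \<in> {0..T} \<Longrightarrow> norm (L' t x) \<le> c"
        using compact_continuous_image[OF cont[of x] compact_Icc, THEN compact_imp_bounded]
        unfolding bounded_iff by blast
      have "norm ((1 / (t - s)) *\<^sub>R (L t x - L s x)) \<le> c" if "s \<in> {0..T}" "t \<in> {0..T}" "s \<noteq> t" for s t
        using diff_le[OF that(1,2) c] that(3) by (simp add: pos_divide_le_eq)
      then show ?thesis by (intro exI[of _ c]) (auto simp: I_def)
    qed
  qed
  then obtain \<kappa> where \<kappa>: "0 < \<kappa>" "\<And>s t x. (s, t) \<in> I \<Longrightarrow> norm ((1 / (t - s)) *\<^sub>R (L t x - L s x)) \<le> \<kappa> * norm x"
    by force
  have bnd: "norm (L' t x) \<le> \<kappa> * norm x" if t: "t \<in> {0..T}" for t x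
  proof (rule has_vector_derivative_norm_le[OF L'[OF t] T t])
    fix s assume s: "s \<in> {0..T}"
    show "norm (L s x - L t x) \<le> \<kappa> * norm x * \<bar>s - t\<bar>"
    proof (cases "s = t")
      case False
      then have "norm ((1 / (s - t)) *\<^sub>R (L s x - L t x)) \<le> \<kappa> * norm x"
        using s t by (intro \<kappa>(2)) (auto simp: I_def)
      then show ?thesis using False by (simp add: pos_divide_le_eq)
    qed simp
  qed
  have unique: "a = b" if "t \<in> {0..T}" "(f has_vector_derivative a) (at t within {0..T})"
    "(f has_vector_derivative b) (at t within {0..T})" for t a b and f :: "real \<Rightarrow> 'b"
    using vector_derivative_unique_within_closed_interval[of 0 T t f a b] that T by simp
  have "bounded_linear (L' t)" if t: "t \<in> {0..T}" for t
  proof (rule bounded_linear_intro)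
    fix x y :: 'a and c :: real
    have "((\<lambda>t. L t x + L t y) has_vector_derivative L' t x + L' t y) (at t within {0..T})"
      by (intro has_vector_derivative_add L' t)
    then have "((\<lambda>t. L t (x + y)) has_vector_derivative L' t x + L' t y) (at t within {0..T})"
      by (rule has_vector_derivative_transform[OF t, rotated])
         (simp add: linear_add[OF bounded_linear.linear[OF lin]])
    then show "L' t (x + y) = L' t x + L' t y" using unique[OF t L'[OF t]] by blast
    have "((\<lambda>t. c *\<^sub>R L t x) has_vector_derivative c *\<^sub>R L' t x) (at t within {0..T})"
      by (intro bounded_linear.has_vector_derivative[OF bounded_linear_scaleR_right] L' t)
    then have "((\<lambda>t. L t (c *\<^sub>R x)) has_vector_derivative c *\<^sub>R L' t x) (at t within {0..T})"
      by (rule has_vector_derivative_transform[OF t, rotated])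
         (simp add: linear_scale[OF bounded_linear.linear[OF lin]])
    then show "L' t (c *\<^sub>R x) = c *\<^sub>R L' t x" using unique[OF t L'[OF t]] by blast
    show "norm (L' t x) \<le> norm x * \<kappa>" using bnd[OF t] by (simp add: mult.commute)
  qed
  then show ?thesis using \<kappa>(1) bnd by blast
qed

lemma yosida_tendsto:
  fixes D :: "'a::real_inner set"
  assumes A: "m_dissipative D A" and x: "x \<in> D"
  shows "(\<lambda>n. yosida D A (inverse (real (Suc n))) x) \<longlonglongrightarrow> A x"
proof -
  have "(\<lambda>n. resolvent D A (inverse (real (Suc n))) v) \<longlonglongrightarrow> v" for v
  proof (rule LIMSEQ_I)
    fix e :: real assume e: "0 < e"
    have "v \<in> closure D" using m_dissipativeD(2)[OF A] by simp
    then obtain d where d: "d \<in> D" "norm (d - v) < e / 4"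
      using e unfolding closure_approachable dist_norm by (metis zero_less_divide_iff zero_less_numeral)
    have "0 < e / (2 * (norm (A d) + 1))" using e by (simp add: add_nonneg_pos)
    then obtain N where N: "inverse (real (Suc N)) < e / (2 * (norm (A d) + 1))" using reals_Archimedean by blast
    have "norm (resolvent D A (inverse (real (Suc n))) v - v) < e" if n: "n \<ge> N" for n
    proof -
      define h where "h = inverse (real (Suc n))"
      have h: "0 < h" by (simp add: h_def)
      define p where "p = norm (A d) + 1"
      have p: "0 < p" by (simp add: p_def add_nonneg_pos)
      have "h \<le> inverse (real (Suc N))" using n by (simp add: h_def field_simps)
      then have "h * p \<le> e / (2 * p) * p"
        using N p by (intro mult_right_mono) (auto simp: p_def)
      also have "\<dots> = e / 2" using p by simp
      finally have "h * norm (A d) \<le> e / 2" using h by (simp add: p_def distrib_left)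
      then have 1: "norm (resolvent D A h d - d) \<le> e / 2" using norm_resolvent_diff_le[OF A h d(1)] by simp
      have 2: "norm (resolvent D A h (d - v)) < e / 4" using norm_resolvent_le[OF A h, of "d - v"] d(2) by simp
      have "resolvent D A h v - v = (resolvent D A h d - d) - resolvent D A h (d - v) + (d - v)"
        using linear_diff[OF bounded_linear.linear[OF bounded_linear_resolvent[OF A h]], of d v] by simp
      also have "norm \<dots> \<le> norm (resolvent D A h d - d) + norm (resolvent D A h (d - v)) + norm (d - v)"
        by (intro norm_triangle_le add_mono norm_triangle_ineq4 order_refl)
      finally show ?thesis using 1 2 d(2) by (simp add: h_def)
    qed
    then show "\<exists>N. \<forall>n\<ge>N. norm (resolvent D A (inverse (real (Suc n))) v - v) < e" by blast
  qed
  moreover have "yosida D A (inverse (real (Suc n))) x = resolvent D A (inverse (real (Suc n))) (A x)" for n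
    by (rule yosida_on_domain[OF A _ x]) simp
  ultimately show ?thesis by simp
qed

text \<open>Takes the role of the closed graph theorem: \<open>A R\<close> is the pointwise limit of
  the bounded operators obtained from the Yosida approximations of \<open>A\<close>, and these are
  pointwise bounded because \<open>R\<close> maps into \<open>D\<close>.\<close>

lemma bounded_linear_operator_resolvent:
  fixes D :: "'a::{real_inner,complete_space} set"
  assumes A: "m_dissipative D A" and B: "m_dissipative D B"
  shows "bounded_linear (\<lambda>y. A (resolvent D B 1 y))"
proof -
  define R where "R = resolvent D B 1"
  have R: "R y \<in> D" "bounded_linear R" for y
    using resolvent_props(1)[OF B] bounded_linear_resolvent[OF B] by (auto simp: R_def)
  have "\<exists>K>0. \<forall>n\<in>UNIV. \<forall>y. norm (yosida D A (inverse (real (Suc n))) (R y)) \<le> K * norm y"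
  proof (rule uniform_boundedness)
    show "bounded_linear (\<lambda>y. yosida D A (inverse (real (Suc n))) (R y))" for n
      by (intro bounded_linear_compose[OF bounded_linear_yosida[OF A]] R) simp
    show "\<exists>c. \<forall>n\<in>UNIV. norm (yosida D A (inverse (real (Suc n))) (R y)) \<le> c" for y
      using norm_yosida_on_domain[OF A _ R(1)] by (intro exI[of _ "norm (A (R y))"]) auto
  qed
  then obtain K where K: "\<And>n y. norm (yosida D A (inverse (real (Suc n))) (R y)) \<le> K * norm y" by blast
  interpret R: bounded_linear R by (rule R)
  have "bounded_linear (\<lambda>y. A (R y))"
  proof (rule bounded_linear_intro)
    show "norm (A (R y)) \<le> norm y * K" for y
      by (rule LIMSEQ_le_const2[OF tendsto_norm[OF yosida_tendsto[OF A R(1)]]]) (use K in \<open>auto simp: mult.commute\<close>)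
  qed (simp_all add: R.add R.scaleR m_dissipativeD(3,4)[OF A] R(1))
  then show ?thesis by (simp add: R_def)
qed

text \<open>Measured in the graph norm at time \<open>0\<close>, the derivatives \<open>A' t\<close>
  are uniformly bounded, so the graph norms are Lipschitz in time. The converse bound holds at each
  \<open>t\<close> with a constant \<open>C t\<close> over which nothing is known; near
  \<open>t\<close> it persists with \<open>2 * C t\<close>, and compactness leaves finitely many
  constants.\<close>

lemma graph_norms_equivalent:
  fixes A A' :: "real \<Rightarrow> 'a::{real_inner,complete_space} \<Rightarrow> 'a"
  assumes T: "0 < T" and A: "\<And>t. t \<in> {0..T} \<Longrightarrow> m_dissipative D (A t)"
    and A': "\<And>t x. t \<in> {0..T} \<Longrightarrow> x \<in> D \<Longrightarrow> ((\<lambda>t. A t x) has_vector_derivative A' t x) (at t within {0..T})"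
    and cont: "\<And>x. x \<in> D \<Longrightarrow> continuous_on {0..T} (\<lambda>t. A' t x)"
  shows "\<exists>\<kappa>\<ge>0. \<forall>s\<in>{0..T}. \<forall>t\<in>{0..T}. \<forall>x\<in>D.
    norm (A' t x) \<le> \<kappa> * (norm x + norm (A t x)) \<and> norm (A s x) \<le> \<kappa> * (norm x + norm (A t x))"
proof -
  have I0: "0 \<in> {0..T}" using T by simp
  define R where "R t = resolvent D (A t) 1" for t
  have R: "R t y \<in> D" if "t \<in> {0..T}" for t y using resolvent_props(1)[OF A[OF that]] by (simp add: R_def)
  have R_inv: "R t (x - A t x) = x" if "t \<in> {0..T}" "x \<in> D" for t x
    unfolding R_def by (rule resolvent_eqI[OF A[OF that(1)]]) (use that in auto)
  have "\<exists>\<kappa>>0. \<forall>t\<in>{0..T}. bounded_linear (\<lambda>y. A' t (R 0 y)) \<and> (\<forall>y. norm (A' t (R 0 y)) \<le> \<kappa> * norm y)"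
  proof (rule strong_derivative_bounded[OF T])
    show "bounded_linear (\<lambda>y. A t (R 0 y))" if "t \<in> {0..T}" for t
      unfolding R_def by (rule bounded_linear_operator_resolvent[OF A[OF that] A[OF I0]])
  qed (intro A' R I0 cont; assumption)+
  then obtain \<kappa>\<^sub>1 where \<kappa>1: "0 < \<kappa>\<^sub>1" "\<And>t y. t \<in> {0..T} \<Longrightarrow> norm (A' t (R 0 y)) \<le> \<kappa>\<^sub>1 * norm y" by blast
  define \<Gamma> where "\<Gamma> t x = norm x + norm (A t x)" for t x
  have \<Gamma>0: "0 \<le> \<Gamma> t x" for t x by (simp add: \<Gamma>_def)
  have A'\<Gamma>: "norm (A' t x) \<le> \<kappa>\<^sub>1 * \<Gamma> 0 x" if t: "t \<in> {0..T}" and x: "x \<in> D" for t x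
  proof -
    have "norm (A' t x) \<le> \<kappa>\<^sub>1 * norm (x - A 0 x)" using \<kappa>1(2)[OF t, of "x - A 0 x"] R_inv[OF I0 x] by simp
    also have "\<dots> \<le> \<kappa>\<^sub>1 * \<Gamma> 0 x" using \<kappa>1(1) norm_triangle_ineq4[of x "A 0 x"] by (simp add: \<Gamma>_def)
    finally show ?thesis .
  qed
  have A_lip: "norm (A t x - A s x) \<le> \<kappa>\<^sub>1 * \<Gamma> 0 x * \<bar>t - s\<bar>" if st: "s \<in> {0..T}" "t \<in> {0..T}" and x: "x \<in> D" for s t x
  proof -
    have "norm (A b x - A a x) \<le> \<kappa>\<^sub>1 * \<Gamma> 0 x * (b - a)" if "a \<in> {0..T}" "b \<in> {0..T}" "a \<le> b" for a b
      by (rule vector_mvt_bound_const[OF that(3), where f'="\<lambda>t. A' t x"])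
         (use that x A'\<Gamma>[OF _ x] in \<open>auto intro!: has_vector_derivative_within_subset[OF A']\<close>)
    from this[OF st] this[OF st(2,1)] show ?thesis
      by (cases "s \<le> t") (auto simp: norm_minus_commute)
  qed
  have \<Gamma>_lip: "\<Gamma> t x \<le> \<Gamma> s x + \<kappa>\<^sub>1 * \<Gamma> 0 x * \<bar>t - s\<bar>" if "s \<in> {0..T}" "t \<in> {0..T}" "x \<in> D" for s t x
    using A_lip[OF that] norm_triangle_ineq2[of "A t x" "A s x"] by (simp add: \<Gamma>_def)
  have "\<exists>C\<ge>1. \<forall>x\<in>D. \<Gamma> 0 x \<le> C * \<Gamma> t x" if t: "t \<in> {0..T}" for t
  proof -
    obtain K where K: "\<And>y. norm (A 0 (R t y)) \<le> norm y * K" "0 < K"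
      using bounded_linear.pos_bounded[OF bounded_linear_operator_resolvent[OF A[OF I0] A[OF t]]]
      unfolding R_def by blast
    have "\<Gamma> 0 x \<le> (1 + K) * \<Gamma> t x" if x: "x \<in> D" for x
    proof -
      have "norm (A 0 x) \<le> norm (x - A t x) * K" using K(1)[of "x - A t x"] R_inv[OF t x] by simp
      also have "\<dots> \<le> \<Gamma> t x * K"
        using K(2) norm_triangle_ineq4[of x "A t x"] by (simp add: \<Gamma>_def)
      finally have "norm (A 0 x) \<le> \<Gamma> t x * K" .
      moreover have "norm x \<le> \<Gamma> t x" by (simp add: \<Gamma>_def)
      ultimately show ?thesis unfolding \<Gamma>_def[of 0] by (simp add: distrib_right mult.commute)
    qed
    then show ?thesis using K(2) by (intro exI[of _ "1 + K"]) auto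
  qed
  then obtain C where C: "\<And>t. t \<in> {0..T} \<Longrightarrow> 1 \<le> C t" "\<And>t x. t \<in> {0..T} \<Longrightarrow> x \<in> D \<Longrightarrow> \<Gamma> 0 x \<le> C t * \<Gamma> t x"
    by metis
  \<comment> \<open>Within this distance the Lipschitz error is at most half of the graph norm at
    time \<open>0\<close> and can be absorbed on the left.\<close>
  define \<delta> where "\<delta> t = 1 / (2 * \<kappa>\<^sub>1 * C t)" for t
  have \<delta>: "0 < \<delta> t" if "t \<in> {0..T}" for t using C(1)[OF that] \<kappa>1(1) by (simp add: \<delta>_def)
  have near: "\<Gamma> 0 x \<le> 2 * C t * \<Gamma> s x"
    if t: "t \<in> {0..T}" and s: "s \<in> {0..T}" "dist t s < \<delta> t" and x: "x \<in> D" for s t x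
  proof -
    have Ct: "1 \<le> C t" by (rule C(1)[OF t])
    have "\<Gamma> 0 x \<le> C t * \<Gamma> t x" by (rule C(2)[OF t x])
    also have "\<dots> \<le> C t * (\<Gamma> s x + \<kappa>\<^sub>1 * \<Gamma> 0 x * \<bar>t - s\<bar>)"
      using \<Gamma>_lip[OF s(1) t x] Ct by (intro mult_left_mono) auto
    also have "\<dots> = C t * \<Gamma> s x + \<Gamma> 0 x * (C t * \<kappa>\<^sub>1 * \<bar>t - s\<bar>)" by (simp add: algebra_simps)
    also have "\<dots> \<le> C t * \<Gamma> s x + \<Gamma> 0 x * (1 / 2)"
    proof (intro add_mono mult_left_mono order_refl \<Gamma>0)
      have "C t * \<kappa>\<^sub>1 * \<bar>t - s\<bar> \<le> C t * \<kappa>\<^sub>1 * \<delta> t"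
        using s(2) Ct \<kappa>1(1) by (intro mult_left_mono) (auto simp: dist_real_def)
      also have "\<dots> = 1 / 2" using Ct \<kappa>1(1) by (simp add: \<delta>_def)
      finally show "C t * \<kappa>\<^sub>1 * \<bar>t - s\<bar> \<le> 1 / 2" .
    qed (use Ct in simp)
    finally show ?thesis by simp
  qed
  have "{0..T} \<subseteq> (\<Union>t\<in>{0..T}. ball t (\<delta> t))" using \<delta> by force
  then obtain k where k: "k \<subseteq> {0..T}" "finite k" "{0..T} \<subseteq> (\<Union>t\<in>k. ball t (\<delta> t))"
    using compactE_image[of "{0..T}" "{0..T}" "\<lambda>t. ball t (\<delta> t)"] open_ball compact_Icc by metis
  define K where "K = Max (insert 1 ((\<lambda>t. 2 * C t) ` k))"
  have K1: "1 \<le> K" unfolding K_def using k(2) by (intro Max_ge) auto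
  have \<Gamma>0_le: "\<Gamma> 0 x \<le> K * \<Gamma> s x" if s: "s \<in> {0..T}" and x: "x \<in> D" for s x
  proof -
    obtain t where t: "t \<in> k" "dist t s < \<delta> t" using k(3) s by fastforce
    have "\<Gamma> 0 x \<le> 2 * C t * \<Gamma> s x" using near[OF _ s t(2) x] k(1) t(1) by blast
    also have "2 * C t \<le> K" unfolding K_def using k(2) t(1) by (intro Max_ge) auto
    then have "2 * C t * \<Gamma> s x \<le> K * \<Gamma> s x" by (intro mult_right_mono \<Gamma>0)
    finally show ?thesis .
  qed
  define \<kappa> where "\<kappa> = (1 + \<kappa>\<^sub>1 * T + \<kappa>\<^sub>1) * K"
  have \<kappa>0: "0 \<le> \<kappa>" using \<kappa>1(1) T K1 by (simp add: \<kappa>_def)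
  have "norm (A' t x) \<le> \<kappa> * \<Gamma> t x \<and> norm (A s x) \<le> \<kappa> * \<Gamma> t x" if s: "s \<in> {0..T}" and t: "t \<in> {0..T}" and x: "x \<in> D" for s t x
  proof
    have "norm (A' t x) \<le> \<kappa>\<^sub>1 * (K * \<Gamma> t x)"
      using \<kappa>1(1) by (intro order_trans[OF A'\<Gamma>[OF t x] mult_left_mono[OF \<Gamma>0_le[OF t x]]]) simp
    also have "\<dots> = \<kappa>\<^sub>1 * K * \<Gamma> t x" by simp
    also have "\<dots> \<le> \<kappa> * \<Gamma> t x"
      using \<kappa>1(1) T K1 by (intro mult_right_mono \<Gamma>0) (auto simp: \<kappa>_def)
    finally show "norm (A' t x) \<le> \<kappa> * \<Gamma> t x" .
    have "norm (A s x) \<le> \<Gamma> s x" by (simp add: \<Gamma>_def)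
    also have "\<dots> \<le> \<Gamma> 0 x + \<kappa>\<^sub>1 * \<Gamma> 0 x * \<bar>s - 0\<bar>" by (rule \<Gamma>_lip[OF I0 s x])
    also have "\<dots> \<le> \<Gamma> 0 x + \<kappa>\<^sub>1 * \<Gamma> 0 x * T"
      using s \<kappa>1(1) \<Gamma>0 by (intro add_mono mult_left_mono order_refl) auto
    also have "\<dots> = (1 + \<kappa>\<^sub>1 * T) * \<Gamma> 0 x" by (simp add: algebra_simps)
    also have "\<dots> \<le> (1 + \<kappa>\<^sub>1 * T) * (K * \<Gamma> t x)"
      using \<Gamma>0_le[OF t x] \<kappa>1(1) T by (intro mult_left_mono) auto
    also have "\<dots> = (1 + \<kappa>\<^sub>1 * T) * K * \<Gamma> t x" by simp
    also have "\<dots> \<le> \<kappa> * \<Gamma> t x" unfolding \<kappa>_def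
      using \<kappa>1(1) K1 by (intro mult_right_mono \<Gamma>0) auto
    finally show "norm (A s x) \<le> \<kappa> * \<Gamma> t x" .
  qed
  then show ?thesis using \<kappa>0 unfolding \<Gamma>_def by blast
qed

text \<open>Insert \<open>x - (1 / m) *\<^sub>R L x\<close> into the nonnegative form; the upper
  bound of the form at \<open>L x\<close> then controls the norm. The hypotheses on \<open>M\<close>
  are bounds of the form only.\<close>

lemma norm_le_of_symmetric_bounds:
  fixes L :: "'a::real_inner \<Rightarrow> 'a"
  assumes lin: "linear L" and sym: "\<And>x y. inner (L x) y = inner x (L y)" and m: "0 < m"
    and nonneg: "\<And>x. 0 \<le> inner (L x) x" and le: "\<And>x. inner (L x) x \<le> m * (norm x)\<^sup>2"
  shows "norm (L x) \<le> m * norm x"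
proof -
  define y where "y = L x"
  have "0 \<le> inner (L (x - (1 / m) *\<^sub>R y)) (x - (1 / m) *\<^sub>R y)" by (rule nonneg)
  also have "\<dots> = inner (L x) x - (2 / m) * inner y y + (1 / m)\<^sup>2 * inner (L y) y"
    by (simp add: linear_diff[OF lin] linear_scale[OF lin] inner_diff_left inner_diff_right sym[of y x]
        power2_eq_square y_def[symmetric] inner_commute[of x y] algebra_simps)
  also have "\<dots> \<le> m * (norm x)\<^sup>2 - (2 / m) * inner y y + (1 / m)\<^sup>2 * (m * (norm y)\<^sup>2)"
    using m by (intro add_mono diff_mono mult_left_mono le) auto
  also have "\<dots> = m * (norm x)\<^sup>2 - (1 / m) * (norm y)\<^sup>2"
    using m by (simp add: power2_eq_square dot_square_norm field_simps)
  finally have "(norm y)\<^sup>2 \<le> (m * norm x)\<^sup>2" using m by (simp add: field_simps power2_eq_square)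
  then have "norm y \<le> m * norm x" by (rule power2_le_imp_le) (use m in simp)
  then show ?thesis by (simp add: y_def)
qed

section \<open>The closed-loop system\<close>

text \<open>Truncation along rays: \<open>y\<close> remains a nonnegative multiple of its
  projection, so the sign condition on \<open>g\<close> survives the composition.\<close>

definition radial_projection :: "real \<Rightarrow> 'a::real_normed_vector \<Rightarrow> 'a" where
  "radial_projection R y = (if norm y \<le> R then y else (R / norm y) *\<^sub>R y)"

lemma norm_radial_projection_le: "0 \<le> R \<Longrightarrow> norm (radial_projection R y) \<le> R"
  by (simp add: radial_projection_def)

lemma radial_projection_multiple: "0 < R \<Longrightarrow> \<exists>c\<ge>0. y = c *\<^sub>R radial_projection R y"
  by (cases "norm y \<le> R") (auto simp: radial_projection_def intro: exI[of _ 1] exI[of _ "norm y / R"])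

text \<open>The factor \<open>2\<close> needs the triangle inequality only; its value does not
  matter, since it just enters a Lipschitz constant of the truncated \<open>g\<close>.\<close>

lemma radial_projection_lipschitz:
  assumes R: "0 \<le> R" shows "norm (radial_projection R x - radial_projection R y) \<le> 2 * norm (x - y)"
proof -
  have mixed: "norm (x - (R / norm y) *\<^sub>R y) \<le> 2 * norm (x - y)" if "norm x \<le> R" "R < norm y" for x y :: 'a
  proof -
    have y0: "0 < norm y" using that R by linarith
    have "y - (R / norm y) *\<^sub>R y = (1 - R / norm y) *\<^sub>R y" by (simp add: scaleR_diff_left)
    then have "norm (y - (R / norm y) *\<^sub>R y) = \<bar>1 - R / norm y\<bar> * norm y" by simp
    also have "\<dots> = norm y - R" using y0 that by (simp add: field_simps abs_if)
    also have "\<dots> \<le> norm (x - y)" using that norm_triangle_ineq3[of x y] by linarith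
    finally show ?thesis using norm_triangle_ineq[of "x - y" "y - (R / norm y) *\<^sub>R y"] by simp
  qed
  have outer: "norm ((R / norm x) *\<^sub>R x - (R / norm y) *\<^sub>R y) \<le> 2 * norm (x - y)"
    if "R < norm x" "R < norm y" for x y :: 'a
  proof -
    have xy0: "0 < norm x" "0 < norm y" using that R by auto
    have "(R / norm x) *\<^sub>R x - (R / norm y) *\<^sub>R y = (R / norm x) *\<^sub>R ((x - y) + (1 - norm x / norm y) *\<^sub>R y)"
      using xy0 by (simp add: algebra_simps scaleR_diff_left)
    also have "norm \<dots> \<le> 1 * norm ((x - y) + (1 - norm x / norm y) *\<^sub>R y)"
      unfolding norm_scaleR using xy0 that R by (intro mult_right_mono) auto
    also have "\<dots> \<le> norm (x - y) + norm ((1 - norm x / norm y) *\<^sub>R y)" by (simp add: norm_triangle_ineq del: norm_scaleR)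
    also have "norm ((1 - norm x / norm y) *\<^sub>R y) = \<bar>(1 - norm x / norm y) * norm y\<bar>" by (simp add: abs_mult)
    also have "(1 - norm x / norm y) * norm y = norm y - norm x" using xy0 by (simp add: field_simps)
    also have "\<bar>norm y - norm x\<bar> \<le> norm (x - y)" using norm_triangle_ineq3[of y x] by (simp add: norm_minus_commute)
    finally show ?thesis by simp
  qed
  show ?thesis
    using mixed[of x y] mixed[of y x] outer[of x y] norm_ge_zero[of "x - y"]
    by (auto simp: radial_projection_def norm_minus_commute not_le)
qed



lemma C2_on_imp_C1_on:
  assumes "C2_on {0..} h" shows "C1_on {0..} h"
proof -
  obtain h' where h': "\<And>t. 0 \<le> t \<Longrightarrow> (h has_vector_derivative h' t) (at t within {0..})" "C1_on {0..} h'"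
    using assms unfolding C2_on_def by auto
  obtain h'' where "\<And>t. 0 \<le> t \<Longrightarrow> (h' has_vector_derivative h'' t) (at t within {0..})"
    using h'(2) unfolding C1_on_def by auto
  then have "continuous_on {0..} h'"
    by (auto simp: continuous_on_eq_continuous_within intro: has_vector_derivative_continuous)
  then show ?thesis using h'(1) unfolding C1_on_def by auto
qed

lemma C1_on_continuous: "C1_on {0..} h \<Longrightarrow> continuous_on {0..} h"
  unfolding C1_on_def by (auto simp: continuous_on_eq_continuous_within intro: has_vector_derivative_continuous)

text \<open>Derivatives within \<open>{0..T}\<close> and within the half-line agree except at the
  right end point; this is the bridge between bounded intervals and global solutions.\<close>

lemma at_within_Icc_0:
  assumes "0 \<le> t" "t < (T::real)" shows "at t within {0..T} = at t within {0..}"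
  by (rule at_within_nhd[of t "{..<T}"]) (use assms in auto)

lemma nonincreasing_imp_derivative_nonpos:
  fixes f :: "real \<Rightarrow> real"
  assumes f': "(f has_vector_derivative f') (at t within {a..b})" and ab: "a < b" "t \<in> {a..b}"
    and mono: "\<And>s t. a \<le> s \<Longrightarrow> s \<le> t \<Longrightarrow> t \<le> b \<Longrightarrow> f t \<le> f s"
  shows "f' \<le> 0"
proof -
  have "((\<lambda>s. (f s - f t) / (s - t)) \<longlongrightarrow> f') (at t within {a..b})"
    using f' by (simp add: has_real_derivative_iff_has_vector_derivative[symmetric] has_field_derivative_iff)
  moreover have "\<forall>\<^sub>F s in at t within {a..b}. (f s - f t) / (s - t) \<le> 0"
    unfolding eventually_at_filter
  proof (intro always_eventually allI impI)
    fix s assume "s \<noteq> t" "s \<in> {a..b}"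
    then show "(f s - f t) / (s - t) \<le> 0"
      using mono[of s t] mono[of t s] ab by (cases "s \<le> t") (auto intro: divide_nonneg_neg divide_nonneg_nonpos divide_nonpos_nonneg)
  qed
  moreover have "at t within {a..b} \<noteq> bot"
    using ab by (simp add: trivial_limit_within)
  ultimately show ?thesis by (intro tendsto_upperbound)
qed

locale closed_loop =
  fixes D\<^sub>0 :: "'x::{real_inner,complete_space} set"
    and A\<^sub>0 :: "real \<Rightarrow> 'x \<Rightarrow> 'x"
    and M :: "real \<Rightarrow> 'x \<Rightarrow>\<^sub>L 'x"
    and B :: "real \<Rightarrow> 'u::{real_inner,complete_space} \<Rightarrow>\<^sub>L 'x"
    and C :: "real \<Rightarrow> 'x \<Rightarrow>\<^sub>L 'u"
    and g :: "'u \<Rightarrow> 'u"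
    and D :: "real \<Rightarrow> 'x set"
    and A f :: "real \<Rightarrow> 'x \<Rightarrow> 'x"
    and m\<^sub>1 m\<^sub>2 \<zeta> :: real
  assumes A0_generator: "\<And>t. 0 \<le> t \<Longrightarrow> generates_contraction_semigroup D\<^sub>0 (A\<^sub>0 t)"
    and A0_C1: "\<And>x. x \<in> D\<^sub>0 \<Longrightarrow> C1_on {0..} (\<lambda>t. A\<^sub>0 t x)"
    and M_symmetric: "\<And>t x z. 0 \<le> t \<Longrightarrow> inner (M t x) z = inner x (M t z)"
    and m_pos: "0 < m\<^sub>1" "0 < m\<^sub>2"
    and M_bounds: "\<And>t x. 0 \<le> t \<Longrightarrow>
           m\<^sub>1 * (norm x)\<^sup>2 \<le> inner (M t x) x \<and> inner (M t x) x \<le> m\<^sub>2 * (norm x)\<^sup>2"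
    and M_C2: "\<And>x. C2_on {0..} (\<lambda>t. M t x)"
    and M_decreasing: "\<And>s t x. 0 \<le> s \<Longrightarrow> s \<le> t \<Longrightarrow> inner (M t x) x \<le> inner (M s x) x"
    and D_eq: "\<And>t. 0 \<le> t \<Longrightarrow> D t = {x. M t x \<in> D\<^sub>0}"
    and A_eq: "\<And>t x. 0 \<le> t \<Longrightarrow> x \<in> D t \<Longrightarrow> A t x = A\<^sub>0 t (M t x)"
    and C_eq: "\<And>t x. 0 \<le> t \<Longrightarrow> C t x = adjoint (B t) (M t x)"
    and B_locally_lipschitz:
          "\<And>t. 0 \<le> t \<Longrightarrow> \<exists>r>0. \<exists>L. L-lipschitz_on (cball t r \<inter> {0..}) B"
    and g_lipschitz: "\<And>S. bounded S \<Longrightarrow> \<exists>L. L-lipschitz_on S g"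
    and zeta_pos: "0 < \<zeta>"
    and g_damping: "\<And>y. \<zeta> * (norm y)\<^sup>2 \<le> inner y (g y)"
    and f_eq: "\<And>t x. 0 \<le> t \<Longrightarrow> f t x = - B t (g (adjoint (B t) (M t x)))"
begin

lemma M_norm_le: "0 \<le> t \<Longrightarrow> norm (M t x) \<le> m\<^sub>2 * norm x"
proof (rule norm_le_of_symmetric_bounds)
  show "linear (M t)" by (rule bounded_linear.linear[OF blinfun.bounded_linear_right])
  show "0 \<le> inner (M t x) x" if "0 \<le> t" for x
    using M_bounds[OF that, of x] m_pos by (smt (verit) mult_nonneg_nonneg zero_le_power2)
qed (use M_symmetric M_bounds m_pos in auto)

text \<open>Derivatives are chosen on the half-line and then restricted. Uniform boundedness is used
  once for \<open>M\<close> and then for its derivative, whose bounded linearity comes from the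
  first use; \<open>\<kappa>\<close> is the sum of the three constants so obtained.\<close>

lemma evolution_system_exists:
  assumes T: "0 < T"
  shows "\<exists>A' M' M'' \<kappa>. evolution_system D\<^sub>0 A\<^sub>0 A' (\<lambda>t. M t) M' M'' T m\<^sub>1 m\<^sub>2 \<kappa>"
proof -
  have sub: "(h has_vector_derivative h') (at t within {0..T})"
    if "(h has_vector_derivative h') (at t within {0..})" for h :: "real \<Rightarrow> 'x" and h' t
    using that by (rule has_vector_derivative_within_subset) auto
  have csub: "continuous_on {0..T} h" if "continuous_on {0..} h" for h :: "real \<Rightarrow> 'x"
    using that by (rule continuous_on_subset) auto
  have "\<forall>x. \<exists>h'. x \<in> D\<^sub>0 \<longrightarrow> (\<forall>t\<ge>0. ((\<lambda>t. A\<^sub>0 t x) has_vector_derivative h' t) (at t within {0..})) \<and> continuous_on {0..} h'"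
    using A0_C1 unfolding C1_on_def by (metis atLeast_iff)
  then obtain a' where a': "\<And>x t. x \<in> D\<^sub>0 \<Longrightarrow> 0 \<le> t \<Longrightarrow> ((\<lambda>t. A\<^sub>0 t x) has_vector_derivative a' x t) (at t within {0..})"
    "\<And>x. x \<in> D\<^sub>0 \<Longrightarrow> continuous_on {0..} (a' x)" by metis
  have "\<forall>x. \<exists>h'. (\<forall>t\<ge>0. ((\<lambda>t. M t x) has_vector_derivative h' t) (at t within {0..})) \<and> C1_on {0..} h'"
    using M_C2 unfolding C2_on_def by (metis atLeast_iff)
  then obtain m' where m': "\<And>x t. 0 \<le> t \<Longrightarrow> ((\<lambda>t. M t x) has_vector_derivative m' x t) (at t within {0..})"
    "\<And>x. C1_on {0..} (m' x)" by metis
  have "\<forall>x. \<exists>h'. (\<forall>t\<ge>0. (m' x has_vector_derivative h' t) (at t within {0..})) \<and> continuous_on {0..} h'"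
    using m'(2) unfolding C1_on_def by (metis atLeast_iff)
  then obtain m'' where m'': "\<And>x t. 0 \<le> t \<Longrightarrow> (m' x has_vector_derivative m'' x t) (at t within {0..})"
    "\<And>x. continuous_on {0..} (m'' x)" by metis
  have diss: "m_dissipative D\<^sub>0 (A\<^sub>0 t)" if "t \<in> {0..T}" for t
    using generates_contraction_semigroup_imp_m_dissipative[OF A0_generator] that by auto
  have dA: "((\<lambda>t. A\<^sub>0 t x) has_vector_derivative a' x t) (at t within {0..T})" if "t \<in> {0..T}" "x \<in> D\<^sub>0" for t x
    using a'(1)[OF that(2)] that(1) by (intro sub) auto
  have cA: "continuous_on {0..T} (\<lambda>t. a' x t)" if "x \<in> D\<^sub>0" for x using a'(2)[OF that] by (rule csub)
  have dM: "((\<lambda>t. M t x) has_vector_derivative m' x t) (at t within {0..T})" if "t \<in> {0..T}" for t x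
    using m'(1) that by (intro sub) auto
  have dM': "((\<lambda>t. m' x t) has_vector_derivative m'' x t) (at t within {0..T})" if "t \<in> {0..T}" for t x
    using m''(1) that by (intro sub) auto
  have cM': "continuous_on {0..T} (\<lambda>t. m' x t)" for x using C1_on_continuous[OF m'(2)] by (rule csub)
  have cM'': "continuous_on {0..T} (\<lambda>t. m'' x t)" for x using m''(2) by (rule csub)
  obtain \<kappa>\<^sub>1 where \<kappa>1: "0 \<le> \<kappa>\<^sub>1" "\<And>s t x. s \<in> {0..T} \<Longrightarrow> t \<in> {0..T} \<Longrightarrow> x \<in> D\<^sub>0 \<Longrightarrow>
      norm (a' x t) \<le> \<kappa>\<^sub>1 * (norm x + norm (A\<^sub>0 t x)) \<and> norm (A\<^sub>0 s x) \<le> \<kappa>\<^sub>1 * (norm x + norm (A\<^sub>0 t x))"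
    using graph_norms_equivalent[where A="A\<^sub>0" and A'="\<lambda>t x. a' x t", OF T diss dA cA] by blast
  obtain \<kappa>\<^sub>2 where \<kappa>2: "0 < \<kappa>\<^sub>2" "\<And>t. t \<in> {0..T} \<Longrightarrow> bounded_linear (\<lambda>x. m' x t)"
      "\<And>t x. t \<in> {0..T} \<Longrightarrow> norm (m' x t) \<le> \<kappa>\<^sub>2 * norm x"
    using strong_derivative_bounded[where L="\<lambda>t. M t" and L'="\<lambda>t x. m' x t", OF T blinfun.bounded_linear_right dM cM'] by blast
  obtain \<kappa>\<^sub>3 where \<kappa>3: "0 < \<kappa>\<^sub>3" "\<And>t. t \<in> {0..T} \<Longrightarrow> bounded_linear (\<lambda>x. m'' x t)"
      "\<And>t x. t \<in> {0..T} \<Longrightarrow> norm (m'' x t) \<le> \<kappa>\<^sub>3 * norm x"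
    using strong_derivative_bounded[where L="\<lambda>t x. m' x t" and L'="\<lambda>t x. m'' x t", OF T \<kappa>2(2) dM' cM''] by blast
  define \<kappa> where "\<kappa> = \<kappa>\<^sub>1 + \<kappa>\<^sub>2 + \<kappa>\<^sub>3"
  have \<kappa>: "0 \<le> \<kappa>" "\<kappa>\<^sub>1 \<le> \<kappa>" "\<kappa>\<^sub>2 \<le> \<kappa>" "\<kappa>\<^sub>3 \<le> \<kappa>" using \<kappa>1(1) \<kappa>2(1) \<kappa>3(1) by (auto simp: \<kappa>_def)
  have "evolution_system D\<^sub>0 A\<^sub>0 (\<lambda>t x. a' x t) (\<lambda>t. M t) (\<lambda>t x. m' x t) (\<lambda>t x. m'' x t) T m\<^sub>1 m\<^sub>2 \<kappa>"
  proof (rule evolution_system.intro)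
    fix s t x assume st: "s \<in> {0..T}" "t \<in> {0..T}" and x: "x \<in> D\<^sub>0"
    show "norm (A\<^sub>0 s x) \<le> \<kappa> * (norm x + norm (A\<^sub>0 t x))"
      using \<kappa>1(2)[OF st x] mult_right_mono[OF \<kappa>(2), of "norm x + norm (A\<^sub>0 t x)"] by fastforce
  next
    fix t x assume t: "t \<in> {0..T}"
    show "norm (a' x t) \<le> \<kappa> * (norm x + norm (A\<^sub>0 t x))" if "x \<in> D\<^sub>0"
      using \<kappa>1(2)[OF t t that] mult_right_mono[OF \<kappa>(2), of "norm x + norm (A\<^sub>0 t x)"] by fastforce
    show "norm (m' x t) \<le> \<kappa> * norm x"
      using \<kappa>2(3)[OF t, of x] mult_right_mono[OF \<kappa>(3), of "norm x"] by simp
    show "norm (m'' x t) \<le> \<kappa> * norm x"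
      using \<kappa>3(3)[OF t, of x] mult_right_mono[OF \<kappa>(4), of "norm x"] by simp
    show "norm (M t x) \<le> m\<^sub>2 * norm x" using M_norm_le t by simp
    show "m\<^sub>1 * (norm x)\<^sup>2 \<le> inner (M t x) x" using M_bounds t by simp
    have "((\<lambda>t. inner (M t x) x) has_vector_derivative inner (m' x t) x) (at t within {0..T})"
      by (rule bounded_linear.has_vector_derivative[OF bounded_linear_inner_left dM[OF t]])
    then show "inner (m' x t) x \<le> 0"
      by (rule nonincreasing_imp_derivative_nonpos[OF _ T t]) (use M_decreasing in auto)
    show "inner (M t x) y = inner x (M t y)" for y using M_symmetric t by simp
  qed (rule T m_pos \<kappa>(1) diss dA cA dM dM' cM'' \<kappa>2(2) \<kappa>3(2) blinfun.bounded_linear_right; assumption)+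
  then show ?thesis by blast
qed

text \<open>A finite subcover of the interval by neighbourhoods of local Lipschitz continuity; the
  maximum of the local constants works globally, as increments add up along the interval.\<close>

lemma B_lipschitz:
  assumes T: "0 < T" shows "\<exists>L\<ge>0. \<forall>s\<in>{0..T}. \<forall>t\<in>{0..T}. norm (B t - B s) \<le> L * \<bar>t - s\<bar>"
proof -
  have "\<forall>t. \<exists>r. 0 \<le> t \<longrightarrow> 0 < r \<and> (\<exists>L. L-lipschitz_on (cball t r \<inter> {0..}) B)"
    using B_locally_lipschitz by blast
  then obtain r where r: "\<And>t. 0 \<le> t \<Longrightarrow> 0 < r t" "\<And>t. 0 \<le> t \<Longrightarrow> \<exists>L. L-lipschitz_on (cball t (r t) \<inter> {0..}) B"
    by metis
  then obtain l where l: "\<And>t. 0 \<le> t \<Longrightarrow> (l t)-lipschitz_on (cball t (r t) \<inter> {0..}) B" by metis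
  have "{0..T} \<subseteq> (\<Union>t\<in>{0..T}. ball t (r t))" using r(1) by force
  then obtain k where k: "k \<subseteq> {0..T}" "finite k" "{0..T} \<subseteq> (\<Union>t\<in>k. ball t (r t))"
    using compactE_image[of "{0..T}" "{0..T}" "\<lambda>t. ball t (r t)"] open_ball compact_Icc by metis
  define L where "L = Max (insert 0 (l ` k))"
  have L0: "0 \<le> L" unfolding L_def using k(2) by (intro Max_ge) auto
  have "L-lipschitz_on {0..T} B"
  proof (rule lipschitz_on_closed_Union[where I=k and U="\<lambda>t. cball t (r t) \<inter> {0..}"])
    show "L-lipschitz_on (cball t (r t) \<inter> {0..}) B" if "t \<in> k" for t
    proof (rule lipschitz_on_le[OF l])
      show "l t \<le> L" unfolding L_def using k(2) that by (intro Max_ge) auto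
    qed (use k(1) that in auto)
    show "{0..T} \<subseteq> (\<Union>t\<in>k. cball t (r t) \<inter> {0..})"
    proof
      fix s assume s: "s \<in> {0..T}"
      then obtain t where "t \<in> k" "s \<in> ball t (r t)" using k(3) by blast
      then show "s \<in> (\<Union>t\<in>k. cball t (r t) \<inter> {0..})" using s by (intro UN_I[of t]) auto
    qed
  qed (use k L0 in auto)
  then show ?thesis using L0 lipschitz_on_normD[of L "{0..T}" B] by (intro exI[of _ L]) fastforce
qed

lemma B_continuous: "continuous_on {0..} B"
  unfolding continuous_on_eq_continuous_within
proof
  fix t :: real assume t: "t \<in> {0..}"
  then obtain L where L: "0 \<le> L" "\<And>a b. a \<in> {0..t + 1} \<Longrightarrow> b \<in> {0..t + 1} \<Longrightarrow> norm (B b - B a) \<le> L * \<bar>b - a\<bar>"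
    using B_lipschitz[of "t + 1"] by auto
  have "L-lipschitz_on {0..t + 1} B" by (rule lipschitz_onI) (use L in \<open>auto simp: dist_norm\<close>)
  then have "continuous_on {0..t + 1} B" by (rule lipschitz_on_continuous_on)
  then have "continuous (at t within {0..t + 1}) B" using t by (simp add: continuous_on_eq_continuous_within)
  then show "continuous (at t within {0..}) B" using at_within_Icc_0[of t "t + 1"] t by simp
qed

lemma B_bounded: "\<exists>b\<ge>0. \<forall>t\<in>{0..T}. norm (B t) \<le> b"
proof -
  have "bounded (B ` {0..T})"
    by (intro compact_imp_bounded compact_continuous_image continuous_on_subset[OF B_continuous]) auto
  then obtain b where "\<forall>x\<in>B ` {0..T}. norm x \<le> b" unfolding bounded_iff by blast
  then show ?thesis by (intro exI[of _ "max 0 b"]) (auto intro: max.coboundedI2)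
qed

lemma g_continuous: "continuous_on UNIV g"
proof -
  have "continuous (at y) g" for y
  proof -
    obtain L where "L-lipschitz_on (ball y 1) g" using g_lipschitz[of "ball y 1"] by auto
    then have "continuous_on (ball y 1) g" by (rule lipschitz_on_continuous_on)
    then show ?thesis by (simp add: continuous_on_eq_continuous_at)
  qed
  then show ?thesis by (simp add: continuous_on_eq_continuous_at)
qed

lemma adjoint_B_continuous:
  assumes z: "continuous_on S z" and S: "S \<subseteq> {0..}"
  shows "continuous_on S (\<lambda>t. adjoint (B t) (z t))"
  unfolding continuous_on_def
proof
  fix t assume t: "t \<in> S"
  have Bt: "((\<lambda>s. B s) \<longlongrightarrow> B t) (at t within S)"
    using continuous_on_subset[OF B_continuous S] t by (simp add: continuous_on_def)
  have zt: "(z \<longlongrightarrow> z t) (at t within S)" using z t by (simp add: continuous_on_def)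
  have "((\<lambda>s. norm (B s) * norm (z s - z t) + norm (B s - B t) * norm (z t)) \<longlongrightarrow>
      norm (B t) * norm (z t - z t) + norm (B t - B t) * norm (z t)) (at t within S)"
    by (intro tendsto_intros Bt zt)
  then have lim: "((\<lambda>s. norm (B s) * norm (z s - z t) + norm (B s - B t) * norm (z t)) \<longlongrightarrow> 0) (at t within S)" by simp
  have "((\<lambda>s. adjoint (B s) (z s) - adjoint (B t) (z t)) \<longlongrightarrow> 0) (at t within S)"
  proof (rule Lim_null_comparison[OF always_eventually lim], rule allI)
    fix s
    have "adjoint (B s) (z s) - adjoint (B t) (z t) = adjoint (B s) (z s - z t) + adjoint (B s - B t) (z t)"
      by (simp add: adjoint_diff_argument flip: adjoint_diff_operator)
    then show "norm (adjoint (B s) (z s) - adjoint (B t) (z t)) \<le> norm (B s) * norm (z s - z t) + norm (B s - B t) * norm (z t)"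
      by (metis add_mono norm_adjoint_le norm_triangle_le)
  qed
  then show "((\<lambda>s. adjoint (B s) (z s)) \<longlongrightarrow> adjoint (B t) (z t)) (at t within S)" by (simp add: LIM_zero_iff)
qed

lemma Mx_continuous:
  assumes x: "continuous_on {0..T} x" and T: "0 < T" shows "continuous_on {0..T} (\<lambda>t. M t (x t))"
proof -
  obtain A' M' M'' \<kappa> where "evolution_system D\<^sub>0 A\<^sub>0 A' (\<lambda>t. M t) M' M'' T m\<^sub>1 m\<^sub>2 \<kappa>"
    using evolution_system_exists[OF T] by blast
  then interpret E: evolution_system D\<^sub>0 A\<^sub>0 A' "\<lambda>t. M t" M' M'' T m\<^sub>1 m\<^sub>2 \<kappa> .
  show ?thesis by (rule E.continuous_on_operators(1)[OF x])
qed

lemma Cx_continuous: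
  assumes x: "continuous_on {0..T} x" and T: "0 < T" shows "continuous_on {0..T} (\<lambda>t. C t (x t))"
proof -
  have "continuous_on {0..T} (\<lambda>t. adjoint (B t) (M t (x t)))"
    by (intro adjoint_B_continuous Mx_continuous x T) auto
  then show ?thesis by (rule continuous_on_eq) (simp add: C_eq)
qed

lemma Bu_continuous:
  assumes u: "continuous_on {0..T} u" shows "continuous_on {0..T} (\<lambda>t. B t (u t))"
  by (intro blinfun.continuous_on u continuous_on_subset[OF B_continuous]) auto

lemma fx_continuous:
  assumes x: "continuous_on {0..T} x" and T: "0 < T" shows "continuous_on {0..T} (\<lambda>t. f t (x t))"
proof -
  have "continuous_on {0..T} (\<lambda>t. g (C t (x t)))"
    by (rule continuous_on_compose2[OF g_continuous Cx_continuous[OF x T]]) auto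
  then have "continuous_on {0..T} (\<lambda>t. - B t (g (C t (x t))))"
    by (intro continuous_on_minus Bu_continuous)
  then show ?thesis by (rule continuous_on_eq) (simp add: C_eq f_eq)
qed

text \<open>The closed-loop equation on a bounded interval, written with \<open>D\<^sub>0\<close>,
  \<open>A\<^sub>0\<close> and \<open>M\<close>, where the evolution system applies. The initial
  value is kept separate.\<close>

definition sol_on where
  "sol_on T u x \<longleftrightarrow> (\<forall>t\<in>{0..T}. M t (x t) \<in> D\<^sub>0 \<and>
     (x has_vector_derivative A\<^sub>0 t (M t (x t)) + f t (x t) + B t (u t)) (at t within {0..T}))"

lemma sol_on_continuous: "sol_on T u x \<Longrightarrow> continuous_on {0..T} x"
  unfolding sol_on_def by (auto simp: continuous_on_eq_continuous_within intro: has_vector_derivative_continuous)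

lemma norm_C_le: "0 \<le> t \<Longrightarrow> norm (C t x) \<le> norm (B t) * (m\<^sub>2 * norm x)"
  unfolding C_eq by (rule order_trans[OF norm_adjoint_le mult_left_mono[OF M_norm_le]]) auto

lemma f_lipschitz:
  assumes T: "0 < T"
  shows "\<exists>c\<ge>0. \<forall>t\<in>{0..T}. \<forall>x y. norm x \<le> r \<longrightarrow> norm y \<le> r \<longrightarrow> norm (f t x - f t y) \<le> c * norm (x - y)"
proof -
  obtain b where b: "0 \<le> b" "\<And>t. t \<in> {0..T} \<Longrightarrow> norm (B t) \<le> b" using B_bounded[of T] by blast
  obtain L where L: "L-lipschitz_on (cball 0 (b * (m\<^sub>2 * \<bar>r\<bar>))) g" using g_lipschitz[of "cball 0 (b * (m\<^sub>2 * \<bar>r\<bar>))"] by auto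
  have L0: "0 \<le> L" by (rule lipschitz_on_nonneg[OF L])
  have Cb: "norm (C t x) \<le> b * (m\<^sub>2 * norm x)" if "t \<in> {0..T}" for t x
    by (rule order_trans[OF norm_C_le mult_right_mono[OF b(2)[OF that]]]) (use that m_pos in auto)
  have "norm (f t x - f t y) \<le> (b * (L * (b * m\<^sub>2))) * norm (x - y)"
    if t: "t \<in> {0..T}" and x: "norm x \<le> r" and y: "norm y \<le> r" for t x y
  proof -
    have in_ball: "C t z \<in> cball 0 (b * (m\<^sub>2 * \<bar>r\<bar>))" if "norm z \<le> r" for z
    proof -
      have "norm (C t z) \<le> b * (m\<^sub>2 * norm z)" by (rule Cb[OF t])
      also have "\<dots> \<le> b * (m\<^sub>2 * \<bar>r\<bar>)" using that b(1) m_pos by (intro mult_left_mono) auto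
      finally show ?thesis by simp
    qed
    have "f t x - f t y = - B t (g (C t x) - g (C t y))"
      using t by (simp add: f_eq C_eq blinfun.diff_right)
    also have "norm \<dots> \<le> b * norm (g (C t x) - g (C t y))"
      using norm_blinfun[of "B t" "g (C t x) - g (C t y)"] mult_right_mono[OF b(2)[OF t], of "norm (g (C t x) - g (C t y))"] by simp
    also have "\<dots> \<le> b * (L * norm (C t x - C t y))"
      by (intro mult_left_mono lipschitz_on_normD[OF L] in_ball x y b)
    also have "norm (C t x - C t y) \<le> b * (m\<^sub>2 * norm (x - y))"
      using Cb[OF t, of "x - y"] by (simp add: blinfun.diff_right)
    then have "b * (L * norm (C t x - C t y)) \<le> b * (L * (b * (m\<^sub>2 * norm (x - y))))"
      by (intro mult_left_mono b L0)
    finally show ?thesis by (simp add: mult_ac)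
  qed
  moreover have "0 \<le> b * (L * (b * m\<^sub>2))" using b(1) L0 m_pos by simp
  ultimately show ?thesis by blast
qed

text \<open>
  The damping makes the nonlinearity dissipative, which bounds the solution independently of any
  truncation of \<open>g\<close>; truncating beyond this bound turns \<open>g\<close> into a globally Lipschitz function.
\<close>

lemma sol_on_exists:
  assumes T: "0 < T" and x0: "M 0 x0 \<in> D\<^sub>0" and u: "C1_on {0..} u"
  shows "\<exists>x. x 0 = x0 \<and> sol_on T u x \<and> continuous_on {0..T} (\<lambda>t. A\<^sub>0 t (M t (x t)))"
proof -
  obtain A' M' M'' \<kappa> where "evolution_system D\<^sub>0 A\<^sub>0 A' (\<lambda>t. M t) M' M'' T m\<^sub>1 m\<^sub>2 \<kappa>"
    using evolution_system_exists[OF T] by blast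
  then interpret E: evolution_system D\<^sub>0 A\<^sub>0 A' "\<lambda>t. M t" M' M'' T m\<^sub>1 m\<^sub>2 \<kappa> .
  obtain b where b: "0 \<le> b" "\<And>t. t \<in> {0..T} \<Longrightarrow> norm (B t) \<le> b" using B_bounded[of T] by blast
  obtain \<beta> where \<beta>: "0 \<le> \<beta>" "\<And>s t. s \<in> {0..T} \<Longrightarrow> t \<in> {0..T} \<Longrightarrow> norm (B t - B s) \<le> \<beta> * \<bar>t - s\<bar>"
    using B_lipschitz[OF T] by blast
  have uc: "continuous_on {0..T} u" by (rule continuous_on_subset[OF C1_on_continuous[OF u]]) auto
  obtain v where v: "\<And>t. t \<in> {0..T} \<Longrightarrow> norm (u t) \<le> v"
    using compact_continuous_image[OF uc compact_Icc, THEN compact_imp_bounded] unfolding bounded_iff by blast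
  have v0: "0 \<le> v" using order_trans[OF norm_ge_zero v[of 0]] T by simp
  obtain u' where u': "\<And>t. 0 \<le> t \<Longrightarrow> (u has_vector_derivative u' t) (at t within {0..})" "continuous_on {0..} u'"
    using u unfolding C1_on_def by auto
  have u'c: "continuous_on {0..T} u'" by (rule continuous_on_subset[OF u'(2)]) auto
  obtain v' where v': "\<And>t. t \<in> {0..T} \<Longrightarrow> norm (u' t) \<le> v'"
    using compact_continuous_image[OF u'c compact_Icc, THEN compact_imp_bounded] unfolding bounded_iff by blast
  have v'0: "0 \<le> v'" using order_trans[OF norm_ge_zero v'[of 0]] T by simp
  have lip: "norm (h t - h s) \<le> k * \<bar>t - s\<bar>"
    if h': "\<And>t. t \<in> {0..T} \<Longrightarrow> (h has_vector_derivative h' t) (at t within {0..T})"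
      and k: "\<And>t. t \<in> {0..T} \<Longrightarrow> norm (h' t) \<le> k" and st: "s \<in> {0..T}" "t \<in> {0..T}"
    for h h' :: "real \<Rightarrow> 'c::real_normed_vector" and k s t
  proof -
    have "norm (h d - h a) \<le> k * (d - a)" if "a \<in> {0..T}" "d \<in> {0..T}" "a \<le> d" for a d
      by (rule vector_mvt_bound_const[OF that(3), where f'=h'])
         (use that k in \<open>auto intro!: has_vector_derivative_within_subset[OF h']\<close>)
    from this[OF st] this[OF st(2,1)] show ?thesis
      by (cases "s \<le> t") (auto simp: norm_minus_commute)
  qed
  have u_lip: "norm (u t - u s) \<le> v' * \<bar>t - s\<bar>" if "s \<in> {0..T}" "t \<in> {0..T}" for s t
  proof -
    have "norm (u d - u a) \<le> v' * (d - a)" if "a \<in> {0..T}" "d \<in> {0..T}" "a \<le> d" for a d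
      by (rule vector_mvt_bound_const[OF that(3), where f'=u'])
         (use that v' in \<open>auto intro!: has_vector_derivative_within_subset[OF u'(1)]\<close>)
    from this[OF that] this[OF that(2,1)] show ?thesis
      by (cases "s \<le> t") (auto simp: norm_minus_commute)
  qed
  have M_lip: "norm (M t x - M s x) \<le> \<kappa> * norm x * \<bar>t - s\<bar>" if "s \<in> {0..T}" "t \<in> {0..T}" for s t x
    by (rule lip[OF E.M_deriv E.M'_norm that])
  \<comment> \<open>Obtained from the input term alone: the truncated damping contributes with the
    right sign and is dropped. Hence the bound does not depend on \<open>R\<close>, and choosing
    \<open>R\<close> from it is not circular.\<close>
  define \<rho> where "\<rho> = E.c\<^sub>0 * (norm x0 + T * (b * v))"
  have \<rho>0: "0 \<le> \<rho>" using E.c0_ge T b(1) v0 by (simp add: \<rho>_def)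
  \<comment> \<open>Exceeds the norm of \<open>C t x\<close> on the ball of radius
    \<open>\<rho>\<close>, so the truncation is inactive along the solution.\<close>
  define R where "R = b * (m\<^sub>2 * \<rho>) + 1"
  have R: "0 < R" using b(1) m_pos \<rho>0 by (simp add: R_def add_nonneg_pos)
  define g' where "g' y = g (radial_projection R y)" for y
  obtain L where L: "L-lipschitz_on (cball 0 R) g" using g_lipschitz[of "cball 0 R"] by auto
  have L0: "0 \<le> L" by (rule lipschitz_on_nonneg[OF L])
  have proj_in: "radial_projection R y \<in> cball 0 R" for y :: 'u
    using norm_radial_projection_le[of R y] R by simp
  have g'_lip: "norm (g' y - g' z) \<le> 2 * L * norm (y - z)" for y z
  proof -
    have "norm (g' y - g' z) \<le> L * norm (radial_projection R y - radial_projection R z)"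
      unfolding g'_def by (rule lipschitz_on_normD[OF L proj_in proj_in])
    also have "\<dots> \<le> L * (2 * norm (y - z))"
      using radial_projection_lipschitz[of R y z] R L0 by (intro mult_left_mono) auto
    finally show ?thesis by simp
  qed
  define G where "G = norm (g 0) + L * R"
  have G: "norm (g' y) \<le> G" for y
  proof -
    have "norm (g (radial_projection R y) - g 0) \<le> L * norm (radial_projection R y - 0)"
      by (rule lipschitz_on_normD[OF L proj_in]) (use R in auto)
    also have "\<dots> \<le> L * R" using norm_radial_projection_le[of R y] R L0 by (intro mult_left_mono) auto
    finally show ?thesis
      using norm_triangle_ineq[of "g (radial_projection R y) - g 0" "g 0"] by (simp add: g'_def G_def)
  qed
  have g'_damping: "0 \<le> inner y (g' y)" for y
  proof -
    obtain c where c: "0 \<le> c" "y = c *\<^sub>R radial_projection R y" using radial_projection_multiple[OF R] by blast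
    have "0 \<le> \<zeta> * (norm (radial_projection R y))\<^sup>2" using zeta_pos by simp
    then have "0 \<le> inner (radial_projection R y) (g' y)" using g_damping[of "radial_projection R y"] by (simp add: g'_def)
    then have "0 \<le> inner (c *\<^sub>R radial_projection R y) (g' y)" using c(1) by simp
    then show ?thesis using c(2) by simp
  qed
  define N where "N t x = - B t (g' (C t x)) + B t (u t)" for t x
  have B_le: "norm (B t w) \<le> b * norm w" if "t \<in> {0..T}" for t w
    using norm_blinfun[of "B t" w] mult_right_mono[OF b(2)[OF that], of "norm w"] by simp
  have N_bound: "norm (N t x) \<le> b * G + b * v" if t: "t \<in> {0..T}" for t x
  proof -
    have "norm (N t x) \<le> norm (B t (g' (C t x))) + norm (B t (u t))"
      unfolding N_def using norm_triangle_ineq[of "- B t (g' (C t x))" "B t (u t)"] by simp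
    also have "\<dots> \<le> b * G + b * v"
      by (intro add_mono order_trans[OF B_le[OF t]] mult_left_mono G v t b)
    finally show ?thesis .
  qed
  have Bdiff: "norm (B t y - B s z) \<le> \<beta> * \<bar>t - s\<bar> * norm y + b * norm (y - z)"
    if st: "s \<in> {0..T}" "t \<in> {0..T}" for s t y z
  proof -
    have "B t y - B s z = (B t - B s) y + B s (y - z)" by (simp add: blinfun.diff_left blinfun.diff_right)
    also have "norm \<dots> \<le> norm (B t - B s) * norm y + b * norm (y - z)"
      by (intro norm_triangle_mono norm_blinfun B_le st)
    also have "\<dots> \<le> \<beta> * \<bar>t - s\<bar> * norm y + b * norm (y - z)"
      using \<beta>(2)[OF st] by (intro add_mono mult_right_mono) auto
    finally show ?thesis .
  qed
  have N_lip: "\<exists>c\<ge>0. \<forall>s\<in>{0..T}. \<forall>t\<in>{0..T}. \<forall>x y. norm x \<le> r \<longrightarrow> norm y \<le> r \<longrightarrow>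
      norm (N t x - N s y) \<le> c * (\<bar>t - s\<bar> + norm (x - y))" for r
  proof -
    \<comment> \<open>A Lipschitz constant, jointly in time and state, of \<open>C t x\<close> on
      the ball of radius \<open>\<bar>r\<bar>\<close>: the summands account for the variation of
      \<open>B\<close>, of \<open>M\<close> and of the state.\<close>
    define c\<^sub>1 where "c\<^sub>1 = \<beta> * (m\<^sub>2 * \<bar>r\<bar>) + b * (\<kappa> * \<bar>r\<bar>) + b * m\<^sub>2"
    have c1: "0 \<le> c\<^sub>1" using \<beta>(1) b(1) m_pos E.\<kappa> by (simp add: c\<^sub>1_def)
    define c where "c = \<beta> * G + b * (2 * L * c\<^sub>1) + (\<beta> * v + b * v')"
    have G0: "0 \<le> G" using order_trans[OF norm_ge_zero G[of 0]] .
    have c0: "0 \<le> c" using \<beta>(1) b(1) G0 L0 c1 v0 v'0 by (simp add: c_def)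
    have "norm (N t x - N s y) \<le> c * (\<bar>t - s\<bar> + norm (x - y))"
      if st: "s \<in> {0..T}" "t \<in> {0..T}" and x: "norm x \<le> r" and y: "norm y \<le> r" for s t x y
    proof -
      define \<tau> where "\<tau> = \<bar>t - s\<bar> + norm (x - y)"
      have \<tau>: "\<bar>t - s\<bar> \<le> \<tau>" "norm (x - y) \<le> \<tau>" "0 \<le> \<tau>" by (auto simp: \<tau>_def)
      have r: "norm x \<le> \<bar>r\<bar>" using x by simp
      have M_diff: "norm (M t x - M s y) \<le> \<kappa> * \<bar>r\<bar> * \<tau> + m\<^sub>2 * \<tau>"
      proof -
        have "M t x - M s y = (M t x - M s x) + M s (x - y)" by (simp add: blinfun.diff_right)
        also have "norm \<dots> \<le> \<kappa> * norm x * \<bar>t - s\<bar> + m\<^sub>2 * norm (x - y)"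
          using M_lip[OF st] M_norm_le[of s] st by (intro norm_triangle_mono) auto
        also have "\<dots> \<le> \<kappa> * \<bar>r\<bar> * \<tau> + m\<^sub>2 * \<tau>"
          using r \<tau> E.\<kappa> m_pos by (intro add_mono mult_mono mult_nonneg_nonneg) auto
        finally show ?thesis .
      qed
      have C_diff: "norm (C t x - C s y) \<le> c\<^sub>1 * \<tau>"
      proof -
        have "C t x - C s y = adjoint (B t - B s) (M t x) + adjoint (B s) (M t x - M s y)"
          using st by (simp add: C_eq adjoint_diff_argument flip: adjoint_diff_operator)
        also have "norm \<dots> \<le> norm (B t - B s) * norm (M t x) + norm (B s) * norm (M t x - M s y)"
          by (intro norm_triangle_mono norm_adjoint_le)
        also have "\<dots> \<le> (\<beta> * \<tau>) * (m\<^sub>2 * \<bar>r\<bar>) + b * (\<kappa> * \<bar>r\<bar> * \<tau> + m\<^sub>2 * \<tau>)"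
        proof (intro add_mono mult_mono M_diff b st)
          show "norm (B t - B s) \<le> \<beta> * \<tau>" using \<beta>(2)[OF st] mult_left_mono[OF \<tau>(1) \<beta>(1)] by simp
          show "norm (M t x) \<le> m\<^sub>2 * \<bar>r\<bar>"             by (rule order_trans[OF M_norm_le mult_left_mono[OF r]]) (use st m_pos in auto)
        qed (use \<beta>(1) \<tau> b m_pos in auto)
        finally show ?thesis by (simp add: c\<^sub>1_def algebra_simps)
      qed
      have "N t x - N s y = - (B t (g' (C t x)) - B s (g' (C s y))) + (B t (u t) - B s (u s))" by (simp add: N_def)
      also have "norm \<dots> \<le> norm (B t (g' (C t x)) - B s (g' (C s y))) + norm (B t (u t) - B s (u s))"
        by (metis norm_minus_cancel norm_triangle_ineq)
      also have "\<dots> \<le> (\<beta> * \<bar>t - s\<bar> * norm (g' (C t x)) + b * norm (g' (C t x) - g' (C s y))) + (\<beta> * \<bar>t - s\<bar> * norm (u t) + b * norm (u t - u s))"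
        by (intro add_mono Bdiff st)
      also have "\<dots> \<le> (\<beta> * \<tau> * G + b * (2 * L * (c\<^sub>1 * \<tau>))) + (\<beta> * \<tau> * v + b * (v' * \<tau>))"
      proof (intro add_mono mult_mono mult_left_mono G v st order_refl \<tau>(1) mult_nonneg_nonneg \<beta>(1) b(1) \<tau>(3))
        show "norm (g' (C t x) - g' (C s y)) \<le> 2 * L * (c\<^sub>1 * \<tau>)"
          using g'_lip[of "C t x" "C s y"] mult_left_mono[OF C_diff, of "2 * L"] L0 by simp
        show "norm (u t - u s) \<le> v' * \<tau>" using u_lip[OF st] mult_left_mono[OF \<tau>(1) v'0] by simp
      qed auto
      also have "\<dots> = c * \<tau>" by (simp add: c_def algebra_simps)
      finally show ?thesis by (simp add: \<tau>_def)
    qed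
    then show ?thesis using c0 by blast
  qed
  obtain x where x: "x 0 = x0" "E.strict_sol (\<lambda>t. N t (x t)) x" "continuous_on {0..T} (\<lambda>t. A\<^sub>0 t (M t (x t)))"
    using E.semilinear_classical_solution[OF N_bound N_lip x0] by blast
  have Buc: "continuous_on {0..T} (\<lambda>t. B t (u t))" by (rule Bu_continuous[OF uc])
  have x_le: "norm (x t) \<le> \<rho>" if t: "t \<in> {0..T}" for t
  proof -
    have "norm (x t) \<le> E.c\<^sub>0 * (norm (x 0) + integral {0..t} (\<lambda>s. norm (B s (u s))))"
    proof (rule E.energy_estimate[OF _ _ Buc t])
      fix t assume t: "t \<in> {0..T}"
      show "(x has_vector_derivative A\<^sub>0 t (M t (x t)) + N t (x t)) (at t within {0..T})"
        using x(2) t by (simp add: E.strict_sol_def)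
      have "inner (M t (x t)) (A\<^sub>0 t (M t (x t))) \<le> 0"
        using m_dissipativeD(5)[OF E.A_m_dissipative[OF t], of "M t (x t)"] x(2) t
        by (simp add: E.strict_sol_def inner_commute)
      moreover have "inner (M t (x t)) (B t (g' (C t (x t)))) = inner (C t (x t)) (g' (C t (x t)))"
        using t inner_adjoint[of "B t" "g' (C t (x t))" "M t (x t)"] by (simp add: C_eq inner_commute)
      ultimately show "inner (M t (x t)) (A\<^sub>0 t (M t (x t)) + N t (x t) - B t (u t)) \<le> 0"
        using g'_damping[of "C t (x t)"] by (simp add: N_def inner_add_right inner_diff_right)
    qed
    also have "\<dots> \<le> E.c\<^sub>0 * (norm x0 + T * (b * v))"
    proof (intro mult_left_mono add_mono E.integral_norm_le_const[OF Buc _ t])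
      show "norm (B s (u s)) \<le> b * v" if "s \<in> {0..T}" for s
        using order_trans[OF B_le[OF that] mult_left_mono[OF v[OF that] b(1)]] .
    qed (use x(1) E.c0_ge in auto)
    finally show ?thesis by (simp add: \<rho>_def)
  qed
  have N_eq: "N t (x t) = f t (x t) + B t (u t)" if t: "t \<in> {0..T}" for t
  proof -
    have "norm (C t (x t)) \<le> norm (B t) * (m\<^sub>2 * norm (x t))" using norm_C_le t by simp
    also have "\<dots> \<le> b * (m\<^sub>2 * \<rho>)" using b(1) b(2)[OF t] m_pos x_le[OF t] by (intro mult_mono) auto
    finally have "radial_projection R (C t (x t)) = C t (x t)" by (simp add: radial_projection_def R_def)
    then show ?thesis using t by (simp add: N_def g'_def f_eq C_eq)
  qed
  have "sol_on T u x" using x(2) N_eq unfolding sol_on_def E.strict_sol_def by (auto simp: add.assoc)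
  then show ?thesis using x(1,3) by blast
qed

text \<open>Gronwall with the Lipschitz constant of \<open>f\<close> on the ball of radius
  \<open>r\<close>. The point is the order of quantifiers: \<open>K\<close> depends only on
  \<open>T\<close> and \<open>r\<close>, so it serves for whole sequences of solutions.\<close>

lemma sol_on_diff_bound:
  assumes T: "0 < T"
  shows "\<exists>K\<ge>0. \<forall>u v x y. sol_on T u x \<longrightarrow> sol_on T v y \<longrightarrow> continuous_on {0..T} u \<longrightarrow> continuous_on {0..T} v \<longrightarrow>
    (\<forall>t\<in>{0..T}. norm (x t) \<le> r \<and> norm (y t) \<le> r) \<longrightarrow>
    (\<forall>t\<in>{0..T}. norm (x t - y t) \<le> K * (norm (x 0 - y 0) + integral {0..T} (\<lambda>s. norm (u s - v s))))"
proof -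
  obtain A' M' M'' \<kappa> where "evolution_system D\<^sub>0 A\<^sub>0 A' (\<lambda>t. M t) M' M'' T m\<^sub>1 m\<^sub>2 \<kappa>"
    using evolution_system_exists[OF T] by blast
  then interpret E: evolution_system D\<^sub>0 A\<^sub>0 A' "\<lambda>t. M t" M' M'' T m\<^sub>1 m\<^sub>2 \<kappa> .
  obtain b where b: "0 \<le> b" "\<And>t. t \<in> {0..T} \<Longrightarrow> norm (B t) \<le> b" using B_bounded[of T] by blast
  obtain c where c: "0 \<le> c" "\<And>t x y. t \<in> {0..T} \<Longrightarrow> norm x \<le> r \<Longrightarrow> norm y \<le> r \<Longrightarrow> norm (f t x - f t y) \<le> c * norm (x - y)"
    using f_lipschitz[OF T, of r] by blast
  define K where "K = E.c\<^sub>0 * (1 + b) * exp (E.c\<^sub>0 * c * T)"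
  have "norm (x t - y t) \<le> K * (norm (x 0 - y 0) + integral {0..T} (\<lambda>s. norm (u s - v s)))"
    if x: "sol_on T u x" and y: "sol_on T v y" and u: "continuous_on {0..T} u" and v: "continuous_on {0..T} v"
      and r: "\<And>t. t \<in> {0..T} \<Longrightarrow> norm (x t) \<le> r" "\<And>t. t \<in> {0..T} \<Longrightarrow> norm (y t) \<le> r" and t: "t \<in> {0..T}" for u v x y t
  proof -
    define F where "F t = f t (x t) + B t (u t)" for t
    define H where "H t = f t (y t) + B t (v t)" for t
    define d where "d t = norm (x t - y t)" for t
    define S where "S = integral {0..T} (\<lambda>s. norm (u s - v s))"
    have xc: "continuous_on {0..T} x" and yc: "continuous_on {0..T} y"
      using sol_on_continuous x y by auto
    have FH: "continuous_on {0..T} F" "continuous_on {0..T} H"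
      unfolding F_def[abs_def] H_def[abs_def]
      by (intro continuous_on_add fx_continuous Bu_continuous xc yc u v T)+
    have sol: "E.strict_sol F x" "E.strict_sol H y"
      using x y unfolding sol_on_def E.strict_sol_def F_def H_def by (auto simp: add.assoc)
    have c': "continuous_on {0..T} (\<lambda>t. F t - H t)" by (intro continuous_on_diff FH)
    have uv: "continuous_on {0..T} (\<lambda>s. norm (u s - v s))" by (intro continuous_intros u v)
    have dc: "continuous_on {0..T} d" unfolding d_def[abs_def] by (intro continuous_intros xc yc)
    have S0: "0 \<le> S" unfolding S_def by (intro integral_nonneg integrable_continuous_interval uv) auto
    have "d t \<le> E.c\<^sub>0 * (d 0 + b * S) + (E.c\<^sub>0 * c) * integral {0..t} d" if t: "t \<in> {0..T}" for t
    proof -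
      have sub: "{0..t} \<subseteq> {0..T}" using t by auto
      have int: "(\<lambda>s. norm (u s - v s)) integrable_on {0..t}" "d integrable_on {0..t}"
        by (intro integrable_continuous_interval continuous_on_subset[OF uv sub] continuous_on_subset[OF dc sub])+
      have "d t \<le> E.c\<^sub>0 * (norm (x 0 - y 0) + integral {0..t} (\<lambda>s. norm (F s - H s)))"
        unfolding d_def by (rule E.strict_sol_bound[OF E.strict_sol_diff[OF sol] c' t])
      also have "integral {0..t} (\<lambda>s. norm (F s - H s)) \<le> integral {0..t} (\<lambda>s. c * d s + b * norm (u s - v s))"
      proof (rule integral_le)
        fix s assume "s \<in> {0..t}"
        then have s: "s \<in> {0..T}" using sub by blast
        have "F s - H s = (f s (x s) - f s (y s)) + B s (u s - v s)" by (simp add: F_def H_def blinfun.diff_right)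
        also have "norm \<dots> \<le> c * norm (x s - y s) + norm (B s) * norm (u s - v s)"
          by (intro norm_triangle_mono c r s norm_blinfun)
        also have "\<dots> \<le> c * d s + b * norm (u s - v s)"
          unfolding d_def using b(2)[OF s] by (intro add_mono mult_right_mono order_refl) auto
        finally show "norm (F s - H s) \<le> c * d s + b * norm (u s - v s)" .
      next
        show "(\<lambda>s. norm (F s - H s)) integrable_on {0..t}"
          by (intro integrable_continuous_interval continuous_on_norm continuous_on_subset[OF c' sub])
        show "(\<lambda>s. c * d s + b * norm (u s - v s)) integrable_on {0..t}"
          by (intro integrable_continuous_interval continuous_on_add continuous_on_mult continuous_on_const
              continuous_on_subset[OF dc sub] continuous_on_subset[OF uv sub])
      qed
      also have "\<dots> = c * integral {0..t} d + b * integral {0..t} (\<lambda>s. norm (u s - v s))"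
        by (intro integral_unique has_integral_add has_integral_mult_right integrable_integral int)
      also have "\<dots> \<le> c * integral {0..t} d + b * S"
        unfolding S_def by (intro add_mono mult_left_mono order_refl b integral_subset_le sub int
            integrable_continuous_interval uv) auto
      finally show ?thesis using E.c0_ge by (simp add: d_def algebra_simps)
    qed
    then have "d t \<le> E.c\<^sub>0 * (d 0 + b * S) * exp (E.c\<^sub>0 * c * t)"
      using t E.c0_ge c(1) by (intro gronwall[OF dc]) auto
    also have "\<dots> \<le> E.c\<^sub>0 * ((1 + b) * (d 0 + S)) * exp (E.c\<^sub>0 * c * T)"
    proof (intro mult_mono mult_left_mono)
      have "0 \<le> b * d 0" using b(1) by (simp add: d_def)
      then show "d 0 + b * S \<le> (1 + b) * (d 0 + S)" using S0 by (simp add: algebra_simps)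
      show "exp (E.c\<^sub>0 * c * t) \<le> exp (E.c\<^sub>0 * c * T)" using t E.c0_ge c(1) by (simp add: mult_left_mono)
    qed (use E.c0_ge b(1) S0 in \<open>auto simp: d_def\<close>)
    finally show ?thesis by (simp add: K_def d_def S_def mult_ac)
  qed
  moreover have "0 \<le> K" using E.c0_ge b(1) by (simp add: K_def)
  ultimately show ?thesis by blast
qed

text \<open>Here the full strength of the damping is used: it absorbs the output in
  \<open>2 * inner y u\<close> by completing the square. Neither the size of \<open>B\<close> nor
  the length of the interval enters the constants, which is what makes stability uniform.\<close>

lemma sol_on_energy:
  assumes T: "0 < T" and x: "sol_on T u x" and u: "continuous_on {0..T} u" and t: "t \<in> {0..T}"
  shows "m\<^sub>1 * (norm (x t))\<^sup>2 \<le> m\<^sub>2 * (norm (x 0))\<^sup>2 + 1 / (2 * \<zeta>) * integral {0..t} (\<lambda>s. (norm (u s))\<^sup>2)"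
proof -
  obtain A' M' M'' \<kappa> where "evolution_system D\<^sub>0 A\<^sub>0 A' (\<lambda>t. M t) M' M'' T m\<^sub>1 m\<^sub>2 \<kappa>"
    using evolution_system_exists[OF T] by blast
  then interpret E: evolution_system D\<^sub>0 A\<^sub>0 A' "\<lambda>t. M t" M' M'' T m\<^sub>1 m\<^sub>2 \<kappa> .
  define x' where "x' t = A\<^sub>0 t (M t (x t)) + f t (x t) + B t (u t)" for t
  have dx: "(x has_vector_derivative x' s) (at s within {0..T})" and xD: "M s (x s) \<in> D\<^sub>0" if "s \<in> {0..T}" for s
    using x that by (auto simp: sol_on_def x'_def)
  have uc: "continuous_on {0..t} (\<lambda>s. (norm (u s))\<^sup>2)"
    using t by (intro continuous_intros continuous_on_subset[OF u]) auto
  define k where "k = 1 / (2 * \<zeta>)"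
  have "inner (M t (x t)) (x t) - k * integral {0..t} (\<lambda>s. (norm (u s))\<^sup>2) \<le>
      inner (M 0 (x 0)) (x 0) - k * integral {0..0} (\<lambda>s. (norm (u s))\<^sup>2)"
  proof (rule nonincreasing_of_nonpos_derivative[where f="\<lambda>t. inner (M t (x t)) (x t) - k * integral {0..t} (\<lambda>s. (norm (u s))\<^sup>2)"
        and f'="\<lambda>t. (inner (M' t (x t)) (x t) + 2 * inner (M t (x t)) (x' t)) - k * (norm (u t))\<^sup>2"])
    fix s assume s: "s \<in> {0..t}"
    then have sI: "s \<in> {0..T}" using t by auto
    have "((\<lambda>t. inner (M t (x t)) (x t)) has_vector_derivative inner (M' s (x s)) (x s) + 2 * inner (M s (x s)) (x' s)) (at s within {0..t})"
      by (rule has_vector_derivative_within_subset[OF E.energy_deriv[OF sI dx[OF sI]]]) (use t in auto)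
    moreover have "((\<lambda>t. k * integral {0..t} (\<lambda>s. (norm (u s))\<^sup>2)) has_vector_derivative k * (norm (u s))\<^sup>2) (at s within {0..t})"
      using DERIV_cmult[OF integral_has_real_derivative[OF uc s], of k]
      by (simp add: has_real_derivative_iff_has_vector_derivative)
    ultimately show "((\<lambda>t. inner (M t (x t)) (x t) - k * integral {0..t} (\<lambda>s. (norm (u s))\<^sup>2)) has_vector_derivative
        (inner (M' s (x s)) (x s) + 2 * inner (M s (x s)) (x' s)) - k * (norm (u s))\<^sup>2) (at s within {0..t})"
      by (rule has_vector_derivative_diff)
    define y where "y = C s (x s)"
    have adj: "inner (M s (x s)) (B s w) = inner y w" for w
      using sI by (simp add: y_def C_eq inner_adjoint inner_commute)
    have "inner (M s (x s)) (A\<^sub>0 s (M s (x s))) \<le> 0"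
      using m_dissipativeD(5)[OF E.A_m_dissipative[OF sI] xD[OF sI]] by (simp add: inner_commute)
    moreover have "inner (M s (x s)) (f s (x s)) = - inner y (g y)"
      using sI adj[of "g y"] by (simp add: f_eq C_eq y_def)
    ultimately have "2 * inner (M s (x s)) (x' s) \<le> 2 * inner y (u s) - 2 * inner y (g y)"
      by (simp add: x'_def inner_add_right adj)
    also have "\<dots> \<le> 2 * (norm y * norm (u s)) - 2 * (\<zeta> * (norm y)\<^sup>2)"
      using norm_cauchy_schwarz[of y "u s"] g_damping[of y] by simp
    also have "\<dots> \<le> k * (norm (u s))\<^sup>2"
    proof -
      have "0 \<le> (2 * \<zeta> * norm y - norm (u s))\<^sup>2 / (2 * \<zeta>)" using zeta_pos by simp
      also have "\<dots> = 2 * (\<zeta> * (norm y)\<^sup>2) - 2 * (norm y * norm (u s)) + k * (norm (u s))\<^sup>2"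
        using zeta_pos by (simp add: k_def power2_eq_square field_simps)
      finally show ?thesis by simp
    qed
    finally show "(inner (M' s (x s)) (x s) + 2 * inner (M s (x s)) (x' s)) - k * (norm (u s))\<^sup>2 \<le> 0"
      using E.M'_nonpos[OF sI, of "x s"] by simp
  qed (use t in auto)
  moreover have "m\<^sub>1 * (norm (x t))\<^sup>2 \<le> inner (M t (x t)) (x t)" using M_bounds t by simp
  moreover have "inner (M 0 (x 0)) (x 0) \<le> m\<^sub>2 * (norm (x 0))\<^sup>2" using M_bounds by simp
  ultimately show ?thesis by (simp add: k_def)
qed

lemma sol_on_unique:
  assumes T: "0 < T" and x: "sol_on T u x" and y: "sol_on T u y" and u: "continuous_on {0..T} u"
    and eq: "x 0 = y 0" and t: "t \<in> {0..T}"
  shows "x t = y t"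
proof -
  have "bounded (x ` {0..T})" "bounded (y ` {0..T})"
    using x y sol_on_continuous by (auto intro!: compact_imp_bounded compact_continuous_image)
  then obtain r\<^sub>1 r\<^sub>2 where r: "\<And>t. t \<in> {0..T} \<Longrightarrow> norm (x t) \<le> r\<^sub>1" "\<And>t. t \<in> {0..T} \<Longrightarrow> norm (y t) \<le> r\<^sub>2"
    unfolding bounded_iff by blast
  obtain K where K: "\<And>u v x y t. sol_on T u x \<Longrightarrow> sol_on T v y \<Longrightarrow> continuous_on {0..T} u \<Longrightarrow> continuous_on {0..T} v \<Longrightarrow>
    (\<And>t. t \<in> {0..T} \<Longrightarrow> norm (x t) \<le> max r\<^sub>1 r\<^sub>2 \<and> norm (y t) \<le> max r\<^sub>1 r\<^sub>2) \<Longrightarrow>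
    t \<in> {0..T} \<Longrightarrow> norm (x t - y t) \<le> K * (norm (x 0 - y 0) + integral {0..T} (\<lambda>s. norm (u s - v s)))"
    using sol_on_diff_bound[OF T, of "max r\<^sub>1 r\<^sub>2"] by blast
  have "norm (x t - y t) \<le> K * (norm (x 0 - y 0) + integral {0..T} (\<lambda>s. norm (u s - u s)))"
    by (rule K[OF x y u u _ t]) (use r in \<open>auto intro: max.coboundedI1 max.coboundedI2\<close>)
  then show ?thesis by (simp add: eq)
qed

lemma classical_solution_imp_sol_on:
  assumes "classical_solution D A f B {0..} 0 x\<^sub>0 u x"
  shows "sol_on T u x" "x 0 = x\<^sub>0"
proof -
  show "x 0 = x\<^sub>0" using assms by (simp add: classical_solution_def)
  show "sol_on T u x"
    unfolding sol_on_def
  proof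
    fix t assume t: "t \<in> {0..T}"
    then have "x t \<in> D t" "(x has_vector_derivative A t (x t) + f t (x t) + B t (u t)) (at t within {0..})"
      using assms by (auto simp: classical_solution_def)
    then show "M t (x t) \<in> D\<^sub>0 \<and>
       (x has_vector_derivative A\<^sub>0 t (M t (x t)) + f t (x t) + B t (u t)) (at t within {0..T})"
      using t D_eq[of t] A_eq[of t "x t"] by (auto intro: has_vector_derivative_within_subset)
  qed
qed

text \<open>Solutions on the intervals up to \<open>Suc n\<close> agree by uniqueness and are glued.
  For uniqueness on the half-line, any two solutions are bounded on each compact interval, where
  \<open>f\<close> is Lipschitz on the resulting ball.\<close>

lemma unique_global_classical_solution_exists:
  assumes x0: "M 0 x\<^sub>0 \<in> D\<^sub>0" and u: "C1_on {0..} u"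
  shows "\<exists>x. unique_global_classical_solution D A f B x\<^sub>0 u x"
proof -
  have uc: "continuous_on {0..T} u" for T by (rule continuous_on_subset[OF C1_on_continuous[OF u]]) auto
  have "\<exists>x. x 0 = x\<^sub>0 \<and> sol_on (real (Suc n)) u x \<and> continuous_on {0..real (Suc n)} (\<lambda>t. A\<^sub>0 t (M t (x t)))" for n
    by (rule sol_on_exists[OF _ x0 u]) simp
  then obtain X where X0: "\<And>n. X n 0 = x\<^sub>0" and X: "\<And>n. sol_on (real (Suc n)) u (X n)"
    and AX: "\<And>n. continuous_on {0..real (Suc n)} (\<lambda>t. A\<^sub>0 t (M t (X n t)))" by metis
  have sol_sub: "sol_on T u y" if "sol_on T' u y" "T \<le> T'" for T T' y
  proof -
    have "{0..T} \<subseteq> {0..T'}" using that(2) by auto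
    then show ?thesis using that(1) unfolding sol_on_def by (blast intro: has_vector_derivative_within_subset)
  qed
  have agree: "X m t = X n t" if "n \<le> m" "t \<in> {0..real (Suc n)}" for m n t
    by (rule sol_on_unique[OF _ sol_sub[OF X] X uc _ that(2)]) (use that X0 in auto)
  \<comment> \<open>The chosen interval ends strictly after \<open>t\<close>, so that derivatives
    within it coincide with derivatives within the half-line.\<close>
  define N where "N t = nat \<lceil>t\<rceil>" for t :: real
  have N: "t < real (Suc (N t))" if "0 \<le> t" for t unfolding N_def using that by linarith
  define x where "x t = X (N t) t" for t
  have x_eq: "x t = X n t" if "0 \<le> t" "t \<le> real (Suc n)" for t n
  proof (cases "n \<le> N t")
    case True
    then show ?thesis using that unfolding x_def by (intro agree) auto
  next
    case False
    then have "X n t = X (N t) t" using that N[OF that(1)] by (intro agree) auto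
    then show ?thesis by (simp add: x_def)
  qed
  have sol: "sol_on (real (Suc n)) u x" for n
    unfolding sol_on_def
  proof
    fix t assume t: "t \<in> {0..real (Suc n)}"
    have "(x has_vector_derivative A\<^sub>0 t (M t (X n t)) + f t (X n t) + B t (u t)) (at t within {0..real (Suc n)})"
      by (rule has_vector_derivative_transform[OF t, of x "X n"]) (use X[of n] t x_eq in \<open>auto simp: sol_on_def\<close>)
    then show "M t (x t) \<in> D\<^sub>0 \<and>
       (x has_vector_derivative A\<^sub>0 t (M t (x t)) + f t (x t) + B t (u t)) (at t within {0..real (Suc n)})"
      using X[of n] t x_eq[of t n] by (auto simp: sol_on_def)
  qed
  define x' where "x' t = A\<^sub>0 t (M t (x t)) + f t (x t) + B t (u t)" for t
  have dx: "(x has_vector_derivative x' t) (at t within {0..})" and xD: "M t (x t) \<in> D\<^sub>0" if "0 \<le> t" for t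
  proof -
    have "t \<in> {0..real (Suc (N t))}" using that N[OF that] by auto
    from bspec[OF sol[unfolded sol_on_def] this, unfolded at_within_Icc_0[OF that N[OF that]]]
    show "(x has_vector_derivative x' t) (at t within {0..})" "M t (x t) \<in> D\<^sub>0" unfolding x'_def by auto
  qed
  have "continuous_on {0..} x'"
    unfolding continuous_on_eq_continuous_within
  proof
    fix t :: real assume "t \<in> {0..}"
    then have t: "0 \<le> t" by simp
    have c: "continuous_on {0..real (Suc (N t))} (\<lambda>t. A\<^sub>0 t (M t (x t)))"
      by (rule continuous_on_eq[OF AX]) (metis x_eq atLeastAtMost_iff)
    have "continuous_on {0..real (Suc (N t))} x'"
      unfolding x'_def[abs_def]
      by (intro continuous_on_add c fx_continuous Bu_continuous uc sol_on_continuous[OF sol]) simp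
    moreover have "t \<in> {0..real (Suc (N t))}" using t N[OF t] by simp
    ultimately have "continuous (at t within {0..real (Suc (N t))}) x'"
      unfolding continuous_on_eq_continuous_within by blast
    then show "continuous (at t within {0..}) x'" unfolding at_within_Icc_0[OF t N[OF t]] .
  qed
  then have "C1_on {0..} x" using dx unfolding C1_on_def by auto
  moreover have "x 0 = x\<^sub>0" by (simp add: x_def X0)
  moreover have "x t \<in> D t" "A t (x t) = A\<^sub>0 t (M t (x t))" if "0 \<le> t" for t
    using xD[OF that] D_eq[OF that] A_eq[OF that] by auto
  ultimately have cl: "classical_solution D A f B {0..} 0 x\<^sub>0 u x"
    using dx unfolding classical_solution_def x'_def by (auto simp: is_interval_ci)
  moreover have "z t = x t" if z: "classical_solution D A f B {0..} 0 x\<^sub>0 u z" and t: "0 \<le> t" for z t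
    by (rule sol_on_unique[OF _ classical_solution_imp_sol_on(1)[OF z] classical_solution_imp_sol_on(1)[OF cl] uc, of "t + 1"])
       (use t classical_solution_imp_sol_on(2)[OF z] classical_solution_imp_sol_on(2)[OF cl] in auto)
  ultimately show ?thesis unfolding unique_global_classical_solution_def by blast
qed

lemma initial_states_dense: "0 < e \<Longrightarrow> \<exists>y. M 0 y \<in> D\<^sub>0 \<and> norm (y - x) \<le> e"
proof -
  obtain A' M' M'' \<kappa> where "evolution_system D\<^sub>0 A\<^sub>0 A' (\<lambda>t. M t) M' M'' 1 m\<^sub>1 m\<^sub>2 \<kappa>"
    using evolution_system_exists[OF zero_less_one] by blast
  then interpret E: evolution_system D\<^sub>0 A\<^sub>0 A' "\<lambda>t. M t" M' M'' 1 m\<^sub>1 m\<^sub>2 \<kappa> .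
  show "0 < e \<Longrightarrow> \<exists>y. M 0 y \<in> D\<^sub>0 \<and> norm (y - x) \<le> e" by (rule E.initial_states_dense)
qed

end

section \<open>Locally square-integrable functions\<close>

lemma AE_lebesgue_on:
  "S \<in> sets lebesgue \<Longrightarrow> (AE s in lebesgue_on S. P s) \<longleftrightarrow> (AE s in lebesgue. s \<in> S \<longrightarrow> P s)"
  by (rule AE_restrict_space_iff) simp

text \<open>Completeness of Lebesgue measure. It is needed because strong measurability gives
  convergence of simple functions almost everywhere only.\<close>

lemma borel_measurable_lebesgue_on_AE:
  fixes g h :: "real \<Rightarrow> real"
  assumes S: "S \<in> sets lebesgue" and g: "g \<in> borel_measurable (lebesgue_on S)"
    and eq: "AE s in lebesgue_on S. g s = h s"
  shows "h \<in> borel_measurable (lebesgue_on S)"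
proof -
  define g' where "g' s = (if s \<in> S then g s else 0)" for s
  define h' where "h' s = (if s \<in> S then h s else 0)" for s
  have g': "g' \<in> borel_measurable lebesgue"
    unfolding g'_def[abs_def] using g borel_measurable_if[OF S, of g] by simp
  have ae: "AE s in lebesgue. g' s = h' s"
    using eq unfolding AE_lebesgue_on[OF S] by eventually_elim (auto simp: g'_def h'_def)
  have "h' \<in> borel_measurable lebesgue"
  proof (rule measurableI)
    fix U :: "real set" assume U: "U \<in> sets borel"
    show "h' -` U \<inter> space lebesgue \<in> sets lebesgue"
    proof (rule completion.in_sets_AE)
      show "g' -` U \<inter> space lebesgue \<in> sets lebesgue" by (rule measurable_sets[OF g' U])
      show "AE x in lebesgue. (x \<in> g' -` U \<inter> space lebesgue) = (x \<in> h' -` U \<inter> space lebesgue)"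
        using ae by eventually_elim auto
    qed auto
  qed auto
  then have "h' \<in> borel_measurable (lebesgue_on S)" by (rule measurable_restrict_space1)
  then show ?thesis
    by (rule measurable_cong[THEN iffD1, rotated]) (auto simp: h'_def space_restrict_space)
qed

lemma strongly_measurable_norm:
  fixes h :: "real \<Rightarrow> 'a::real_normed_vector"
  assumes S: "S \<in> sets lebesgue" and h: "strongly_measurable (lebesgue_on S) h"
  shows "(\<lambda>s. norm (h s)) \<in> borel_measurable (lebesgue_on S)"
proof -
  obtain \<phi> where \<phi>: "\<And>n. simple_function (lebesgue_on S) (\<phi> n)" "AE s in lebesgue_on S. (\<lambda>n. \<phi> n s) \<longlonglongrightarrow> h s"
    using h unfolding strongly_measurable_def by blast
  have m: "(\<lambda>s. norm (\<phi> n s)) \<in> borel_measurable (lebesgue_on S)" for n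
    by (rule borel_measurable_simple_function, rule simple_function_compose1[OF \<phi>(1)])
  have "(\<lambda>s. lim (\<lambda>n. norm (\<phi> n s))) \<in> borel_measurable (lebesgue_on S)"
    by (rule borel_measurable_lim_metric[OF m])
  moreover have "AE s in lebesgue_on S. lim (\<lambda>n. norm (\<phi> n s)) = norm (h s)"
    using \<phi>(2) by eventually_elim (intro limI tendsto_norm)
  ultimately show ?thesis by (rule borel_measurable_lebesgue_on_AE[OF S])
qed

lemma strongly_measurable_add:
  assumes "strongly_measurable N g" "strongly_measurable N h"
  shows "strongly_measurable N (\<lambda>s. g s + h s)"
proof -
  obtain \<phi> \<psi> where \<phi>: "\<And>n. simple_function N (\<phi> n)" "AE s in N. (\<lambda>n. \<phi> n s) \<longlonglongrightarrow> g s"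
    and \<psi>: "\<And>n. simple_function N (\<psi> n)" "AE s in N. (\<lambda>n. \<psi> n s) \<longlonglongrightarrow> h s"
    using assms unfolding strongly_measurable_def by blast
  have "simple_function N (\<lambda>s. \<phi> n s + \<psi> n s)" for n
    by (rule simple_function_compose2[OF \<phi>(1) \<psi>(1)])
  moreover have "AE s in N. (\<lambda>n. \<phi> n s + \<psi> n s) \<longlonglongrightarrow> g s + h s"
    using \<phi>(2) \<psi>(2) by eventually_elim (auto intro: tendsto_add)
  ultimately show ?thesis unfolding strongly_measurable_def by (intro exI[of _ "\<lambda>n s. \<phi> n s + \<psi> n s"]) blast
qed

lemma strongly_measurable_minus:
  assumes "strongly_measurable N g"
  shows "strongly_measurable N (\<lambda>s. - g s)"
proof -
  obtain \<phi> where \<phi>: "\<And>n. simple_function N (\<phi> n)" "AE s in N. (\<lambda>n. \<phi> n s) \<longlonglongrightarrow> g s"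
    using assms unfolding strongly_measurable_def by blast
  have "simple_function N (\<lambda>s. - \<phi> n s)" for n by (rule simple_function_compose1[OF \<phi>(1)])
  moreover have "AE s in N. (\<lambda>n. - \<phi> n s) \<longlonglongrightarrow> - g s"
    using \<phi>(2) by eventually_elim (auto intro: tendsto_minus)
  ultimately show ?thesis unfolding strongly_measurable_def by (intro exI[of _ "\<lambda>n s. - \<phi> n s"]) blast
qed

lemma strongly_measurable_restrict:
  assumes h: "strongly_measurable (lebesgue_on S) h" and S: "S \<in> sets lebesgue" "S' \<in> sets lebesgue" "S' \<subseteq> S"
  shows "strongly_measurable (lebesgue_on S') h"
proof -
  obtain \<phi> where \<phi>: "\<And>n. simple_function (lebesgue_on S) (\<phi> n)" "AE s in lebesgue_on S. (\<lambda>n. \<phi> n s) \<longlonglongrightarrow> h s"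
    using h unfolding strongly_measurable_def by blast
  have "simple_function (lebesgue_on S') (\<phi> n)" for n
    unfolding simple_function_def
  proof safe
    have fin: "finite (\<phi> n ` S)" using \<phi>(1)[of n] by (simp add: simple_function_def space_restrict_space)
    show "finite (\<phi> n ` space (lebesgue_on S'))"
      by (rule finite_subset[OF image_mono fin]) (use S(3) in \<open>simp add: space_restrict_space\<close>)
    fix s assume "s \<in> space (lebesgue_on S')"
    then have "s \<in> S'" by (simp add: space_restrict_space)
    then have "\<phi> n -` {\<phi> n s} \<inter> S \<in> sets (lebesgue_on S)"
      using \<phi>(1)[of n] S(3) by (auto simp: simple_function_def space_restrict_space)
    then have "\<phi> n -` {\<phi> n s} \<inter> S \<in> sets lebesgue" using S(1) by (simp add: sets_restrict_space_iff)
    then have "(\<phi> n -` {\<phi> n s} \<inter> S) \<inter> S' \<in> sets lebesgue" using S(2) by blast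
    moreover have "(\<phi> n -` {\<phi> n s} \<inter> S) \<inter> S' = \<phi> n -` {\<phi> n s} \<inter> S'" using S(3) by blast
    ultimately show "\<phi> n -` {\<phi> n s} \<inter> space (lebesgue_on S') \<in> sets (lebesgue_on S')"
      using S(2) by (simp add: sets_restrict_space_iff space_restrict_space)
  qed
  moreover have "AE s in lebesgue_on S'. (\<lambda>n. \<phi> n s) \<longlonglongrightarrow> h s"
    using \<phi>(2) unfolding AE_lebesgue_on[OF S(1)] AE_lebesgue_on[OF S(2)] by eventually_elim (use S(3) in auto)
  ultimately show ?thesis unfolding strongly_measurable_def by blast
qed

lemma strongly_measurable_continuous:
  fixes h :: "real \<Rightarrow> 'a::real_normed_vector"
  assumes h: "continuous_on {0..} h"
  shows "strongly_measurable (lebesgue_on {0..}) h"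
proof -
  \<comment> \<open>Time is rounded down to a grid of width \<open>1 / Suc n\<close> and capped at
    \<open>n\<close>. The sampling times take finitely many values, so \<open>h\<close> composed
    with them is simple whatever the target space is.\<close>
  define \<psi> where "\<psi> n s = min (real n) (real_of_int \<lfloor>s * real (Suc n)\<rfloor> / real (Suc n))" for n s
  have sf: "simple_function (lebesgue_on {0..}) (\<lambda>s. h (\<psi> n s))" for n
  proof (rule simple_function_compose1[where f="\<psi> n"], rule simple_function_borel_measurable)
    have "\<psi> n \<in> borel_measurable borel" unfolding \<psi>_def[abs_def] by measurable
    then have "\<psi> n \<in> borel_measurable lebesgue" by (simp add: measurable_completion)
    then show "\<psi> n \<in> borel_measurable (lebesgue_on {0..})" by (rule measurable_restrict_space1)
    have "\<psi> n ` {0..} \<subseteq> insert (real n) ((\<lambda>k. real_of_int k / real (Suc n)) ` {0..int (n * Suc n)})"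
    proof (rule image_subsetI)
      fix s :: real assume s: "s \<in> {0..}"
      define k where "k = \<lfloor>s * real (Suc n)\<rfloor>"
      show "\<psi> n s \<in> insert (real n) ((\<lambda>k. real_of_int k / real (Suc n)) ` {0..int (n * Suc n)})"
      proof (cases "real n \<le> real_of_int k / real (Suc n)")
        case True
        then show ?thesis by (simp add: \<psi>_def k_def)
      next
        case False
        then have "real_of_int k < real n * real (Suc n)" by (simp add: pos_divide_le_eq not_le pos_divide_less_eq)
        then have "real_of_int k < real_of_int (int (n * Suc n))" by (simp only: of_int_of_nat_eq of_nat_mult of_int_mult)
        then have "k \<le> int (n * Suc n)" by linarith
        moreover have "0 \<le> k" using s by (simp add: k_def)
        moreover have "\<psi> n s = real_of_int k / real (Suc n)" using False by (simp add: \<psi>_def k_def)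
        ultimately show ?thesis by auto
      qed
    qed
    then have "finite (\<psi> n ` {0..})" by (rule finite_subset) simp
    then show "finite (\<psi> n ` space (lebesgue_on {0..}))" by (simp add: space_restrict_space)
  qed
  have "(\<lambda>n. h (\<psi> n s)) \<longlonglongrightarrow> h s" if s: "0 \<le> s" for s
  proof -
    have \<psi>0: "0 \<le> \<psi> n s" for n using s by (simp add: \<psi>_def)
    have "(\<lambda>n. \<psi> n s) \<longlonglongrightarrow> s"
    proof (rule tendsto_sandwich[where f="\<lambda>n. s - 1 / real (Suc n)" and h="\<lambda>_. s"])
      have fl: "s - 1 / real (Suc n) \<le> real_of_int \<lfloor>s * real (Suc n)\<rfloor> / real (Suc n)"
        "real_of_int \<lfloor>s * real (Suc n)\<rfloor> / real (Suc n) \<le> s" for n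
      proof -
        have "s * real (Suc n) - 1 \<le> real_of_int \<lfloor>s * real (Suc n)\<rfloor>" by linarith
        then show "s - 1 / real (Suc n) \<le> real_of_int \<lfloor>s * real (Suc n)\<rfloor> / real (Suc n)"
          by (simp add: pos_le_divide_eq left_diff_distrib del: of_nat_Suc)
        have "real_of_int \<lfloor>s * real (Suc n)\<rfloor> \<le> s * real (Suc n)" by linarith
        then show "real_of_int \<lfloor>s * real (Suc n)\<rfloor> / real (Suc n) \<le> s"
          by (simp add: pos_divide_le_eq del: of_nat_Suc)
      qed
      obtain m where m: "s \<le> real m" using real_arch_simple by blast
      show "\<forall>\<^sub>F n in sequentially. s - 1 / real (Suc n) \<le> \<psi> n s"
      proof (rule eventually_sequentiallyI[of m])
        fix n assume "m \<le> n"
        then have "s \<le> real n" using m by linarith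
        then have "s - 1 / real (Suc n) \<le> real n" by (smt (verit) divide_nonneg_nonneg of_nat_0_le_iff)
        then show "s - 1 / real (Suc n) \<le> \<psi> n s" using fl(1)[of n] by (simp add: \<psi>_def)
      qed
      show "\<forall>\<^sub>F n in sequentially. \<psi> n s \<le> s"
        using fl(2) by (intro always_eventually allI) (simp add: \<psi>_def min.coboundedI2)
      have "(\<lambda>n. s - 1 / real (Suc n)) \<longlonglongrightarrow> s - 0"
        by (intro tendsto_diff tendsto_const LIMSEQ_Suc[OF lim_1_over_n])
      then show "(\<lambda>n. s - 1 / real (Suc n)) \<longlonglongrightarrow> s" by simp
    qed simp
    then show ?thesis
      by (rule continuous_on_tendsto_compose[OF h]) (use s \<psi>0 in auto)
  qed
  then have "AE s in lebesgue_on {0..}. (\<lambda>n. h (\<psi> n s)) \<longlonglongrightarrow> h s"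
    by (intro AE_I2) (simp add: space_restrict_space)
  then show ?thesis
    unfolding strongly_measurable_def by (intro exI[of _ "\<lambda>n s. h (\<psi> n s)"] conjI allI sf)
qed

lemma L2_loc_continuous:
  fixes h :: "real \<Rightarrow> 'a::real_normed_vector"
  assumes h: "continuous_on {0..} h"
  shows "h \<in> L2_loc"
  unfolding L2_loc_def
proof (intro CollectI conjI allI impI strongly_measurable_continuous h)
  fix t :: real assume "0 < t"
  show "integrable (lebesgue_on {0..t}) (\<lambda>s. (norm (h s))\<^sup>2)"
    by (intro continuous_imp_integrable_real continuous_intros continuous_on_subset[OF h]) auto
qed

lemma L2_norm_continuous:
  fixes h :: "real \<Rightarrow> 'a::real_normed_vector"
  assumes h: "continuous_on {0..t} h"
  shows "(L2_norm t h)\<^sup>2 = integral {0..t} (\<lambda>s. (norm (h s))\<^sup>2)"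
proof -
  have "integrable (lebesgue_on {0..t}) (\<lambda>s. (norm (h s))\<^sup>2)"
    by (intro continuous_imp_integrable_real continuous_intros h)
  then have "(\<integral>s. (norm (h s))\<^sup>2 \<partial>lebesgue_on {0..t}) = integral {0..t} (\<lambda>s. (norm (h s))\<^sup>2)"
    by (rule lebesgue_integral_eq_integral) simp
  moreover have "0 \<le> (\<integral>s. (norm (h s))\<^sup>2 \<partial>lebesgue_on {0..t})" by simp
  ultimately show ?thesis by (simp add: L2_norm_def)
qed

lemma L2_norm_nonneg: "0 \<le> L2_norm t h" by (simp add: L2_norm_def)

lemma L2_norm_minus_commute: "L2_norm t (\<lambda>s. g s - h s) = L2_norm t (\<lambda>s. h s - g s)"
  by (simp add: L2_norm_def norm_minus_commute)

lemma L2_locD: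
  assumes "h \<in> L2_loc"
  shows "strongly_measurable (lebesgue_on {0..}) h"
    and "0 < t \<Longrightarrow> integrable (lebesgue_on {0..t}) (\<lambda>s. (norm (h s))\<^sup>2)"
  using assms by (auto simp: L2_loc_def)

lemma norm_add_square_le: "(norm (a + b))\<^sup>2 \<le> 2 * (norm a)\<^sup>2 + 2 * (norm b)\<^sup>2" for a b :: "'a::real_normed_vector"
proof -
  have "(norm (a + b))\<^sup>2 \<le> (norm a + norm b)\<^sup>2" by (intro power_mono norm_triangle_ineq) auto
  moreover have "0 \<le> (norm a - norm b)\<^sup>2" by simp
  ultimately show ?thesis by (simp add: power2_eq_square algebra_simps)
qed

lemma L2_loc_add:
  fixes g h :: "real \<Rightarrow> 'a::real_normed_vector"
  assumes g: "g \<in> L2_loc" and h: "h \<in> L2_loc" shows "(\<lambda>s. g s + h s) \<in> L2_loc"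
  unfolding L2_loc_def
proof (intro CollectI conjI allI impI)
  show m: "strongly_measurable (lebesgue_on {0..}) (\<lambda>s. g s + h s)"
    by (intro strongly_measurable_add L2_locD g h)
  fix t :: real assume t: "0 < t"
  show "integrable (lebesgue_on {0..t}) (\<lambda>s. (norm (g s + h s))\<^sup>2)"
  proof (rule Bochner_Integration.integrable_bound)
    show "integrable (lebesgue_on {0..t}) (\<lambda>s. 2 * (norm (g s))\<^sup>2 + 2 * (norm (h s))\<^sup>2)"
      using L2_locD(2)[OF g t] L2_locD(2)[OF h t] by auto
    have "strongly_measurable (lebesgue_on {0..t}) (\<lambda>s. g s + h s)"
      by (rule strongly_measurable_restrict[OF m]) auto
    then have "(\<lambda>s. norm (g s + h s)) \<in> borel_measurable (lebesgue_on {0..t})"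
      by (intro strongly_measurable_norm) auto
    then show "(\<lambda>s. (norm (g s + h s))\<^sup>2) \<in> borel_measurable (lebesgue_on {0..t})" by simp
    show "AE s in lebesgue_on {0..t}. norm ((norm (g s + h s))\<^sup>2) \<le> norm (2 * (norm (g s))\<^sup>2 + 2 * (norm (h s))\<^sup>2)"
      by (intro AE_I2) (simp add: abs_of_nonneg norm_add_square_le)
  qed
qed

lemma L2_loc_minus: "h \<in> L2_loc \<Longrightarrow> (\<lambda>s. - h s) \<in> L2_loc"
  unfolding L2_loc_def using strongly_measurable_minus by auto

lemma L2_loc_diff: "g \<in> L2_loc \<Longrightarrow> h \<in> L2_loc \<Longrightarrow> (\<lambda>s. g s - h s) \<in> L2_loc"
  using L2_loc_add[OF _ L2_loc_minus, of g h] by simp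

lemma L2_norm_add_square:
  fixes g h :: "real \<Rightarrow> 'a::real_normed_vector"
  assumes g: "g \<in> L2_loc" and h: "h \<in> L2_loc" and t: "0 < t"
  shows "(L2_norm t (\<lambda>s. g s + h s))\<^sup>2 \<le> 2 * (L2_norm t g)\<^sup>2 + 2 * (L2_norm t h)\<^sup>2"
proof -
  have "(\<integral>s. (norm (g s + h s))\<^sup>2 \<partial>lebesgue_on {0..t}) \<le> (\<integral>s. 2 * (norm (g s))\<^sup>2 + 2 * (norm (h s))\<^sup>2 \<partial>lebesgue_on {0..t})"
    using L2_locD(2)[OF g t] L2_locD(2)[OF h t] L2_locD(2)[OF L2_loc_add[OF g h] t]
    by (intro integral_mono norm_add_square_le) auto
  also have "\<dots> = 2 * (\<integral>s. (norm (g s))\<^sup>2 \<partial>lebesgue_on {0..t}) + 2 * (\<integral>s. (norm (h s))\<^sup>2 \<partial>lebesgue_on {0..t})"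
    using L2_locD(2)[OF g t] L2_locD(2)[OF h t] by simp
  finally show ?thesis by (simp add: L2_norm_def)
qed

text \<open>The factor \<open>2\<close> spares the Minkowski inequality; the constant is irrelevant below.\<close>

lemma L2_norm_add:
  fixes g h :: "real \<Rightarrow> 'a::real_normed_vector"
  assumes g: "g \<in> L2_loc" and h: "h \<in> L2_loc" and t: "0 < t"
  shows "L2_norm t (\<lambda>s. g s + h s) \<le> 2 * (L2_norm t g + L2_norm t h)"
proof (rule power2_le_imp_le)
  have "(L2_norm t (\<lambda>s. g s + h s))\<^sup>2 \<le> 2 * (L2_norm t g)\<^sup>2 + 2 * (L2_norm t h)\<^sup>2"
    by (rule L2_norm_add_square[OF assms])
  also have "\<dots> \<le> 4 * (L2_norm t g)\<^sup>2 + 4 * (L2_norm t h)\<^sup>2 + 8 * (L2_norm t g * L2_norm t h)"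
    by (simp add: L2_norm_nonneg)
  also have "\<dots> = (2 * (L2_norm t g + L2_norm t h))\<^sup>2" by (simp add: power2_eq_square algebra_simps)
  finally show "(L2_norm t (\<lambda>s. g s + h s))\<^sup>2 \<le> (2 * (L2_norm t g + L2_norm t h))\<^sup>2" .
qed (simp add: L2_norm_nonneg)

lemma L2_norm_triangle:
  fixes g h k :: "real \<Rightarrow> 'a::real_normed_vector"
  assumes "g \<in> L2_loc" "h \<in> L2_loc" "k \<in> L2_loc" "0 < t"
  shows "L2_norm t (\<lambda>s. g s - k s) \<le> 2 * (L2_norm t (\<lambda>s. g s - h s) + L2_norm t (\<lambda>s. h s - k s))"
  using L2_norm_add[OF L2_loc_diff[OF assms(1,2)] L2_loc_diff[OF assms(2,3)] assms(4)] by simp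

lemma L2_norm_mono:
  fixes h :: "real \<Rightarrow> 'a::real_normed_vector"
  assumes h: "h \<in> L2_loc" and t: "0 < t" "t \<le> T"
  shows "L2_norm t h \<le> L2_norm T h"
proof -
  have T: "0 < T" using t by simp
  have eq: "(\<integral>s. (norm (h s))\<^sup>2 \<partial>lebesgue_on {0..r}) = (\<integral>s. indicator {0..r} s *\<^sub>R (norm (h s))\<^sup>2 \<partial>lebesgue)" for r
    by (rule integral_restrict_space) simp
  have int: "integrable lebesgue (\<lambda>s. indicator {0..r} s *\<^sub>R (norm (h s))\<^sup>2)" if "0 < r" for r
    using L2_locD(2)[OF h that] by (subst (asm) integrable_restrict_space) auto
  have "(\<integral>s. (norm (h s))\<^sup>2 \<partial>lebesgue_on {0..t}) \<le> (\<integral>s. (norm (h s))\<^sup>2 \<partial>lebesgue_on {0..T})"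
    unfolding eq using t by (intro integral_mono int T t(1)) (auto simp: indicator_def)
  then show ?thesis by (simp add: L2_norm_def)
qed

lemma L2_norm_bounded:
  fixes h :: "real \<Rightarrow> 'a::real_normed_vector"
  assumes h: "continuous_on {0..t} h" and le: "\<And>s. s \<in> {0..t} \<Longrightarrow> norm (h s) \<le> e" and t: "0 < t" and e: "0 \<le> e"
  shows "L2_norm t h \<le> sqrt t * e"
proof (rule power2_le_imp_le)
  have "(L2_norm t h)\<^sup>2 = integral {0..t} (\<lambda>s. (norm (h s))\<^sup>2)" by (rule L2_norm_continuous[OF h])
  also have "\<dots> \<le> integral {0..t} (\<lambda>s. e\<^sup>2)"
    using le by (intro integral_le integrable_continuous_interval continuous_intros h power_mono) auto
  also have "\<dots> = (sqrt t * e)\<^sup>2" using t by (simp add: power_mult_distrib)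
  finally show "(L2_norm t h)\<^sup>2 \<le> (sqrt t * e)\<^sup>2" .
qed (use t e in simp)

text \<open>Young's inequality with a free parameter replaces Cauchy-Schwarz; the constant
  \<open>t + 1\<close> is cruder than \<open>sqrt t\<close>, but any constant depending on
  \<open>t\<close> will do.\<close>

lemma integral_norm_le_L2_norm:
  fixes h :: "real \<Rightarrow> 'a::real_normed_vector"
  assumes h: "continuous_on {0..t} h" and t: "0 < t"
  shows "integral {0..t} (\<lambda>s. norm (h s)) \<le> (t + 1) * L2_norm t h"
proof (rule field_le_epsilon)
  fix e :: real assume e: "0 < e"
  define n where "n = L2_norm t h"
  have n: "0 \<le> n" by (simp add: n_def L2_norm_nonneg)
  \<comment> \<open>The summand \<open>e / t\<close> keeps \<open>\<eta>\<close> positive when the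
    norm is \<open>0\<close> and costs exactly \<open>e\<close> after integration.\<close>
  define \<eta> where "\<eta> = n + e / t"
  have \<eta>: "0 < \<eta>" "n \<le> \<eta>" using n e t by (auto simp: \<eta>_def add_nonneg_pos)
  have int: "(\<lambda>s. (norm (h s))\<^sup>2) integrable_on {0..t}"
    by (intro integrable_continuous_interval continuous_intros h)
  have "integral {0..t} (\<lambda>s. norm (h s)) \<le> integral {0..t} (\<lambda>s. \<eta> + (1 / \<eta>) * (norm (h s))\<^sup>2)"
  proof (rule integral_le)
    fix s
    have "0 \<le> (norm (h s) - \<eta>)\<^sup>2 + norm (h s) * \<eta>" using \<eta>(1) by simp
    then have "norm (h s) * \<eta> \<le> \<eta> * \<eta> + (norm (h s))\<^sup>2" by (simp add: power2_eq_square algebra_simps)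
    then show "norm (h s) \<le> \<eta> + (1 / \<eta>) * (norm (h s))\<^sup>2" using \<eta>(1) by (simp add: field_simps)
  qed (intro integrable_continuous_interval continuous_intros h)+
  also have "\<dots> = t * \<eta> + (1 / \<eta>) * n\<^sup>2"
  proof (rule integral_unique)
    have "((\<lambda>s. \<eta>) has_integral t * \<eta>) {0..t}" using has_integral_const_real[of \<eta> 0 t] t by simp
    moreover have "((\<lambda>s. (norm (h s))\<^sup>2) has_integral n\<^sup>2) {0..t}"
      unfolding n_def L2_norm_continuous[OF h] by (rule integrable_integral[OF int])
    ultimately show "((\<lambda>s. \<eta> + (1 / \<eta>) * (norm (h s))\<^sup>2) has_integral t * \<eta> + (1 / \<eta>) * n\<^sup>2) {0..t}"
      by (intro has_integral_add has_integral_mult_right)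
  qed
  also have "(1 / \<eta>) * n\<^sup>2 \<le> n"
    using mult_left_mono[OF \<eta>(2) n] \<eta>(1) by (simp add: power2_eq_square pos_divide_le_eq)
  also have "t * \<eta> + n = (t + 1) * n + e" using t by (simp add: \<eta>_def algebra_simps)
  finally show "integral {0..t} (\<lambda>s. norm (h s)) \<le> (t + 1) * L2_norm t h + e" by (simp add: n_def)
qed

lemma L2_norm_eq_0_imp_AE:
  fixes h :: "real \<Rightarrow> 'a::real_normed_vector"
  assumes h: "h \<in> L2_loc" and 0: "\<And>t. 0 < t \<Longrightarrow> L2_norm t h = 0"
  shows "AE s in lebesgue_on {0..}. h s = 0"
proof -
  have "AE s in lebesgue. s \<in> {0..real (Suc n)} \<longrightarrow> h s = 0" for n
  proof -
    have "(\<integral>s. (norm (h s))\<^sup>2 \<partial>lebesgue_on {0..real (Suc n)}) = 0"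
      using 0[of "real (Suc n)"] by (simp add: L2_norm_def)
    then have "AE s in lebesgue_on {0..real (Suc n)}. (norm (h s))\<^sup>2 = 0"
      using integral_nonneg_eq_0_iff_AE[OF L2_locD(2)[OF h, of "real (Suc n)"]] by simp
    then show ?thesis by (subst (asm) AE_lebesgue_on) auto
  qed
  then have "AE s in lebesgue. \<forall>n. s \<in> {0..real (Suc n)} \<longrightarrow> h s = 0" by (subst AE_all_countable) blast
  then have "AE s in lebesgue. s \<in> {0..} \<longrightarrow> h s = 0"
  proof eventually_elim
    case (elim s)
    obtain n where "s \<le> real n" using real_arch_simple by blast
    then have "s \<le> real (Suc n)" by simp
    then show ?case using elim by auto
  qed
  then show ?thesis by (subst AE_lebesgue_on) auto
qed

subsection \<open>Density of smooth inputs\<close>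

lemma cube_pos_deriv: "((\<lambda>x::real. (max 0 x)^3) has_real_derivative 3 * (max 0 x)\<^sup>2) (at x)"
proof (cases x "0 :: real" rule: linorder_cases)
  case less
  have "((\<lambda>_. 0) has_real_derivative 3 * (max 0 x)\<^sup>2) (at x)" using less by simp
  then show ?thesis
    by (rule has_field_derivative_transform_within_open[of _ _ _ "{..<0}"]) (use less in auto)
next
  case greater
  have "((\<lambda>x. x^3) has_real_derivative 3 * (max 0 x)\<^sup>2) (at x)" using greater
    by (auto intro!: derivative_eq_intros)
  then show ?thesis
    by (rule has_field_derivative_transform_within_open[of _ _ _ "{0<..}"]) (use greater in auto)
next
  case equal
  have "((\<lambda>h. (max 0 h)^3 / h) \<longlongrightarrow> 0) (at (0::real))"
  proof (rule Lim_null_comparison)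
    show "\<forall>\<^sub>F h in at 0. norm ((max 0 h)^3 / h) \<le> h\<^sup>2" for h :: real
      unfolding eventually_at_filter
      by (intro always_eventually allI impI) (auto simp: max_def power3_eq_cube power2_eq_square)
    show "((\<lambda>h. h\<^sup>2) \<longlongrightarrow> 0) (at (0::real))"
      by (rule tendsto_eq_rhs[OF tendsto_power[OF tendsto_ident_at]]) simp
  qed
  then show ?thesis using equal by (simp add: has_field_derivative_iff)
qed

lemma square_pos_deriv: "((\<lambda>x::real. (max 0 x)\<^sup>2) has_real_derivative 2 * max 0 x) (at x)"
proof (cases x "0 :: real" rule: linorder_cases)
  case less
  have "((\<lambda>_. 0) has_real_derivative 2 * max 0 x) (at x)" using less by simp
  then show ?thesis
    by (rule has_field_derivative_transform_within_open[of _ _ _ "{..<0}"]) (use less in auto)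
next
  case greater
  have "((\<lambda>x. x\<^sup>2) has_real_derivative 2 * max 0 x) (at x)" using greater
    by (auto intro!: derivative_eq_intros)
  then show ?thesis
    by (rule has_field_derivative_transform_within_open[of _ _ _ "{0<..}"]) (use greater in auto)
next
  case equal
  have "((\<lambda>h. (max 0 h)\<^sup>2 / h) \<longlongrightarrow> 0) (at (0::real))"
  proof (rule Lim_null_comparison)
    show "\<forall>\<^sub>F h in at 0. norm ((max 0 h)\<^sup>2 / h) \<le> \<bar>h\<bar>" for h :: real
      unfolding eventually_at_filter
      by (intro always_eventually allI impI) (auto simp: max_def power2_eq_square)
    show "((\<lambda>h. \<bar>h\<bar>) \<longlongrightarrow> 0) (at (0::real))"
      using tendsto_rabs[OF tendsto_ident_at, of "0::real" UNIV] by simp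
  qed
  then show ?thesis using equal by (simp add: has_field_derivative_iff)
qed

text \<open>Cubes of positive parts are of class \<open>C\<^sup>2\<close>.\<close>

definition cutoff :: "real \<Rightarrow> real \<Rightarrow> real" where
  "cutoff T s = (max 0 (1 - (max 0 (s - T))^3))^3"

lemma cutoff_eq_1: "s \<le> T \<Longrightarrow> cutoff T s = 1" by (simp add: cutoff_def)

lemma cutoff_eq_0: "T + 1 \<le> s \<Longrightarrow> cutoff T s = 0"
  using power_mono[of 1 "s - T" 3] by (simp add: cutoff_def)

lemma cutoff_C2:
  "\<exists>c' c''. (\<forall>s. (cutoff T has_real_derivative c' s) (at s)) \<and> (\<forall>s. (c' has_real_derivative c'' s) (at s)) \<and> continuous_on UNIV c''"
proof (intro exI conjI allI)
  define r where "r s = 1 - (max 0 (s - T))^3" for s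
  have shift: "((\<lambda>s. s - T) has_real_derivative 1) (at s)" for s by (auto intro!: derivative_eq_intros)
  have r: "(r has_real_derivative - (3 * (max 0 (s - T))\<^sup>2)) (at s)" for s
    using DERIV_diff[OF DERIV_const[of 1] DERIV_chain2[OF cube_pos_deriv shift]] by (simp add: r_def[abs_def])
  have r2: "((\<lambda>s. (max 0 (s - T))\<^sup>2) has_real_derivative 2 * max 0 (s - T)) (at s)" for s
    using DERIV_chain2[OF square_pos_deriv shift] by simp
  show "(cutoff T has_real_derivative 3 * (max 0 (r s))\<^sup>2 * - (3 * (max 0 (s - T))\<^sup>2)) (at s)" for s
    using DERIV_chain2[OF cube_pos_deriv r, of s] by (simp add: cutoff_def[abs_def] r_def)
  have rsq: "((\<lambda>s. (max 0 (r s))\<^sup>2) has_real_derivative 2 * max 0 (r s) * - (3 * (max 0 (s - T))\<^sup>2)) (at s)" for s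
    using DERIV_chain2[OF square_pos_deriv r, of s] by simp
  show "((\<lambda>s. 3 * (max 0 (r s))\<^sup>2 * - (3 * (max 0 (s - T))\<^sup>2)) has_real_derivative
      (3 * (max 0 (r s))\<^sup>2 * - (3 * (2 * max 0 (s - T))) +
       3 * (2 * max 0 (r s) * - (3 * (max 0 (s - T))\<^sup>2)) * - (3 * (max 0 (s - T))\<^sup>2))) (at s)" for s
    by (rule DERIV_cong[OF DERIV_mult[OF DERIV_cmult[OF rsq, of 3] DERIV_minus[OF DERIV_cmult[OF r2, of 3]]]])
       (simp add: algebra_simps)
  show "continuous_on UNIV (\<lambda>s. 3 * (max 0 (r s))\<^sup>2 * - (3 * (2 * max 0 (s - T))) +
       3 * (2 * max 0 (r s) * - (3 * (max 0 (s - T))\<^sup>2)) * - (3 * (max 0 (s - T))\<^sup>2))"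
    unfolding r_def by (intro continuous_intros)
qed

lemma smooth_cutoff_in_C2_compact_support:
  assumes p: "real_polynomial_function p"
  shows "(\<lambda>s. (p s * cutoff T s) *\<^sub>R v) \<in> C2_compact_support"
  unfolding C2_compact_support_def
proof (intro CollectI conjI)
  obtain p' where p': "real_polynomial_function p'" "\<And>s. (p has_real_derivative p' s) (at s)"
    using has_real_derivative_polynomial_function[OF p] by blast
  obtain p'' where p'': "real_polynomial_function p''" "\<And>s. (p' has_real_derivative p'' s) (at s)"
    using has_real_derivative_polynomial_function[OF p'(1)] by blast
  obtain c' c'' where c: "\<And>s. (cutoff T has_real_derivative c' s) (at s)" "\<And>s. (c' has_real_derivative c'' s) (at s)"
    "continuous_on UNIV c''" using cutoff_C2 by blast
  have cont: "continuous_on {0..} k" if "\<And>s. (k has_real_derivative k' s) (at s)" for k k' :: "real \<Rightarrow> real"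
    using that by (meson DERIV_isCont continuous_at_imp_continuous_on)
  have p''c: "continuous_on {0..} p''"
    using continuous_real_polymonial_function[OF p''(1)] continuous_at_imp_continuous_on by blast
  define h' where "h' s = p s * c' s + p' s * cutoff T s" for s
  define h'' where "h'' s = (p s * c'' s + p' s * c' s) + (p' s * c' s + p'' s * cutoff T s)" for s
  have d1: "((\<lambda>s. p s * cutoff T s) has_real_derivative h' s) (at s)" for s
    unfolding h'_def by (auto intro!: derivative_eq_intros p' c)
  have d2: "(h' has_real_derivative h'' s) (at s)" for s
    unfolding h'_def[abs_def] h''_def by (auto intro!: derivative_eq_intros p' p'' c)
  have vec: "((\<lambda>s. k s *\<^sub>R v) has_vector_derivative k' *\<^sub>R v) (at s within {0..})"
    if "(k has_real_derivative k') (at s)" for k k' s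
  proof -
    have "(k has_vector_derivative k') (at s within {0..})"
      using that by (simp add: has_real_derivative_iff_has_vector_derivative has_vector_derivative_at_within)
    then show ?thesis by (rule bounded_linear.has_vector_derivative[OF bounded_linear_scaleR_left])
  qed
  have "continuous_on {0..} (\<lambda>s. h'' s *\<^sub>R v)"
    unfolding h''_def by (intro continuous_intros cont[OF p'(2)] cont[OF p''(2)] cont[OF c(1)] cont[OF c(2)] p''c
      continuous_on_subset[OF c(3)]) auto
  then have "C1_on {0..} (\<lambda>s. h' s *\<^sub>R v)"
    unfolding C1_on_def by (intro exI[of _ "\<lambda>s. h'' s *\<^sub>R v"] conjI ballI vec d2)
  then show "C2_on {0..} (\<lambda>s. (p s * cutoff T s) *\<^sub>R v)"
    unfolding C2_on_def by (intro exI[of _ "\<lambda>s. h' s *\<^sub>R v"] conjI ballI vec d1)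
  have "{t. 0 \<le> t \<and> (p t * cutoff T t) *\<^sub>R v \<noteq> 0} \<subseteq> {0..max 0 (T + 1)}"
  proof
    fix t assume t: "t \<in> {t. 0 \<le> t \<and> (p t * cutoff T t) *\<^sub>R v \<noteq> 0}"
    then have "\<not> T + 1 \<le> t" using cutoff_eq_0 by auto
    then show "t \<in> {0..max 0 (T + 1)}" using t by auto
  qed
  then have "bounded {t. 0 \<le> t \<and> (p t * cutoff T t) *\<^sub>R v \<noteq> 0}" by (rule bounded_subset[rotated]) simp
  then show "compact (closure {t. 0 \<le> t \<and> (p t * cutoff T t) *\<^sub>R v \<noteq> 0})" by (simp add: compact_closure)
qed

lemma C2_compact_support_add:
  assumes u: "u \<in> C2_compact_support" and v: "v \<in> C2_compact_support"
  shows "(\<lambda>s. u s + v s) \<in> C2_compact_support"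
  unfolding C2_compact_support_def
proof (intro CollectI conjI)
  have C1: "C1_on S (\<lambda>s. a s + b s)" if "C1_on S a" "C1_on S b" for S and a b :: "real \<Rightarrow> 'a"
  proof -
    obtain a' b' where "\<And>t. t \<in> S \<Longrightarrow> (a has_vector_derivative a' t) (at t within S)" "continuous_on S a'"
      "\<And>t. t \<in> S \<Longrightarrow> (b has_vector_derivative b' t) (at t within S)" "continuous_on S b'"
      using \<open>C1_on S a\<close> \<open>C1_on S b\<close> unfolding C1_on_def by blast
    then show ?thesis unfolding C1_on_def
      by (intro exI[of _ "\<lambda>t. a' t + b' t"]) (auto intro!: has_vector_derivative_add continuous_intros)
  qed
  obtain u' v' where "\<And>t. t \<in> {0..} \<Longrightarrow> (u has_vector_derivative u' t) (at t within {0..})" "C1_on {0..} u'"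
    "\<And>t. t \<in> {0..} \<Longrightarrow> (v has_vector_derivative v' t) (at t within {0..})" "C1_on {0..} v'"
    using u v unfolding C2_compact_support_def C2_on_def by blast
  then show "C2_on {0..} (\<lambda>s. u s + v s)" unfolding C2_on_def
    by (intro exI[of _ "\<lambda>t. u' t + v' t"]) (auto intro!: has_vector_derivative_add C1)
  have "bounded {t. 0 \<le> t \<and> u t \<noteq> 0}" "bounded {t. 0 \<le> t \<and> v t \<noteq> 0}"
    using u v unfolding C2_compact_support_def by (auto simp: compact_closure)
  then have "bounded ({t. 0 \<le> t \<and> u t \<noteq> 0} \<union> {t. 0 \<le> t \<and> v t \<noteq> 0})" by simp
  then have "bounded {t. 0 \<le> t \<and> u t + v t \<noteq> 0}" by (rule bounded_subset) auto
  then show "compact (closure {t. 0 \<le> t \<and> u t + v t \<noteq> 0})" by (simp add: compact_closure)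
qed

lemma C2_compact_support_continuous: "u \<in> C2_compact_support \<Longrightarrow> continuous_on {0..} u"
  unfolding C2_compact_support_def by (auto intro: C1_on_continuous C2_on_imp_C1_on)

lemma C2_compact_support_L2_loc: "u \<in> C2_compact_support \<Longrightarrow> u \<in> L2_loc"
  by (intro L2_loc_continuous C2_compact_support_continuous)

lemma L2_loc_indicator:
  fixes v :: "'a::real_normed_vector"
  assumes E: "E \<in> sets lebesgue"
  shows "(\<lambda>s. indicator E s *\<^sub>R v) \<in> L2_loc"
  unfolding L2_loc_def
proof (intro CollectI conjI allI impI)
  have "simple_function (lebesgue_on {0..}) (\<lambda>s. indicator E s *\<^sub>R v)"
  proof (rule simple_function_compose1[where f="\<lambda>s. indicator E s :: real"], rule simple_function_borel_measurable)
    show "(indicator E :: real \<Rightarrow> real) \<in> borel_measurable (lebesgue_on {0..})"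
      by (rule measurable_restrict_space1) (use E in simp)
    have "(indicator E :: real \<Rightarrow> real) ` space (lebesgue_on {0..}) \<subseteq> {0, 1}" by (auto simp: indicator_def)
    then show "finite ((indicator E :: real \<Rightarrow> real) ` space (lebesgue_on {0..}))" by (rule finite_subset) simp
  qed
  then show "strongly_measurable (lebesgue_on {0..}) (\<lambda>s. indicator E s *\<^sub>R v)"
    unfolding strongly_measurable_def by (intro exI[of _ "\<lambda>n s. indicator E s *\<^sub>R v"]) simp
  fix t :: real assume t: "0 < t"
  show "integrable (lebesgue_on {0..t}) (\<lambda>s. (norm (indicator E s *\<^sub>R v))\<^sup>2)"
  proof (rule Bochner_Integration.integrable_bound)
    show "integrable (lebesgue_on {0..t}) (\<lambda>s. (norm v)\<^sup>2)" by (intro continuous_imp_integrable_real continuous_intros)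
    have "(indicator E :: real \<Rightarrow> real) \<in> borel_measurable (lebesgue_on {0..t})"
      by (rule measurable_restrict_space1) (use E in simp)
    then show "(\<lambda>s. (norm (indicator E s *\<^sub>R v))\<^sup>2) \<in> borel_measurable (lebesgue_on {0..t})" by simp
  qed (auto simp: indicator_def)
qed

text \<open>Regularity of Lebesgue measure encloses \<open>E\<close> between a closed and an open
  set, Urysohn's lemma interpolates continuously, Weierstrass replaces the interpolant by a
  polynomial on \<open>{0..T}\<close>, and the cutoff makes the support bounded without altering
  anything on that interval.\<close>

lemma approximate_indicator:
  fixes v :: "'a::real_normed_vector"
  assumes E: "E \<in> sets lebesgue" and T: "0 < T" and e: "0 < e"
  shows "\<exists>w\<in>C2_compact_support. L2_norm T (\<lambda>s. w s - indicator E s *\<^sub>R v) \<le> e"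
proof -
  \<comment> \<open>Squared, because a function bounded by \<open>norm v\<close> and supported on a
    set of measure \<open>\<delta>\<close> has \<open>L^2\<close> norm at most
    \<open>sqrt \<delta> * norm v\<close>, here at most \<open>e / 4\<close>. The tolerance
    \<open>\<epsilon>\<close> below makes the polynomial error \<open>e / 4\<close> as well.\<close>
  define \<delta> where "\<delta> = (e / (4 * (norm v + 1)))\<^sup>2"
  have nv: "0 < norm v + 1" by (simp add: add_nonneg_pos)
  have \<delta>: "0 < \<delta>" using e nv by (simp add: \<delta>_def)
  obtain U where U: "open U" "E \<subseteq> U" "U - E \<in> lmeasurable" "emeasure lebesgue (U - E) < ennreal (\<delta> / 2)"
    using sets_lebesgue_outer_open[OF E, of "\<delta> / 2"] \<delta> by auto
  obtain V where V: "closed V" "V \<subseteq> E" "E - V \<in> lmeasurable" "emeasure lebesgue (E - V) < ennreal (\<delta> / 2)"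
    using sets_lebesgue_inner_closed[OF E, of "\<delta> / 2"] \<delta> by auto
  have "closed (- U)" by (rule closed_Compl[OF U(1)])
  moreover have "V \<inter> - U = {}" using U(2) V(2) by auto
  ultimately obtain k :: "real \<Rightarrow> real" where k: "continuous_on UNIV k" "\<And>s. k s \<in> closed_segment 1 0"
    "\<And>s. s \<in> V \<Longrightarrow> k s = 1" "\<And>s. s \<in> - U \<Longrightarrow> k s = 0"
    using Urysohn[OF V(1), of "- U" 1 0] by metis
  have k01: "0 \<le> k s" "k s \<le> 1" for s using k(2)[of s] by (auto simp: closed_segment_eq_real_ivl)
  define W where "W = (U - E) \<union> (E - V)"
  have W: "W \<in> lmeasurable" using U(3) V(3) by (simp add: W_def fmeasurable.Un)
  have "emeasure lebesgue W \<le> emeasure lebesgue (U - E) + emeasure lebesgue (E - V)"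
    unfolding W_def using U(3) V(3) by (intro emeasure_subadditive) (auto simp: fmeasurableD)
  also have "\<dots> \<le> ennreal (\<delta> / 2) + ennreal (\<delta> / 2)" using U(4) V(4) by (intro add_mono) auto
  also have "\<dots> = ennreal \<delta>" using \<delta> by (simp flip: ennreal_plus)
  finally have mW: "measure lebesgue W \<le> \<delta>" using \<delta> W by (simp add: emeasure_eq_measure2)
  define \<epsilon> where "\<epsilon> = e / (4 * (norm v + 1) * (sqrt T + 1))"
  have sT: "0 < sqrt T + 1" using T by (simp add: add_nonneg_pos)
  have \<epsilon>: "0 < \<epsilon>" using e nv sT by (simp add: \<epsilon>_def)
  obtain p where p: "real_polynomial_function p" "\<And>s. s \<in> {0..T} \<Longrightarrow> \<bar>k s - p s\<bar> < \<epsilon>"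
    using Stone_Weierstrass_real_polynomial_function[of "{0..T}" k \<epsilon>] continuous_on_subset[OF k(1)] \<epsilon> by auto
  define w where "w s = (p s * cutoff T s) *\<^sub>R v" for s
  have w: "w \<in> C2_compact_support" unfolding w_def[abs_def] by (rule smooth_cutoff_in_C2_compact_support[OF p(1)])
  have wL: "w \<in> L2_loc" by (rule C2_compact_support_L2_loc[OF w])
  have kL: "(\<lambda>s. k s *\<^sub>R v) \<in> L2_loc"
    by (intro L2_loc_continuous continuous_intros continuous_on_subset[OF k(1)]) auto
  have "L2_norm T (\<lambda>s. w s - k s *\<^sub>R v) \<le> sqrt T * (\<epsilon> * norm v)"
  proof (rule L2_norm_bounded[OF _ _ T])
    show "continuous_on {0..T} (\<lambda>s. w s - k s *\<^sub>R v)"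
      by (intro continuous_intros continuous_on_subset[OF C2_compact_support_continuous[OF w]] continuous_on_subset[OF k(1)]) auto
    fix s assume s: "s \<in> {0..T}"
    then have "w s - k s *\<^sub>R v = (p s - k s) *\<^sub>R v" by (simp add: w_def cutoff_eq_1 scaleR_diff_left)
    then show "norm (w s - k s *\<^sub>R v) \<le> \<epsilon> * norm v"
      using p(2)[OF s] by (simp add: abs_minus_commute mult_right_mono)
  qed (use \<epsilon> in auto)
  also have "\<dots> \<le> (sqrt T + 1) * (\<epsilon> * (norm v + 1))" using \<epsilon> T by (intro mult_mono) auto
  also have "\<dots> = e / 4"
  proof -
    have "a * (e / (4 * b * a) * b) = e / 4" if "0 < a" "0 < b" for a b :: real using that by simp
    then show ?thesis unfolding \<epsilon>_def using nv sT by blast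
  qed
  finally have 1: "L2_norm T (\<lambda>s. w s - k s *\<^sub>R v) \<le> e / 4" .
  have "L2_norm T (\<lambda>s. k s *\<^sub>R v - indicator E s *\<^sub>R v) \<le> sqrt \<delta> * norm v"
  proof (rule power2_le_imp_le)
    have iW: "integrable (lebesgue_on {0..T}) (\<lambda>s. (norm v)\<^sup>2 * indicator W s)"
    proof -
      have "W \<inter> {0..T} \<in> lmeasurable" by (rule fmeasurable_Int_fmeasurable[OF W]) simp
      then have "integrable lebesgue (\<lambda>s. (norm v)\<^sup>2 * indicator (W \<inter> {0..T}) s)"
        unfolding lmeasurable_iff_integrable by (rule integrable_mult_right)
      then show ?thesis
        by (subst integrable_restrict_space) (auto simp: indicator_inter_arith mult_ac)
    qed
    have "(L2_norm T (\<lambda>s. k s *\<^sub>R v - indicator E s *\<^sub>R v))\<^sup>2 = (\<integral>s. (norm (k s *\<^sub>R v - indicator E s *\<^sub>R v))\<^sup>2 \<partial>lebesgue_on {0..T})"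
      by (simp add: L2_norm_def)
    also have "\<dots> \<le> (\<integral>s. (norm v)\<^sup>2 * indicator W s \<partial>lebesgue_on {0..T})"
    proof (rule integral_mono[OF L2_locD(2)[OF L2_loc_diff[OF kL L2_loc_indicator[OF E]] T] iW])
      fix s
      have "\<bar>k s - indicator E s\<bar> \<le> indicator W s"
        using k01[of s] k(3,4)[of s] U(2) V(2) by (auto simp: W_def indicator_def)
      then have "\<bar>k s - indicator E s\<bar>\<^sup>2 \<le> indicator W s" by (auto simp: indicator_def abs_square_le_1 split: if_splits)
      then have "\<bar>k s - indicator E s\<bar>\<^sup>2 * (norm v)\<^sup>2 \<le> indicator W s * (norm v)\<^sup>2" by (rule mult_right_mono) simp
      then show "(norm (k s *\<^sub>R v - indicator E s *\<^sub>R v))\<^sup>2 \<le> (norm v)\<^sup>2 * indicator W s"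
        by (simp add: power_mult_distrib mult.commute flip: scaleR_diff_left)
    qed
    also have "\<dots> = (norm v)\<^sup>2 * measure lebesgue (W \<inter> {0..T})"
      using W by (subst integral_restrict_space) (auto simp: indicator_inter_arith[symmetric] mult.assoc mult.left_commute[of "indicator _ _"] Int_commute)
    also have "\<dots> \<le> (norm v)\<^sup>2 * \<delta>"
      using W mW by (intro mult_left_mono order_trans[OF measure_mono_fmeasurable mW]) (auto simp: fmeasurableD)
    also have "\<dots> = (sqrt \<delta> * norm v)\<^sup>2" using \<delta> by (simp add: power_mult_distrib)
    finally show "(L2_norm T (\<lambda>s. k s *\<^sub>R v - indicator E s *\<^sub>R v))\<^sup>2 \<le> (sqrt \<delta> * norm v)\<^sup>2" .
  qed (use \<delta> in simp)
  also have "sqrt \<delta> = e / (4 * (norm v + 1))" using e nv by (simp add: \<delta>_def)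
  also have "\<dots> * norm v \<le> e / (4 * (norm v + 1)) * (norm v + 1)" using e nv by (intro mult_left_mono) auto
  also have "\<dots> = e / 4"
  proof -
    have "e / (4 * b) * b = e / 4" if "0 < b" for b :: real using that by simp
    then show ?thesis using nv by blast
  qed
  finally have 2: "L2_norm T (\<lambda>s. k s *\<^sub>R v - indicator E s *\<^sub>R v) \<le> e / 4" .
  have "L2_norm T (\<lambda>s. w s - indicator E s *\<^sub>R v) \<le>
      2 * (L2_norm T (\<lambda>s. w s - k s *\<^sub>R v) + L2_norm T (\<lambda>s. k s *\<^sub>R v - indicator E s *\<^sub>R v))"
    by (rule L2_norm_triangle[OF wL kL L2_loc_indicator[OF E] T])
  also have "\<dots> \<le> e" using 1 2 by simp
  finally show ?thesis using w by blast
qed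

lemma L2_norm_cong:
  "(\<And>s. s \<in> {0..t} \<Longrightarrow> norm (g s) = norm (h s)) \<Longrightarrow> L2_norm t g = L2_norm t h"
  unfolding L2_norm_def
  by (intro arg_cong[where f=sqrt] Bochner_Integration.integral_cong) (auto simp: space_restrict_space)

text \<open>Membership and approximation share one induction, because the triangle inequality for
  \<open>L2_norm\<close> presupposes membership.\<close>

lemma approximate_sum_indicator:
  fixes F :: "'a::real_normed_vector set"
  assumes F: "finite F" and E: "\<And>c. E c \<in> sets lebesgue" and T: "0 < T"
  shows "(\<lambda>s. \<Sum>c\<in>F. indicator (E c) s *\<^sub>R c) \<in> L2_loc \<and>
    (\<forall>e>0. \<exists>w\<in>C2_compact_support. L2_norm T (\<lambda>s. w s - (\<Sum>c\<in>F. indicator (E c) s *\<^sub>R c)) \<le> e)"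
  using F
proof (induction F)
  case empty
  have "(\<lambda>s. 0 :: 'a) \<in> L2_loc" by (intro L2_loc_continuous continuous_on_const)
  moreover have "\<exists>w\<in>C2_compact_support :: (real \<Rightarrow> 'a) set. L2_norm T w \<le> e" if "0 < e" for e
    using approximate_indicator[OF sets.empty_sets T that, of "0 :: 'a"] by simp
  ultimately show ?case by simp
next
  case (insert c F)
  define S where "S s = (\<Sum>c\<in>F. indicator (E c) s *\<^sub>R c)" for s
  have S: "S \<in> L2_loc" using insert.IH by (simp add: S_def[abs_def])
  have eq: "(\<Sum>c\<in>insert c F. indicator (E c) s *\<^sub>R c) = indicator (E c) s *\<^sub>R c + S s" for s
    unfolding S_def by (rule sum.insert[OF insert.hyps])
  show ?case
    unfolding eq
  proof (intro conjI allI impI L2_loc_add L2_loc_indicator E S)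
    fix e :: real assume e: "0 < e"
    then have e4: "0 < e / 4" by simp
    obtain w\<^sub>1 where w1: "w\<^sub>1 \<in> C2_compact_support" "L2_norm T (\<lambda>s. w\<^sub>1 s - indicator (E c) s *\<^sub>R c) \<le> e / 4"
      using approximate_indicator[OF E T e4] by blast
    obtain w\<^sub>2 where w2: "w\<^sub>2 \<in> C2_compact_support" "L2_norm T (\<lambda>s. w\<^sub>2 s - S s) \<le> e / 4"
      using insert.IH e4 unfolding S_def by blast
    have "L2_norm T (\<lambda>s. (w\<^sub>1 s - indicator (E c) s *\<^sub>R c) + (w\<^sub>2 s - S s)) \<le>
        2 * (L2_norm T (\<lambda>s. w\<^sub>1 s - indicator (E c) s *\<^sub>R c) + L2_norm T (\<lambda>s. w\<^sub>2 s - S s))"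
      by (intro L2_norm_add L2_loc_diff C2_compact_support_L2_loc w1(1) w2(1) L2_loc_indicator E S T)
    also have "\<dots> \<le> e" using w1(2) w2(2) by simp
    finally have "L2_norm T (\<lambda>s. (w\<^sub>1 s + w\<^sub>2 s) - (indicator (E c) s *\<^sub>R c + S s)) \<le> e"
      by (simp add: algebra_simps)
    then show "\<exists>w\<in>C2_compact_support. L2_norm T (\<lambda>s. w s - (indicator (E c) s *\<^sub>R c + S s)) \<le> e"
      by (intro bexI[of _ "\<lambda>s. w\<^sub>1 s + w\<^sub>2 s"] C2_compact_support_add w1(1) w2(1))
  qed
qed

lemma approximate_simple_function:
  fixes \<psi> :: "real \<Rightarrow> 'a::real_normed_vector"
  assumes \<psi>: "simple_function (lebesgue_on {0..}) \<psi>" and T: "0 < T" and e: "0 < e"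
  shows "\<exists>w\<in>C2_compact_support. L2_norm T (\<lambda>s. w s - \<psi> s) \<le> e"
proof -
  define F where "F = \<psi> ` {0..}"
  define E where "E c = \<psi> -` {c} \<inter> {0..}" for c
  have F: "finite F" using simple_functionD(1)[OF \<psi>] by (simp add: F_def space_restrict_space)
  have E: "E c \<in> sets lebesgue" for c
    using simple_functionD(2)[OF \<psi>, of "{c}"] by (simp add: E_def space_restrict_space sets_restrict_space_iff)
  have eq: "(\<Sum>c\<in>F. indicator (E c) s *\<^sub>R c) = \<psi> s" if "s \<in> {0..T}" for s
  proof -
    have "(\<Sum>c\<in>F. indicator (E c) s *\<^sub>R c) = (\<Sum>c\<in>F. if c = \<psi> s then c else 0)"
      using that by (intro sum.cong) (auto simp: E_def indicator_def)
    also have "\<dots> = \<psi> s" using F that by (simp add: F_def)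
    finally show ?thesis .
  qed
  have sum_eq: "L2_norm T (\<lambda>s. w s - (\<Sum>c\<in>F. indicator (E c) s *\<^sub>R c)) = L2_norm T (\<lambda>s. w s - \<psi> s)" for w
    by (rule L2_norm_cong) (simp add: eq)
  show ?thesis
    using conjunct2[OF approximate_sum_indicator[where E=E, OF F E T], rule_format, OF e] unfolding sum_eq .
qed

lemma strongly_measurable_simple: "simple_function N h \<Longrightarrow> strongly_measurable N h"
  unfolding strongly_measurable_def by (intro exI[of _ "\<lambda>_. h"]) simp

lemma strongly_measurable_norm_Icc:
  fixes h :: "real \<Rightarrow> 'a::real_normed_vector"
  assumes "strongly_measurable (lebesgue_on {0..}) h"
  shows "(\<lambda>s. norm (h s)) \<in> borel_measurable (lebesgue_on {0..t})"
  by (rule strongly_measurable_norm[OF _ strongly_measurable_restrict[OF assms]]) auto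

text \<open>Truncating the approximating simple functions at \<open>2 |u|\<close> makes dominated convergence applicable.\<close>

lemma C2_compact_support_dense_Icc:
  fixes u :: "real \<Rightarrow> 'a::real_normed_vector"
  assumes u: "u \<in> L2_loc" and T: "0 < T" and e: "0 < e"
  shows "\<exists>w\<in>C2_compact_support. L2_norm T (\<lambda>s. w s - u s) \<le> e"
proof -
  obtain \<phi> where \<phi>: "\<And>n. simple_function (lebesgue_on {0..}) (\<phi> n)" "AE s in lebesgue_on {0..}. (\<lambda>n. \<phi> n s) \<longlonglongrightarrow> u s"
    using L2_locD(1)[OF u] unfolding strongly_measurable_def by blast
  define W where "W n = {s \<in> space (lebesgue_on {0..}). norm (\<phi> n s) \<le> 2 * norm (u s)}" for n
  have um: "(\<lambda>s. norm (u s)) \<in> borel_measurable (lebesgue_on {0..})"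
    by (rule strongly_measurable_norm[OF _ L2_locD(1)[OF u]]) simp
  have "(\<lambda>s. norm (\<phi> n s)) \<in> borel_measurable (lebesgue_on {0..})" for n
    by (rule strongly_measurable_norm[OF _ strongly_measurable_simple[OF \<phi>(1)]]) simp
  then have W: "W n \<in> sets (lebesgue_on {0..})" for n
    unfolding W_def using um by (intro borel_measurable_le) auto
  define \<psi> where "\<psi> n s = (if s \<in> W n then \<phi> n s else 0)" for n s
  have \<psi>: "simple_function (lebesgue_on {0..}) (\<psi> n)" for n
    unfolding \<psi>_def[abs_def] using W by (intro simple_function_If_set \<phi>(1) simple_function_const) auto
  have \<psi>_le: "norm (\<psi> n s) \<le> 2 * norm (u s)" for n s by (simp add: \<psi>_def W_def)
  have \<psi>_lim: "AE s in lebesgue_on {0..}. (\<lambda>n. \<psi> n s) \<longlonglongrightarrow> u s"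
    using \<phi>(2) AE_space
  proof eventually_elim
    case (elim s)
    show ?case
    proof (cases "u s = 0")
      case True
      then have "\<psi> n s = 0" for n using \<psi>_le[of n s] by simp
      then show ?thesis using True by simp
    next
      case False
      have "\<forall>\<^sub>F n in sequentially. norm (\<phi> n s) < 2 * norm (u s)"
        by (rule order_tendstoD(2)[OF tendsto_norm[OF elim(1)]]) (use False in simp)
      then have "\<forall>\<^sub>F n in sequentially. \<psi> n s = \<phi> n s"
        by eventually_elim (use elim(2) in \<open>simp add: \<psi>_def W_def\<close>)
      then show ?thesis using elim(1) by (rule iffD2[OF tendsto_cong])
    qed
  qed
  have \<psi>L: "\<psi> n \<in> L2_loc" for n
    unfolding L2_loc_def
  proof (intro CollectI conjI allI impI strongly_measurable_simple \<psi>)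
    fix t :: real assume t: "0 < t"
    show "integrable (lebesgue_on {0..t}) (\<lambda>s. (norm (\<psi> n s))\<^sup>2)"
    proof (rule Bochner_Integration.integrable_bound)
      show "integrable (lebesgue_on {0..t}) (\<lambda>s. 4 * (norm (u s))\<^sup>2)" using L2_locD(2)[OF u t] by simp
      show "(\<lambda>s. (norm (\<psi> n s))\<^sup>2) \<in> borel_measurable (lebesgue_on {0..t})"
        using strongly_measurable_norm_Icc[OF strongly_measurable_simple[OF \<psi>]] by simp
      have "(norm (\<psi> n s))\<^sup>2 \<le> 4 * (norm (u s))\<^sup>2" for s
        using power_mono[OF \<psi>_le, of n s 2] by (simp add: power_mult_distrib)
      then show "AE s in lebesgue_on {0..t}. norm ((norm (\<psi> n s))\<^sup>2) \<le> norm (4 * (norm (u s))\<^sup>2)" by simp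
    qed
  qed
  have "(\<lambda>n. \<integral>s. (norm (\<psi> n s - u s))\<^sup>2 \<partial>lebesgue_on {0..T}) \<longlonglongrightarrow> (\<integral>s. 0 \<partial>lebesgue_on {0..T})"
  proof (rule integral_dominated_convergence[where w="\<lambda>s. 9 * (norm (u s))\<^sup>2"])
    show "(\<lambda>s. (norm (\<psi> n s - u s))\<^sup>2) \<in> borel_measurable (lebesgue_on {0..T})" for n
      using strongly_measurable_norm_Icc[OF L2_locD(1)[OF L2_loc_diff[OF \<psi>L u]]] by simp
    show "integrable (lebesgue_on {0..T}) (\<lambda>s. 9 * (norm (u s))\<^sup>2)" using L2_locD(2)[OF u T] by simp
    have "AE s in lebesgue. s \<in> {0..} \<longrightarrow> (\<lambda>n. \<psi> n s) \<longlonglongrightarrow> u s"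
      using \<psi>_lim by (subst (asm) AE_lebesgue_on) auto
    then have "AE s in lebesgue. s \<in> {0..T} \<longrightarrow> (\<lambda>n. (norm (\<psi> n s - u s))\<^sup>2) \<longlonglongrightarrow> 0"
    proof eventually_elim
      case (elim s)
      have "(\<lambda>n. (norm (\<psi> n s - u s))\<^sup>2) \<longlonglongrightarrow> (norm (u s - u s))\<^sup>2" if "s \<in> {0..T}"
        using elim that by (intro tendsto_intros) auto
      then show ?case by simp
    qed
    then show "AE s in lebesgue_on {0..T}. (\<lambda>n. (norm (\<psi> n s - u s))\<^sup>2) \<longlonglongrightarrow> 0"
      by (subst AE_lebesgue_on) auto
    have "(norm (\<psi> n s - u s))\<^sup>2 \<le> 9 * (norm (u s))\<^sup>2" for n s
    proof -
      have "norm (\<psi> n s - u s) \<le> 3 * norm (u s)" using norm_triangle_ineq4[of "\<psi> n s" "u s"] \<psi>_le[of n s] by simp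
      from power_mono[OF this, of 2] show ?thesis by (simp add: power_mult_distrib)
    qed
    then show "AE s in lebesgue_on {0..T}. norm ((norm (\<psi> n s - u s))\<^sup>2) \<le> 9 * (norm (u s))\<^sup>2" for n by simp
  qed simp
  then have "(\<lambda>n. L2_norm T (\<lambda>s. \<psi> n s - u s)) \<longlonglongrightarrow> sqrt 0"
    unfolding L2_norm_def by (intro tendsto_real_sqrt) simp
  then have "\<forall>\<^sub>F n in sequentially. L2_norm T (\<lambda>s. \<psi> n s - u s) < e / 4"
    by (rule order_tendstoD(2)) (use e in simp)
  then obtain n where n: "L2_norm T (\<lambda>s. \<psi> n s - u s) < e / 4" using eventually_happens by fastforce
  have "0 < e / 4" using e by simp
  then obtain w where w: "w \<in> C2_compact_support" "L2_norm T (\<lambda>s. w s - \<psi> n s) \<le> e / 4"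
    using approximate_simple_function[OF \<psi> T] by blast
  have "L2_norm T (\<lambda>s. w s - u s) \<le> 2 * (L2_norm T (\<lambda>s. w s - \<psi> n s) + L2_norm T (\<lambda>s. \<psi> n s - u s))"
    by (rule L2_norm_triangle[OF C2_compact_support_L2_loc[OF w(1)] \<psi>L u T])
  also have "\<dots> \<le> e" using n w(2) by simp
  finally show ?thesis using w(1) by blast
qed

text \<open>The \<open>n\<close>-th approximant is good on \<open>{0..Suc n}\<close> only; as the
  norms increase with the interval, one sequence then serves for every \<open>t\<close>.\<close>

lemma C2_compact_support_dense:
  fixes u :: "real \<Rightarrow> 'a::real_normed_vector"
  assumes u: "u \<in> L2_loc"
  shows "\<exists>w. (\<forall>n. w n \<in> C2_compact_support) \<and> L2_loc_tendsto w u"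
proof -
  have "\<exists>w\<in>C2_compact_support. L2_norm (real (Suc n)) (\<lambda>s. w s - u s) \<le> 1 / real (Suc n)" for n
    by (rule C2_compact_support_dense_Icc[OF u]) auto
  then obtain w where w: "\<And>n. w n \<in> C2_compact_support"
    "\<And>n. L2_norm (real (Suc n)) (\<lambda>s. w n s - u s) \<le> 1 / real (Suc n)" by metis
  have wL: "w n \<in> L2_loc" for n by (rule C2_compact_support_L2_loc[OF w(1)])
  have "(\<lambda>n. L2_norm t (\<lambda>s. w n s - u s)) \<longlonglongrightarrow> 0" if t: "0 < t" for t
  proof (rule Lim_null_comparison)
    obtain m where m: "t \<le> real m" using real_arch_simple by blast
    show "\<forall>\<^sub>F n in sequentially. norm (L2_norm t (\<lambda>s. w n s - u s)) \<le> 1 / real (Suc n)"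
    proof (rule eventually_sequentiallyI[of m])
      fix n assume "m \<le> n"
      then have "t \<le> real (Suc n)" using m by linarith
      then have "L2_norm t (\<lambda>s. w n s - u s) \<le> L2_norm (real (Suc n)) (\<lambda>s. w n s - u s)"
        by (rule L2_norm_mono[OF L2_loc_diff[OF wL u] t])
      also have "\<dots> \<le> 1 / real (Suc n)" by (rule w(2))
      finally show "norm (L2_norm t (\<lambda>s. w n s - u s)) \<le> 1 / real (Suc n)" by (simp add: L2_norm_nonneg)
    qed
    show "(\<lambda>n. 1 / real (Suc n)) \<longlonglongrightarrow> 0" by (rule LIMSEQ_Suc[OF lim_1_over_n])
  qed
  then show ?thesis using w(1) wL u unfolding L2_loc_tendsto_def by blast
qed

section \<open>Generalized solutions\<close>

lemma continuous_on_atLeast_0: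
  assumes "\<And>T. 0 < T \<Longrightarrow> continuous_on {0..T} h"
  shows "continuous_on {0::real..} h"
  unfolding continuous_on_eq_continuous_within
proof
  fix t :: real assume "t \<in> {0..}"
  then have t: "0 \<le> t" by simp
  have "continuous_on {0..t + 1} h" by (rule assms) (use t in simp)
  moreover have "t \<in> {0..t + 1}" using t by simp
  ultimately have "continuous (at t within {0..t + 1}) h" unfolding continuous_on_eq_continuous_within by blast
  moreover have "at t within {0..t + 1} = at t within {0..}" by (rule at_within_Icc_0[OF t]) simp
  ultimately show "continuous (at t within {0..}) h" by simp
qed

lemma linear_in_class_K: "0 < a \<Longrightarrow> (\<lambda>r. a * r) \<in> class_K"
  unfolding class_K_def by (auto intro!: continuous_intros strict_mono_onI)

text \<open>Turns a quadratic energy inequality into the sum of two linear comparison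
  functions.\<close>

lemma sqrt_of_square_bound:
  fixes a b c d e x :: real
  assumes "a * x\<^sup>2 \<le> b * d\<^sup>2 + c * e\<^sup>2" "0 < a" "0 < b" "0 < c" "0 \<le> d" "0 \<le> e"
  shows "x \<le> sqrt (b / a) * d + sqrt (c / a) * e"
proof (rule power2_le_imp_le)
  have "x\<^sup>2 \<le> (b * d\<^sup>2 + c * e\<^sup>2) / a" using assms by (simp add: pos_le_divide_eq mult.commute)
  also have "\<dots> = (sqrt (b / a) * d)\<^sup>2 + (sqrt (c / a) * e)\<^sup>2"
    using assms by (simp add: power_mult_distrib add_divide_distrib)
  also have "\<dots> \<le> (sqrt (b / a) * d + sqrt (c / a) * e)\<^sup>2"
    using assms by (simp add: power2_sum)
  finally show "x\<^sup>2 \<le> (sqrt (b / a) * d + sqrt (c / a) * e)\<^sup>2" .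
qed (use assms in simp)

section \<open>Well-posedness and stability of generalized solutions\<close>

context closed_loop
begin

abbreviation classical where "classical \<equiv> unique_global_classical_solution D A f B"

abbreviation generalized where "generalized \<equiv> generalized_solution_output D A f B C"

lemma classical_sol_on:
  assumes "classical x\<^sub>0 u x" shows "sol_on T u x" "x 0 = x\<^sub>0"
  using assms classical_solution_imp_sol_on unfolding unique_global_classical_solution_def by blast+

lemma classical_energy:
  assumes x: "classical x\<^sub>0 u x" and u: "u \<in> C2_compact_support" and t: "0 < t"
  shows "m\<^sub>1 * (norm (x t))\<^sup>2 \<le> m\<^sub>2 * (norm x\<^sub>0)\<^sup>2 + 1 / (2 * \<zeta>) * (L2_norm t u)\<^sup>2"
proof -
  have uc: "continuous_on {0..t} u"
    by (rule continuous_on_subset[OF C2_compact_support_continuous[OF u]]) auto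
  show ?thesis
    using sol_on_energy[OF t classical_sol_on(1)[OF x] uc, of t] t
    by (simp add: L2_norm_continuous[OF uc] classical_sol_on(2)[OF x])
qed

text \<open>Covers \<open>t = 0\<close>, which the energy inequality on a nondegenerate interval
  leaves out.\<close>

lemma classical_initial: "m\<^sub>1 * (norm x)\<^sup>2 \<le> m\<^sub>2 * (norm x)\<^sup>2" for x :: 'x
  using M_bounds[of 0 x] by simp

text \<open>The energy inequality confines all solutions with data of size at most
  \<open>\<rho>\<close> to one ball, on which the Lipschitz comparison has a common constant. Thus
  the dependence on the data is locally Lipschitz in the \<open>L^2\<close> norm of the
  input.\<close>

lemma classical_diff_bound:
  assumes T: "0 < T" and \<rho>: "0 \<le> \<rho>"
  shows "\<exists>K\<ge>0. \<forall>x\<^sub>0 y\<^sub>0 u v x y. classical x\<^sub>0 u x \<longrightarrow> classical y\<^sub>0 v y \<longrightarrow>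
    u \<in> C2_compact_support \<longrightarrow> v \<in> C2_compact_support \<longrightarrow>
    norm x\<^sub>0 \<le> \<rho> \<longrightarrow> norm y\<^sub>0 \<le> \<rho> \<longrightarrow> L2_norm T u \<le> \<rho> \<longrightarrow> L2_norm T v \<le> \<rho> \<longrightarrow>
    (\<forall>t\<in>{0..T}. norm (x t - y t) \<le> K * (norm (x\<^sub>0 - y\<^sub>0) + L2_norm T (\<lambda>s. u s - v s)))"
proof -
  define r where "r = sqrt (m\<^sub>2 / m\<^sub>1) * \<rho> + sqrt (1 / (2 * \<zeta>) / m\<^sub>1) * \<rho>"
  have bound: "norm (x t) \<le> r"
    if x: "classical x\<^sub>0 u x" and u: "u \<in> C2_compact_support" and le: "norm x\<^sub>0 \<le> \<rho>" "L2_norm T u \<le> \<rho>" and t: "t \<in> {0..T}"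
    for x\<^sub>0 u x t
  proof -
    have "m\<^sub>1 * (norm (x t))\<^sup>2 \<le> m\<^sub>2 * \<rho>\<^sup>2 + 1 / (2 * \<zeta>) * \<rho>\<^sup>2"
    proof (cases "t = 0")
      case True
      have "m\<^sub>1 * (norm (x t))\<^sup>2 \<le> m\<^sub>2 * (norm x\<^sub>0)\<^sup>2"
        using True classical_initial classical_sol_on(2)[OF x] by simp
      also have "\<dots> \<le> m\<^sub>2 * \<rho>\<^sup>2" using le(1) m_pos by (intro mult_left_mono power_mono) auto
      also have "\<dots> \<le> m\<^sub>2 * \<rho>\<^sup>2 + 1 / (2 * \<zeta>) * \<rho>\<^sup>2" using zeta_pos by simp
      finally show ?thesis .
    next
      case False
      then have t': "0 < t" "t \<le> T" using t by auto
      have "L2_norm t u \<le> \<rho>" using L2_norm_mono[OF C2_compact_support_L2_loc[OF u] t'] le(2) by simp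
      then show ?thesis
        using le(1) m_pos zeta_pos
        by (intro order_trans[OF classical_energy[OF x u t'(1)]] add_mono mult_left_mono power_mono) (auto simp: L2_norm_nonneg)
    qed
    then show ?thesis unfolding r_def using m_pos zeta_pos \<rho> by (intro sqrt_of_square_bound) auto
  qed
  obtain K where K: "0 \<le> K" "\<And>u v x y t. sol_on T u x \<Longrightarrow> sol_on T v y \<Longrightarrow> continuous_on {0..T} u \<Longrightarrow> continuous_on {0..T} v \<Longrightarrow>
      (\<forall>t\<in>{0..T}. norm (x t) \<le> r \<and> norm (y t) \<le> r) \<Longrightarrow> t \<in> {0..T} \<Longrightarrow>
      norm (x t - y t) \<le> K * (norm (x 0 - y 0) + integral {0..T} (\<lambda>s. norm (u s - v s)))"
    using sol_on_diff_bound[OF T, of r] by blast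
  have "norm (x t - y t) \<le> K * (T + 1) * (norm (x\<^sub>0 - y\<^sub>0) + L2_norm T (\<lambda>s. u s - v s))"
    if x: "classical x\<^sub>0 u x" and y: "classical y\<^sub>0 v y" and uv: "u \<in> C2_compact_support" "v \<in> C2_compact_support"
      and le: "norm x\<^sub>0 \<le> \<rho>" "norm y\<^sub>0 \<le> \<rho>" "L2_norm T u \<le> \<rho>" "L2_norm T v \<le> \<rho>" and t: "t \<in> {0..T}"
    for x\<^sub>0 y\<^sub>0 u v x y t
  proof -
    have uc: "continuous_on {0..T} u" "continuous_on {0..T} v"
      using uv by (auto intro: continuous_on_subset[OF C2_compact_support_continuous])
    have "norm (x t - y t) \<le> K * (norm (x 0 - y 0) + integral {0..T} (\<lambda>s. norm (u s - v s)))"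
      using bound[OF x uv(1) le(1,3)] bound[OF y uv(2) le(2,4)]
      by (intro K(2)[OF classical_sol_on(1)[OF x] classical_sol_on(1)[OF y] uc _ t]) auto
    also have "\<dots> \<le> K * ((T + 1) * norm (x\<^sub>0 - y\<^sub>0) + (T + 1) * L2_norm T (\<lambda>s. u s - v s))"
    proof (intro mult_left_mono add_mono K(1))
      show "norm (x 0 - y 0) \<le> (T + 1) * norm (x\<^sub>0 - y\<^sub>0)"
        using mult_right_mono[of 1 "T + 1" "norm (x\<^sub>0 - y\<^sub>0)"] T
        by (simp add: classical_sol_on(2)[OF x] classical_sol_on(2)[OF y])
      show "integral {0..T} (\<lambda>s. norm (u s - v s)) \<le> (T + 1) * L2_norm T (\<lambda>s. u s - v s)"
        by (intro integral_norm_le_L2_norm continuous_intros uc T)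
    qed
    finally show ?thesis by (simp add: algebra_simps)
  qed
  moreover have "0 \<le> K * (T + 1)" using K(1) T by simp
  ultimately show ?thesis by blast
qed

lemma generalizedE:
  assumes "generalized x\<^sub>0 u x y"
  obtains x\<^sub>0\<^sub>n u\<^sub>n x\<^sub>n where "\<And>n. u\<^sub>n n \<in> C2_compact_support" "x\<^sub>0\<^sub>n \<longlonglongrightarrow> x\<^sub>0" "L2_loc_tendsto u\<^sub>n u"
    "\<And>n. classical (x\<^sub>0\<^sub>n n) (u\<^sub>n n) (x\<^sub>n n)" "\<And>t. 0 < t \<Longrightarrow> uniform_limit {0..t} x\<^sub>n x sequentially"
    "L2_loc_tendsto (\<lambda>n s. C s (x\<^sub>n n s)) y"
  using assms unfolding generalized_solution_output_def by blast

lemma generalized_continuous: "generalized x\<^sub>0 u x y \<Longrightarrow> continuous_on {0..} x"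
  unfolding generalized_solution_output_def by blast

lemma generalized_L2_loc: "generalized x\<^sub>0 u x y \<Longrightarrow> u \<in> L2_loc" "generalized x\<^sub>0 u x y \<Longrightarrow> y \<in> L2_loc"
  unfolding generalized_solution_output_def L2_loc_tendsto_def by blast+

lemma L2_loc_tendstoD:
  assumes "L2_loc_tendsto h h\<^sub>0"
  shows "h n \<in> L2_loc" "h\<^sub>0 \<in> L2_loc" "0 < t \<Longrightarrow> (\<lambda>n. L2_norm t (\<lambda>s. h n s - h\<^sub>0 s)) \<longlonglongrightarrow> 0"
  using assms unfolding L2_loc_tendsto_def by auto

text \<open>Approximating data leave the ball of radius \<open>\<rho>\<close> only slightly; the
  factor \<open>2\<close> is the one of \<open>L2_norm_add\<close>.\<close>

lemma eventually_bounded_data: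
  assumes x0: "x\<^sub>0\<^sub>n \<longlonglongrightarrow> x\<^sub>0" and u: "L2_loc_tendsto u\<^sub>n u" and T: "0 < T"
    and \<rho>: "norm x\<^sub>0 \<le> \<rho>" "L2_norm T u \<le> \<rho>"
  shows "\<forall>\<^sub>F n in sequentially. norm (x\<^sub>0\<^sub>n n) \<le> 2 * (\<rho> + 1) \<and> L2_norm T (u\<^sub>n n) \<le> 2 * (\<rho> + 1)"
proof -
  have \<rho>0: "0 \<le> \<rho>" using \<rho>(1) norm_ge_zero order_trans by blast
  have "norm x\<^sub>0 < 2 * (\<rho> + 1)" using \<rho>(1) \<rho>0 by simp
  then have "\<forall>\<^sub>F n in sequentially. norm (x\<^sub>0\<^sub>n n) < 2 * (\<rho> + 1)"
    by (rule order_tendstoD(2)[OF tendsto_norm[OF x0]])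
  moreover have "\<forall>\<^sub>F n in sequentially. L2_norm T (\<lambda>s. u\<^sub>n n s - u s) < 1"
    by (rule order_tendstoD(2)[OF L2_loc_tendstoD(3)[OF u T]]) simp
  ultimately show ?thesis
  proof eventually_elim
    case (elim n)
    have "L2_norm T (\<lambda>s. (u\<^sub>n n s - u s) + u s) \<le> 2 * (L2_norm T (\<lambda>s. u\<^sub>n n s - u s) + L2_norm T u)"
      by (intro L2_norm_add L2_loc_diff L2_loc_tendstoD[OF u] T)
    then show ?case using elim \<rho>(2) by simp
  qed
qed

text \<open>The estimate for classical solutions is uniform on balls of data, and the approximating
  data eventually lie in a slightly larger ball, so it passes to the limit.\<close>

lemma generalized_diff_bound:
  assumes T: "0 < T" and \<rho>: "0 \<le> \<rho>"
  shows "\<exists>K\<ge>0. \<forall>x\<^sub>0 y\<^sub>0 u v x y z w. generalized x\<^sub>0 u x z \<longrightarrow> generalized y\<^sub>0 v y w \<longrightarrow>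
    norm x\<^sub>0 \<le> \<rho> \<longrightarrow> norm y\<^sub>0 \<le> \<rho> \<longrightarrow> L2_norm T u \<le> \<rho> \<longrightarrow> L2_norm T v \<le> \<rho> \<longrightarrow>
    (\<forall>t\<in>{0..T}. norm (x t - y t) \<le> K * (norm (x\<^sub>0 - y\<^sub>0) + L2_norm T (\<lambda>s. u s - v s)))"
proof -
  define \<rho>' where "\<rho>' = 2 * (\<rho> + 1)"
  have \<rho>'0: "0 \<le> \<rho>'" using \<rho> by (simp add: \<rho>'_def)
  obtain K where K: "0 \<le> K" "\<And>x\<^sub>0 y\<^sub>0 u v x y t. classical x\<^sub>0 u x \<Longrightarrow> classical y\<^sub>0 v y \<Longrightarrow>
    u \<in> C2_compact_support \<Longrightarrow> v \<in> C2_compact_support \<Longrightarrow>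
    norm x\<^sub>0 \<le> \<rho>' \<Longrightarrow> norm y\<^sub>0 \<le> \<rho>' \<Longrightarrow> L2_norm T u \<le> \<rho>' \<Longrightarrow> L2_norm T v \<le> \<rho>' \<Longrightarrow> t \<in> {0..T} \<Longrightarrow>
    norm (x t - y t) \<le> K * (norm (x\<^sub>0 - y\<^sub>0) + L2_norm T (\<lambda>s. u s - v s))"
    using classical_diff_bound[OF T \<rho>'0] by blast
  have "norm (x t - y t) \<le> 4 * K * (norm (x\<^sub>0 - y\<^sub>0) + L2_norm T (\<lambda>s. u s - v s))"
    if x: "generalized x\<^sub>0 u x z" and y: "generalized y\<^sub>0 v y w"
      and le: "norm x\<^sub>0 \<le> \<rho>" "norm y\<^sub>0 \<le> \<rho>" "L2_norm T u \<le> \<rho>" "L2_norm T v \<le> \<rho>" and t: "t \<in> {0..T}"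
    for x\<^sub>0 y\<^sub>0 u v x y z w t
  proof -
    obtain x\<^sub>0\<^sub>n u\<^sub>n x\<^sub>n where xn: "\<And>n. u\<^sub>n n \<in> C2_compact_support" "x\<^sub>0\<^sub>n \<longlonglongrightarrow> x\<^sub>0" "L2_loc_tendsto u\<^sub>n u"
      "\<And>n. classical (x\<^sub>0\<^sub>n n) (u\<^sub>n n) (x\<^sub>n n)" "\<And>t. 0 < t \<Longrightarrow> uniform_limit {0..t} x\<^sub>n x sequentially"
      using x by (rule generalizedE) blast
    obtain y\<^sub>0\<^sub>n v\<^sub>n y\<^sub>n where yn: "\<And>n. v\<^sub>n n \<in> C2_compact_support" "y\<^sub>0\<^sub>n \<longlonglongrightarrow> y\<^sub>0" "L2_loc_tendsto v\<^sub>n v"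
      "\<And>n. classical (y\<^sub>0\<^sub>n n) (v\<^sub>n n) (y\<^sub>n n)" "\<And>t. 0 < t \<Longrightarrow> uniform_limit {0..t} y\<^sub>n y sequentially"
      using y by (rule generalizedE) blast
    define a where "a n = L2_norm T (\<lambda>s. u\<^sub>n n s - u s)" for n
    define b where "b n = L2_norm T (\<lambda>s. v\<^sub>n n s - v s)" for n
    define d where "d = L2_norm T (\<lambda>s. u s - v s)"
    have ab: "a \<longlonglongrightarrow> 0" "b \<longlonglongrightarrow> 0"
      unfolding a_def[abs_def] b_def[abs_def] by (intro L2_loc_tendstoD(3) xn yn T)+
    \<comment> \<open>The chain leads from the approximate input through \<open>u\<close> and
      \<open>v\<close>; applying twice the triangle inequality with factor \<open>2\<close> gives
      the weights \<open>2\<close>, \<open>4\<close>, \<open>4\<close>.\<close>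
    have le_n: "L2_norm T (\<lambda>s. u\<^sub>n n s - v\<^sub>n n s) \<le> 2 * a n + 4 * d + 4 * b n" for n
    proof -
      have "L2_norm T (\<lambda>s. u\<^sub>n n s - v\<^sub>n n s) \<le> 2 * (a n + L2_norm T (\<lambda>s. u s - v\<^sub>n n s))"
        unfolding a_def by (intro L2_norm_triangle L2_loc_tendstoD[OF xn(3)] L2_loc_tendstoD[OF yn(3)] T)
      moreover have "L2_norm T (\<lambda>s. u s - v\<^sub>n n s) \<le> 2 * (d + L2_norm T (\<lambda>s. v s - v\<^sub>n n s))"
        unfolding d_def by (intro L2_norm_triangle L2_loc_tendstoD[OF xn(3)] L2_loc_tendstoD[OF yn(3)] T)
      ultimately show ?thesis using L2_norm_minus_commute[of T v "v\<^sub>n n"] by (simp add: b_def)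
    qed
    have "\<forall>\<^sub>F n in sequentially. norm (x\<^sub>n n t - y\<^sub>n n t) \<le> K * (norm (x\<^sub>0\<^sub>n n - y\<^sub>0\<^sub>n n) + (2 * a n + 4 * d + 4 * b n))"
      using eventually_bounded_data[OF xn(2,3) T le(1,3)] eventually_bounded_data[OF yn(2,3) T le(2,4)]
    proof eventually_elim
      case (elim n)
      have "norm (x\<^sub>n n t - y\<^sub>n n t) \<le> K * (norm (x\<^sub>0\<^sub>n n - y\<^sub>0\<^sub>n n) + L2_norm T (\<lambda>s. u\<^sub>n n s - v\<^sub>n n s))"
        using elim unfolding \<rho>'_def[symmetric] by (intro K(2)[OF xn(4) yn(4) xn(1) yn(1) _ _ _ _ t]) auto
      also have "\<dots> \<le> K * (norm (x\<^sub>0\<^sub>n n - y\<^sub>0\<^sub>n n) + (2 * a n + 4 * d + 4 * b n))"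
        using le_n K(1) by (intro mult_left_mono add_left_mono) auto
      finally show ?case .
    qed
    moreover have "(\<lambda>n. norm (x\<^sub>n n t - y\<^sub>n n t)) \<longlonglongrightarrow> norm (x t - y t)"
      by (intro tendsto_norm tendsto_diff tendsto_uniform_limitI[OF xn(5)[OF T] t] tendsto_uniform_limitI[OF yn(5)[OF T] t])
    moreover have "(\<lambda>n. K * (norm (x\<^sub>0\<^sub>n n - y\<^sub>0\<^sub>n n) + (2 * a n + 4 * d + 4 * b n))) \<longlonglongrightarrow>
        K * (norm (x\<^sub>0 - y\<^sub>0) + (2 * 0 + 4 * d + 4 * 0))"
      by (intro tendsto_intros xn(2) yn(2) ab)
    ultimately have "norm (x t - y t) \<le> K * (norm (x\<^sub>0 - y\<^sub>0) + (2 * 0 + 4 * d + 4 * 0))"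
      by (intro tendsto_le[OF sequentially_bot])
    also have "\<dots> \<le> K * (4 * (norm (x\<^sub>0 - y\<^sub>0) + d))" using K(1) by (intro mult_left_mono) auto
    finally show ?thesis by (simp add: d_def mult_ac)
  qed
  moreover have "0 \<le> 4 * K" using K(1) by simp
  ultimately show ?thesis by blast
qed

lemma C_bounded:
  "\<exists>c\<ge>0. \<forall>t\<in>{0..T}. \<forall>x. norm (C t x) \<le> c * norm x"
proof -
  obtain b where b: "0 \<le> b" "\<And>t. t \<in> {0..T} \<Longrightarrow> norm (B t) \<le> b" using B_bounded[of T] by blast
  have "norm (C t x) \<le> b * m\<^sub>2 * norm x" if t: "t \<in> {0..T}" for t x
  proof -
    have "norm (C t x) \<le> norm (B t) * (m\<^sub>2 * norm x)" by (rule norm_C_le) (use t in simp)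
    also have "\<dots> \<le> b * (m\<^sub>2 * norm x)" using b(2)[OF t] m_pos by (intro mult_right_mono) auto
    finally show ?thesis by (simp add: mult_ac)
  qed
  moreover have "0 \<le> b * m\<^sub>2" using b(1) m_pos by simp
  ultimately show ?thesis by blast
qed

lemma Cx_L2_loc: "continuous_on {0..} x \<Longrightarrow> (\<lambda>s. C s (x s)) \<in> L2_loc"
  by (intro L2_loc_continuous continuous_on_atLeast_0 Cx_continuous) (auto intro: continuous_on_subset)

lemma output_diff_bound:
  assumes t: "0 < t"
  shows "\<exists>c\<ge>0. \<forall>x z e. continuous_on {0..} x \<longrightarrow> continuous_on {0..} z \<longrightarrow> (\<forall>s\<in>{0..t}. norm (x s - z s) \<le> e) \<longrightarrow>
    L2_norm t (\<lambda>s. C s (x s) - C s (z s)) \<le> c * e"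
proof -
  obtain c where c: "0 \<le> c" "\<And>s x. s \<in> {0..t} \<Longrightarrow> norm (C s x) \<le> c * norm x" using C_bounded[of t] by blast
  have "L2_norm t (\<lambda>s. C s (x s) - C s (z s)) \<le> sqrt t * c * e"
    if x: "continuous_on {0..} x" and z: "continuous_on {0..} z" and e: "\<And>s. s \<in> {0..t} \<Longrightarrow> norm (x s - z s) \<le> e" for x z e
  proof -
    have "0 \<le> e" using order_trans[OF norm_ge_zero e[of 0]] t by simp
    have "L2_norm t (\<lambda>s. C s (x s) - C s (z s)) \<le> sqrt t * (c * e)"
    proof (rule L2_norm_bounded[OF _ _ t])
      show "continuous_on {0..t} (\<lambda>s. C s (x s) - C s (z s))"
        by (intro continuous_on_diff Cx_continuous t continuous_on_subset[OF x] continuous_on_subset[OF z]) auto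
      fix s assume s: "s \<in> {0..t}"
      have "norm (C s (x s) - C s (z s)) \<le> c * norm (x s - z s)"
        using c(2)[OF s, of "x s - z s"] by (simp add: blinfun.diff_right)
      also have "\<dots> \<le> c * e" by (rule mult_left_mono[OF e[OF s] c(1)])
      finally show "norm (C s (x s) - C s (z s)) \<le> c * e" .
    qed (use c(1) \<open>0 \<le> e\<close> in simp)
    then show ?thesis by simp
  qed
  moreover have "0 \<le> sqrt t * c" using c(1) t by simp
  ultimately show ?thesis by blast
qed

lemma output_tendsto:
  assumes t: "0 < t" and x: "uniform_limit {0..t} X x sequentially"
    and cont: "\<And>n. continuous_on {0..} (X n)" "continuous_on {0..} x"
  shows "(\<lambda>n. L2_norm t (\<lambda>s. C s (X n s) - C s (x s))) \<longlonglongrightarrow> 0"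
proof (rule LIMSEQ_I)
  fix e :: real assume e: "0 < e"
  obtain c where c: "0 \<le> c" "\<And>x z e. continuous_on {0..} x \<Longrightarrow> continuous_on {0..} z \<Longrightarrow>
      (\<forall>s\<in>{0..t}. norm (x s - z s) \<le> e) \<Longrightarrow> L2_norm t (\<lambda>s. C s (x s) - C s (z s)) \<le> c * e"
    using output_diff_bound[OF t] by blast
  have e': "0 < e / (c + 1)" using e c(1) by simp
  obtain N where N: "\<And>n s. n \<ge> N \<Longrightarrow> s \<in> {0..t} \<Longrightarrow> norm (X n s - x s) \<le> e / (c + 1)"
    using uniform_limitE[OF x e'] by blast
  have "norm (L2_norm t (\<lambda>s. C s (X n s) - C s (x s)) - 0) < e" if "n \<ge> N" for n
  proof -
    have "L2_norm t (\<lambda>s. C s (X n s) - C s (x s)) \<le> c * (e / (c + 1))"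
      using N[OF that] by (intro c(2) cont) auto
    also have "\<dots> < (c + 1) * (e / (c + 1))" using e' by (intro mult_strict_right_mono) auto
    also have "\<dots> = e" using c(1) by simp
    finally show ?thesis by (simp add: L2_norm_nonneg)
  qed
  then show "\<exists>N. \<forall>n\<ge>N. norm (L2_norm t (\<lambda>s. C s (X n s) - C s (x s)) - 0) < e" by blast
qed

lemma classical_continuous: "classical x\<^sub>0 u x \<Longrightarrow> continuous_on {0..} x"
  unfolding unique_global_classical_solution_def classical_solution_def by (auto intro: C1_on_continuous)

text \<open>States converge uniformly on compact intervals and \<open>C\<close> is bounded there, so
  the approximate outputs also tend to \<open>C x\<close>. The output is thereby determined by the
  state, to which its uniqueness and continuity are reduced.\<close>

lemma generalized_output_L2_norm:
  assumes x: "generalized x\<^sub>0 u x y" and t: "0 < t"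
  shows "L2_norm t (\<lambda>s. y s - C s (x s)) = 0"
proof -
  obtain x\<^sub>0\<^sub>n u\<^sub>n x\<^sub>n where xn: "\<And>n. classical (x\<^sub>0\<^sub>n n) (u\<^sub>n n) (x\<^sub>n n)" "uniform_limit {0..t} x\<^sub>n x sequentially"
    and y: "L2_loc_tendsto (\<lambda>n s. C s (x\<^sub>n n s)) y"
    using x t by (elim generalizedE) blast
  have xc: "continuous_on {0..} x" by (rule generalized_continuous[OF x])
  have "(\<lambda>n. 2 * (L2_norm t (\<lambda>s. C s (x\<^sub>n n s) - y s) + L2_norm t (\<lambda>s. C s (x\<^sub>n n s) - C s (x s)))) \<longlonglongrightarrow> 2 * (0 + 0)"
    by (intro tendsto_intros L2_loc_tendstoD(3)[OF y t] output_tendsto[OF t xn(2) classical_continuous[OF xn(1)] xc])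
  moreover have "L2_norm t (\<lambda>s. y s - C s (x s)) \<le>
      2 * (L2_norm t (\<lambda>s. C s (x\<^sub>n n s) - y s) + L2_norm t (\<lambda>s. C s (x\<^sub>n n s) - C s (x s)))" for n
    using L2_norm_triangle[OF L2_loc_tendstoD(2)[OF y] L2_loc_tendstoD(1)[OF y, of n] Cx_L2_loc[OF xc] t]
    by (simp add: L2_norm_minus_commute[of t y])
  ultimately have "L2_norm t (\<lambda>s. y s - C s (x s)) \<le> 2 * (0 + 0)"
    by (intro LIMSEQ_le_const) auto
  then show ?thesis using L2_norm_nonneg[of t "\<lambda>s. y s - C s (x s)"] by simp
qed

lemma generalized_output_AE:
  assumes "generalized x\<^sub>0 u x y"
  shows "AE t in lebesgue_on {0..}. y t = C t (x t)"
proof -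
  have "AE t in lebesgue_on {0..}. y t - C t (x t) = 0"
    by (intro L2_norm_eq_0_imp_AE L2_loc_diff generalized_L2_loc[OF assms] Cx_L2_loc generalized_continuous[OF assms]
        generalized_output_L2_norm[OF assms])
  then show ?thesis by simp
qed

lemma generalized_depends_continuously:
  assumes x: "generalized x\<^sub>0 u x y" and t: "0 < t" and e: "0 < e"
  shows "\<exists>\<delta>>0. \<forall>x\<^sub>0' u' x' y'. generalized x\<^sub>0' u' x' y' \<longrightarrow> norm (x\<^sub>0' - x\<^sub>0) < \<delta> \<longrightarrow>
    L2_norm t (\<lambda>s. u' s - u s) < \<delta> \<longrightarrow> (\<forall>s\<in>{0..t}. norm (x' s - x s) \<le> e)"
proof -
  \<comment> \<open>Bounds the given data and, as \<open>\<delta> \<le> 1\<close>, all perturbed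
    data too; the factor \<open>2\<close> is again that of \<open>L2_norm_add\<close>.\<close>
  define \<rho> where "\<rho> = norm x\<^sub>0 + 1 + 2 * (1 + L2_norm t u)"
  have \<rho>: "0 \<le> \<rho>" by (simp add: \<rho>_def L2_norm_nonneg)
  obtain K where K: "0 \<le> K" "\<And>x\<^sub>0 y\<^sub>0 u v x y z w s. generalized x\<^sub>0 u x z \<Longrightarrow> generalized y\<^sub>0 v y w \<Longrightarrow>
    norm x\<^sub>0 \<le> \<rho> \<Longrightarrow> norm y\<^sub>0 \<le> \<rho> \<Longrightarrow> L2_norm t u \<le> \<rho> \<Longrightarrow> L2_norm t v \<le> \<rho> \<Longrightarrow> s \<in> {0..t} \<Longrightarrow>
    norm (x s - y s) \<le> K * (norm (x\<^sub>0 - y\<^sub>0) + L2_norm t (\<lambda>s. u s - v s))"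
    using generalized_diff_bound[OF t \<rho>] by blast
  define \<delta> where "\<delta> = min 1 (e / (2 * (K + 1)))"
  have \<delta>: "0 < \<delta>" "\<delta> \<le> 1" "\<delta> \<le> e / (2 * (K + 1))" using e K(1) by (auto simp: \<delta>_def)
  have "norm (x' s - x s) \<le> e"
    if x': "generalized x\<^sub>0' u' x' y'" and close: "norm (x\<^sub>0' - x\<^sub>0) < \<delta>" "L2_norm t (\<lambda>s. u' s - u s) < \<delta>" and s: "s \<in> {0..t}"
    for x\<^sub>0' u' x' y' s
  proof -
    have "norm x\<^sub>0' \<le> \<rho>"
      using norm_triangle_ineq[of "x\<^sub>0' - x\<^sub>0" x\<^sub>0] close(1) \<delta>(2) L2_norm_nonneg[of t u] by (simp add: \<rho>_def)
    moreover have "L2_norm t (\<lambda>s. (u' s - u s) + u s) \<le> 2 * (L2_norm t (\<lambda>s. u' s - u s) + L2_norm t u)"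
      by (intro L2_norm_add L2_loc_diff generalized_L2_loc(1)[OF x'] generalized_L2_loc(1)[OF x] t)
    then have "L2_norm t u' \<le> \<rho>" using close(2) \<delta>(2) norm_ge_zero[of x\<^sub>0] unfolding \<rho>_def by (simp del: norm_ge_zero)
    moreover have "norm x\<^sub>0 \<le> \<rho>" "L2_norm t u \<le> \<rho>"
      using L2_norm_nonneg[of t u] by (simp_all add: \<rho>_def add_nonneg_nonneg)
    ultimately have "norm (x' s - x s) \<le> K * (norm (x\<^sub>0' - x\<^sub>0) + L2_norm t (\<lambda>s. u' s - u s))"
      by (intro K(2)[OF x' x _ _ _ _ s])
    also have "\<dots> \<le> (K + 1) * (2 * (e / (2 * (K + 1))))"
      using close \<delta> K(1) L2_norm_nonneg[of t "\<lambda>s. u' s - u s"] by (intro mult_mono) auto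
    also have "\<dots> = e"
    proof -
      have cancel: "p * (2 * (e / (2 * p))) = e" if "0 < p" for p :: real using that by simp
      show ?thesis by (rule cancel) (use K(1) in simp)
    qed
    finally show ?thesis .
  qed
  then show ?thesis using \<delta>(1) by blast
qed

text \<open>A second solution for the same data is a perturbation of size zero, so continuous
  dependence makes the distance smaller than every \<open>e\<close>.\<close>

lemma generalized_unique:
  assumes x: "generalized x\<^sub>0 u x y" and x': "generalized x\<^sub>0 u x' y'" and t: "0 \<le> t"
  shows "x t = x' t"
proof -
  \<comment> \<open>The longer interval has positive length also for \<open>t = 0\<close>.\<close>
  have t1: "0 < t + 1" using t by simp
  have "norm (x' t - x t) \<le> 0 + e" if e: "0 < e" for e
  proof -
    obtain \<delta> where "0 < \<delta>" "\<And>x\<^sub>0' u' x' y' s. generalized x\<^sub>0' u' x' y' \<Longrightarrow> norm (x\<^sub>0' - x\<^sub>0) < \<delta> \<Longrightarrow>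
        L2_norm (t + 1) (\<lambda>s. u' s - u s) < \<delta> \<Longrightarrow> s \<in> {0..t + 1} \<Longrightarrow> norm (x' s - x s) \<le> e"
      using generalized_depends_continuously[OF x t1 e] by blast
    from this(2)[OF x', of t] \<open>0 < \<delta>\<close> show ?thesis using t by (simp add: L2_norm_def)
  qed
  then have "norm (x' t - x t) \<le> 0" by (rule field_le_epsilon)
  then show ?thesis by simp
qed

lemma generalized_output_depends_continuously:
  assumes x: "generalized x\<^sub>0 u x y" and t: "0 < t" and e: "0 < e"
  shows "\<exists>\<delta>>0. \<forall>x\<^sub>0' u' x' y'. generalized x\<^sub>0' u' x' y' \<longrightarrow> norm (x\<^sub>0' - x\<^sub>0) < \<delta> \<longrightarrow>
    L2_norm t (\<lambda>s. u' s - u s) < \<delta> \<longrightarrow> L2_norm t (\<lambda>s. y' s - y s) < e"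
proof -
  obtain c where c: "0 \<le> c" "\<And>x z e. continuous_on {0..} x \<Longrightarrow> continuous_on {0..} z \<Longrightarrow>
      (\<forall>s\<in>{0..t}. norm (x s - z s) \<le> e) \<Longrightarrow> L2_norm t (\<lambda>s. C s (x s) - C s (z s)) \<le> c * e"
    using output_diff_bound[OF t] by blast
  define \<epsilon> where "\<epsilon> = e / (4 * (c + 1))"
  have \<epsilon>: "0 < \<epsilon>" using e c(1) by (simp add: \<epsilon>_def)
  obtain \<delta> where \<delta>: "0 < \<delta>" "\<And>x\<^sub>0' u' x' y'. generalized x\<^sub>0' u' x' y' \<Longrightarrow> norm (x\<^sub>0' - x\<^sub>0) < \<delta> \<Longrightarrow>
      L2_norm t (\<lambda>s. u' s - u s) < \<delta> \<Longrightarrow> \<forall>s\<in>{0..t}. norm (x' s - x s) \<le> \<epsilon>"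
    using generalized_depends_continuously[OF x t \<epsilon>] by blast
  have "L2_norm t (\<lambda>s. y' s - y s) < e"
    if x': "generalized x\<^sub>0' u' x' y'" and close: "norm (x\<^sub>0' - x\<^sub>0) < \<delta>" "L2_norm t (\<lambda>s. u' s - u s) < \<delta>" for x\<^sub>0' u' x' y'
  proof -
    have cont: "continuous_on {0..} x'" "continuous_on {0..} x"
      using generalized_continuous x x' by blast+
    note L = generalized_L2_loc(2)[OF x'] generalized_L2_loc(2)[OF x] Cx_L2_loc[OF cont(1)] Cx_L2_loc[OF cont(2)]
    have "L2_norm t (\<lambda>s. y' s - y s) \<le> 2 * (L2_norm t (\<lambda>s. y' s - C s (x' s)) + L2_norm t (\<lambda>s. C s (x' s) - y s))"
      by (rule L2_norm_triangle[OF L(1,3,2) t])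
    moreover have "L2_norm t (\<lambda>s. C s (x' s) - y s) \<le>
        2 * (L2_norm t (\<lambda>s. C s (x' s) - C s (x s)) + L2_norm t (\<lambda>s. C s (x s) - y s))"
      by (rule L2_norm_triangle[OF L(3,4,2) t])
    moreover have "L2_norm t (\<lambda>s. C s (x s) - y s) = 0"
      using generalized_output_L2_norm[OF x t] by (simp add: L2_norm_minus_commute[of t y])
    moreover have "L2_norm t (\<lambda>s. C s (x' s) - C s (x s)) \<le> c * \<epsilon>"
      by (rule c(2)[OF cont \<delta>(2)[OF x' close]])
    ultimately have "L2_norm t (\<lambda>s. y' s - y s) \<le> 4 * (c * \<epsilon>)"
      using generalized_output_L2_norm[OF x' t] by simp
    also have "\<dots> < 4 * ((c + 1) * \<epsilon>)" using \<epsilon> by simp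
    also have "\<dots> = e"
    proof -
      have cancel: "4 * (p * (e / (4 * p))) = e" if "0 < p" for p :: real using that by simp
      show ?thesis unfolding \<epsilon>_def by (rule cancel) (use c(1) in simp)
    qed
    finally show ?thesis .
  qed
  then show ?thesis using \<delta>(1) by blast
qed

text \<open>Approximate the data by those with classical solutions; the difference bound makes these
  solutions uniformly Cauchy on every \<open>{0..T}\<close>. The generalized output is simply
  \<open>C x\<close>.\<close>

lemma generalized_exists:
  assumes u: "u \<in> L2_loc"
  shows "\<exists>x y. generalized x\<^sub>0 u x y"
proof -
  obtain u\<^sub>n where un: "\<And>n. u\<^sub>n n \<in> C2_compact_support" and u_lim: "L2_loc_tendsto u\<^sub>n u"
    using C2_compact_support_dense[OF u] by blast
  have "\<exists>z. M 0 z \<in> D\<^sub>0 \<and> norm (z - x\<^sub>0) \<le> 1 / real (Suc n)" for n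
    by (rule initial_states_dense) simp
  then obtain x\<^sub>0\<^sub>n where x0n: "\<And>n. M 0 (x\<^sub>0\<^sub>n n) \<in> D\<^sub>0" "\<And>n. norm (x\<^sub>0\<^sub>n n - x\<^sub>0) \<le> 1 / real (Suc n)" by metis
  have x0_lim: "x\<^sub>0\<^sub>n \<longlonglongrightarrow> x\<^sub>0"
    by (rule LIM_zero_cancel, rule Lim_null_comparison[OF _ LIMSEQ_Suc[OF lim_1_over_n]]) (use x0n(2) in simp)
  have "\<exists>x. classical (x\<^sub>0\<^sub>n n) (u\<^sub>n n) x" for n
    using un[of n] by (intro unique_global_classical_solution_exists x0n(1) C2_on_imp_C1_on) (simp add: C2_compact_support_def)
  then obtain X where X: "\<And>n. classical (x\<^sub>0\<^sub>n n) (u\<^sub>n n) (X n)" by metis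
  have conv: "uniformly_convergent_on {0..T} X" if T: "0 < T" for T
  proof (rule Cauchy_uniformly_convergent, unfold uniformly_Cauchy_on_def, intro allI impI)
    fix e :: real assume e: "0 < e"
    define \<rho> where "\<rho> = norm x\<^sub>0 + L2_norm T u"
    have \<rho>: "norm x\<^sub>0 \<le> \<rho>" "L2_norm T u \<le> \<rho>" "0 \<le> 2 * (\<rho> + 1)" by (auto simp: \<rho>_def L2_norm_nonneg add_nonneg_nonneg)
    obtain K where K: "0 \<le> K" "\<And>x\<^sub>0 y\<^sub>0 u v x y t. classical x\<^sub>0 u x \<Longrightarrow> classical y\<^sub>0 v y \<Longrightarrow>
      u \<in> C2_compact_support \<Longrightarrow> v \<in> C2_compact_support \<Longrightarrow>
      norm x\<^sub>0 \<le> 2 * (\<rho> + 1) \<Longrightarrow> norm y\<^sub>0 \<le> 2 * (\<rho> + 1) \<Longrightarrow> L2_norm T u \<le> 2 * (\<rho> + 1) \<Longrightarrow> L2_norm T v \<le> 2 * (\<rho> + 1) \<Longrightarrow> t \<in> {0..T} \<Longrightarrow>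
      norm (x t - y t) \<le> K * (norm (x\<^sub>0 - y\<^sub>0) + L2_norm T (\<lambda>s. u s - v s))"
      using classical_diff_bound[OF T \<rho>(3)] by blast
    \<comment> \<open>The distance of two approximate initial states costs
      \<open>2 * \<epsilon>\<close>, that of two inputs \<open>4 * \<epsilon>\<close>.\<close>
    define \<epsilon> where "\<epsilon> = e / (6 * (K + 1))"
    have \<epsilon>: "0 < \<epsilon>" using e K(1) by (simp add: \<epsilon>_def)
    have "\<forall>\<^sub>F n in sequentially. norm (x\<^sub>0\<^sub>n n - x\<^sub>0) < \<epsilon>"
      using tendstoD[OF x0_lim \<epsilon>] by (simp add: dist_norm)
    moreover have "\<forall>\<^sub>F n in sequentially. L2_norm T (\<lambda>s. u\<^sub>n n s - u s) < \<epsilon>"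
      by (rule order_tendstoD(2)[OF L2_loc_tendstoD(3)[OF u_lim T] \<epsilon>])
    ultimately have "\<forall>\<^sub>F n in sequentially. (norm (x\<^sub>0\<^sub>n n - x\<^sub>0) < \<epsilon> \<and> L2_norm T (\<lambda>s. u\<^sub>n n s - u s) < \<epsilon>) \<and>
        norm (x\<^sub>0\<^sub>n n) \<le> 2 * (\<rho> + 1) \<and> L2_norm T (u\<^sub>n n) \<le> 2 * (\<rho> + 1)"
      by (intro eventually_conj eventually_bounded_data[OF x0_lim u_lim T \<rho>(1,2)])
    then obtain N where N: "\<And>n. n \<ge> N \<Longrightarrow> norm (x\<^sub>0\<^sub>n n - x\<^sub>0) < \<epsilon>" "\<And>n. n \<ge> N \<Longrightarrow> L2_norm T (\<lambda>s. u\<^sub>n n s - u s) < \<epsilon>"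
      "\<And>n. n \<ge> N \<Longrightarrow> norm (x\<^sub>0\<^sub>n n) \<le> 2 * (\<rho> + 1)" "\<And>n. n \<ge> N \<Longrightarrow> L2_norm T (u\<^sub>n n) \<le> 2 * (\<rho> + 1)"
      unfolding eventually_sequentially by blast
    have "dist (X m t) (X n t) < e" if t: "t \<in> {0..T}" and mn: "m \<ge> N" "n \<ge> N" for t m n
    proof -
      have "L2_norm T (\<lambda>s. u\<^sub>n m s - u\<^sub>n n s) \<le> 2 * (L2_norm T (\<lambda>s. u\<^sub>n m s - u s) + L2_norm T (\<lambda>s. u s - u\<^sub>n n s))"
        by (intro L2_norm_triangle L2_loc_tendstoD[OF u_lim] T)
      then have "L2_norm T (\<lambda>s. u\<^sub>n m s - u\<^sub>n n s) \<le> 4 * \<epsilon>"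
        using N(2)[OF mn(1)] N(2)[OF mn(2)] L2_norm_minus_commute[of T u "u\<^sub>n n"] by simp
      moreover have "norm (x\<^sub>0\<^sub>n m - x\<^sub>0\<^sub>n n) \<le> 2 * \<epsilon>"
        using norm_triangle_ineq4[of "x\<^sub>0\<^sub>n m - x\<^sub>0" "x\<^sub>0\<^sub>n n - x\<^sub>0"] N(1)[OF mn(1)] N(1)[OF mn(2)] by simp
      ultimately have "K * (norm (x\<^sub>0\<^sub>n m - x\<^sub>0\<^sub>n n) + L2_norm T (\<lambda>s. u\<^sub>n m s - u\<^sub>n n s)) \<le> K * (6 * \<epsilon>)"
        using K(1) by (intro mult_left_mono) auto
      moreover have "norm (X m t - X n t) \<le> K * (norm (x\<^sub>0\<^sub>n m - x\<^sub>0\<^sub>n n) + L2_norm T (\<lambda>s. u\<^sub>n m s - u\<^sub>n n s))"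
        by (rule K(2)[OF X X un un N(3)[OF mn(1)] N(3)[OF mn(2)] N(4)[OF mn(1)] N(4)[OF mn(2)] t])
      moreover have "K * (6 * \<epsilon>) < (K + 1) * (6 * \<epsilon>)" using \<epsilon> by simp
      moreover have "(K + 1) * (6 * \<epsilon>) = e"
      proof -
        have cancel: "p * (6 * (e / (6 * p))) = e" if "0 < p" for p :: real using that by simp
        show ?thesis unfolding \<epsilon>_def by (rule cancel) (use K(1) in simp)
      qed
      ultimately show ?thesis by (simp add: dist_norm)
    qed
    then show "\<exists>N. \<forall>t\<in>{0..T}. \<forall>m\<ge>N. \<forall>n\<ge>N. dist (X m t) (X n t) < e" by blast
  qed
  \<comment> \<open>The pointwise limit does not refer to \<open>T\<close>, so one function is the
    uniform limit on all intervals.\<close>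
  define x where "x t = lim (\<lambda>n. X n t)" for t
  have x_lim: "uniform_limit {0..T} X x sequentially" if "0 < T" for T
    using conv[OF that] unfolding x_def[abs_def] uniformly_convergent_uniform_limit_iff .
  have Xc: "continuous_on {0..} (X n)" for n by (rule classical_continuous[OF X])
  have xc: "continuous_on {0..} x"
  proof (rule continuous_on_atLeast_0)
    fix T :: real assume T: "0 < T"
    show "continuous_on {0..T} x"
      by (rule uniform_limit_theorem[OF _ x_lim[OF T]]) (auto intro!: always_eventually continuous_on_subset[OF Xc])
  qed
  have "L2_loc_tendsto (\<lambda>n s. C s (X n s)) (\<lambda>s. C s (x s))"
    unfolding L2_loc_tendsto_def using output_tendsto[OF _ x_lim Xc xc] by (auto intro: Cx_L2_loc Xc xc)
  then have "generalized x\<^sub>0 u x (\<lambda>s. C s (x s))"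
    unfolding generalized_solution_output_def using xc un x0_lim u_lim X x_lim Cx_L2_loc[OF xc] by blast
  then show ?thesis by blast
qed

text \<open>Limit of the energy inequality for classical solutions. The gain
  \<open>2 / \<zeta>\<close> is four times the \<open>1 / (2 * \<zeta>)\<close> there, since the
  approximate inputs are estimated with the factor \<open>2\<close> of \<open>L2_norm_add\<close>; a
  larger gain does no harm.\<close>

lemma generalized_bound:
  assumes x: "generalized x\<^sub>0 u x y" and t: "0 \<le> t"
  shows "norm (x t) \<le> sqrt (m\<^sub>2 / m\<^sub>1) * norm x\<^sub>0 + sqrt (2 / \<zeta> / m\<^sub>1) * L2_norm t u"
proof (rule sqrt_of_square_bound)
  obtain x\<^sub>0\<^sub>n u\<^sub>n x\<^sub>n where un: "\<And>n. u\<^sub>n n \<in> C2_compact_support" and x0n: "x\<^sub>0\<^sub>n \<longlonglongrightarrow> x\<^sub>0" and u: "L2_loc_tendsto u\<^sub>n u"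
    and xn: "\<And>n. classical (x\<^sub>0\<^sub>n n) (u\<^sub>n n) (x\<^sub>n n)" and ul: "\<And>t. 0 < t \<Longrightarrow> uniform_limit {0..t} x\<^sub>n x sequentially"
    using x by (rule generalizedE) blast
  show "m\<^sub>1 * (norm (x t))\<^sup>2 \<le> m\<^sub>2 * (norm x\<^sub>0)\<^sup>2 + 2 / \<zeta> * (L2_norm t u)\<^sup>2"
  proof (cases "t = 0")
    case True
    have "(\<lambda>n. x\<^sub>n n 0) \<longlonglongrightarrow> x 0" using tendsto_uniform_limitI[OF ul[of 1], of 0] by simp
    then have "x\<^sub>0\<^sub>n \<longlonglongrightarrow> x 0" by (simp add: classical_sol_on(2)[OF xn])
    then have "x 0 = x\<^sub>0" using x0n by (rule LIMSEQ_unique)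
    moreover have "0 \<le> 2 / \<zeta> * (L2_norm t u)\<^sup>2" using zeta_pos by simp
    ultimately show ?thesis using True classical_initial[of x\<^sub>0] by simp
  next
    case False
    then have t': "0 < t" using t by simp
    define a where "a n = L2_norm t (\<lambda>s. u\<^sub>n n s - u s)" for n
    have a: "a \<longlonglongrightarrow> 0" unfolding a_def[abs_def] by (rule L2_loc_tendstoD(3)[OF u t'])
    have "m\<^sub>1 * (norm (x\<^sub>n n t))\<^sup>2 \<le> m\<^sub>2 * (norm (x\<^sub>0\<^sub>n n))\<^sup>2 + 1 / (2 * \<zeta>) * (2 * (a n + L2_norm t u))\<^sup>2" for n
    proof -
      have "L2_norm t (\<lambda>s. (u\<^sub>n n s - u s) + u s) \<le> 2 * (a n + L2_norm t u)"
        unfolding a_def by (intro L2_norm_add L2_loc_diff L2_loc_tendstoD[OF u] t')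
      then have "L2_norm t (u\<^sub>n n) \<le> 2 * (a n + L2_norm t u)" by simp
      then show ?thesis
        using zeta_pos by (intro order_trans[OF classical_energy[OF xn un t']] add_left_mono mult_left_mono power_mono L2_norm_nonneg) auto
    qed
    moreover have "(\<lambda>n. m\<^sub>1 * (norm (x\<^sub>n n t))\<^sup>2) \<longlonglongrightarrow> m\<^sub>1 * (norm (x t))\<^sup>2"
      using t' by (intro tendsto_intros tendsto_uniform_limitI[OF ul[OF t']]) simp
    moreover have "(\<lambda>n. m\<^sub>2 * (norm (x\<^sub>0\<^sub>n n))\<^sup>2 + 1 / (2 * \<zeta>) * (2 * (a n + L2_norm t u))\<^sup>2) \<longlonglongrightarrow>
        m\<^sub>2 * (norm x\<^sub>0)\<^sup>2 + 1 / (2 * \<zeta>) * (2 * (0 + L2_norm t u))\<^sup>2"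
      by (intro tendsto_intros x0n a)
    ultimately have "m\<^sub>1 * (norm (x t))\<^sup>2 \<le> m\<^sub>2 * (norm x\<^sub>0)\<^sup>2 + 1 / (2 * \<zeta>) * (2 * (0 + L2_norm t u))\<^sup>2"
      by (intro LIMSEQ_le) auto
    then show ?thesis by (simp add: power_mult_distrib)
  qed
qed (use m_pos zeta_pos L2_norm_nonneg in auto)

lemma closed_loop_well_posed: "well_posed D A f B C"
  unfolding well_posed_def Let_def
proof (intro conjI allI ballI impI)
  fix x\<^sub>0 :: 'x and u :: "real \<Rightarrow> 'u" assume u: "u \<in> L2_loc"
  show "\<exists>x y. generalized x\<^sub>0 u x y" by (rule generalized_exists[OF u])
  fix x y x' y' assume g: "generalized x\<^sub>0 u x y \<and> generalized x\<^sub>0 u x' y'"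
  have eq: "x t = x' t" if "0 \<le> t" for t using generalized_unique g that by blast
  then show "x t = x' t" if "0 \<le> t" for t using that .
  have "AE t in lebesgue_on {0..}. y t = C t (x t)" "AE t in lebesgue_on {0..}. y' t = C t (x' t)"
    using generalized_output_AE g by blast+
  then show "AE t in lebesgue_on {0..}. y t = y' t"
    using AE_space by eventually_elim (simp add: eq space_restrict_space)
next
  fix x\<^sub>0 u x y and t e :: real
  assume g: "generalized x\<^sub>0 u x y" and t: "0 < t" and e: "0 < e"
  have "0 < e / 2" using e by simp
  then obtain \<delta> where \<delta>: "0 < \<delta>" "\<And>x\<^sub>0' u' x' y'. generalized x\<^sub>0' u' x' y' \<Longrightarrow> norm (x\<^sub>0' - x\<^sub>0) < \<delta> \<Longrightarrow>
      L2_norm t (\<lambda>s. u' s - u s) < \<delta> \<Longrightarrow> \<forall>s\<in>{0..t}. norm (x' s - x s) \<le> e / 2"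
    using generalized_depends_continuously[OF g t] by blast
  have "\<forall>s\<in>{0..t}. norm (x' s - x s) < e"
    if "generalized x\<^sub>0' u' x' y'" "norm (x\<^sub>0' - x\<^sub>0) < \<delta>" "L2_norm t (\<lambda>s. u' s - u s) < \<delta>" for x\<^sub>0' u' x' y'
    using \<delta>(2)[OF that] e by force
  \<comment> \<open>\<open>T = t\<close> is taken: states on \<open>{0..t}\<close> depend on the
    input on that interval only.\<close>
  then show "\<exists>T>0. \<exists>\<delta>>0. \<forall>x\<^sub>0'. \<forall>u'\<in>L2_loc. \<forall>x' y'.
      generalized x\<^sub>0' u' x' y' \<and> norm (x\<^sub>0' - x\<^sub>0) < \<delta> \<and> L2_norm T (\<lambda>s. u' s - u s) < \<delta> \<longrightarrow>
      (\<forall>s\<in>{0..t}. norm (x' s - x s) < e)"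
    using t \<delta>(1) by blast
next
  fix x\<^sub>0 u x y and t e :: real
  assume g: "generalized x\<^sub>0 u x y" and t: "0 < t" and e: "0 < e"
  show "\<exists>T>0. \<exists>\<delta>>0. \<forall>x\<^sub>0'. \<forall>u'\<in>L2_loc. \<forall>x' y'.
      generalized x\<^sub>0' u' x' y' \<and> norm (x\<^sub>0' - x\<^sub>0) < \<delta> \<and> L2_norm T (\<lambda>s. u' s - u s) < \<delta> \<longrightarrow>
      L2_norm t (\<lambda>s. y' s - y s) < e"
    using generalized_output_depends_continuously[OF g t e] t by blast
qed

lemma closed_loop_uniformly_globally_stable: "uniformly_globally_stable D A f B C"
  unfolding uniformly_globally_stable_def Let_def generalized_solution_def
proof (intro conjI allI ballI impI)
  show "\<exists>x y. generalized x\<^sub>0 u x y" if "u \<in> L2_loc" for x\<^sub>0 u by (rule generalized_exists[OF that])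
  show "x t = x' t" if "(\<exists>y. generalized x\<^sub>0 u x y) \<and> (\<exists>y. generalized x\<^sub>0 u x' y)" "0 \<le> t" for x\<^sub>0 u x x' t
    using that generalized_unique by blast
  have "(\<lambda>r. sqrt (m\<^sub>2 / m\<^sub>1) * r) \<in> class_K" "(\<lambda>r. sqrt (2 / \<zeta> / m\<^sub>1) * r) \<in> class_K"
    using m_pos zeta_pos by (auto intro!: linear_in_class_K)
  then show "\<exists>\<sigma>\<in>class_K. \<exists>\<gamma>\<in>class_K. \<forall>x\<^sub>0. \<forall>u\<in>L2_loc. \<forall>x. (\<exists>y. generalized x\<^sub>0 u x y) \<longrightarrow>
      (\<forall>t\<ge>0. norm (x t) \<le> \<sigma> (norm x\<^sub>0) + \<gamma> (L2_norm t u))"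
    using generalized_bound by (intro bexI[of _ "\<lambda>r. sqrt (m\<^sub>2 / m\<^sub>1) * r"] bexI[of _ "\<lambda>r. sqrt (2 / \<zeta> / m\<^sub>1) * r"]) blast+
qed

end

theorem corollary5p1:
  fixes D\<^sub>0 :: "'x::{real_inner,complete_space} set"
    and A\<^sub>0 :: "real \<Rightarrow> 'x \<Rightarrow> 'x"
    and M :: "real \<Rightarrow> 'x \<Rightarrow>\<^sub>L 'x"
    and B :: "real \<Rightarrow> 'u::{real_inner,complete_space} \<Rightarrow>\<^sub>L 'x"
    and C :: "real \<Rightarrow> 'x \<Rightarrow>\<^sub>L 'u"
    and g :: "'u \<Rightarrow> 'u"
    and D :: "real \<Rightarrow> 'x set"
    and A f :: "real \<Rightarrow> 'x \<Rightarrow> 'x"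
    and m\<^sub>1 m\<^sub>2 \<zeta> :: real
  assumes A0_generator: "\<And>t. 0 \<le> t \<Longrightarrow> generates_contraction_semigroup D\<^sub>0 (A\<^sub>0 t)"
    and A0_C1: "\<And>x. x \<in> D\<^sub>0 \<Longrightarrow> C1_on {0..} (\<lambda>t. A\<^sub>0 t x)"
    and M_symmetric: "\<And>t x z. 0 \<le> t \<Longrightarrow> inner (M t x) z = inner x (M t z)"
    and m_pos: "0 < m\<^sub>1" "0 < m\<^sub>2"
    and M_bounds: "\<And>t x. 0 \<le> t \<Longrightarrow>
           m\<^sub>1 * (norm x)\<^sup>2 \<le> inner (M t x) x \<and> inner (M t x) x \<le> m\<^sub>2 * (norm x)\<^sup>2"
    and M_C2: "\<And>x. C2_on {0..} (\<lambda>t. M t x)"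
    and M_decreasing: "\<And>s t x. 0 \<le> s \<Longrightarrow> s \<le> t \<Longrightarrow> inner (M t x) x \<le> inner (M s x) x"
    and D_eq: "\<And>t. 0 \<le> t \<Longrightarrow> D t = {x. M t x \<in> D\<^sub>0}"
    and A_eq: "\<And>t x. 0 \<le> t \<Longrightarrow> x \<in> D t \<Longrightarrow> A t x = A\<^sub>0 t (M t x)"
    and C_eq: "\<And>t x. 0 \<le> t \<Longrightarrow> C t x = adjoint (B t) (M t x)"
    and B_locally_lipschitz:
          "\<And>t. 0 \<le> t \<Longrightarrow> \<exists>r>0. \<exists>L. L-lipschitz_on (cball t r \<inter> {0..}) B"
    and g_lipschitz: "\<And>S. bounded S \<Longrightarrow> \<exists>L. L-lipschitz_on S g"
    and zeta_pos: "0 < \<zeta>"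
    and g_damping: "\<And>y. \<zeta> * (norm y)\<^sup>2 \<le> inner y (g y)"
    and f_eq: "\<And>t x. 0 \<le> t \<Longrightarrow> f t x = - B t (g (adjoint (B t) (M t x)))"
  shows "well_posed D A f B C \<and> uniformly_globally_stable D A f B C"
proof -
  interpret closed_loop D\<^sub>0 A\<^sub>0 M B C g D A f m\<^sub>1 m\<^sub>2 \<zeta>
    by (rule closed_loop.intro) (fact assms)+
  show ?thesis using closed_loop_well_posed closed_loop_uniformly_globally_stable by blast
qed

end
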